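(* Let $$L\phi(x)=\int_{\mathbb{R}^d}(\phi(w)-\phi(x))\,\nu(x,dw)$$ with a bounded weakly continuous stochastic kernel $\nu$, so that $L$ generates a $C$-Feller jump process $X_t^x$ in $\mathbb{R}^d$. Then the Pareto dual generator is given by $$L^{D(f)}g(y)=(-1)^d\int_{\mathbb{R}^d}\frac{\partial^d g(z)}{\partial z_1\cdots\partial z_d}\left[\mathbf{1}_{z\ngeq y}\int_{w\ge y}\nu(z,dw)-\mathbf{1}_{z\ge y}\int_{w\ngeq y}\nu(z,dw)\right]dz.$$ If the kernel $\nu$ has continuous bounded mixed derivatives, so that $\frac{\partial^{|I|}\nu}{\partial z_I}(z,dw)$ is again a bounded kernel (possibly signed) for any nonempty subset $I\subset\{1,\dots,d\}$ (including the whole set), then $L^{D(f)}$ can be rewritten as $$L^{D(f)}g(y)=-g(y)\int_{\mathbb{R}^d}\nu(y,dw)-{\sum_{I}}'\int_{z_I\ge y_I}dz_I\,g(y_{\bar I},z_I)\int_{\mathbb{R}^d}\frac{\partial^{|I|}\nu}{\partial z_I}(y_{\bar I},z_I,dw)$$ $$+\int_{\mathbb{R}^d}g(z)\,dz\left[\mathbf{1}_{z\ngeq y}\int_{w\ge y}\frac{\partial^d\nu}{\partial z_1\cdots\partial z_d}(z,dw)-\mathbf{1}_{z\ge y}\int_{w\ngeq y}\frac{\partial^d\nu}{\partial z_1\cdots\partial z_d}(z,dw)\right],$$ where $\sum'$ is the sum over all proper subsets $I$ of $\{1,\dots,d\}$ (excluding the empty set and the whole set). Finally, $L^{D(f)}$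 itself generates a $C$-Feller Markov process $Y_t^y$ if and only if the following conditions hold: (1) all mixed derivatives of orders from $1$ to $d-1$ of the jump rates are non-positive, i.e. $\displaystyle\int_{\mathbb{R}^d}\frac{\partial^{|I|}\nu}{\partial z_I}(z,dw)\le 0$ for any proper subset $I$ of $\{1,\dots,d\}$; (2) $\displaystyle\int_{w\ge y}\frac{\partial^d\nu}{\partial z_1\cdots\partial z_d}(z,dw)\ge 0$ for $z\ngeq y$, and $\displaystyle\int_{w\ngeq y}\frac{\partial^d\nu}{\partial z_1\cdots\partial z_d}(z,dw)\le 0$ for $z\ge y$. If this is the case, the duality relation $\mathbf{P}(X_t^x\ge y)=\mathbf{P}(Y_t^y\le x)$ holds.
   Context: A stochastic kernel $\nu(x,dw)$ on $\mathbb{R}^d$ is a kernel such that all measures $\nu(x,\cdot)$ are positive (not necessarily of mass one); it is bounded if $\sup_x\|\nu(x,\cdot)\|<\infty$ and weakly continuous if $x\mapsto\nu(x,\cdot)$ is continuous in the weak topology of measures. $C$-Feller means that the semigroup of the process preserves the space of bounded continuous functions. Superscripts $x,y$ in $X_t^x,Y_t^y$ denote initial points. $\ge$ is the Pareto (coordinatewise) order on $\mathbb{R}^d$, and $z\ngeq y$ means that $z\ge y$ fails. For a bounded signed measure $Q$, $(FQ)(y)=\int_{x\ge y}Q(dx)$; if $Q$ has a density $q$ and $g=FQ$, then $q=F^{-1}g=(-1)^d\frac{\partial^d g}{\partial y_1\cdots\partial y_d}$. The Pareto dual generator is $L^{D(f)}=F\circ L'\circ F^{-1}$, where $L'$ is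 the standard dual of $L$, acting on densities by $L'q(dz)=\int q(x)\nu(x,dz)\,dx-q(z)\,dz\int\nu(z,dw)$. The formulas for $L^{D(f)}g$ are for $d$ times differentiable $g$, the second one for such $g$ vanishing at infinity together with its derivatives (so that boundary terms at infinity vanish in integration by parts). Here $f(x,y)=\mathbf{1}_{\{x\ge y\}}$. For $I\subset\{1,\dots,d\}$, $\bar I$ is the complement, $|I|$ the cardinality, $\frac{\partial^{|I|}}{\partial z_I}$ the mixed derivative once in each $z_i$, $i\in I$, and $(y_{\bar I},z_I)$ the vector with coordinates from $z$ for indices in $I$ and from $y$ otherwise. Proper subsets exclude both the empty set and the whole set.
   Formalization: Sufficiency of (1),(2) and duality also assume: ν(z,{w≥y})→0 as any z_i→−∞, ν(z,{w≱y})→0 as z→+∞ on the diagonal, no mass on hyperplanes w_i=c (else false, e.g. constant ν). The second formula and generation take g integrable, also along faces; Y is not killed. *)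

theory Defs
  imports "HOL-Probability.Probability"
begin

definition bounded_continuous :: "('a::topological_space \<Rightarrow> real) set" where
  "bounded_continuous = {\<phi>. continuous_on UNIV \<phi> \<and> bounded (range \<phi>)}"

definition bounded_kernel :: "('a::topological_space \<Rightarrow> 'a measure) \<Rightarrow> bool" where
  "bounded_kernel \<nu> \<longleftrightarrow>
     (\<forall>x. finite_measure (\<nu> x) \<and> sets (\<nu> x) = sets borel) \<and>
     (\<forall>A\<in>sets borel. (\<lambda>x. measure (\<nu> x) A) \<in> borel_measurable borel) \<and>
     (\<exists>B. \<forall>x. measure (\<nu> x) UNIV \<le> B)"

definition weakly_continuous :: "('a::topological_space \<Rightarrow> 'a measure) \<Rightarrow> bool" where
  "weakly_continuous \<nu> \<longleftrightarrow>
     (\<forall>\<phi>\<in>bounded_continuous. continuous_on UNIV (\<lambda>x. \<integral>w. \<phi> w \<partial>\<nu> x))"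

definition jump_generator :: "('a \<Rightarrow> 'a measure) \<Rightarrow> ('a \<Rightarrow> real) \<Rightarrow> 'a \<Rightarrow> real" where
  "jump_generator \<nu> \<phi> x = (\<integral>w. (\<phi> w - \<phi> x) \<partial>\<nu> x)"


section \<open>C-Feller Markov processes\<close>

text \<open>
  A Markov process is given by its transition probabilities: \<open>T t x\<close> is the law at time \<open>t\<close> of
  the process started at \<open>x\<close>. Its values on negative \<open>t\<close> are irrelevant.
\<close>

definition markov_transition :: "(real \<Rightarrow> 'a::topological_space \<Rightarrow> 'a measure) \<Rightarrow> bool" where
  "markov_transition T \<longleftrightarrow>
     (\<forall>t\<ge>0. T t \<in> borel \<rightarrow>\<^sub>M prob_algebra borel) \<and>
     (\<forall>x. T 0 x = return borel x) \<and>
     (\<forall>s\<ge>0. \<forall>t\<ge>0. \<forall>x. T (s + t) x = T s x \<bind> T t)"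

definition C_Feller :: "(real \<Rightarrow> 'a::topological_space \<Rightarrow> 'a measure) \<Rightarrow> bool" where
  "C_Feller T \<longleftrightarrow> markov_transition T \<and>
     (\<forall>t\<ge>0. \<forall>\<phi>\<in>bounded_continuous. (\<lambda>x. \<integral>w. \<phi> w \<partial>T t x) \<in> bounded_continuous)"

text \<open>
  The operator \<open>A\<close>, given on the set \<open>E\<close> of functions, generates the C-Feller process with
  transition probabilities \<open>T\<close>: the infinitesimal generator (derivative of the semigroup at time
  zero in the supremum norm) is \<open>A\<close> on \<open>E\<close>.
\<close>

definition generates_C_Feller ::
    "('a::topological_space \<Rightarrow> real) set \<Rightarrow> (('a \<Rightarrow> real) \<Rightarrow> 'a \<Rightarrow> real)
      \<Rightarrow> (real \<Rightarrow> 'a \<Rightarrow> 'a measure) \<Rightarrow> bool" where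
  "generates_C_Feller E A T \<longleftrightarrow> C_Feller T \<and>
     (\<forall>g\<in>E. uniform_limit UNIV (\<lambda>t y. ((\<integral>u. g u \<partial>T t y) - g y) / t) (A g) (at_right 0))"


section \<open>The Pareto dual generator\<close>

text \<open>
  Bounded signed measures are represented by their set functions. The order on \<^typ>\<open>real ^ 'n\<close> is
  the coordinatewise one.
\<close>

definition pareto_F :: "((real ^ 'n) set \<Rightarrow> real) \<Rightarrow> real ^ 'n \<Rightarrow> real" where
  "pareto_F Q y = Q {x. y \<le> x}"

definition with_density :: "(real ^ 'n \<Rightarrow> real) \<Rightarrow> (real ^ 'n) set \<Rightarrow> real" where
  "with_density q A = (LINT x:A|lborel. q x)"

definition pareto_range :: "(real ^ 'n \<Rightarrow> real) set" where
  "pareto_range = {g. \<exists>q. integrable lborel q \<and> pareto_F (with_density q) = g}"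

text \<open>The density \<open>pareto_F_inv g\<close> is determined up to a null set when \<open>g\<close> is in \<open>pareto_range\<close>.\<close>

definition pareto_F_inv :: "(real ^ 'n \<Rightarrow> real) \<Rightarrow> real ^ 'n \<Rightarrow> real" where
  "pareto_F_inv g = (SOME q. integrable lborel q \<and> pareto_F (with_density q) = g)"

definition standard_dual ::
    "(real ^ 'n \<Rightarrow> (real ^ 'n) measure) \<Rightarrow> (real ^ 'n \<Rightarrow> real) \<Rightarrow> (real ^ 'n) set \<Rightarrow> real" where
  "standard_dual \<nu> q A =
     (\<integral>x. q x * measure (\<nu> x) A \<partial>lborel) - (LINT z:A|lborel. q z * measure (\<nu> z) UNIV)"

definition pareto_dual_generator ::
    "(real ^ 'n \<Rightarrow> (real ^ 'n) measure) \<Rightarrow> (real ^ 'n \<Rightarrow> real) \<Rightarrow> real ^ 'n \<Rightarrow> real" where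
  "pareto_dual_generator \<nu> g = pareto_F (standard_dual \<nu> (pareto_F_inv g))"


section \<open>Mixed derivatives\<close>

text \<open>
  \<open>G I\<close> is the derivative of \<open>g\<close> taken once in each coordinate in \<open>I\<close>; it exists, and does not
  depend on the order of differentiation. Given \<open>g\<close>, there is at most one such \<open>G\<close>.
\<close>

definition mixed_derivatives ::
    "(real ^ 'n \<Rightarrow> real) \<Rightarrow> ('n set \<Rightarrow> real ^ 'n \<Rightarrow> real) \<Rightarrow> bool" where
  "mixed_derivatives g G \<longleftrightarrow> G {} = g \<and>
     (\<forall>I i z. i \<notin> I \<longrightarrow>
        ((\<lambda>t. G I (z + t *\<^sub>R axis i 1)) has_real_derivative G (insert i I) z) (at 0))"

definition glue :: "'n set \<Rightarrow> real ^ 'n \<Rightarrow> ('n \<Rightarrow> real) \<Rightarrow> real ^ 'n" where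
  "glue I y z = (\<chi> i. if i \<in> I then z i else y $ i)"

text \<open>
  Functions with mixed derivatives, vanishing at infinity together with them. The last two
  conditions make the integrals in the integrated-by-parts formula absolutely convergent.
\<close>

definition vanishing_test_functions :: "(real ^ 'n \<Rightarrow> real) set" where
  "vanishing_test_functions = {g \<in> pareto_range.
     (\<exists>G. mixed_derivatives g G \<and> (\<forall>I. (G I \<longlongrightarrow> 0) at_infinity)) \<and>
     integrable lborel g \<and>
     (\<forall>y I. I \<noteq> {} \<and> I \<noteq> UNIV \<longrightarrow>
        set_integrable (Pi\<^sub>M I (\<lambda>_. lborel)) {z. \<forall>i\<in>I. y $ i \<le> z i} (\<lambda>z. g (glue I y z)))}"

text \<open>
  The pair \<open>(M, N)\<close> of finite measures stands for the signed measure \<open>M - N\<close>; the two need not be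
  mutually singular.
\<close>

type_synonym 'a signed_measure = "'a measure \<times> 'a measure"

definition smeasure :: "'a signed_measure \<Rightarrow> 'a set \<Rightarrow> real" where
  "smeasure Q A = measure (fst Q) A - measure (snd Q) A"

definition sintegral :: "'a signed_measure \<Rightarrow> ('a \<Rightarrow> real) \<Rightarrow> real" where
  "sintegral Q \<phi> = (\<integral>w. \<phi> w \<partial>fst Q) - (\<integral>w. \<phi> w \<partial>snd Q)"

text \<open>
  \<open>D I\<close> is the mixed derivative of the kernel \<open>\<nu>\<close> in the coordinates in \<open>I\<close>, a bounded signed
  kernel. Continuity and differentiation are in the weak topology of measures, as in
  \<^const>\<open>weakly_continuous\<close>.
\<close>

definition kernel_mixed_derivatives ::
    "(real ^ 'n \<Rightarrow> (real ^ 'n) measure) \<Rightarrow> ('n set \<Rightarrow> real ^ 'n \<Rightarrow> (real ^ 'n) signed_measure)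
      \<Rightarrow> bool" where
  "kernel_mixed_derivatives \<nu> D \<longleftrightarrow>
     (\<forall>I. bounded_kernel (\<lambda>z. fst (D I z)) \<and> bounded_kernel (\<lambda>z. snd (D I z))) \<and>
     (\<forall>\<phi>\<in>bounded_continuous.
        mixed_derivatives (\<lambda>z. \<integral>w. \<phi> w \<partial>\<nu> z) (\<lambda>I z. sintegral (D I z) \<phi>) \<and>
        (\<forall>I. continuous_on UNIV (\<lambda>z. sintegral (D I z) \<phi>)))"

text \<open>
  The dual process has its values in \<^typ>\<open>real ^ 'n\<close>, it is not killed and it is C-Feller. Together
  with the duality relation (and kernel derivatives as above) this forces the following three
  conditions on \<open>\<nu>\<close>, none of which follows from the sign conditions on the mixed derivatives:
  letting one coordinate of \<open>x\<close> tend to \<open>-\<infinity>\<close> in \<open>P (Y \<le> x)\<close> gives the first, letting all of them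
  tend to \<open>\<infinity>\<close> gives the second, and continuity in \<open>y\<close> of the law of \<open>Y\<close> gives the third. For
  instance, for a constant kernel of positive mass, both sign conditions hold and the first formula
  for the dual generator sends mass to infinity.
\<close>

definition pareto_proper :: "(real ^ 'n \<Rightarrow> (real ^ 'n) measure) \<Rightarrow> bool" where
  "pareto_proper \<nu> \<longleftrightarrow>
     (\<forall>x y i. ((\<lambda>s. measure (\<nu> (\<chi> j. if j = i then s else x $ j)) {w. y \<le> w}) \<longlongrightarrow> 0) at_bot) \<and>
     (\<forall>y. ((\<lambda>s. measure (\<nu> (\<chi> j. s)) {w. \<not> y \<le> w}) \<longlongrightarrow> 0) at_top) \<and>
     (\<forall>x i c. measure (\<nu> x) {w. w $ i = c} = 0)"

definition nonpositive_rate_derivatives ::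
    "('n set \<Rightarrow> real ^ 'n \<Rightarrow> (real ^ 'n) signed_measure) \<Rightarrow> bool" where
  "nonpositive_rate_derivatives D \<longleftrightarrow>
     (\<forall>I z. I \<noteq> {} \<and> I \<noteq> UNIV \<longrightarrow> smeasure (D I z) UNIV \<le> 0)"

definition top_derivative_signs ::
    "('n set \<Rightarrow> real ^ 'n \<Rightarrow> (real ^ 'n) signed_measure) \<Rightarrow> bool" where
  "top_derivative_signs D \<longleftrightarrow>
     (\<forall>y z. (\<not> y \<le> z \<longrightarrow> smeasure (D UNIV z) {w. y \<le> w} \<ge> 0) \<and>
            (y \<le> z \<longrightarrow> smeasure (D UNIV z) {w. \<not> y \<le> w} \<le> 0))"

end

(*
  Writing g as the tail integral of a density q, the generator is an integral of q against tail masses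
  of nu. Lebesgue's differentiation theorem, one coordinate at a time, identifies q with the mixed
  derivative of g up to sign, which is the first formula; if nu is differentiable, expanding it over the
  faces I at y of the orthant above y and integrating by parts gives the second one:
  L g y = (sum over nonempty I of the integral of g dens_I over the face I) - g y nu(y, UNIV).

  If L generates a process, L g y is nonnegative whenever g is nonnegative and vanishes at y. Bumps
  concentrated near a face then force dens_I to be nonnegative, which is the sign conditions.

  Conversely, nonnegative densities dens_I define a kernel kappa. The expansion of nu over boxes together
  with the properness of nu gives kappa(y, {z <= x}) = nu(x, {w >= y}) + (nu(y, UNIV) - nu(x, UNIV)) 1{y <= x},
  so kappa has the same total rate as nu, and L is the jump generator of kappa. The same identity
  says that the steps of the two uniformized chains are dual, which passes to the iterates and to the
  semigroups. These are the only processes with the given generators: a generator equation on a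
  bounded pointwise dense set extends to all bounded continuous functions with an error O(t^2), which
  determines the semigroup.
*)
theory Submission
  imports Defs
begin

section \<open>Coordinates and mixed derivatives\<close>

text \<open>The signed kernels \<open>D I\<close> are controlled only through bounded continuous
  integrands, whereas the generator involves masses of orthants \<open>{w. y \<le> w}\<close>.
  Orthants are closed, so identities between integrals are proved for continuous functions and
  passed to the limit by dominated convergence. A sign at a single point \<open>z\<close> escapes
  this method, because \<open>smeasure (D UNIV z) {w. y \<le> w}\<close> need not be continuous in
  \<open>z\<close>. The indicator of the orthant is therefore replaced by an average of orthant
  indicators over shifted vertices, whose integral is continuous in \<open>z\<close>. Uniqueness
  works for a small class of test functions because all estimates depend on a function only through
  a bound of its absolute value. They survive bounded pointwise limits, and products of one-variable
  bumps are rich enough by Stone-Weierstrass. The rate of uniformization must be common to both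
  kernels: the staying probabilities of the two chains then absorb the difference of the jump rates
  at \<open>x\<close> and at \<open>y\<close>.\<close>

abbreviation lborel_pi :: "'n set \<Rightarrow> ('n \<Rightarrow> real) measure" where
  "lborel_pi I \<equiv> Pi\<^sub>M I (\<lambda>_. lborel)"

definition vupd :: "real ^ 'n \<Rightarrow> 'n \<Rightarrow> real \<Rightarrow> real ^ 'n" where
  "vupd z i s = (\<chi> j. if j = i then s else z $ j)"

lemma vupd_nth [simp]: "vupd z i s $ j = (if j = i then s else z $ j)"
  by (simp add: vupd_def)

lemma glue_nth [simp]: "glue I y z $ i = (if i \<in> I then z i else y $ i)"
  by (simp add: glue_def)

lemma glue_empty [simp]: "glue {} y z = y"
  by (simp add: vec_eq_iff)

lemma glue_UNIV: "glue UNIV y z = (\<chi> i. z i)"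
  by (simp add: vec_eq_iff)

lemma glue_insert: "glue (insert i I) y z = vupd (glue I y z) i (z i)"
  by (simp add: vec_eq_iff)

lemma glue_insert_upd: "i \<notin> I \<Longrightarrow> glue (insert i I) y (z(i := t)) = vupd (glue I y z) i t"
  by (auto simp add: vec_eq_iff)

lemma glue_vupd: "i \<notin> I \<Longrightarrow> glue I (vupd y i t) z = vupd (glue I y z) i t"
  by (auto simp add: vec_eq_iff)

lemma sigma_finite_lborel_pi: "sigma_finite_measure (lborel_pi (I :: 'n::finite set))"
proof -
  interpret product_sigma_finite "\<lambda>_::'n. lborel :: real measure" by standard
  show ?thesis by (rule sigma_finite) simp
qed

lemma borel_measurable_vec:
  assumes "\<And>i. (\<lambda>x. f x i) \<in> borel_measurable M"
  shows "(\<lambda>x. (\<chi> i. f x i) :: real ^ 'n) \<in> borel_measurable M"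
proof (subst borel_measurable_euclidean_space, rule ballI)
  fix b :: "real ^ 'n" assume "b \<in> Basis"
  then obtain i where b: "b = axis i 1"
    by (auto simp: Basis_vec_def)
  show "(\<lambda>x. (\<chi> i. f x i) \<bullet> b) \<in> borel_measurable M"
    using assms by (simp add: b inner_axis)
qed

lemma glue_measurable [measurable]:
  "glue I y \<in> borel_measurable (lborel_pi (I :: 'n::finite set))"
  unfolding glue_def
proof (rule borel_measurable_vec)
  fix i :: 'n
  show "(\<lambda>x. if i \<in> I then x i else y $ i) \<in> borel_measurable (lborel_pi I)"
    by (cases "i \<in> I") auto
qed

lemma vec_nth_measurable [measurable]: "(\<lambda>x::real^'n. x $ i) \<in> borel_measurable borel"
  by (intro borel_measurable_continuous_onI continuous_intros)

lemma vec_le_sets [measurable, simp]: "{w. (y :: real^'n) \<le> w} \<in> sets borel" "{w. w \<le> (y :: real^'n)} \<in> sets borel"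
  by (simp_all add: less_eq_vec_def)

lemma vec_not_le_sets [measurable, simp]: "{w. \<not> (y :: real^'n) \<le> w} \<in> sets borel"
  by (simp add: less_eq_vec_def)

lemma closed_vec_ge: "closed {w. (y :: real^'n) \<le> w}"
  by (simp add: less_eq_vec_def closed_Collect_all closed_Collect_le continuous_intros)

section \<open>Lebesgue measure as a product over coordinates\<close>

text \<open>Lebesgue measure is determined by its values on open boxes, and these factor. The vector
  \<open>y\<close> is arbitrary since \<open>glue UNIV\<close> overwrites every coordinate; with it,
  the whole space can be treated as one more face at \<open>y\<close>.\<close>

lemma lborel_eq_distr_glue:
  "(lborel :: (real ^ 'n) measure) = distr (lborel_pi UNIV) borel (glue UNIV y)"
proof (rule lborel_eqI)
  interpret product_sigma_finite "\<lambda>_::'n. lborel :: real measure" by standard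
  fix l u :: "real^'n" assume le: "\<And>b. b \<in> Basis \<Longrightarrow> l \<bullet> b \<le> u \<bullet> b"
  have le': "l $ i \<le> u $ i" for i
    using le[of "axis i 1"] by (simp add: inner_axis)
  have "emeasure (distr (lborel_pi UNIV) borel (glue UNIV y)) (box l u) =
     emeasure (lborel_pi UNIV) (\<Pi>\<^sub>E i\<in>UNIV. {l $ i <..< u $ i})"
    by (subst emeasure_distr) (auto simp: space_PiM PiE_def Pi_def mem_box_cart intro!: arg_cong[where f="emeasure _"])
  also have "\<dots> = (\<Prod>i\<in>UNIV. emeasure lborel {l $ i <..< u $ i})"
    by (subst emeasure_PiM) auto
  also have "\<dots> = ennreal (\<Prod>i\<in>UNIV. u $ i - l $ i)"
    using le' by (simp add: prod_ennreal)
  also have "(\<Prod>i\<in>UNIV. u $ i - l $ i) = (\<Prod>b\<in>Basis. (u - l) \<bullet> b)"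
  proof -
    have B: "(Basis :: (real^'n) set) = (\<lambda>i. axis i 1) ` UNIV"
      by (auto simp: Basis_vec_def)
    have "inj (\<lambda>i. axis i (1::real) :: real^'n)"
      by (auto simp: inj_def axis_eq_axis)
    then show ?thesis
      unfolding B by (subst prod.reindex) (auto simp: inner_axis)
  qed
  finally show "emeasure (distr (lborel_pi UNIV) borel (glue UNIV y)) (box l u) = ennreal (\<Prod>b\<in>Basis. (u - l) \<bullet> b)" .
qed simp

lemma lborel_integral_glue:
  fixes f :: "real ^ 'n \<Rightarrow> real"
  assumes [measurable]: "f \<in> borel_measurable borel"
  shows "(\<integral>z. f z \<partial>lborel) = (\<integral>z. f (glue UNIV y z) \<partial>lborel_pi UNIV)"
  by (subst lborel_eq_distr_glue[of y]) (simp add: integral_distr)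

lemma lborel_integrable_glue:
  fixes f :: "real ^ 'n \<Rightarrow> real"
  assumes [measurable]: "f \<in> borel_measurable borel"
  shows "integrable lborel f \<longleftrightarrow> integrable (lborel_pi UNIV) (\<lambda>z. f (glue UNIV y z))"
  by (subst lborel_eq_distr_glue[of y]) (simp add: integrable_distr_eq)

lemma lborel_pi_box:
  fixes I :: "'n::finite set"
  shows "{z \<in> space (lborel_pi I). \<forall>i\<in>I. a i \<le> z i \<and> z i \<le> b i} \<in> sets (lborel_pi I)"
    "emeasure (lborel_pi I) {z \<in> space (lborel_pi I). \<forall>i\<in>I. a i \<le> z i \<and> z i \<le> b i} < \<infinity>"
proof -
  interpret product_sigma_finite "\<lambda>_::'n. lborel :: real measure" by standard
  have eq: "{z \<in> space (lborel_pi I). \<forall>i\<in>I. a i \<le> z i \<and> z i \<le> b i} = (\<Pi>\<^sub>E i\<in>I. {a i .. b i})"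
    by (auto simp: space_PiM PiE_def Pi_def)
  show "{z \<in> space (lborel_pi I). \<forall>i\<in>I. a i \<le> z i \<and> z i \<le> b i} \<in> sets (lborel_pi I)"
    by measurable
  have "(\<Prod>i\<in>I. emeasure lborel {a i..b i}) < \<infinity>"
    by (induction I rule: infinite_finite_induct) (auto simp: ennreal_mult_less_top emeasure_lborel_Icc_eq)
  then show "emeasure (lborel_pi I) {z \<in> space (lborel_pi I). \<forall>i\<in>I. a i \<le> z i \<and> z i \<le> b i} < \<infinity>"
    unfolding eq by (subst emeasure_PiM) auto
qed

lemma lborel_pi_integrable_box:
  fixes f :: "('n::finite \<Rightarrow> real) \<Rightarrow> real"
  assumes f: "f \<in> borel_measurable (lborel_pi I)"
    and bd: "\<And>z. \<bar>f z\<bar> \<le> C"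
    and supp: "\<And>z. \<not> (\<forall>i\<in>I. a i \<le> z i \<and> z i \<le> b i) \<Longrightarrow> f z = 0"
  shows "integrable (lborel_pi I) f"
proof (rule Bochner_Integration.integrable_bound)
  let ?B = "{z \<in> space (lborel_pi I). \<forall>i\<in>I. a i \<le> z i \<and> z i \<le> b i}"
  show "integrable (lborel_pi I) (\<lambda>z. C * indicator ?B z)"
    using lborel_pi_box[of I a b] by simp
  show "AE x in lborel_pi I. norm (f x) \<le> norm (C * indicator ?B x)"
    using bd supp by (intro AE_I2) (auto simp: indicator_def intro: order_trans[OF _ abs_ge_self])
qed fact

section \<open>Calculus of mixed derivatives\<close>

text \<open>\<open>mixed_derivatives\<close> differentiates at the base point only. Moving the base
  point along the axis gives the derivative of a whole one-dimensional section, the form required by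
  the fundamental theorem of calculus.\<close>

lemma mixed_derivatives_vupd:
  assumes "mixed_derivatives g G" "i \<notin> I"
  shows "((\<lambda>s. G I (vupd z i s)) has_real_derivative G (insert i I) (vupd z i s)) (at s)"
proof -
  have "vupd z i s + t *\<^sub>R axis i 1 = vupd z i (s + t)" for t
    by (auto simp: vec_eq_iff axis_def)
  moreover have "((\<lambda>t. G I (vupd z i s + t *\<^sub>R axis i 1)) has_real_derivative G (insert i I) (vupd z i s)) (at 0)"
    using assms unfolding mixed_derivatives_def by blast
  ultimately have "((\<lambda>t. G I (vupd z i (s + t))) has_real_derivative G (insert i I) (vupd z i s)) (at 0)"
    by simp
  then show ?thesis
    using DERIV_shift[of "\<lambda>s. G I (vupd z i s)" _ 0 s] by (simp add: add.commute)
qed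

lemma mixed_derivatives_add:
  assumes "mixed_derivatives g G" "mixed_derivatives h H"
  shows "mixed_derivatives (\<lambda>x. g x + h x) (\<lambda>I x. G I x + H I x)"
  using assms unfolding mixed_derivatives_def by (auto intro!: derivative_eq_intros)

text \<open>Leibniz rule: \<open>K\<close> collects the coordinates whose derivative falls on
  \<open>g\<close>. Differentiation in a new coordinate \<open>i\<close> doubles the terms,
  according to whether \<open>i\<close> joins \<open>K\<close> or its complement, which is the
  splitting of \<open>Pow (insert i I)\<close>.\<close>

lemma mixed_derivatives_mult:
  fixes g h :: "real ^ 'n \<Rightarrow> real"
  assumes g: "mixed_derivatives g G" and h: "mixed_derivatives h H"
  shows "mixed_derivatives (\<lambda>x. g x * h x) (\<lambda>I x. \<Sum>K\<in>Pow I. G K x * H (I - K) x)"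
  unfolding mixed_derivatives_def
proof (intro conjI allI impI)
  show "(\<lambda>x. \<Sum>K\<in>Pow {}. G K x * H ({} - K) x) = (\<lambda>x. g x * h x)"
    using g h by (simp add: mixed_derivatives_def)
  fix I :: "'n set" and i and z :: "real^'n" assume i: "i \<notin> I"
  have 1: "((\<lambda>t. G K (z + t *\<^sub>R axis i 1)) has_real_derivative G (insert i K) z) (at 0)"
     "((\<lambda>t. H (I - K) (z + t *\<^sub>R axis i 1)) has_real_derivative H (insert i (I - K)) z) (at 0)"
    if "K \<in> Pow I" for K
    using g h i that unfolding mixed_derivatives_def by blast+
  have "((\<lambda>t. \<Sum>K\<in>Pow I. G K (z + t *\<^sub>R axis i 1) * H (I - K) (z + t *\<^sub>R axis i 1))
    has_real_derivative (\<Sum>K\<in>Pow I. G (insert i K) z * H (I - K) z + H (insert i (I - K)) z * G K z)) (at 0)"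
    by (intro DERIV_sum) (use DERIV_mult[OF 1] in simp)
  moreover have "(\<Sum>K\<in>Pow (insert i I). G K z * H (insert i I - K) z) =
     (\<Sum>K\<in>Pow I. G (insert i K) z * H (I - K) z + H (insert i (I - K)) z * G K z)"
  proof -
    have "(\<Sum>K\<in>Pow (insert i I). G K z * H (insert i I - K) z) =
       (\<Sum>K\<in>Pow I. G K z * H (insert i I - K) z) + (\<Sum>K\<in>insert i ` Pow I. G K z * H (insert i I - K) z)"
      unfolding Pow_insert using i by (intro sum.union_disjoint) auto
    also have "(\<Sum>K\<in>insert i ` Pow I. G K z * H (insert i I - K) z) = (\<Sum>K\<in>Pow I. G (insert i K) z * H (insert i I - insert i K) z)"
    proof (subst sum.reindex)
      show "inj_on (insert i) (Pow I)"
        using i by (intro inj_onI) (metis PowD insert_ident subsetD)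
    qed (simp add: o_def)
    also have "\<dots> = (\<Sum>K\<in>Pow I. G (insert i K) z * H (I - K) z)"
    proof (intro sum.cong refl)
      fix K assume "K \<in> Pow I"
      then have "insert i I - insert i K = I - K" using i by auto
      then show "G (insert i K) z * H (insert i I - insert i K) z = G (insert i K) z * H (I - K) z" by simp
    qed
    also have "(\<Sum>K\<in>Pow I. G K z * H (insert i I - K) z) = (\<Sum>K\<in>Pow I. H (insert i (I - K)) z * G K z)"
    proof (intro sum.cong refl)
      fix K assume "K \<in> Pow I"
      then have "insert i I - K = insert i (I - K)" using i by auto
      then show "G K z * H (insert i I - K) z = H (insert i (I - K)) z * G K z" by simp
    qed
    finally show ?thesis by (simp add: sum.distrib add.commute)
  qed
  ultimately show "((\<lambda>t. \<Sum>K\<in>Pow I. G K (z + t *\<^sub>R axis i 1) * H (I - K) (z + t *\<^sub>R axis i 1))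
     has_real_derivative (\<Sum>K\<in>Pow (insert i I). G K z * H (insert i I - K) z)) (at 0)"
    by simp
qed

definition prod_deriv :: "('n \<Rightarrow> real \<Rightarrow> real) \<Rightarrow> ('n \<Rightarrow> real \<Rightarrow> real) \<Rightarrow> 'n set \<Rightarrow> real ^ 'n \<Rightarrow> real" where
  "prod_deriv u u' I z = (\<Prod>i\<in>UNIV. if i \<in> I then u' i (z $ i) else u i (z $ i))"

lemma mixed_derivatives_prod:
  assumes "\<And>i t. (u i has_real_derivative u' i t) (at t)"
  shows "mixed_derivatives (\<lambda>z::real^'n. \<Prod>i\<in>UNIV. u i (z $ i)) (prod_deriv u u')"
  unfolding mixed_derivatives_def
proof (intro conjI allI impI)
  show "prod_deriv u u' {} = (\<lambda>z. \<Prod>i\<in>UNIV. u i (z $ i))"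
    by (simp add: prod_deriv_def fun_eq_iff)
  fix I :: "'n set" and i and z :: "real^'n" assume i: "i \<notin> I"
  define c where "c = (\<Prod>j\<in>UNIV - {i}. if j \<in> I then u' j (z $ j) else u j (z $ j))"
  have 1: "prod_deriv u u' I (z + t *\<^sub>R axis i 1) = c * u i (t + z $ i)" for t
  proof -
    have "(\<Prod>j\<in>UNIV - {i}. if j \<in> I then u' j ((z + t *\<^sub>R axis i 1) $ j) else u j ((z + t *\<^sub>R axis i 1) $ j)) = c"
      unfolding c_def by (intro prod.cong) (auto simp: axis_def)
    then show ?thesis
      unfolding prod_deriv_def using i by (subst prod.remove[of _ i]) (auto simp: axis_def add.commute)
  qed
  have 2: "prod_deriv u u' (insert i I) z = c * u' i (z $ i)"
  proof -
    have "(\<Prod>j\<in>UNIV - {i}. if j \<in> insert i I then u' j (z $ j) else u j (z $ j)) = c"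
      unfolding c_def by (intro prod.cong) auto
    then show ?thesis
      unfolding prod_deriv_def using i by (subst prod.remove[of _ i]) auto
  qed
  have "((\<lambda>t. u i (t + z $ i)) has_real_derivative u' i (z $ i)) (at 0)"
    using DERIV_shift[of "u i" "u' i (z $ i)" 0 "z $ i"] assms by simp
  then show "((\<lambda>t. prod_deriv u u' I (z + t *\<^sub>R axis i 1)) has_real_derivative prod_deriv u u' (insert i I) z) (at 0)"
    unfolding 1 2 by (rule DERIV_cmult)
qed

lemma continuous_on_prod_deriv:
  assumes "\<And>i. continuous_on UNIV (u i)" "\<And>i. continuous_on UNIV (u' i)"
  shows "continuous_on UNIV (prod_deriv u u' I :: real^'n \<Rightarrow> real)"
proof -
  have "continuous_on UNIV (\<lambda>z::real^'n. if i \<in> I then u' i (z $ i) else u i (z $ i))" for i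
  proof -
    have "continuous_on UNIV (\<lambda>z::real^'n. z $ i)"
      by (intro continuous_intros)
    then have "continuous_on UNIV (\<lambda>z::real^'n. u i (z $ i))" "continuous_on UNIV (\<lambda>z::real^'n. u' i (z $ i))"
      using continuous_on_compose2[OF assms(1)] continuous_on_compose2[OF assms(2)] by blast+
    then show ?thesis by (cases "i \<in> I") auto
  qed
  then show ?thesis unfolding prod_deriv_def by (intro continuous_on_prod)
qed

section \<open>Integration by parts\<close>

lemma has_derivative_max0_sq: "((\<lambda>s::real. (max 0 s)\<^sup>2) has_real_derivative 2 * max 0 s) (at s)"
proof -
  consider "s < 0" | "s > 0" | "s = 0" by linarith
  then show ?thesis
  proof cases
    case 1
    have "((\<lambda>s::real. 0) has_real_derivative 0) (at s)" by simp
    then have "((\<lambda>s::real. (max 0 s)\<^sup>2) has_real_derivative 0) (at s)"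
      by (rule has_field_derivative_transform_within_open[of _ _ _ "{..<0}"]) (use 1 in auto)
    then show ?thesis using 1 by simp
  next
    case 2
    have "((\<lambda>s::real. s\<^sup>2) has_real_derivative 2 * s) (at s)" by (auto intro!: derivative_eq_intros)
    then have "((\<lambda>s::real. (max 0 s)\<^sup>2) has_real_derivative 2 * s) (at s)"
      by (rule has_field_derivative_transform_within_open[of _ _ _ "{0<..}"]) (use 2 in auto)
    then show ?thesis using 2 by simp
  next
    case 3
    have "((\<lambda>h::real. (max 0 h)\<^sup>2 / h) \<longlongrightarrow> 0) (at 0)"
    proof (rule Lim_null_comparison)
      show "\<forall>\<^sub>F h in at 0. norm ((max 0 h)\<^sup>2 / h) \<le> \<bar>h\<bar>"
        by (rule always_eventually) (auto simp: max_def power2_eq_square)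
      show "((\<lambda>h::real. \<bar>h\<bar>) \<longlongrightarrow> 0) (at 0)"
        by (auto intro!: tendsto_eq_intros)
    qed
    then show ?thesis using 3 by (simp add: DERIV_def)
  qed
qed

section \<open>Bumps and cutoff functions\<close>

text \<open>A bump on the interval from -1 to 1 with value 1 at the origin. The outer square makes
  it continuously differentiable at the ends of the interval; this suffices because mixed
  derivatives differentiate once in each coordinate.\<close>

definition bump :: "real \<Rightarrow> real" where
  "bump t = (max 0 (1 - t\<^sup>2))\<^sup>2"

definition bump' :: "real \<Rightarrow> real" where
  "bump' t = - 4 * t * max 0 (1 - t\<^sup>2)"

lemma bump_deriv: "(bump has_real_derivative bump' t) (at t)"
proof -
  have "((\<lambda>t. 1 - t\<^sup>2) has_real_derivative - (2 * t)) (at t)"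
    by (auto intro!: derivative_eq_intros)
  from DERIV_chain2[OF has_derivative_max0_sq this] show ?thesis
    unfolding bump_def[abs_def] bump'_def by (simp add: algebra_simps)
qed

lemma bump_nonneg [simp]: "0 \<le> bump t"
  by (simp add: bump_def)

lemma bump_le_1: "bump t \<le> 1"
  by (simp add: bump_def power_le_one)

lemma bump_0 [simp]: "bump 0 = 1"
  by (simp add: bump_def)

lemma bump_outside: "1 \<le> \<bar>t\<bar> \<Longrightarrow> bump t = 0" "1 \<le> \<bar>t\<bar> \<Longrightarrow> bump' t = 0"
  by (simp_all add: bump_def bump'_def abs_le_square_iff[of 1 t, simplified])

lemma bump'_bound: "\<bar>bump' t\<bar> \<le> 4"
proof (cases "1 \<le> \<bar>t\<bar>")
  case False
  then have "\<bar>t\<bar> * max 0 (1 - t\<^sup>2) \<le> 1 * 1"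
    by (intro mult_mono) auto
  then show ?thesis by (simp add: bump'_def abs_mult)
qed (simp add: bump_outside)

lemma continuous_bump: "continuous_on A bump" "continuous_on A bump'"
  unfolding bump_def[abs_def] bump'_def[abs_def] by (intro continuous_intros)+

text \<open>\<open>cutoff k {}\<close> is a product of bumps of half-width \<open>Suc k\<close>; the
  second argument selects one of its mixed derivatives, so the function and its derivatives form a
  single family.\<close>

definition cutoff :: "nat \<Rightarrow> 'n set \<Rightarrow> real ^ 'n \<Rightarrow> real" where
  "cutoff k = prod_deriv (\<lambda>_ t. bump (t / real (Suc k))) (\<lambda>_ t. bump' (t / real (Suc k)) / real (Suc k))"

lemma mixed_derivatives_cutoff: "mixed_derivatives (cutoff k {}) (cutoff k)"
proof -
  have "((\<lambda>t. bump (t / real (Suc k))) has_real_derivative bump' (t / real (Suc k)) / real (Suc k)) (at t)" for t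
  proof -
    have "((\<lambda>t. t / real (Suc k)) has_real_derivative 1 / real (Suc k)) (at t)"
      by (rule DERIV_cdivide[OF DERIV_ident])
    from DERIV_chain2[OF bump_deriv this] show ?thesis by simp
  qed
  from mixed_derivatives_prod[of "\<lambda>_ t. bump (t / real (Suc k))", OF this]
  show ?thesis unfolding cutoff_def by (simp add: prod_deriv_def[abs_def])
qed

lemma continuous_cutoff: "continuous_on UNIV (cutoff k I)"
  unfolding cutoff_def
  by (intro continuous_on_prod_deriv continuous_intros
      continuous_on_compose2[OF continuous_bump(1)[of UNIV]] continuous_on_compose2[OF continuous_bump(2)[of UNIV]]) auto

lemma cutoff_outside: "real (Suc k) \<le> \<bar>z $ i\<bar> \<Longrightarrow> cutoff k I z = 0"
proof -
  assume "real (Suc k) \<le> \<bar>z $ i\<bar>"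
  then have "1 \<le> \<bar>z $ i / real (Suc k)\<bar>" by (simp add: field_simps)
  from bump_outside[OF this] show ?thesis
    unfolding cutoff_def prod_deriv_def by (intro prod_zero) (auto intro!: bexI[of _ i])
qed

lemma abs_cutoff_le: "\<bar>cutoff k I (z :: real^'n)\<bar> \<le> 4 ^ CARD('n)"
proof -
  have "\<bar>if i \<in> I then bump' (z $ i / real (Suc k)) / real (Suc k) else bump (z $ i / real (Suc k))\<bar> \<le> 4" for i
  proof -
    have "\<bar>bump' (z $ i / real (Suc k))\<bar> / real (Suc k) \<le> 4 / 1"
      by (intro frac_le) (auto simp: bump'_bound)
    then show ?thesis
      using bump_le_1[of "z $ i / real (Suc k)"] by auto
  qed
  then have "\<bar>cutoff k I z\<bar> \<le> (\<Prod>i\<in>(UNIV::'n set). 4)"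
    unfolding cutoff_def prod_deriv_def abs_prod by (intro prod_mono) auto
  then show ?thesis by simp
qed

text \<open>Each differentiation brings out a factor \<open>1 / real (Suc k)\<close>, so in the
  limit only the undifferentiated cutoff survives.\<close>

lemma cutoff_tendsto: "(\<lambda>k. cutoff k I z) \<longlonglongrightarrow> (if I = {} then 1 else 0)"
proof -
  have 0: "(\<lambda>k. c / real (Suc k)) \<longlonglongrightarrow> 0" for c :: real
    using tendsto_mult_left[OF LIMSEQ_inverse_real_of_nat, of c] by (simp add: divide_inverse)
  have b: "isCont bump 0"
    using continuous_bump(1)[of UNIV] by (simp add: continuous_on_eq_continuous_at)
  have 1: "(\<lambda>k. bump (c / real (Suc k))) \<longlonglongrightarrow> 1" for c
    using isCont_tendsto_compose[OF b 0] by simp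
  have 2: "(\<lambda>k. bump' (c / real (Suc k)) / real (Suc k)) \<longlonglongrightarrow> 0" for c
  proof (rule Lim_null_comparison[OF _ 0[of 4]])
    show "\<forall>\<^sub>F k in sequentially. norm (bump' (c / real (Suc k)) / real (Suc k)) \<le> 4 / real (Suc k)"
      by (intro always_eventually allI) (auto simp: intro!: divide_right_mono bump'_bound)
  qed
  have "(\<lambda>k. \<Prod>i\<in>UNIV. if i \<in> I then bump' (z $ i / real (Suc k)) / real (Suc k) else bump (z $ i / real (Suc k)))
     \<longlonglongrightarrow> (\<Prod>i\<in>UNIV. if i \<in> I then 0 else 1)"
    by (intro tendsto_prod) (use 1 2 in auto)
  moreover have "(\<Prod>i\<in>UNIV. if i \<in> I then 0 else 1::real) = (if I = {} then 1 else 0)"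
    by (auto intro!: prod_zero)
  ultimately show ?thesis unfolding cutoff_def prod_deriv_def by simp
qed

section \<open>Expansion over the faces of a box\<close>

text \<open>The points \<open>glue I y z\<close> that count lie in a compact box, degenerate in the
  coordinates outside \<open>I\<close>, on which a continuous function is bounded.\<close>

lemma face_bounded:
  assumes cont: "continuous_on UNIV f"
  shows "\<exists>C. \<forall>z. \<bar>if \<forall>i\<in>I. a i \<le> z i \<and> z i \<le> b i then f (glue I y z) else 0 :: real\<bar> \<le> C"
proof -
  let ?B = "cbox (glue I y a) (glue I y b)"
  have "compact (f ` ?B)"
    by (intro compact_continuous_image continuous_on_subset[OF cont]) auto
  then obtain C where C: "\<And>x. x \<in> ?B \<Longrightarrow> \<bar>f x\<bar> \<le> C"
    unfolding compact_eq_bounded_closed bounded_iff by auto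
  have "\<bar>if \<forall>i\<in>I. a i \<le> z i \<and> z i \<le> b i then f (glue I y z) else 0 :: real\<bar> \<le> max 0 C" for z
  proof (cases "\<forall>i\<in>I. a i \<le> z i \<and> z i \<le> b i")
    case True
    then have "glue I y z \<in> ?B" by (simp add: mem_box_cart)
    from C[OF this] True show ?thesis by auto
  qed auto
  then show ?thesis by blast
qed

lemma face_integrable:
  assumes cont: "continuous_on UNIV f"
  shows "integrable (lborel_pi (I :: 'n::finite set)) (\<lambda>z. if \<forall>i\<in>I. a i \<le> z i \<and> z i \<le> b i then f (glue I y z) else 0 :: real)"
proof -
  have [measurable]: "f \<in> borel_measurable borel"
    using cont by (rule borel_measurable_continuous_onI)
  obtain C where "\<And>z. \<bar>if \<forall>i\<in>I. a i \<le> z i \<and> z i \<le> b i then f (glue I y z) else 0 :: real\<bar> \<le> C"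
    using face_bounded[OF cont, of I a b y] by blast
  then show ?thesis
    by (intro lborel_pi_integrable_box[where a=a and b=b and C=C]) auto
qed

text \<open>Fubini with the new coordinate innermost, which isolates a one-dimensional integral for
  the fundamental theorem of calculus.\<close>

lemma integral_face_insert:
  fixes f :: "real ^ 'n \<Rightarrow> real"
  assumes cont: "continuous_on UNIV f" and j: "j \<notin> I"
  shows "(\<integral>z. (if \<forall>i\<in>insert j I. a i \<le> z i \<and> z i \<le> b i then f (glue (insert j I) y z) else 0) \<partial>lborel_pi (insert j I)) =
    (\<integral>z. (if \<forall>i\<in>I. a i \<le> z i \<and> z i \<le> b i then
        \<integral>t. f (vupd (glue I y z) j t) * indicator {a j .. b j} t \<partial>lborel else 0) \<partial>lborel_pi I)"
proof -
  interpret product_sigma_finite "\<lambda>_::'n. lborel :: real measure" by standard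
  show ?thesis
    unfolding product_integral_insert[OF finite j face_integrable[OF cont]]
  proof (intro Bochner_Integration.integral_cong refl)
    fix z :: "'n \<Rightarrow> real"
    have "(\<forall>i\<in>insert j I. a i \<le> (z(j := t)) i \<and> (z(j := t)) i \<le> b i) \<longleftrightarrow>
       t \<in> {a j..b j} \<and> (\<forall>i\<in>I. a i \<le> z i \<and> z i \<le> b i)" for t
      using j by auto
    then show "(\<integral>t. (if \<forall>i\<in>insert j I. a i \<le> (z(j := t)) i \<and> (z(j := t)) i \<le> b i
               then f (glue (insert j I) y (z(j := t))) else 0) \<partial>lborel) =
         (if \<forall>i\<in>I. a i \<le> z i \<and> z i \<le> b i then
            \<integral>t. f (vupd (glue I y z) j t) * indicator {a j..b j} t \<partial>lborel else 0)"
      by (auto simp: glue_insert_upd[OF j] indicator_def if_distrib cong: if_cong intro!: Bochner_Integration.integral_cong)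
  qed
qed

lemma mixed_derivatives_FTC:
  assumes md: "mixed_derivatives g G" and cont: "\<And>I. continuous_on UNIV (G I)" and j: "j \<notin> I" and le: "a \<le> b"
  shows "(\<integral>t. G (insert j I) (vupd z j t) * indicator {a .. b} t \<partial>lborel) = G I (vupd z j b) - G I (vupd z j a)"
proof (rule integral_FTC_Icc_real[OF le])
  fix t
  show "((\<lambda>s. G I (vupd z j s)) has_real_derivative G (insert j I) (vupd z j t)) (at t)"
    using mixed_derivatives_vupd[OF md j] .
  have "continuous_on UNIV (\<lambda>t. vupd z j t)"
    unfolding vupd_def
  proof (rule continuous_on_vec_lambda)
    fix i show "continuous_on UNIV (\<lambda>x. if i = j then x else z $ i)"
      by (cases "i = j") auto
  qed
  then have "continuous_on UNIV (\<lambda>t. G (insert j I) (vupd z j t))"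
    using continuous_on_compose2[OF cont] by blast
  then show "isCont (\<lambda>t. G (insert j I) (vupd z j t)) t"
    by (simp add: continuous_on_eq_continuous_at)
qed

text \<open>Iterated fundamental theorem of calculus. In the induction step the base point moves
  from \<open>y\<close> to \<open>vupd y j (x j)\<close>. The move changes the term over a face
  \<open>I\<close> by the term over \<open>insert j I\<close>, and the old and new terms together
  run through all subsets of \<open>insert j J\<close>.\<close>

lemma mixed_derivatives_expansion:
  fixes g :: "real ^ 'n \<Rightarrow> real"
  assumes md: "mixed_derivatives g G" and cont: "\<And>I. continuous_on UNIV (G I)"
    and le: "\<And>i. i \<in> J \<Longrightarrow> y $ i \<le> x i"
  shows "g (glue J y x) = (\<Sum>I\<in>Pow J. \<integral>z. (if \<forall>i\<in>I. y $ i \<le> z i \<and> z i \<le> x i then G I (glue I y z) else 0) \<partial>lborel_pi I)"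
proof -
  have "finite J" by simp
  then show ?thesis using le
  proof (induction J arbitrary: y rule: finite_induct)
    case empty
    have "G {} = g" using md by (simp add: mixed_derivatives_def)
    then show ?case by (simp add: PiM_empty)
  next
    case (insert j J)
    define y' where "y' = vupd y j (x j)"
    have fj: "glue (insert j J) y x = glue J y' x"
      using insert.hyps by (simp add: y'_def glue_vupd glue_insert)
    have "g (glue J y' x) = (\<Sum>I\<in>Pow J. \<integral>z. (if \<forall>i\<in>I. y' $ i \<le> z i \<and> z i \<le> x i then G I (glue I y' z) else 0) \<partial>lborel_pi I)"
      using insert.prems insert.hyps by (intro insert.IH) (auto simp: y'_def)
    also have "\<dots> = (\<Sum>I\<in>Pow J. (\<integral>z. (if \<forall>i\<in>I. y $ i \<le> z i \<and> z i \<le> x i then G I (glue I y z) else 0) \<partial>lborel_pi I)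
      + (\<integral>z. (if \<forall>i\<in>insert j I. y $ i \<le> z i \<and> z i \<le> x i then G (insert j I) (glue (insert j I) y z) else 0) \<partial>lborel_pi (insert j I)))"
    proof (intro sum.cong refl)
      fix I assume "I \<in> Pow J"
      then have jI: "j \<notin> I" using insert.hyps by auto
      have eq: "(if \<forall>i\<in>I. y' $ i \<le> z i \<and> z i \<le> x i then G I (glue I y' z) else 0) =
          (if \<forall>i\<in>I. y $ i \<le> z i \<and> z i \<le> x i then G I (glue I y z) else 0)
          + (if \<forall>i\<in>I. y $ i \<le> z i \<and> z i \<le> x i then
        \<integral>t. G (insert j I) (vupd (glue I y z) j t) * indicator {y $ j .. x j} t \<partial>lborel else 0)" for z
      proof -
        have 1: "(\<forall>i\<in>I. y' $ i \<le> z i \<and> z i \<le> x i) \<longleftrightarrow> (\<forall>i\<in>I. y $ i \<le> z i \<and> z i \<le> x i)"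
          using jI by (auto simp: y'_def)
        have 2: "vupd (glue I y z) j (y $ j) = glue I y z"
          using jI by (auto simp: vec_eq_iff)
        have 3: "y $ j \<le> x j" using insert.prems by simp
        show ?thesis
          unfolding 1 unfolding y'_def glue_vupd[OF jI] mixed_derivatives_FTC[OF md cont jI 3] 2
          by simp
      qed
      have i1: "integrable (lborel_pi I) (\<lambda>z. if \<forall>i\<in>I. y $ i \<le> z i \<and> z i \<le> x i then G I (glue I y z) else 0)"
        by (rule face_integrable[OF cont])
      have i2: "integrable (lborel_pi I) (\<lambda>z. if \<forall>i\<in>I. y' $ i \<le> z i \<and> z i \<le> x i then G I (glue I y' z) else 0)"
        by (rule face_integrable[OF cont])
      have i3: "integrable (lborel_pi I) (\<lambda>z. if \<forall>i\<in>I. y $ i \<le> z i \<and> z i \<le> x i then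
        \<integral>t. G (insert j I) (vupd (glue I y z) j t) * indicator {y $ j .. x j} t \<partial>lborel else 0)"
        using Bochner_Integration.integrable_diff[OF i2 i1] unfolding eq by simp
      show "(\<integral>z. (if \<forall>i\<in>I. y' $ i \<le> z i \<and> z i \<le> x i then G I (glue I y' z) else 0) \<partial>lborel_pi I) =
         (\<integral>z. (if \<forall>i\<in>I. y $ i \<le> z i \<and> z i \<le> x i then G I (glue I y z) else 0) \<partial>lborel_pi I)
      + (\<integral>z. (if \<forall>i\<in>insert j I. y $ i \<le> z i \<and> z i \<le> x i then G (insert j I) (glue (insert j I) y z) else 0) \<partial>lborel_pi (insert j I))"
        unfolding integral_face_insert[OF cont jI] eq using i1 i3 by simp
    qed
    also have "\<dots> = (\<Sum>I\<in>Pow (insert j J). \<integral>z. (if \<forall>i\<in>I. y $ i \<le> z i \<and> z i \<le> x i then G I (glue I y z) else 0) \<partial>lborel_pi I)"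
    proof -
      have inj: "inj_on (insert j) (Pow J)"
        using insert.hyps by (intro inj_onI) (metis PowD insert_ident subsetD)
      have dis: "Pow J \<inter> insert j ` Pow J = {}" using insert.hyps by auto
      show ?thesis unfolding Pow_insert sum.distrib
        by (subst sum.union_disjoint) (use insert.hyps dis in \<open>auto simp: sum.reindex[OF inj] o_def\<close>)
    qed
    finally show ?case unfolding fj .
  qed
qed

lemma pareto_F_with_density: "pareto_F (with_density q) y = (\<integral>x. (if y \<le> x then q x else 0) \<partial>lborel)"
  unfolding pareto_F_def with_density_def set_lebesgue_integral_def
  by (intro Bochner_Integration.integral_cong) (auto simp: indicator_def)

text \<open>By Fubini, from the expansion of \<open>h x\<close> into integrals of its mixed derivatives over the faces at
  \<open>y\<close> of the box between \<open>y\<close> and \<open>x\<close>.\<close>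

lemma integration_by_parts_ge:
  fixes h :: "real ^ 'n \<Rightarrow> real"
  assumes q: "integrable lborel q" and md: "mixed_derivatives h H" and cont: "\<And>I. continuous_on UNIV (H I)"
    and supp: "\<And>I z. \<not> z \<le> b \<Longrightarrow> H I z = 0"
  shows "(\<integral>x. (if y \<le> x then q x * h x else 0) \<partial>lborel) =
    (\<Sum>I\<in>UNIV. \<integral>z. (if \<forall>i\<in>I. y $ i \<le> z i then pareto_F (with_density q) (glue I y z) * H I (glue I y z) else 0) \<partial>lborel_pi I)"
proof -
  have [measurable]: "q \<in> borel_measurable borel"
    using q by (simp add: borel_measurable_integrable)
  have Hm [measurable]: "H I \<in> borel_measurable borel" for I
    using cont by (rule borel_measurable_continuous_onI)
  have h: "h = H {}" using md by (simp add: mixed_derivatives_def)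
  \<comment> \<open>One condition serves both orders of integration: for fixed \<open>x\<close> it
    cuts the face down to the part below \<open>x\<close>, for fixed \<open>z\<close> it restricts
    \<open>x\<close> to the orthant above \<open>glue I y z\<close>, over which \<open>q\<close>
    integrates to the value of \<open>pareto_F\<close> at that point.\<close>
  define k where "k I x z = (if (\<forall>i\<in>I. y $ i \<le> z i) \<and> glue I y z \<le> x then H I (glue I y z) else 0)" for I x z
  have exp: "(if y \<le> x then q x * h x else 0) = (\<Sum>I\<in>UNIV. \<integral>z. q x * k I x z \<partial>lborel_pi I)" for x
  proof (cases "y \<le> x")
    case True
    have "h (glue UNIV y (($) x)) = (\<Sum>I\<in>Pow UNIV. \<integral>z. (if \<forall>i\<in>I. y $ i \<le> z i \<and> z i \<le> x $ i then H I (glue I y z) else 0) \<partial>lborel_pi I)"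
      using True by (intro mixed_derivatives_expansion[OF md cont]) (auto simp: less_eq_vec_def)
    also have "glue UNIV y (($) x) = x" by (simp add: vec_eq_iff)
    also have "(\<Sum>I\<in>Pow UNIV. \<integral>z. (if \<forall>i\<in>I. y $ i \<le> z i \<and> z i \<le> x $ i then H I (glue I y z) else 0) \<partial>lborel_pi I)
       = (\<Sum>I\<in>UNIV. \<integral>z. k I x z \<partial>lborel_pi I)"
    proof -
      have "(\<forall>i\<in>I. y $ i \<le> z i) \<and> glue I y z \<le> x \<longleftrightarrow> (\<forall>i\<in>I. y $ i \<le> z i \<and> z i \<le> x $ i)" for I z
        using True unfolding less_eq_vec_def by auto
      then show ?thesis unfolding k_def by simp
    qed
    finally show ?thesis using True by (simp add: sum_distrib_left)
  next
    case False
    have "k I x z = 0" for I z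
    proof -
      have "\<not> ((\<forall>i\<in>I. y $ i \<le> z i) \<and> glue I y z \<le> x)"
      proof
        assume *: "(\<forall>i\<in>I. y $ i \<le> z i) \<and> glue I y z \<le> x"
        have "y $ i \<le> x $ i" for i
          using * unfolding less_eq_vec_def by (cases "i \<in> I") (auto intro: order_trans dest!: spec[of _ i])
        then show False using False by (simp add: less_eq_vec_def)
      qed
      then show ?thesis by (auto simp: k_def)
    qed
    then show ?thesis using False by simp
  qed
  have km: "(\<lambda>(x, z). k I x z) \<in> borel_measurable (borel \<Otimes>\<^sub>M lborel_pi I)" for I
    unfolding k_def less_eq_vec_def case_prod_unfold by measurable
  \<comment> \<open>The support condition confines \<open>k\<close> to a box of finite measure in
    \<open>z\<close>, where it is bounded. Together with the integrability of \<open>q\<close> this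
    makes the double integral absolutely convergent.\<close>
  have int: "integrable (lborel \<Otimes>\<^sub>M lborel_pi I) (\<lambda>(x, z). q x * k I x z)" for I
  proof -
    interpret sigma_finite_measure "lborel_pi I" by (rule sigma_finite_lborel_pi)
    interpret pair_sigma_finite "lborel :: (real^'n) measure" "lborel_pi I" by standard
    have supp': "H I (glue I y z) = 0" if "\<not> (\<forall>i\<in>I. z i \<le> b $ i)" for z
      using that by (intro supp) (auto simp: less_eq_vec_def)
    obtain C where C: "\<And>z. \<bar>if \<forall>i\<in>I. y $ i \<le> z i \<and> z i \<le> b $ i then H I (glue I y z) else 0\<bar> \<le> C"
      using face_bounded[OF cont[of I], of I "($) y" "($) b" y] by blast
    let ?B = "{z \<in> space (lborel_pi I). \<forall>i\<in>I. y $ i \<le> z i \<and> z i \<le> b $ i}"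
    have [measurable]: "?B \<in> sets (lborel_pi I)" by (rule lborel_pi_box)
    have fin: "integrable (lborel_pi I) (indicator ?B :: _ \<Rightarrow> real)"
      using lborel_pi_box(2)[of I "($) y" "($) b"] by (intro integrable_real_indicator) auto
    have "integrable (lborel \<Otimes>\<^sub>M lborel_pi I) (\<lambda>p. q (fst p) * (C * indicator ?B (snd p)))"
    proof (rule Fubini_integrable)
      show "integrable lborel (\<lambda>x. \<integral>z. norm (q (fst (x, z)) * (C * indicator ?B (snd (x, z)))) \<partial>lborel_pi I)"
        using q by (simp add: abs_mult)
      show "AE x in lborel. integrable (lborel_pi I) (\<lambda>z. q (fst (x, z)) * (C * indicator ?B (snd (x, z))))"
        using fin by simp
    qed simp
    then show ?thesis
    proof (rule Bochner_Integration.integrable_bound)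
      show "(\<lambda>(x, z). q x * k I x z) \<in> borel_measurable (lborel \<Otimes>\<^sub>M lborel_pi I)"
        using km[of I] by measurable
      have "\<bar>k I x z\<bar> \<le> \<bar>C * indicator ?B z\<bar>" if "z \<in> space (lborel_pi I)" for x z
        using C[of z] supp'[of z] that unfolding k_def by (auto simp: indicator_def)
      then show "AE p in lborel \<Otimes>\<^sub>M lborel_pi I. norm (case p of (x, z) \<Rightarrow> q x * k I x z) \<le> norm (q (fst p) * (C * indicator ?B (snd p)))"
        by (intro AE_I2) (auto simp: abs_mult[of "q _"] space_pair_measure intro!: mult_left_mono)
    qed
  qed
  have int': "integrable lborel (\<lambda>x. \<integral>z. q x * k I x z \<partial>lborel_pi I)" for I
  proof -
    interpret sigma_finite_measure "lborel_pi I" by (rule sigma_finite_lborel_pi)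
    interpret pair_sigma_finite "lborel :: (real^'n) measure" "lborel_pi I" by standard
    show ?thesis using integrable_fst'[OF int[of I]] by simp
  qed
  have inner: "(\<lambda>z. \<integral>x. q x * k I x z \<partial>lborel) = (\<lambda>z. if \<forall>i\<in>I. y $ i \<le> z i then pareto_F (with_density q) (glue I y z) * H I (glue I y z) else 0)" for I
  proof
    fix z
    have "q x * k I x z = (if glue I y z \<le> x then q x else 0) * (if \<forall>i\<in>I. y $ i \<le> z i then H I (glue I y z) else 0)" for x
      by (simp add: k_def)
    then show "(\<integral>x. q x * k I x z \<partial>lborel) = (if \<forall>i\<in>I. y $ i \<le> z i then pareto_F (with_density q) (glue I y z) * H I (glue I y z) else 0)"
      by (simp add: pareto_F_with_density)
  qed
  have "(\<integral>x. (if y \<le> x then q x * h x else 0) \<partial>lborel) = (\<Sum>I\<in>UNIV. \<integral>x. \<integral>z. q x * k I x z \<partial>lborel_pi I \<partial>lborel)"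
    unfolding exp by (intro Bochner_Integration.integral_sum int')
  also have "\<dots> = (\<Sum>I\<in>UNIV. \<integral>z. \<integral>x. q x * k I x z \<partial>lborel \<partial>lborel_pi I)"
  proof (intro sum.cong refl)
    fix I :: "'n set"
    interpret sigma_finite_measure "lborel_pi I" by (rule sigma_finite_lborel_pi)
    interpret pair_sigma_finite "lborel :: (real^'n) measure" "lborel_pi I" by standard
    show "(\<integral>x. \<integral>z. q x * k I x z \<partial>lborel_pi I \<partial>lborel) = (\<integral>z. \<integral>x. q x * k I x z \<partial>lborel \<partial>lborel_pi I)"
      by (rule Fubini_integral[OF int, symmetric])
  qed
  finally show ?thesis unfolding inner .
qed

lemma integrable_bounded_mult:
  fixes f g :: "'a \<Rightarrow> real"
  assumes "integrable M f" "g \<in> borel_measurable M" "\<And>x. \<bar>g x\<bar> \<le> C"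
  shows "integrable M (\<lambda>x. f x * g x)"
proof (rule Bochner_Integration.integrable_bound)
  show "integrable M (\<lambda>x. C * f x)" using assms by simp
  show "(\<lambda>x. f x * g x) \<in> borel_measurable M" using assms by (auto intro: borel_measurable_integrable)
  have "\<bar>g x\<bar> * \<bar>f x\<bar> \<le> \<bar>C\<bar> * \<bar>f x\<bar>" for x
    using assms(3)[of x] by (intro mult_right_mono) auto
  then show "AE x in M. norm (f x * g x) \<le> norm (C * f x)"
    by (auto simp: abs_mult mult.commute)
qed

lemma integral_mult_tendsto:
  fixes f :: "'a \<Rightarrow> real" and s :: "nat \<Rightarrow> 'a \<Rightarrow> real"
  assumes f: "integrable M f" and m: "\<And>k. s k \<in> borel_measurable M"
    and bd: "\<And>k x. \<bar>s k x\<bar> \<le> C" and lim: "\<And>x. (\<lambda>k. s k x) \<longlonglongrightarrow> l x"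
  shows "(\<lambda>k. \<integral>x. f x * s k x \<partial>M) \<longlonglongrightarrow> (\<integral>x. f x * l x \<partial>M)"
proof (rule integral_dominated_convergence)
  have lm: "l \<in> borel_measurable M"
    by (rule borel_measurable_LIMSEQ_real[OF lim m])
  show "(\<lambda>x. f x * l x) \<in> borel_measurable M" "\<And>k. (\<lambda>x. f x * s k x) \<in> borel_measurable M"
    using f m lm by (auto intro: borel_measurable_integrable)
  show "integrable M (\<lambda>x. C * \<bar>f x\<bar>)" using f by simp
  show "AE x in M. (\<lambda>k. f x * s k x) \<longlonglongrightarrow> f x * l x"
    using lim by (intro AE_I2 tendsto_intros)
  have "\<bar>s k x\<bar> * \<bar>f x\<bar> \<le> C * \<bar>f x\<bar>" for k x
    using bd by (intro mult_right_mono) auto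
  then show "AE x in M. norm (f x * s k x) \<le> C * \<bar>f x\<bar>" for k
    by (auto simp: abs_mult mult.commute)
qed

section \<open>Removal of the support condition by cutoffs\<close>

text \<open>The Leibniz expansion of the mixed derivatives of \<open>h\<close> times
  \<open>cutoff k {}\<close>. As \<open>k\<close> grows only the term with \<open>K = I\<close>
  persists, and the family stays uniformly bounded when \<open>H\<close> is.\<close>

definition cut_deriv :: "('n set \<Rightarrow> real ^ 'n \<Rightarrow> real) \<Rightarrow> nat \<Rightarrow> 'n set \<Rightarrow> real ^ 'n \<Rightarrow> real" where
  "cut_deriv H k I x = (\<Sum>K\<in>Pow I. H K x * cutoff k (I - K) x)"

lemma mixed_derivatives_cut:
  "mixed_derivatives h H \<Longrightarrow> mixed_derivatives (\<lambda>x. h x * cutoff k {} x) (cut_deriv H k)"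
  using mixed_derivatives_mult[OF _ mixed_derivatives_cutoff] unfolding cut_deriv_def[abs_def] .

lemma continuous_cut_deriv:
  "(\<And>I. continuous_on UNIV (H I)) \<Longrightarrow> continuous_on UNIV (cut_deriv H k I)"
  unfolding cut_deriv_def[abs_def] by (intro continuous_intros continuous_cutoff)

lemma cut_deriv_outside: "real (Suc k) \<le> \<bar>z $ i\<bar> \<Longrightarrow> cut_deriv H k I z = 0"
  unfolding cut_deriv_def using cutoff_outside by (intro sum.neutral) auto

lemma cut_deriv_bound:
  assumes "\<And>I z. \<bar>H I z\<bar> \<le> C"
  shows "\<bar>cut_deriv H k I (z :: real^'n)\<bar> \<le> 2 ^ CARD('n) * (C * 4 ^ CARD('n))"
proof -
  have C: "0 \<le> C" using assms[of undefined undefined] by linarith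
  have "\<bar>cut_deriv H k I z\<bar> \<le> (\<Sum>K\<in>Pow I. C * 4 ^ CARD('n))"
    unfolding cut_deriv_def
    by (intro order_trans[OF sum_abs] sum_mono) (auto simp: abs_mult intro!: mult_mono assms abs_cutoff_le C)
  also have "\<dots> \<le> 2 ^ CARD('n) * (C * 4 ^ CARD('n))"
    using C by (auto simp: card_Pow intro!: mult_right_mono power_increasing card_mono)
  finally show ?thesis .
qed

lemma cut_deriv_tendsto: "(\<lambda>k. cut_deriv H k I z) \<longlonglongrightarrow> H I z"
proof -
  have "(\<lambda>k. cut_deriv H k I z) \<longlonglongrightarrow> (\<Sum>K\<in>Pow I. H K z * (if I - K = {} then 1 else 0))"
    unfolding cut_deriv_def by (intro tendsto_intros cutoff_tendsto)
  also have "(\<Sum>K\<in>Pow I. H K z * (if I - K = {} then 1 else 0)) = (\<Sum>K\<in>Pow I. if K = I then H K z else 0)"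
    by (intro sum.cong) auto
  also have "\<dots> = H I z" by simp
  finally show ?thesis .
qed

text \<open>Cutting \<open>h\<close> off on ever larger cubes makes all terms on lower dimensional faces disappear.\<close>

lemma integration_by_parts_whole:
  fixes h :: "real ^ 'n \<Rightarrow> real"
  assumes q: "integrable lborel q" and md: "mixed_derivatives h H" and cont: "\<And>I. continuous_on UNIV (H I)"
    and bd: "\<And>I z. \<bar>H I z\<bar> \<le> C" and g: "integrable lborel (pareto_F (with_density q))"
  shows "(\<integral>x. q x * h x \<partial>lborel) = (\<integral>z. pareto_F (with_density q) z * H UNIV z \<partial>lborel)"
proof (rule LIMSEQ_unique)
  let ?g = "pareto_F (with_density q)"
  have h: "H {} = h" using md by (simp add: mixed_derivatives_def)
  have cm [measurable]: "cut_deriv H k I \<in> borel_measurable borel" for k I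
    by (rule borel_measurable_continuous_onI[OF continuous_cut_deriv[OF cont]])
  have gm [measurable]: "?g \<in> borel_measurable borel"
    using g by (simp add: borel_measurable_integrable)
  have eq: "(\<integral>x. q x * cut_deriv H k {} x \<partial>lborel) = (\<integral>z. ?g z * cut_deriv H k UNIV z \<partial>lborel)" for k
  proof -
    \<comment> \<open>The vertex \<open>?y\<close> lies on the boundary of the support of the
      cutoff. A point of a proper face keeps some coordinate equal to \<open>- real (Suc k)\<close>,
      where all cut derivatives vanish, so only the term over the whole space remains.\<close>
    let ?b = "(\<chi> i. real (Suc k)) :: real^'n" and ?y = "(\<chi> i. - real (Suc k)) :: real^'n"
    let ?F = "\<lambda>I z. if \<forall>i\<in>I. ?y $ i \<le> z i then ?g (glue I ?y z) * cut_deriv H k I (glue I ?y z) else 0"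
    have out1: "cut_deriv H k I z = 0" if "\<not> z \<le> ?b" for I z
    proof -
      from that obtain i where "real (Suc k) < z $ i" by (auto simp: less_eq_vec_def not_le)
      then show ?thesis by (intro cut_deriv_outside[of _ _ i]) auto
    qed
    have out2: "cut_deriv H k I z = 0" if "\<not> ?y \<le> z" for I z
    proof -
      from that obtain i where "z $ i < - real (Suc k)" by (auto simp: less_eq_vec_def not_le)
      then show ?thesis by (intro cut_deriv_outside[of _ _ i]) auto
    qed
    have c0: "cut_deriv H k {} = (\<lambda>x. h x * cutoff k {} x)" by (simp add: cut_deriv_def fun_eq_iff h)
    have "(\<integral>x. q x * cut_deriv H k {} x \<partial>lborel) = (\<integral>x. (if ?y \<le> x then q x * cut_deriv H k {} x else 0) \<partial>lborel)"
    proof (intro Bochner_Integration.integral_cong refl)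
      fix x show "q x * cut_deriv H k {} x = (if ?y \<le> x then q x * cut_deriv H k {} x else 0)"
        using out2[of x "{}"] by (cases "?y \<le> x") simp_all
    qed
    also have "\<dots> = (\<Sum>I\<in>UNIV. \<integral>z. ?F I z \<partial>lborel_pi I)"
      unfolding c0 by (intro integration_by_parts_ge[OF q mixed_derivatives_cut[OF md] continuous_cut_deriv[OF cont] out1])
    also have "\<dots> = (\<Sum>I\<in>{UNIV}. \<integral>z. ?F I z \<partial>lborel_pi I)"
    proof (rule sum.mono_neutral_right)
      show "\<forall>I\<in>UNIV - {UNIV}. (\<integral>z. ?F I z \<partial>lborel_pi I) = 0"
      proof
        fix I :: "'n set" assume "I \<in> UNIV - {UNIV}"
        then obtain i where "i \<notin> I" by auto
        then have "cut_deriv H k I (glue I ?y z) = 0" for z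
          by (intro cut_deriv_outside[of _ _ i]) auto
        then have "?F I z = 0" for z by simp
        then show "(\<integral>z. ?F I z \<partial>lborel_pi I) = 0" by simp
      qed
    qed auto
    also have "\<dots> = (\<integral>z. ?g (glue UNIV ?y z) * cut_deriv H k UNIV (glue UNIV ?y z) \<partial>lborel_pi UNIV)"
    proof -
      have "?F UNIV z = ?g (glue UNIV ?y z) * cut_deriv H k UNIV (glue UNIV ?y z)" for z
        using out2[of "glue UNIV ?y z" UNIV] by (auto simp: less_eq_vec_def)
      then show ?thesis by simp
    qed
    also have "\<dots> = (\<integral>z. ?g z * cut_deriv H k UNIV z \<partial>lborel)"
      by (rule lborel_integral_glue[symmetric]) measurable
    finally show ?thesis .
  qed
  show "(\<lambda>k. \<integral>x. q x * cut_deriv H k {} x \<partial>lborel) \<longlonglongrightarrow> (\<integral>x. q x * h x \<partial>lborel)"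
    unfolding h[symmetric]
    by (intro integral_mult_tendsto[OF q _ cut_deriv_bound[OF bd] cut_deriv_tendsto]) simp
  show "(\<lambda>k. \<integral>x. q x * cut_deriv H k {} x \<partial>lborel) \<longlonglongrightarrow> (\<integral>z. ?g z * H UNIV z \<partial>lborel)"
    unfolding eq
    by (intro integral_mult_tendsto[OF g _ cut_deriv_bound[OF bd] cut_deriv_tendsto]) simp
qed

text \<open>The vertex \<open>y\<close> stays fixed while the cutoff is removed, so the terms over
  all faces persist. The assumed integrability on each face supplies the dominating function
  there.\<close>

lemma integration_by_parts_faces:
  fixes h :: "real ^ 'n \<Rightarrow> real"
  assumes q: "integrable lborel q" and md: "mixed_derivatives h H" and cont: "\<And>I. continuous_on UNIV (H I)"
    and bd: "\<And>I z. \<bar>H I z\<bar> \<le> C"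
    and g: "\<And>I. integrable (lborel_pi I) (\<lambda>z. if \<forall>i\<in>I. y $ i \<le> z i then pareto_F (with_density q) (glue I y z) else 0)"
  shows "(\<integral>x. (if y \<le> x then q x * h x else 0) \<partial>lborel) =
    (\<Sum>I\<in>UNIV. \<integral>z. (if \<forall>i\<in>I. y $ i \<le> z i then pareto_F (with_density q) (glue I y z) * H I (glue I y z) else 0) \<partial>lborel_pi I)"
proof (rule LIMSEQ_unique)
  let ?g = "pareto_F (with_density q)"
  have h: "H {} = h" using md by (simp add: mixed_derivatives_def)
  have cm [measurable]: "cut_deriv H k I \<in> borel_measurable borel" for k I
    by (rule borel_measurable_continuous_onI[OF continuous_cut_deriv[OF cont]])
  have qm [measurable]: "q \<in> borel_measurable borel"
    using q by (simp add: borel_measurable_integrable)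
  let ?q = "\<lambda>x. if y \<le> x then q x else 0"
  have q': "integrable lborel ?q"
    by (rule Bochner_Integration.integrable_bound[OF q]) (auto simp: less_eq_vec_def)
  let ?G = "\<lambda>I z. if \<forall>i\<in>I. y $ i \<le> z i then ?g (glue I y z) else 0"
  have eq: "(\<integral>x. ?q x * cut_deriv H k {} x \<partial>lborel) = (\<Sum>I\<in>UNIV. \<integral>z. ?G I z * cut_deriv H k I (glue I y z) \<partial>lborel_pi I)" for k
  proof -
    let ?b = "(\<chi> i. real (Suc k)) :: real^'n"
    have out1: "cut_deriv H k I z = 0" if "\<not> z \<le> ?b" for I z
    proof -
      from that obtain i where "real (Suc k) < z $ i" by (auto simp: less_eq_vec_def not_le)
      then show ?thesis by (intro cut_deriv_outside[of _ _ i]) auto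
    qed
    have c0: "cut_deriv H k {} = (\<lambda>x. h x * cutoff k {} x)" by (simp add: cut_deriv_def fun_eq_iff h)
    have "(\<integral>x. ?q x * cut_deriv H k {} x \<partial>lborel) = (\<integral>x. (if y \<le> x then q x * cut_deriv H k {} x else 0) \<partial>lborel)"
      by (intro Bochner_Integration.integral_cong) auto
    also have "\<dots> = (\<Sum>I\<in>UNIV. \<integral>z. (if \<forall>i\<in>I. y $ i \<le> z i then ?g (glue I y z) * cut_deriv H k I (glue I y z) else 0) \<partial>lborel_pi I)"
      unfolding c0 by (intro integration_by_parts_ge[OF q mixed_derivatives_cut[OF md] continuous_cut_deriv[OF cont] out1])
    also have "\<dots> = (\<Sum>I\<in>UNIV. \<integral>z. ?G I z * cut_deriv H k I (glue I y z) \<partial>lborel_pi I)"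
      by (intro sum.cong Bochner_Integration.integral_cong refl) auto
    finally show ?thesis .
  qed
  show "(\<lambda>k. \<integral>x. ?q x * cut_deriv H k {} x \<partial>lborel) \<longlonglongrightarrow> (\<integral>x. (if y \<le> x then q x * h x else 0) \<partial>lborel)"
  proof -
    have "(\<lambda>k. \<integral>x. ?q x * cut_deriv H k {} x \<partial>lborel) \<longlonglongrightarrow> (\<integral>x. ?q x * H {} x \<partial>lborel)"
      by (intro integral_mult_tendsto[OF q' _ cut_deriv_bound[OF bd] cut_deriv_tendsto]) simp
    also have "(\<integral>x. ?q x * H {} x \<partial>lborel) = (\<integral>x. (if y \<le> x then q x * h x else 0) \<partial>lborel)"
      unfolding h by (intro Bochner_Integration.integral_cong) auto
    finally show ?thesis .
  qed
  show "(\<lambda>k. \<integral>x. ?q x * cut_deriv H k {} x \<partial>lborel) \<longlonglongrightarrow>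
     (\<Sum>I\<in>UNIV. \<integral>z. (if \<forall>i\<in>I. y $ i \<le> z i then ?g (glue I y z) * H I (glue I y z) else 0) \<partial>lborel_pi I)"
  proof -
    have "(\<lambda>k. \<integral>x. ?q x * cut_deriv H k {} x \<partial>lborel) \<longlonglongrightarrow> (\<Sum>I\<in>UNIV. \<integral>z. ?G I z * H I (glue I y z) \<partial>lborel_pi I)"
      unfolding eq
      by (intro tendsto_sum integral_mult_tendsto[OF g _ cut_deriv_bound[OF bd] cut_deriv_tendsto]) measurable
    also have "(\<Sum>I\<in>UNIV. \<integral>z. ?G I z * H I (glue I y z) \<partial>lborel_pi I) =
      (\<Sum>I\<in>UNIV. \<integral>z. (if \<forall>i\<in>I. y $ i \<le> z i then ?g (glue I y z) * H I (glue I y z) else 0) \<partial>lborel_pi I)"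
      by (intro sum.cong Bochner_Integration.integral_cong refl) auto
    finally show ?thesis .
  qed
qed

section \<open>Formulas for the dual generator\<close>

lemma bounded_continuousE:
  assumes "\<phi> \<in> bounded_continuous"
  obtains b where "continuous_on UNIV \<phi>" "\<And>w. \<bar>\<phi> w\<bar> \<le> b" "0 \<le> b"
proof -
  have "bounded (range \<phi>)" using assms by (simp add: bounded_continuous_def)
  then obtain b where "\<forall>x\<in>range \<phi>. norm x \<le> b" unfolding bounded_iff by blast
  then have b: "\<forall>w. \<bar>\<phi> w\<bar> \<le> b" by simp
  show ?thesis
  proof (rule that)
    show "continuous_on UNIV \<phi>" using assms by (simp add: bounded_continuous_def)
    show "\<bar>\<phi> w\<bar> \<le> b" for w using b by simp
    show "0 \<le> b" using b[rule_format, of undefined] by linarith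
  qed
qed

lemma bounded_continuousI:
  assumes "continuous_on UNIV \<phi>" "\<And>w. \<bar>\<phi> w\<bar> \<le> b"
  shows "\<phi> \<in> bounded_continuous"
proof -
  have "bounded (range \<phi>)" unfolding bounded_iff using assms(2) by (intro exI[of _ b]) simp
  then show ?thesis using assms(1) by (simp add: bounded_continuous_def)
qed

lemma bounded_continuous_measurable: "\<phi> \<in> bounded_continuous \<Longrightarrow> \<phi> \<in> borel_measurable borel"
  by (auto simp: bounded_continuous_def intro: borel_measurable_continuous_onI)

lemma const_bounded_continuous: "(\<lambda>_. c) \<in> bounded_continuous"
  by (rule bounded_continuousI[of _ "\<bar>c\<bar>"]) auto

lemma integrable_bounded:
  fixes \<phi> :: "'a \<Rightarrow> real"
  assumes "finite_measure M" "\<phi> \<in> borel_measurable M" "\<And>w. \<bar>\<phi> w\<bar> \<le> b"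
  shows "integrable M \<phi>"
proof -
  interpret finite_measure M by fact
  show ?thesis using assms by (intro integrable_const_bound[of _ b]) auto
qed

lemma abs_integral_le:
  fixes \<phi> :: "'a \<Rightarrow> real"
  assumes "finite_measure M" "\<phi> \<in> borel_measurable M" "\<And>w. \<bar>\<phi> w\<bar> \<le> b"
  shows "\<bar>\<integral>w. \<phi> w \<partial>M\<bar> \<le> b * measure M (space M)"
proof -
  interpret finite_measure M by fact
  have "\<bar>\<integral>w. \<phi> w \<partial>M\<bar> \<le> (\<integral>w. \<bar>\<phi> w\<bar> \<partial>M)" by (rule integral_abs_bound)
  also have "\<dots> \<le> (\<integral>w. b \<partial>M)"
    using integrable_bounded[OF assms] by (intro integral_mono) (auto simp: assms)
  finally show ?thesis by (simp add: mult.commute)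
qed

text \<open>The bridge from bounded continuous integrands, which is all that weak continuity and
  weak differentiability refer to, to masses of closed sets such as the orthants
  \<open>{w. y \<le> w}\<close>.\<close>

lemma closed_approximation:
  fixes A :: "'a::metric_space set"
  assumes "closed A"
  obtains \<phi> :: "nat \<Rightarrow> 'a \<Rightarrow> real" where "\<And>k. \<phi> k \<in> bounded_continuous" "\<And>k w. 0 \<le> \<phi> k w" "\<And>k w. \<phi> k w \<le> 1"
    "\<And>w. (\<lambda>k. \<phi> k w) \<longlonglongrightarrow> indicator A w"
proof (cases "A = {}")
  \<comment> \<open>\<open>infdist\<close> to the empty set is 0 by convention, so the formula of
    the other case would give the constant 1 instead of 0.\<close>
  case True
  then show ?thesis using that[of "\<lambda>_ _. 0"] by (simp add: const_bounded_continuous)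
next
  case False
  define \<phi> where "\<phi> k w = max 0 (1 - real k * infdist w A)" for k w
  show ?thesis
  proof (rule that)
    show 01: "\<phi> k w \<le> 1" "0 \<le> \<phi> k w" for k w by (auto simp: \<phi>_def infdist_nonneg)
    show "\<phi> k \<in> bounded_continuous" for k
    proof (rule bounded_continuousI)
      show "continuous_on UNIV (\<phi> k)" unfolding \<phi>_def[abs_def] by (intro continuous_intros)
      show "\<bar>\<phi> k w\<bar> \<le> 1" for w using 01 by simp
    qed
    show "(\<lambda>k. \<phi> k w) \<longlonglongrightarrow> indicator A w" for w
    proof (cases "w \<in> A")
      case True
      then show ?thesis by (simp add: \<phi>_def)
    next
      case nA: False
      then have pos: "0 < infdist w A"
        using assms False by (metis in_closed_iff_infdist_zero infdist_nonneg order_less_le)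
      obtain N where N: "1 / infdist w A < real N" using reals_Archimedean2 by blast
      have "\<phi> k w = 0" if "k \<ge> N" for k
      proof -
        have "1 / infdist w A < real k" using N that by linarith
        then show ?thesis using pos by (simp add: \<phi>_def field_simps max_def)
      qed
      then have "\<forall>\<^sub>F k in sequentially. \<phi> k w = 0" by (auto simp: eventually_sequentially)
      then show ?thesis using nA by (simp add: tendsto_eventually)
    qed
  qed
qed

lemma integral_bounded_tendsto:
  fixes s :: "nat \<Rightarrow> 'a \<Rightarrow> real"
  assumes fin: "finite_measure M" and m: "\<And>k. s k \<in> borel_measurable M"
    and bd: "\<And>k x. \<bar>s k x\<bar> \<le> C" and lim: "\<And>x. (\<lambda>k. s k x) \<longlonglongrightarrow> l x"
  shows "(\<lambda>k. \<integral>x. s k x \<partial>M) \<longlonglongrightarrow> (\<integral>x. l x \<partial>M)"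
proof -
  interpret finite_measure M by fact
  have "integrable M (\<lambda>_. 1::real)" by simp
  from integral_mult_tendsto[OF this m bd lim] show ?thesis by simp
qed

definition finite_borel :: "'a::topological_space measure \<Rightarrow> bool" where
  "finite_borel M \<longleftrightarrow> finite_measure M \<and> sets M = sets borel"

lemma finite_borel_space: "finite_borel M \<Longrightarrow> space M = UNIV"
  using sets_eq_imp_space_eq[of M borel] by (simp add: finite_borel_def)

lemma finite_borel_measurable: "finite_borel M \<Longrightarrow> borel_measurable M = borel_measurable borel"
  using measurable_cong_sets[of M borel borel borel] by (simp add: finite_borel_def)

lemma abs_integral_le_finite_borel:
  fixes \<phi> :: "'a::topological_space \<Rightarrow> real"
  assumes "finite_borel M" "\<phi> \<in> borel_measurable borel" "\<And>w. \<bar>\<phi> w\<bar> \<le> b"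
  shows "\<bar>\<integral>w. \<phi> w \<partial>M\<bar> \<le> b * measure M UNIV"
proof -
  have "finite_measure M" "\<phi> \<in> borel_measurable M"
    using assms(1,2) finite_borel_measurable[OF assms(1)] by (auto simp: finite_borel_def)
  from abs_integral_le[OF this assms(3)] show ?thesis
    by (simp add: finite_borel_space[OF assms(1)])
qed

lemma bounded_kernel_finite_borel: "bounded_kernel K \<Longrightarrow> finite_borel (K x)"
  by (auto simp: bounded_kernel_def finite_borel_def)

lemma bounded_kernelE:
  assumes "bounded_kernel K"
  obtains B where "0 < B" "\<And>x A. measure (K x) A \<le> B"
proof -
  from assms obtain B where B: "\<And>x. measure (K x) UNIV \<le> B" by (auto simp: bounded_kernel_def)
  have "measure (K x) A \<le> max 1 B" for x A
  proof -
    have fb: "finite_borel (K x)" using assms by (rule bounded_kernel_finite_borel)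
    interpret finite_measure "K x" using fb by (simp add: finite_borel_def)
    have "measure (K x) A \<le> measure (K x) UNIV"
      using bounded_measure[of A] finite_borel_space[OF fb] by simp
    then show ?thesis using B[of x] by simp
  qed
  then show ?thesis using that[of "max 1 B"] by simp
qed

lemma bounded_kernel_measurable:
  "bounded_kernel K \<Longrightarrow> A \<in> sets borel \<Longrightarrow> (\<lambda>x. measure (K x) A) \<in> borel_measurable borel"
  by (simp add: bounded_kernel_def)

lemma integral_indicator_finite_borel:
  "finite_borel M \<Longrightarrow> A \<in> sets borel \<Longrightarrow> (\<integral>w. indicator A w \<partial>M) = measure M A"
  by (simp add: finite_borel_def)

lemma integral_closed_approximation:
  assumes "finite_borel M" "closed A" "\<And>k. \<phi> k \<in> bounded_continuous" "\<And>k w. 0 \<le> \<phi> k w" "\<And>k w. \<phi> k w \<le> (1 :: real)"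
    "\<And>w. (\<lambda>k. \<phi> k w) \<longlonglongrightarrow> indicator A w"
  shows "(\<lambda>k. \<integral>w. \<phi> k w \<partial>M) \<longlonglongrightarrow> measure M A"
proof -
  have "(\<lambda>k. \<integral>w. \<phi> k w \<partial>M) \<longlonglongrightarrow> (\<integral>w. indicator A w \<partial>M)"
  proof (rule integral_bounded_tendsto[where C=1])
    show "finite_measure M" using assms(1) by (simp add: finite_borel_def)
    show "\<phi> k \<in> borel_measurable M" for k
      unfolding finite_borel_measurable[OF assms(1)] by (rule bounded_continuous_measurable[OF assms(3)])
    show "\<bar>\<phi> k w\<bar> \<le> 1" for k w using assms(4)[of k w] assms(5)[of k w] by linarith
  qed fact
  then show ?thesis
    using integral_indicator_finite_borel[OF assms(1) borel_closed[OF assms(2)]] by simp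
qed

section \<open>The dual generator and the derivatives of the kernel\<close>

lemma pareto_F_invD:
  assumes "g \<in> pareto_range"
  shows "integrable lborel (pareto_F_inv g)" "pareto_F (with_density (pareto_F_inv g)) = g"
  using someI_ex[of "\<lambda>q. integrable lborel q \<and> pareto_F (with_density q) = g"] assms
  unfolding pareto_range_def pareto_F_inv_def by auto

lemma pareto_dual_generator_eq:
  "pareto_dual_generator \<nu> g y =
     (\<integral>x. pareto_F_inv g x * measure (\<nu> x) {w. y \<le> w} \<partial>lborel)
     - (\<integral>x. (if y \<le> x then pareto_F_inv g x * measure (\<nu> x) UNIV else 0) \<partial>lborel)"
  unfolding pareto_dual_generator_def pareto_F_def standard_dual_def set_lebesgue_integral_def
  by (intro arg_cong2[where f="(-)"] Bochner_Integration.integral_cong) (auto simp: indicator_def)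

lemma kernel_derivative_finite_borel:
  "kernel_mixed_derivatives \<nu> D \<Longrightarrow> finite_borel (fst (D I z))"
  "kernel_mixed_derivatives \<nu> D \<Longrightarrow> finite_borel (snd (D I z))"
  using bounded_kernel_finite_borel[of "\<lambda>z. fst (D I z)"] bounded_kernel_finite_borel[of "\<lambda>z. snd (D I z)"]
  by (auto simp: kernel_mixed_derivatives_def)

text \<open>Each derivative is a difference of two bounded kernels, and there are finitely many
  coordinate sets, so the sum of their bounds is one constant for all of them. The last bound is
  quantified inside the logic because \<open>\<phi>\<close> and \<open>b\<close> vary after
  \<open>C\<close> is chosen.\<close>

lemma kernel_derivative_bound:
  assumes "kernel_mixed_derivatives \<nu> D"
  obtains C where "0 < C" "\<And>I z A. \<bar>smeasure (D I z) A\<bar> \<le> C"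
    "\<forall>I z \<phi> b. \<phi> \<in> borel_measurable borel \<longrightarrow> (\<forall>w. \<bar>\<phi> w\<bar> \<le> b) \<longrightarrow> \<bar>sintegral (D I z) \<phi>\<bar> \<le> C * b"
proof -
  note fb = kernel_derivative_finite_borel[OF assms]
  have "\<exists>B>0. \<forall>z A. measure (fst (D I z)) A + measure (snd (D I z)) A \<le> B" for I
  proof -
    have "bounded_kernel (\<lambda>z. fst (D I z))" "bounded_kernel (\<lambda>z. snd (D I z))"
      using assms by (auto simp: kernel_mixed_derivatives_def)
    note k = this
    obtain B1 where B1: "0 < B1" "\<And>z A. measure (fst (D I z)) A \<le> B1"
      using bounded_kernelE[OF k(1)] by blast
    obtain B2 where B2: "0 < B2" "\<And>z A. measure (snd (D I z)) A \<le> B2"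
      using bounded_kernelE[OF k(2)] by blast
    show ?thesis
    proof (intro exI[of _ "B1 + B2"] conjI allI)
      show "0 < B1 + B2" using B1 B2 by simp
      show "measure (fst (D I z)) A + measure (snd (D I z)) A \<le> B1 + B2" for z A
        by (intro add_mono B1 B2)
    qed
  qed
  then obtain B where B: "\<And>I. B I > 0" "\<And>I z A. measure (fst (D I z)) A + measure (snd (D I z)) A \<le> B I"
    by metis
  define C where "C = (\<Sum>I\<in>UNIV. B I)"
  have BC: "B I \<le> C" for I
    unfolding C_def using B(1) by (intro member_le_sum) (auto intro: less_imp_le)
  have C: "measure (fst (D I z)) A + measure (snd (D I z)) A \<le> C" for I z A
    using B(2)[of I z A] BC[of I] by linarith
  show ?thesis
  proof (rule that[of C])
    show "0 < C" using BC[of undefined] B(1)[of undefined] by linarith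
    show "\<bar>smeasure (D I z) A\<bar> \<le> C" for I z A
      using C[of I z A] measure_nonneg[of "fst (D I z)" A] measure_nonneg[of "snd (D I z)" A]
      unfolding smeasure_def by linarith
    show "\<forall>I z \<phi> b. \<phi> \<in> borel_measurable borel \<longrightarrow> (\<forall>w. \<bar>\<phi> w\<bar> \<le> b) \<longrightarrow> \<bar>sintegral (D I z) \<phi>\<bar> \<le> C * b"
    proof (intro allI impI)
      fix I z and \<phi> :: "real ^ 'a \<Rightarrow> real" and b :: real assume \<phi>: "\<phi> \<in> borel_measurable borel" "\<forall>w. \<bar>\<phi> w\<bar> \<le> b"
      note \<phi>' = \<phi>(1) \<phi>(2)[rule_format]
      have b: "0 \<le> b" using \<phi>'(2)[of undefined] by linarith
      have "\<bar>\<integral>w. \<phi> w \<partial>fst (D I z)\<bar> \<le> b * measure (fst (D I z)) UNIV" "\<bar>\<integral>w. \<phi> w \<partial>snd (D I z)\<bar> \<le> b * measure (snd (D I z)) UNIV"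
        by (rule abs_integral_le_finite_borel[OF fb(1) \<phi>']) (rule abs_integral_le_finite_borel[OF fb(2) \<phi>'])
      then have "\<bar>sintegral (D I z) \<phi>\<bar> \<le> b * (measure (fst (D I z)) UNIV + measure (snd (D I z)) UNIV)"
        unfolding sintegral_def by (simp add: distrib_left)
      also have "\<dots> \<le> b * C" using C b by (intro mult_left_mono)
      finally show "\<bar>sintegral (D I z) \<phi>\<bar> \<le> C * b" by (simp add: mult.commute)
    qed
  qed
qed

lemma smeasure_bound:
  assumes "kernel_mixed_derivatives \<nu> D"
  obtains C where "0 < C" "\<And>I z A. \<bar>smeasure (D I z) A\<bar> \<le> C"
  by (rule kernel_derivative_bound[OF assms], rule that, assumption+)

lemma sintegral_bound:
  assumes "kernel_mixed_derivatives \<nu> D"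
  obtains C where "0 < C"
    "\<forall>I z \<phi> b. \<phi> \<in> borel_measurable borel \<longrightarrow> (\<forall>w. \<bar>\<phi> w\<bar> \<le> b) \<longrightarrow> \<bar>sintegral (D I z) \<phi>\<bar> \<le> C * b"
  by (rule kernel_derivative_bound[OF assms], rule that, assumption+)

lemma smeasure_measurable:
  "kernel_mixed_derivatives \<nu> D \<Longrightarrow> A \<in> sets borel \<Longrightarrow> (\<lambda>z. smeasure (D I z) A) \<in> borel_measurable borel"
  unfolding smeasure_def
  by (intro borel_measurable_diff bounded_kernel_measurable) (auto simp: kernel_mixed_derivatives_def)

lemma kernel_mixed_derivativesD:
  assumes "kernel_mixed_derivatives \<nu> D" "\<phi> \<in> bounded_continuous"
  shows "mixed_derivatives (\<lambda>z. \<integral>w. \<phi> w \<partial>\<nu> z) (\<lambda>I z. sintegral (D I z) \<phi>)"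
    "continuous_on UNIV (\<lambda>z. sintegral (D I z) \<phi>)"
  using assms by (auto simp: kernel_mixed_derivatives_def)

lemma sintegral_one: 
  assumes "kernel_mixed_derivatives \<nu> D"
  shows "sintegral (D I z) (\<lambda>_. 1) = smeasure (D I z) UNIV"
  using kernel_derivative_finite_borel[OF assms, of I z]
  by (auto simp: sintegral_def smeasure_def finite_borel_space)

lemma mixed_derivatives_empty: "mixed_derivatives g G \<Longrightarrow> G {} = g"
  unfolding mixed_derivatives_def by (elim conjE)

text \<open>The test function 1 turns weak derivatives of the kernel into ordinary mixed derivatives
  of the total jump rate.\<close>

lemma smeasure_UNIV_derivatives:
  assumes nu: "bounded_kernel \<nu>" and D: "kernel_mixed_derivatives \<nu> D"
  shows "mixed_derivatives (\<lambda>z. measure (\<nu> z) UNIV) (\<lambda>I z. smeasure (D I z) UNIV)"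
    "continuous_on UNIV (\<lambda>z. smeasure (D I z) UNIV)"
  using kernel_mixed_derivativesD[OF D const_bounded_continuous[of 1]]
  by (simp_all add: sintegral_one[OF D] finite_borel_space[OF bounded_kernel_finite_borel[OF nu]])

lemma smeasure_closed_approximation:
  assumes D: "kernel_mixed_derivatives \<nu> D" and A: "closed A" "\<And>k. \<phi> k \<in> bounded_continuous" "\<And>k w. 0 \<le> \<phi> k w" "\<And>k w. \<phi> k w \<le> (1 :: real)"
    "\<And>w. (\<lambda>k. \<phi> k w) \<longlonglongrightarrow> indicator A w"
  shows "(\<lambda>k. sintegral (D I z) (\<phi> k)) \<longlonglongrightarrow> smeasure (D I z) A"
  unfolding sintegral_def smeasure_def
  by (intro tendsto_diff integral_closed_approximation[where \<phi>=\<phi>] kernel_derivative_finite_borel[OF D] A)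

text \<open>With a bounded continuous function in place of the indicator of \<open>A\<close> this is
  integration by parts over the whole space, the integral against \<open>\<nu> x\<close> being the
  function to differentiate. The bounds are uniform along an approximation of \<open>A\<close>, so
  both sides pass to the limit.\<close>

lemma integral_density_closed:
  assumes nu: "bounded_kernel \<nu>" and D: "kernel_mixed_derivatives \<nu> D" and A: "closed A"
    and q: "integrable lborel q" and g: "integrable lborel (pareto_F (with_density q))"
  shows "(\<integral>x. q x * measure (\<nu> x) A \<partial>lborel) = (\<integral>z. pareto_F (with_density q) z * smeasure (D UNIV z) A \<partial>lborel)"
proof -
  obtain C where C: "0 < C" "\<forall>I z \<phi> b. \<phi> \<in> borel_measurable borel \<longrightarrow> (\<forall>w. \<bar>\<phi> w\<bar> \<le> b) \<longrightarrow> \<bar>sintegral (D I z) \<phi>\<bar> \<le> C * b"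
    by (rule sintegral_bound[OF D])
  obtain B where B: "0 < B" "\<And>x A. measure (\<nu> x) A \<le> B" using bounded_kernelE[OF nu] by blast
  obtain \<phi> :: "nat \<Rightarrow> real ^ 'a \<Rightarrow> real" where \<phi>: "\<And>k. \<phi> k \<in> bounded_continuous" "\<And>k w. 0 \<le> \<phi> k w" "\<And>k w. \<phi> k w \<le> 1"
    "\<And>w. (\<lambda>k. \<phi> k w) \<longlonglongrightarrow> indicator A w" using closed_approximation[OF A] by blast
  have fb: "finite_borel (\<nu> x)" for x using nu by (rule bounded_kernel_finite_borel)
  have \<phi>01: "\<bar>\<phi> k w\<bar> \<le> 1" for k w using \<phi>(2)[of k w] \<phi>(3)[of k w] by linarith
  have bd: "\<bar>sintegral (D I z) (\<phi> k)\<bar> \<le> C * 1" for I z k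
    using C(2) bounded_continuous_measurable[OF \<phi>(1)] \<phi>01 by blast
  have eq: "(\<integral>x. q x * (\<integral>w. \<phi> k w \<partial>\<nu> x) \<partial>lborel) = (\<integral>z. pareto_F (with_density q) z * sintegral (D UNIV z) (\<phi> k) \<partial>lborel)" for k
    by (rule integration_by_parts_whole[where H="\<lambda>I z. sintegral (D I z) (\<phi> k)", OF q kernel_mixed_derivativesD[OF D \<phi>(1)] bd g])
  have meas: "(\<lambda>z. sintegral (D I z) (\<phi> k)) \<in> borel_measurable lborel" for I k
    using borel_measurable_continuous_onI[OF kernel_mixed_derivativesD(2)[OF D \<phi>(1)]] by simp
  have "(\<lambda>k. \<integral>x. q x * (\<integral>w. \<phi> k w \<partial>\<nu> x) \<partial>lborel) \<longlonglongrightarrow> (\<integral>x. q x * measure (\<nu> x) A \<partial>lborel)"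
  proof (rule integral_mult_tendsto[OF q])
    show "(\<lambda>x. \<integral>w. \<phi> k w \<partial>\<nu> x) \<in> borel_measurable lborel" for k
    proof -
      have "(\<lambda>x. \<integral>w. \<phi> k w \<partial>\<nu> x) = (\<lambda>z. sintegral (D {} z) (\<phi> k))"
        using kernel_mixed_derivativesD(1)[OF D \<phi>(1)[of k]] unfolding mixed_derivatives_def by (elim conjE) (rule sym)
      then show ?thesis using meas by simp
    qed
    show "\<bar>\<integral>w. \<phi> k w \<partial>\<nu> x\<bar> \<le> B" for k x
    proof -
      have "\<bar>\<integral>w. \<phi> k w \<partial>\<nu> x\<bar> \<le> 1 * measure (\<nu> x) UNIV"
        by (rule abs_integral_le_finite_borel[OF fb bounded_continuous_measurable[OF \<phi>(1)] \<phi>01])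
      then show ?thesis using B(2)[of x UNIV] by linarith
    qed
    show "(\<lambda>k. \<integral>w. \<phi> k w \<partial>\<nu> x) \<longlonglongrightarrow> measure (\<nu> x) A" for x
      by (rule integral_closed_approximation[where \<phi>=\<phi>]) (fact fb A \<phi>)+
  qed
  moreover have "(\<lambda>k. \<integral>x. q x * (\<integral>w. \<phi> k w \<partial>\<nu> x) \<partial>lborel) \<longlonglongrightarrow> (\<integral>z. pareto_F (with_density q) z * smeasure (D UNIV z) A \<partial>lborel)"
    unfolding eq
  proof (rule integral_mult_tendsto[OF g])
    show "(\<lambda>z. sintegral (D UNIV z) (\<phi> k)) \<in> borel_measurable lborel" for k by (rule meas)
    show "\<bar>sintegral (D UNIV z) (\<phi> k)\<bar> \<le> C * 1" for k z by (rule bd)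
    show "(\<lambda>k. sintegral (D UNIV z) (\<phi> k)) \<longlonglongrightarrow> smeasure (D UNIV z) A" for z
      by (rule smeasure_closed_approximation[where \<phi>=\<phi>]) (fact D A \<phi>)+
  qed
  ultimately show ?thesis by (rule LIMSEQ_unique)
qed

text \<open>The factor of \<open>g\<close> on the face \<open>I\<close> at \<open>y\<close> once the
  generator is integrated by parts. Proper faces receive a contribution only from the loss term,
  which is restricted to the orthant above \<open>y\<close> and involves total masses. On the full
  space the gain term adds the tail mass, and the two combine into one expression on each side of
  the boundary of the orthant.\<close>

definition dual_density ::
  "('n set \<Rightarrow> real ^ 'n \<Rightarrow> (real ^ 'n) signed_measure) \<Rightarrow> real ^ 'n \<Rightarrow> 'n set \<Rightarrow> real ^ 'n \<Rightarrow> real" where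
  "dual_density D y I z =
    (if I = UNIV then (if y \<le> z then - smeasure (D UNIV z) {w. \<not> y \<le> w} else smeasure (D UNIV z) {w. y \<le> w})
     else if y \<le> z then - smeasure (D I z) UNIV else 0)"

lemma smeasure_compl:
  assumes "kernel_mixed_derivatives \<nu> D" "{w. P w} \<in> sets borel"
  shows "smeasure (D I z) {w. \<not> P w} = smeasure (D I z) UNIV - smeasure (D I z) {w. P w}"
proof -
  have "measure M {w. \<not> P w} = measure M UNIV - measure M {w. P w}" if fb: "finite_borel M" for M :: "(real^'a) measure"
  proof -
    interpret finite_measure M using fb by (simp add: finite_borel_def)
    have "measure M (space M - {w. P w}) = measure M (space M) - measure M {w. P w}"
      using assms(2) fb by (intro finite_measure_compl) (simp add: finite_borel_def)
    moreover have "space M - {w. P w} = {w. \<not> P w}" using finite_borel_space[OF fb] by auto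
    ultimately show ?thesis by (simp add: finite_borel_space[OF fb])
  qed
  then show ?thesis using kernel_derivative_finite_borel[OF assms(1)] unfolding smeasure_def by simp
qed

lemma dual_density_UNIV:
  assumes "kernel_mixed_derivatives \<nu> D"
  shows "dual_density D y UNIV z = smeasure (D UNIV z) {w. y \<le> w} - (if y \<le> z then smeasure (D UNIV z) UNIV else 0)"
  by (simp add: dual_density_def smeasure_compl[OF assms])

lemma glue_ge_iff: "y \<le> glue I y z \<longleftrightarrow> (\<forall>i\<in>I. y $ i \<le> z i)"
  by (auto simp: less_eq_vec_def)

lemma sum_subsets_split:
  fixes f :: "'n::finite set \<Rightarrow> real"
  shows "(\<Sum>I\<in>UNIV. f I) = f {} + (\<Sum>I | I \<noteq> {} \<and> I \<noteq> UNIV. f I) + f UNIV"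
proof -
  have "(UNIV :: 'n set set) = insert {} (insert UNIV {I. I \<noteq> {} \<and> I \<noteq> UNIV})" by auto
  then have "sum f UNIV = sum f (insert {} (insert UNIV {I. I \<noteq> {} \<and> I \<noteq> UNIV}))" by simp
  also have "\<dots> = f {} + (f UNIV + (\<Sum>I | I \<noteq> {} \<and> I \<noteq> UNIV. f I))" by (subst sum.insert; simp)
  finally show ?thesis by simp
qed

lemma sum_nonempty_split:
  fixes f :: "'n::finite set \<Rightarrow> real"
  shows "(\<Sum>I | I \<noteq> {}. f I) = (\<Sum>I | I \<noteq> {} \<and> I \<noteq> UNIV. f I) + f UNIV"
proof -
  have "{I. I \<noteq> {}} = insert UNIV {I. I \<noteq> {} \<and> I \<noteq> (UNIV :: 'n set)}" by auto
  then show ?thesis by simp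
qed

text \<open>The definition of the test functions speaks of proper faces only. The empty face is a
  single point, and on the full face integrability is inherited from \<open>lborel\<close>.\<close>

lemma vanishing_faces_integrable:
  assumes g: "g \<in> vanishing_test_functions"
  shows "integrable (lborel_pi I) (\<lambda>z. if \<forall>i\<in>I. y $ i \<le> z i then g (glue I y z) else 0)"
proof -
  have gi: "integrable lborel g" using g by (simp add: vanishing_test_functions_def)
  have [measurable]: "g \<in> borel_measurable borel" using gi by (simp add: borel_measurable_integrable)
  consider "I = {}" | "I = UNIV" | "I \<noteq> {}" "I \<noteq> UNIV" by blast
  then show ?thesis
  proof cases
    case 1
    then show ?thesis by (simp add: PiM_empty integrable_count_space)
  next
    case 2
    have "integrable lborel (\<lambda>x. if y \<le> x then g x else 0)"
      by (rule Bochner_Integration.integrable_bound[OF gi]) (auto simp: less_eq_vec_def)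
    then have "integrable (lborel_pi UNIV) (\<lambda>z. if y \<le> glue UNIV y z then g (glue UNIV y z) else 0)"
      by (subst (asm) lborel_integrable_glue[of _ y]) (auto simp: less_eq_vec_def)
    then show ?thesis unfolding 2 glue_ge_iff by simp
  next
    case 3
    then have "set_integrable (lborel_pi I) {z. \<forall>i\<in>I. y $ i \<le> z i} (\<lambda>z. g (glue I y z))"
      using g by (simp add: vanishing_test_functions_def)
    then show ?thesis
      unfolding set_integrable_def
      by (rule Bochner_Integration.integrable_cong[THEN iffD1, rotated -1]) (auto simp: indicator_def)
  qed
qed

lemma dual_density_measurable:
  assumes D: "kernel_mixed_derivatives \<nu> D"
  shows "dual_density D y I \<in> borel_measurable borel"
proof -
  have "(\<lambda>z. smeasure (D I z) A) \<in> borel_measurable borel" if "A \<in> sets borel" for A I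
    using D that by (rule smeasure_measurable)
  note m = this
  have If: "(\<lambda>z. if y \<le> z then f z else g z) \<in> borel_measurable borel"
    if "f \<in> borel_measurable borel" "g \<in> borel_measurable borel" for f g :: "real^'a \<Rightarrow> real"
    using that by (intro measurable_If) simp_all
  show ?thesis
  proof (cases "I = UNIV")
    case True
    then show ?thesis
      unfolding dual_density_def[abs_def] if_P[OF True] by (intro If borel_measurable_uminus m) simp_all
  next
    case False
    then show ?thesis
      unfolding dual_density_def[abs_def] if_not_P[OF False] by (intro If borel_measurable_uminus m) simp_all
  qed
qed

lemma dual_density_bound:
  assumes D: "kernel_mixed_derivatives \<nu> D"
  obtains C where "0 < C" "\<And>y I z. \<bar>dual_density D y I z\<bar> \<le> C"
proof -
  obtain C where "0 < C" "\<And>I z A. \<bar>smeasure (D I z) A\<bar> \<le> C"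
    using smeasure_bound[OF D] by blast
  then show ?thesis using that[of C] unfolding dual_density_def by auto
qed

text \<open>The gain term is an integral over the whole space, so parts leave the top derivative
  alone. The loss term is an integral over the orthant above \<open>y\<close> and leaves a term on
  each of its faces: the empty face gives the total rate at \<open>y\<close>, and the full face
  merges with the gain term.\<close>

proposition pareto_dual_generator_faces:
  fixes \<nu> :: "real ^ 'n \<Rightarrow> (real ^ 'n) measure"
  assumes nu: "bounded_kernel \<nu>" and D: "kernel_mixed_derivatives \<nu> D" and g: "g \<in> vanishing_test_functions"
  shows "pareto_dual_generator \<nu> g y =
    (\<Sum>I | I \<noteq> {}. \<integral>z. g (glue I y z) * dual_density D y I (glue I y z) \<partial>lborel_pi I) - g y * measure (\<nu> y) UNIV"
proof -
  let ?q = "pareto_F_inv g"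
  have gr: "g \<in> pareto_range" and gi: "integrable lborel g"
    using g unfolding vanishing_test_functions_def by blast+
  note q = pareto_F_invD[OF gr]
  have [measurable]: "g \<in> borel_measurable borel" using gi by (simp add: borel_measurable_integrable)
  obtain C where "0 < C" and C: "\<And>I z A. \<bar>smeasure (D I z) A\<bar> \<le> C" using smeasure_bound[OF D] by blast
  note r = smeasure_UNIV_derivatives[OF nu D]
  have [measurable]: "(\<lambda>z. smeasure (D I z) A) \<in> borel_measurable borel" if "A \<in> sets borel" for I A
    using D that by (rule smeasure_measurable)
  let ?f = "\<lambda>I. \<integral>z. (if \<forall>i\<in>I. y $ i \<le> z i then g (glue I y z) * smeasure (D I (glue I y z)) UNIV else 0) \<partial>lborel_pi I"
  have 1: "(\<integral>x. ?q x * measure (\<nu> x) {w. y \<le> w} \<partial>lborel) = (\<integral>z. g z * smeasure (D UNIV z) {w. y \<le> w} \<partial>lborel)"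
    using integral_density_closed[OF nu D closed_vec_ge[of y] q(1)] gi unfolding q(2) by blast
  have 2: "(\<integral>x. (if y \<le> x then ?q x * measure (\<nu> x) UNIV else 0) \<partial>lborel) = (\<Sum>I\<in>UNIV. ?f I)"
    using integration_by_parts_faces[OF q(1) r(1) r(2) C, of y, unfolded q(2), OF vanishing_faces_integrable[OF g]] .
  have e: "?f {} = g y * measure (\<nu> y) UNIV"
  proof -
    have "smeasure (D {} y) UNIV = measure (\<nu> y) UNIV"
      using fun_cong[OF mixed_derivatives_empty[OF r(1)], of y] .
    then show ?thesis by (simp add: PiM_empty)
  qed
  have pI: "(\<integral>z. g (glue I y z) * dual_density D y I (glue I y z) \<partial>lborel_pi I) = - ?f I" if "I \<noteq> UNIV" for I
  proof -
    have "g (glue I y z) * dual_density D y I (glue I y z) =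
      - (if \<forall>i\<in>I. y $ i \<le> z i then g (glue I y z) * smeasure (D I (glue I y z)) UNIV else 0)" for z
      using that by (simp add: dual_density_def glue_ge_iff)
    then show ?thesis by simp
  qed
  have U: "(\<integral>z. g (glue UNIV y z) * dual_density D y UNIV (glue UNIV y z) \<partial>lborel_pi UNIV) =
     (\<integral>z. g z * smeasure (D UNIV z) {w. y \<le> w} \<partial>lborel) - ?f UNIV"
  proof -
    have dm [measurable]: "dual_density D y UNIV \<in> borel_measurable borel" by (rule dual_density_measurable[OF D])
    have "(\<integral>z. g (glue UNIV y z) * dual_density D y UNIV (glue UNIV y z) \<partial>lborel_pi UNIV) = (\<integral>z. g z * dual_density D y UNIV z \<partial>lborel)"
      by (rule lborel_integral_glue[symmetric]) measurable
    also have "\<dots> = (\<integral>z. g z * smeasure (D UNIV z) {w. y \<le> w} - (if y \<le> z then g z * smeasure (D UNIV z) UNIV else 0) \<partial>lborel)"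
      unfolding dual_density_UNIV[OF D] by (intro Bochner_Integration.integral_cong) (auto simp: algebra_simps)
    also have "\<dots> = (\<integral>z. g z * smeasure (D UNIV z) {w. y \<le> w} \<partial>lborel) - (\<integral>z. (if y \<le> z then g z * smeasure (D UNIV z) UNIV else 0) \<partial>lborel)"
    proof (rule Bochner_Integration.integral_diff)
      show i: "integrable lborel (\<lambda>z. g z * smeasure (D UNIV z) {w. y \<le> w})"
        by (rule integrable_bounded_mult[OF gi _ C]) simp
      have "integrable lborel (\<lambda>z. g z * smeasure (D UNIV z) UNIV)"
        by (rule integrable_bounded_mult[OF gi _ C]) simp
      then show "integrable lborel (\<lambda>z. if y \<le> z then g z * smeasure (D UNIV z) UNIV else 0)"
        by (rule Bochner_Integration.integrable_bound) (auto simp: less_eq_vec_def)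
    qed
    also have "(\<integral>z. (if y \<le> z then g z * smeasure (D UNIV z) UNIV else 0) \<partial>lborel) = ?f UNIV"
      by (subst lborel_integral_glue[of _ y]) (auto simp: glue_ge_iff less_eq_vec_def)
    finally show ?thesis .
  qed
  show ?thesis
    unfolding pareto_dual_generator_eq 1 2 sum_subsets_split[of ?f] e sum_nonempty_split U
    using pI by (simp add: sum_negf)
qed

section \<open>Kernels determined by continuous functions, and finite sums of measures\<close>

text \<open>Closed sets form an intersection-stable generator of the Borel sets, and their
  indicators are bounded pointwise limits of bounded continuous functions.\<close>

lemma finite_borel_measure_eqI:
  fixes M N :: "'a::metric_space measure"
  assumes M: "finite_borel M" and N: "finite_borel N"
    and eq: "\<And>\<phi>. \<phi> \<in> bounded_continuous \<Longrightarrow> (\<integral>w. \<phi> w \<partial>M) = (\<integral>w. \<phi> w \<partial>N)"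
  shows "M = N"
proof (rule measure_eqI_generator_eq)
  interpret M: finite_measure M using M by (simp add: finite_borel_def)
  interpret N: finite_measure N using N by (simp add: finite_borel_def)
  show "Int_stable (Collect closed :: 'a set set)" by (auto simp: Int_stable_def)
  show "sets M = sigma_sets UNIV (Collect closed)" "sets N = sigma_sets UNIV (Collect closed)"
    using M N by (simp_all add: finite_borel_def borel_eq_closed)
  show "range (\<lambda>_::nat. UNIV) \<subseteq> (Collect closed :: 'a set set)" by auto
  show "emeasure M UNIV \<noteq> \<infinity>" by simp
  fix A :: "'a set" assume "A \<in> Collect closed"
  then have A: "closed A" by simp
  obtain \<phi> :: "nat \<Rightarrow> 'a \<Rightarrow> real" where \<phi>: "\<And>k. \<phi> k \<in> bounded_continuous" "\<And>k w. 0 \<le> \<phi> k w" "\<And>k w. \<phi> k w \<le> 1"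
    "\<And>w. (\<lambda>k. \<phi> k w) \<longlonglongrightarrow> indicator A w" using closed_approximation[OF A] by blast
  have 1: "(\<lambda>k. \<integral>w. \<phi> k w \<partial>M) \<longlonglongrightarrow> measure M A"
    by (rule integral_closed_approximation[where \<phi>=\<phi>]) (fact M A \<phi>)+
  have 2: "(\<lambda>k. \<integral>w. \<phi> k w \<partial>N) \<longlonglongrightarrow> measure N A"
    by (rule integral_closed_approximation[where \<phi>=\<phi>]) (fact N A \<phi>)+
  have "measure M A = measure N A"
    using LIMSEQ_unique[OF 1] 2 eq[OF \<phi>(1)] by simp
  then show "emeasure M A = emeasure N A"
    by (simp add: M.emeasure_eq_measure N.emeasure_eq_measure)
qed auto

text \<open>For the dual kernel weak continuity is established first; the measurability demanded by
  \<open>bounded_kernel\<close> is then deduced from it, for closed sets by approximation and in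
  general by a Dynkin argument.\<close>

lemma weakly_continuous_measurable:
  fixes K :: "'a::metric_space \<Rightarrow> 'a measure"
  assumes fb: "\<And>x. finite_borel (K x)" and wc: "weakly_continuous K" and A: "A \<in> sets borel"
  shows "(\<lambda>x. measure (K x) A) \<in> borel_measurable borel"
proof -
  have A': "A \<in> sigma_sets UNIV (Collect closed)" using A by (simp add: borel_eq_closed)
  have clo: "(\<lambda>x. measure (K x) A) \<in> borel_measurable borel" if cl: "closed A" for A
  proof -
    obtain \<phi> :: "nat \<Rightarrow> 'a \<Rightarrow> real" where \<phi>: "\<And>k. \<phi> k \<in> bounded_continuous" "\<And>k w. 0 \<le> \<phi> k w" "\<And>k w. \<phi> k w \<le> 1"
      "\<And>w. (\<lambda>k. \<phi> k w) \<longlonglongrightarrow> indicator A w" using closed_approximation[OF cl] by blast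
    show ?thesis
    proof (rule borel_measurable_LIMSEQ_real)
      show "(\<lambda>k. \<integral>w. \<phi> k w \<partial>K x) \<longlonglongrightarrow> measure (K x) A" for x
        by (rule integral_closed_approximation[where \<phi>=\<phi>]) (fact fb cl \<phi>)+
      show "(\<lambda>x. \<integral>w. \<phi> k w \<partial>K x) \<in> borel_measurable borel" for k
        using wc \<phi>(1) by (intro borel_measurable_continuous_onI) (simp add: weakly_continuous_def)
    qed
  qed
  show ?thesis
  proof (rule sigma_sets_induct_disjoint[OF _ _ A'])
    show "Int_stable (Collect closed :: 'a set set)" by (auto simp: Int_stable_def)
    show "Collect closed \<subseteq> Pow (UNIV :: 'a set)" by simp
    show "(\<lambda>x. measure (K x) A) \<in> borel_measurable borel" if "A \<in> Collect closed" for A using clo that by simp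
    show "(\<lambda>x. measure (K x) {}) \<in> borel_measurable borel" by simp
  next
    fix A :: "'a set" assume B: "A \<in> sigma_sets UNIV (Collect closed)" and IH: "(\<lambda>x. measure (K x) A) \<in> borel_measurable borel"
    have "measure (K x) (UNIV - A) = measure (K x) UNIV - measure (K x) A" for x
    proof -
      interpret finite_measure "K x" using fb[of x] by (simp add: finite_borel_def)
      show ?thesis using finite_measure_compl[of A] B fb[of x]
        by (simp add: finite_borel_space[OF fb] finite_borel_def borel_eq_closed)
    qed
    then show "(\<lambda>x. measure (K x) (UNIV - A)) \<in> borel_measurable borel"
      using IH clo[of UNIV] by simp
  next
    fix A :: "nat \<Rightarrow> 'a set"
    assume dis: "disjoint_family A" and B: "range A \<subseteq> sigma_sets UNIV (Collect closed)"
      and IH: "\<And>i. (\<lambda>x. measure (K x) (A i)) \<in> borel_measurable borel"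
    have "measure (K x) (\<Union>i. A i) = (\<Sum>i. measure (K x) (A i))" for x
    proof -
      interpret finite_measure "K x" using fb[of x] by (simp add: finite_borel_def)
      have "range A \<subseteq> sets (K x)" using B fb[of x] by (simp add: finite_borel_def borel_eq_closed)
      from finite_measure_UNION[OF this dis] show ?thesis by (simp add: sums_iff)
    qed
    then show "(\<lambda>x. measure (K x) (\<Union>i. A i)) \<in> borel_measurable borel"
      using IH by simp
  qed
qed

text \<open>Occurs with two index sets: the booleans, for jumping or staying in a step of the
  uniformized chain, and the nonempty coordinate sets, for the parts of the dual kernel on the faces
  at \<open>y\<close>.\<close>

definition sum_measure :: "'i set \<Rightarrow> ('i \<Rightarrow> 'a::topological_space measure) \<Rightarrow> 'a measure" where
  "sum_measure S M = measure_of UNIV (sets borel) (\<lambda>A. \<Sum>i\<in>S. emeasure (M i) A)"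

lemma sets_sum_measure [simp]: "sets (sum_measure S M) = sets borel"
  unfolding sum_measure_def using sets.sigma_sets_eq[of borel] by (subst sets_measure_of) auto

lemma space_sum_measure [simp]: "space (sum_measure S M) = UNIV"
  unfolding sum_measure_def by (subst space_measure_of) auto

lemma emeasure_sum_measure:
  fixes M :: "'i \<Rightarrow> 'a::topological_space measure"
  assumes fin: "finite S" and M: "\<And>i. i \<in> S \<Longrightarrow> sets (M i) = sets borel" and A: "A \<in> sets borel"
  shows "emeasure (sum_measure S M) A = (\<Sum>i\<in>S. emeasure (M i) A)"
proof (rule emeasure_measure_of[OF sum_measure_def])
  show "sets borel \<subseteq> Pow (UNIV :: 'a set)" by simp
  show "A \<in> sets (sum_measure S M)" using A by simp
  show "positive (sets (sum_measure S M)) (\<lambda>A. \<Sum>i\<in>S. emeasure (M i) A)" by (simp add: positive_def)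
  show "countably_additive (sets (sum_measure S M)) (\<lambda>A. \<Sum>i\<in>S. emeasure (M i) A)"
  proof (rule countably_additiveI)
    fix B :: "nat \<Rightarrow> 'a set" assume B: "range B \<subseteq> sets (sum_measure S M)" "disjoint_family B"
    have "(\<Sum>n. \<Sum>i\<in>S. emeasure (M i) (B n)) = (\<Sum>i\<in>S. \<Sum>n. emeasure (M i) (B n))"
      by (intro suminf_sum) simp
    also have "\<dots> = (\<Sum>i\<in>S. emeasure (M i) (\<Union>n. B n))"
      using B M by (intro sum.cong refl suminf_emeasure) auto
    finally show "(\<Sum>n. \<Sum>i\<in>S. emeasure (M i) (B n)) = (\<Sum>i\<in>S. emeasure (M i) (\<Union>n. B n))" .
  qed
qed

lemma nn_integral_sum_measure:
  fixes M :: "'i \<Rightarrow> 'a::topological_space measure"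
  assumes fin: "finite S" and M: "\<And>i. i \<in> S \<Longrightarrow> sets (M i) = sets borel" and f: "f \<in> borel_measurable borel"
  shows "(\<integral>\<^sup>+x. f x \<partial>sum_measure S M) = (\<Sum>i\<in>S. \<integral>\<^sup>+x. f x \<partial>M i)"
proof -
  have m: "g \<in> borel_measurable (M i)" if "g \<in> borel_measurable borel" "i \<in> S" for g :: "'a \<Rightarrow> ennreal" and i
    using that(1) unfolding measurable_cong_sets[OF M[OF that(2)] refl] .
  have m': "g \<in> borel_measurable (sum_measure S M)" if "g \<in> borel_measurable borel" for g :: "'a \<Rightarrow> ennreal"
    using that unfolding measurable_cong_sets[OF sets_sum_measure refl] .
  show ?thesis using f
  proof (induction rule: borel_measurable_induct)
    case (cong f g)
    then have "f = g" by (intro ext) simp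
    then show ?case using cong.IH by simp
  next
    case (set A)
    then show ?case
      by (simp add: emeasure_sum_measure[OF fin M] M)
  next
    case (mult u c)
    then show ?case by (simp add: nn_integral_cmult m m' sum_distrib_left)
  next
    case (add u v)
    then show ?case by (simp add: nn_integral_add m m' sum.distrib)
  next
    case (seq U)
    have mono: "incseq (\<lambda>n. \<integral>\<^sup>+x. U n x \<partial>M i)" for i
      using seq.hyps by (auto simp: incseq_def le_fun_def intro!: nn_integral_mono)
    have "(\<integral>\<^sup>+x. (SUP n. U n x) \<partial>sum_measure S M) = (SUP n. \<Sum>i\<in>S. \<integral>\<^sup>+x. U n x \<partial>M i)"
      using seq by (subst nn_integral_monotone_convergence_SUP) (auto simp: m')
    also have "\<dots> = (\<Sum>i\<in>S. SUP n. \<integral>\<^sup>+x. U n x \<partial>M i)"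
      using mono by (intro ennreal_SUP_sum) auto
    also have "\<dots> = (\<Sum>i\<in>S. \<integral>\<^sup>+x. (SUP n. U n x) \<partial>M i)"
      using seq by (intro sum.cong refl) (subst nn_integral_monotone_convergence_SUP; auto simp: m)
    finally show ?case by (simp add: SUP_apply image_comp)
  qed
qed

lemma integral_sum_measure:
  fixes M :: "'i \<Rightarrow> 'a::topological_space measure" and f :: "'a \<Rightarrow> real"
  assumes fin: "finite S" and M: "\<And>i. i \<in> S \<Longrightarrow> sets (M i) = sets borel" and f: "f \<in> borel_measurable borel"
    and int: "\<And>i. i \<in> S \<Longrightarrow> integrable (M i) f"
  shows "integrable (sum_measure S M) f" "(\<integral>x. f x \<partial>sum_measure S M) = (\<Sum>i\<in>S. \<integral>x. f x \<partial>M i)"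
proof -
  have f': "f \<in> borel_measurable (sum_measure S M)"
    using f unfolding measurable_cong_sets[OF sets_sum_measure refl] .
  have fin': "(\<integral>\<^sup>+x. ennreal \<bar>f x\<bar> \<partial>M i) < \<infinity>" if "i \<in> S" for i
    using int[OF that] by (simp add: integrable_iff_bounded)
  have eq: "(\<integral>\<^sup>+x. ennreal (g x) \<partial>sum_measure S M) = (\<Sum>i\<in>S. \<integral>\<^sup>+x. ennreal (g x) \<partial>M i)"
    if "g \<in> borel_measurable borel" for g :: "'a \<Rightarrow> real"
    using that by (intro nn_integral_sum_measure fin M) auto
  show I: "integrable (sum_measure S M) f"
    unfolding integrable_iff_bounded using f f' fin fin' eq[of "\<lambda>x. \<bar>f x\<bar>"] by auto
  have le: "(\<integral>\<^sup>+x. ennreal (f x) \<partial>M i) < \<top>" "(\<integral>\<^sup>+x. ennreal (- f x) \<partial>M i) < \<top>" if "i \<in> S" for i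
    by (rule le_less_trans[OF nn_integral_mono fin'[OF that, unfolded infinity_ennreal_def]]; auto intro!: ennreal_leI)+
  have "(\<integral>x. f x \<partial>sum_measure S M) = enn2real (\<Sum>i\<in>S. \<integral>\<^sup>+x. ennreal (f x) \<partial>M i) - enn2real (\<Sum>i\<in>S. \<integral>\<^sup>+x. ennreal (- f x) \<partial>M i)"
    using f by (simp add: real_lebesgue_integral_def[OF I] eq)
  also have "\<dots> = (\<Sum>i\<in>S. enn2real (\<integral>\<^sup>+x. ennreal (f x) \<partial>M i)) - (\<Sum>i\<in>S. enn2real (\<integral>\<^sup>+x. ennreal (- f x) \<partial>M i))"
    using le by (simp add: enn2real_sum)
  also have "\<dots> = (\<Sum>i\<in>S. \<integral>x. f x \<partial>M i)"
    using int by (simp add: real_lebesgue_integral_def sum_subtractf)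
  finally show "(\<integral>x. f x \<partial>sum_measure S M) = (\<Sum>i\<in>S. \<integral>x. f x \<partial>M i)" .
qed

section \<open>Jump processes with bounded rates\<close>

text \<open>Law of one step of the uniformized chain when \<open>r\<close> is at least the total
  rate: a jump with law \<open>K x\<close> scaled by \<open>1 / r\<close>, and no motion with the
  remaining probability.\<close>

definition jump_step :: "('a::topological_space \<Rightarrow> 'a measure) \<Rightarrow> real \<Rightarrow> 'a \<Rightarrow> 'a measure" where
  "jump_step K r x = sum_measure UNIV
     (\<lambda>b. if b then density (K x) (\<lambda>_. ennreal (1 / r))
          else density (return borel x) (\<lambda>_. ennreal (1 - measure (K x) UNIV / r)))"

lemma emeasure_density_const_borel:
  "sets M = sets borel \<Longrightarrow> A \<in> sets borel \<Longrightarrow> emeasure (density M (\<lambda>_. c)) A = c * emeasure M A"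
  by (subst emeasure_density) (auto simp: nn_integral_cmult_indicator)

section \<open>Poisson weights\<close>

text \<open>Parameter 0 occurs at time 0 and stands for the point mass at 0;
  \<open>poisson_pmf\<close> covers the positive parameters.\<close>

definition pois :: "real \<Rightarrow> nat pmf" where
  "pois s = (if s \<le> 0 then return_pmf 0 else poisson_pmf s)"

lemma pmf_pois: "0 \<le> s \<Longrightarrow> pmf (pois s) k = s ^ k / fact k * exp (- s)"
  by (cases "s = 0"; cases k) (auto simp: pois_def)

lemma pmf_map_plus: "pmf (map_pmf ((+) k) p) m = (if k \<le> m then pmf p (m - k) else 0)" for k m :: nat
proof (cases "k \<le> m")
  case True
  then show ?thesis using pmf_map_inj'[of "(+) k" p "m - k"] by (simp add: inj_def)
next
  case False
  then show ?thesis by (auto intro!: pmf_map_outside)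
qed

lemma pois_add:
  assumes s: "0 \<le> s" and t: "0 \<le> t"
  shows "bind_pmf (pois s) (\<lambda>k. map_pmf ((+) k) (pois t)) = pois (s + t)"
proof (rule pmf_eqI)
  fix m
  have "pmf (bind_pmf (pois s) (\<lambda>k. map_pmf ((+) k) (pois t))) m = (\<integral>k. (if k \<le> m then pmf (pois t) (m - k) else 0) \<partial>pois s)"
    by (simp add: pmf_bind pmf_map_plus)
  also have "\<dots> = (\<Sum>k\<le>m. (if k \<le> m then pmf (pois t) (m - k) else 0) * pmf (pois s) k)"
    by (rule integral_measure_pmf_real) (auto split: if_splits)
  also have "\<dots> = (\<Sum>k\<le>m. of_nat (m choose k) * s ^ k * t ^ (m - k) / fact m * exp (- (s + t)))"
  proof (intro sum.cong refl)
    fix k assume k: "k \<in> {..m}"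
    have e: "exp (- (s + t)) = exp (- t) * exp (- s)" by (simp flip: exp_add)
    have "real (m choose k) = fact m / (fact k * fact (m - k))" using k by (intro binomial_fact) simp
    then show "(if k \<le> m then pmf (pois t) (m - k) else 0) * pmf (pois s) k =
       of_nat (m choose k) * s ^ k * t ^ (m - k) / fact m * exp (- (s + t))"
      using k unfolding e by (simp add: pmf_pois s t mult_ac)
  qed
  also have "\<dots> = (s + t) ^ m / fact m * exp (- (s + t))"
    by (simp add: binomial_ring sum_divide_distrib sum_distrib_right)
  finally show "pmf (bind_pmf (pois s) (\<lambda>k. map_pmf ((+) k) (pois t))) m = pmf (pois (s + t)) m"
    using s t by (simp add: pmf_pois)
qed

text \<open>Compared with the weights \<open>1 - s\<close> at 0 and \<open>s\<close> at 1, the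
  Poisson weights at 0, at 1 and beyond 1 are each off by at most the square of \<open>s\<close>,
  whence the factor 3. All three estimates come from \<open>1 - s \<le> exp (- s)\<close> and
  \<open>(1 + s) * exp (- s) \<le> 1\<close>.\<close>

lemma pois_second_order:
  assumes s: "0 \<le> s" and F: "\<And>k. \<bar>F k\<bar> \<le> b"
  shows "\<bar>(\<integral>k. F k \<partial>pois s) - F 0 - s * (F 1 - F 0)\<bar> \<le> 3 * b * s\<^sup>2"
proof -
  let ?p0 = "exp (- s)" and ?p1 = "s * exp (- s)"
  have b: "0 \<le> b" using F[of 0] by linarith
  define R where "R k = (if k \<ge> 2 then F k else 0)" for k
  define J where "J k = (if k \<ge> 2 then 1 else 0 :: real)" for k :: nat
  have intb: "integrable (pois s) h" if "\<And>k. \<bar>h k\<bar> \<le> c" for h :: "nat \<Rightarrow> real" and c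
    using that by (intro integrable_bounded[OF measure_pmf.finite_measure_axioms]) auto
  have i0: "integrable (pois s) (indicator {i} :: nat \<Rightarrow> real)" for i
    by (rule intb[of _ 1]) (auto simp: indicator_def)
  have iR: "integrable (pois s) R" by (rule intb[of _ b]) (use F b in \<open>auto simp: R_def\<close>)
  have iJ: "integrable (pois s) J" by (rule intb[of _ 1]) (auto simp: J_def)
  have e: "(\<integral>k. indicator {i} k \<partial>pois s) = pmf (pois s) i" for i
    by (simp add: measure_pmf_single)
  have p: "pmf (pois s) 0 = ?p0" "pmf (pois s) 1 = ?p1" using s by (simp_all add: pmf_pois)
  have "(\<integral>k. F k \<partial>pois s) = (\<integral>k. F 0 * indicator {0} k + F 1 * indicator {1} k + R k \<partial>pois s)"
  proof (intro Bochner_Integration.integral_cong refl)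
    fix k :: nat
    show "F k = F 0 * indicator {0} k + F 1 * indicator {1} k + R k"
      by (cases "k = 0"; cases "k = 1") (auto simp: R_def indicator_def)
  qed
  also have "\<dots> = F 0 * ?p0 + F 1 * ?p1 + (\<integral>k. R k \<partial>pois s)"
    using i0 iR e p by simp
  finally have 1: "(\<integral>k. F k \<partial>pois s) = F 0 * ?p0 + F 1 * ?p1 + (\<integral>k. R k \<partial>pois s)" .
  have "(\<integral>k. 1 \<partial>pois s) = (\<integral>k. indicator {0} k + indicator {1} k + J k \<partial>pois s)"
  proof (intro Bochner_Integration.integral_cong refl)
    fix k :: nat
    show "1 = indicator {0} k + indicator {1} k + J k"
      by (cases "k = 0"; cases "k = 1") (auto simp: J_def indicator_def)
  qed
  also have "\<dots> = ?p0 + ?p1 + (\<integral>k. J k \<partial>pois s)"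
    using i0 iJ e p by simp
  finally have 2: "(\<integral>k. J k \<partial>pois s) = 1 - ?p0 - ?p1" by simp
  have "\<bar>\<integral>k. R k \<partial>pois s\<bar> \<le> (\<integral>k. \<bar>R k\<bar> \<partial>pois s)" by (rule integral_abs_bound)
  also have "\<dots> \<le> (\<integral>k. b * J k \<partial>pois s)"
  proof (rule integral_mono)
    show "integrable (pois s) (\<lambda>k. \<bar>R k\<bar>)" using iR by simp
    show "integrable (pois s) (\<lambda>k. b * J k)" using iJ by simp
    show "\<bar>R k\<bar> \<le> b * J k" for k using F b by (simp add: R_def J_def)
  qed
  also have "\<dots> = b * (1 - ?p0 - ?p1)" using 2 by simp
  finally have 3: "\<bar>\<integral>k. R k \<partial>pois s\<bar> \<le> b * (1 - ?p0 - ?p1)" .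
  have ge: "1 - s \<le> ?p0" using exp_ge_add_one_self[of "- s"] by simp
  have "(1 + s) * ?p0 \<le> exp s * ?p0" by (intro mult_right_mono exp_ge_add_one_self) auto
  then have le: "(1 + s) * ?p0 \<le> 1" by (simp flip: exp_add)
  have q0: "0 \<le> ?p0 - 1 + s" using ge by simp
  have q0': "?p0 - 1 + s \<le> s\<^sup>2"
  proof -
    have "s * (1 - s) \<le> s * ?p0" using ge s by (intro mult_left_mono)
    then show ?thesis using le by (simp add: algebra_simps power2_eq_square)
  qed
  have q1: "0 \<le> s - ?p1" using s mult_left_mono[of ?p0 1 s] by simp
  have q1': "s - ?p1 \<le> s\<^sup>2" using mult_left_mono[OF ge s] by (simp add: algebra_simps power2_eq_square)
  have q2: "1 - ?p0 - ?p1 \<le> s\<^sup>2"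
  proof -
    have "(1 + s) * (1 - s) \<le> (1 + s) * ?p0" using ge s by (intro mult_left_mono) auto
    then show ?thesis by (simp add: algebra_simps power2_eq_square)
  qed
  have "\<bar>F 0 * (?p0 - 1 + s)\<bar> \<le> b * s\<^sup>2"
    unfolding abs_mult using F[of 0] q0 q0' b by (intro mult_mono) auto
  moreover have "\<bar>F 1 * (s - ?p1)\<bar> \<le> b * s\<^sup>2"
    unfolding abs_mult using F[of 1] q1 q1' b by (intro mult_mono) auto
  moreover have "\<bar>\<integral>k. R k \<partial>pois s\<bar> \<le> b * s\<^sup>2"
    using 3 mult_left_mono[OF q2 b] by linarith
  moreover have "(\<integral>k. F k \<partial>pois s) - F 0 - s * (F 1 - F 0) = F 0 * (?p0 - 1 + s) - F 1 * (s - ?p1) + (\<integral>k. R k \<partial>pois s)"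
    unfolding 1 by (simp add: algebra_simps)
  ultimately show ?thesis by linarith
qed

section \<open>The uniformized chain and its semigroup\<close>

text \<open>\<open>r\<close> is any upper bound of the jump rates rather than the least one: two
  kernels can then be uniformized with the same \<open>r\<close> and their chains compared step by
  step.\<close>

locale jump_kernel =
  fixes K :: "'a::metric_space \<Rightarrow> 'a measure" and r :: real
  assumes kernel: "bounded_kernel K" and weak: "weakly_continuous K"
    and r: "0 < r" and rate_le: "\<And>x. measure (K x) UNIV \<le> r"
begin

lemma fb: "finite_borel (K x)"
  using kernel by (rule bounded_kernel_finite_borel)

lemma sets_K: "sets (K x) = sets borel"
  using fb by (simp add: finite_borel_def)

lemma fin_K: "finite_measure (K x)"
  using fb by (simp add: finite_borel_def)

lemma measurable_K: "f \<in> borel_measurable borel \<Longrightarrow> f \<in> borel_measurable (K x)"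
  unfolding finite_borel_measurable[OF fb] .

lemma integrable_K:
  assumes "f \<in> borel_measurable borel" "\<And>w. \<bar>f w\<bar> \<le> (b :: real)"
  shows "integrable (K x) f"
  by (rule integrable_bounded[OF fin_K measurable_K[OF assms(1)] assms(2)])

lemma jump_generator_eq:
  assumes "f \<in> borel_measurable borel" "\<And>w. \<bar>f w\<bar> \<le> b"
  shows "jump_generator K f x = (\<integral>w. f w \<partial>K x) - f x * measure (K x) UNIV"
proof -
  interpret finite_measure "K x" by (rule fin_K)
  show ?thesis
    unfolding jump_generator_def
    by (subst Bochner_Integration.integral_diff) (auto simp: integrable_K[OF assms] finite_borel_space[OF fb])
qed

lemma abs_integral_K_le:
  assumes "f \<in> borel_measurable borel" "\<And>w. \<bar>f w\<bar> \<le> b"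
  shows "\<bar>\<integral>w. f w \<partial>K x\<bar> \<le> b * r"
proof -
  have b: "0 \<le> b" using assms(2)[of undefined] by linarith
  have "\<bar>\<integral>w. f w \<partial>K x\<bar> \<le> b * measure (K x) UNIV"
    by (rule abs_integral_le_finite_borel[OF fb assms])
  also have "\<dots> \<le> b * r" using b rate_le by (intro mult_left_mono)
  finally show ?thesis .
qed

lemma jump_generator_bound:
  assumes "f \<in> borel_measurable borel" "\<And>w. \<bar>f w\<bar> \<le> b"
  shows "\<bar>jump_generator K f x\<bar> \<le> 2 * r * b"
proof -
  have b: "0 \<le> b" using assms(2)[of undefined] by linarith
  have "\<bar>f x * measure (K x) UNIV\<bar> \<le> b * r"
    unfolding abs_mult using assms(2) rate_le b by (intro mult_mono) auto
  then show ?thesis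
    unfolding jump_generator_eq[OF assms] using abs_integral_K_le[OF assms, of x] by (simp add: algebra_simps)
qed

lemma jump_generator_bounded_continuous:
  assumes f: "f \<in> bounded_continuous"
  shows "jump_generator K f \<in> bounded_continuous"
proof -
  obtain b where b: "continuous_on UNIV f" "\<And>w. \<bar>f w\<bar> \<le> b" "0 \<le> b" using bounded_continuousE[OF f] by blast
  note m = bounded_continuous_measurable[OF f]
  show ?thesis
  proof (rule bounded_continuousI)
    have "continuous_on UNIV (\<lambda>x. \<integral>w. f w \<partial>K x)" "continuous_on UNIV (\<lambda>x. measure (K x) UNIV)"
      using weak f const_bounded_continuous[of 1] unfolding weakly_continuous_def
      by (auto dest!: bspec[of _ _ "\<lambda>_. 1"] simp: finite_borel_space[OF fb])
    then show "continuous_on UNIV (jump_generator K f)"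
      unfolding jump_generator_eq[OF m b(2), abs_def] by (intro continuous_intros b(1))
    show "\<bar>jump_generator K f x\<bar> \<le> 2 * r * b" for x by (rule jump_generator_bound[OF m b(2)])
  qed
qed

lemma sets_step [simp]: "sets (jump_step K r x) = sets borel"
  by (simp add: jump_step_def)

lemma emeasure_step:
  assumes A: "A \<in> sets borel"
  shows "emeasure (jump_step K r x) A = ennreal (measure (K x) A / r + (1 - measure (K x) UNIV / r) * indicator A x)"
proof -
  interpret finite_measure "K x" by (rule fin_K)
  have le: "measure (K x) UNIV / r \<le> 1" using rate_le[of x] r by simp
  have "emeasure (jump_step K r x) A = ennreal (1 / r) * ennreal (measure (K x) A) + ennreal (1 - measure (K x) UNIV / r) * ennreal (indicator A x)"
    unfolding jump_step_def using A
    by (subst emeasure_sum_measure) (auto simp: sets_K UNIV_bool emeasure_density_const_borel emeasure_eq_measure split: split_indicator)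
  also have "\<dots> = ennreal (measure (K x) A / r + (1 - measure (K x) UNIV / r) * indicator A x)"
    using r le by (simp flip: ennreal_mult ennreal_plus)
  finally show ?thesis .
qed

lemma measure_step:
  assumes A: "A \<in> sets borel"
  shows "measure (jump_step K r x) A = measure (K x) A / r + (1 - measure (K x) UNIV / r) * indicator A x"
proof -
  have le: "measure (K x) UNIV / r \<le> 1" using rate_le[of x] r by simp
  show ?thesis
    by (rule measure_eq_emeasure_eq_ennreal[OF _ emeasure_step[OF A]]) (use r le in simp)
qed

lemma prob_space_step: "prob_space (jump_step K r x)"
proof (rule prob_spaceI)
  have "space (jump_step K r x) = UNIV" by (simp add: jump_step_def)
  then show "emeasure (jump_step K r x) (space (jump_step K r x)) = 1"
    by (simp add: emeasure_step)
qed

lemma step_measurable: "jump_step K r \<in> borel \<rightarrow>\<^sub>M prob_algebra borel"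
proof (rule measurable_prob_algebraI[OF prob_space_step measurable_subprob_algebra])
  show "subprob_space (jump_step K r x)" for x
    using prob_space_step by (rule prob_space_imp_subprob_space)
  fix A :: "'a set" assume A: "A \<in> sets borel"
  have [measurable]: "(\<lambda>x. measure (K x) B) \<in> borel_measurable borel" if "B \<in> sets borel" for B
    using bounded_kernel_measurable[OF kernel that] .
  note [measurable] = A
  show "(\<lambda>x. emeasure (jump_step K r x) A) \<in> borel_measurable borel"
    unfolding emeasure_step[OF A] by measurable
qed simp_all

text \<open>As an operator a step is the identity plus the generator divided by \<open>r\<close>.
  This carries bounded continuity through the iterates and produces the linear term of the semigroup
  in \<open>t\<close>.\<close>

lemma integral_step:
  assumes f: "f \<in> borel_measurable borel" "\<And>w. \<bar>f w\<bar> \<le> b"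
  shows "(\<integral>w. f w \<partial>jump_step K r x) = f x + jump_generator K f x / r"
proof -
  have le: "measure (K x) UNIV / r \<le> 1" using rate_le[of x] r by simp
  have fR: "f \<in> borel_measurable (return borel x)" using f(1) by simp
  have i1: "integrable (density (K x) (\<lambda>_. ennreal (1 / r))) f" 
    using integrable_K[OF f] measurable_K[OF f(1)] r by (subst integrable_density) auto
  have i2: "integrable (density (return borel x) (\<lambda>_. ennreal (1 - measure (K x) UNIV / r))) f"
  proof -
    interpret prob_space "return borel x" by (rule prob_space_return) simp
    have "integrable (return borel x) f"
      by (rule integrable_bounded[OF _ fR f(2)]) unfold_locales
    then show ?thesis using le f by (subst integrable_density) auto
  qed
  have "(\<integral>w. f w \<partial>jump_step K r x) = (\<integral>w. f w \<partial>density (K x) (\<lambda>_. ennreal (1 / r))) +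
      (\<integral>w. f w \<partial>density (return borel x) (\<lambda>_. ennreal (1 - measure (K x) UNIV / r)))"
    unfolding jump_step_def
    by (subst integral_sum_measure(2)) (auto simp: UNIV_bool sets_K f i1 i2)
  also have "(\<integral>w. f w \<partial>density (K x) (\<lambda>_. ennreal (1 / r))) = (\<integral>w. f w \<partial>K x) / r"
    using measurable_K[OF f(1)] r by (subst integral_density) auto
  also have "(\<integral>w. f w \<partial>density (return borel x) (\<lambda>_. ennreal (1 - measure (K x) UNIV / r))) = (1 - measure (K x) UNIV / r) * f x"
    using f le by (subst integral_density) (auto simp: integral_return)
  also have "(\<integral>w. f w \<partial>K x) / r + (1 - measure (K x) UNIV / r) * f x = f x + jump_generator K f x / r"
    unfolding jump_generator_eq[OF f] using r by (simp add: field_simps)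
  finally show ?thesis .
qed

text \<open>The new step is put in front. The version with the new step at the end follows from
  \<open>iter_add\<close>, and the duality of the chains plays the two versions against each
  other.\<close>

primrec iter :: "nat \<Rightarrow> 'a \<Rightarrow> 'a measure" where
  "iter 0 x = return borel x"
| "iter (Suc k) x = jump_step K r x \<bind> iter k"

lemma iter_0': "iter 0 = return borel" by (simp add: fun_eq_iff)

lemma iter_measurable: "iter k \<in> borel \<rightarrow>\<^sub>M prob_algebra borel"
proof (induction k)
  case 0
  show ?case unfolding iter_0' by (rule measurable_return_prob_space)
next
  case (Suc k)
  have "iter (Suc k) = (\<lambda>x. jump_step K r x \<bind> iter k)" by (simp add: fun_eq_iff)
  then show ?case using measurable_bind_prob_space[OF step_measurable Suc.IH] by simp
qed

lemma iter_add: "iter (m + n) x = iter m x \<bind> iter n"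
proof (induction m arbitrary: x)
  case 0
  show ?case by (simp add: bind_return[OF measurable_prob_algebraD[OF iter_measurable]])
next
  case (Suc m)
  have "iter (Suc m + n) x = jump_step K r x \<bind> (\<lambda>y. iter m y \<bind> iter n)"
    unfolding iter.simps add_Suc by (intro arg_cong2[where f=bind] refl ext Suc.IH)
  also have "\<dots> = (jump_step K r x \<bind> iter m) \<bind> iter n"
    by (rule bind_assoc[symmetric, where N=borel and R=borel])
      (simp_all only: measurable_cong_sets[OF sets_step refl] measurable_prob_algebraD[OF iter_measurable])
  finally show ?case by simp
qed

lemma prob_space_iter: "prob_space (iter k x)"
  using measurable_space[OF iter_measurable, of x k] by (simp add: space_prob_algebra)

lemma sets_iter: "sets (iter k x) = sets borel"
  using measurable_space[OF iter_measurable, of x k] by (simp add: space_prob_algebra)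

lemma finite_borel_iter: "finite_borel (iter k x)"
proof -
  interpret prob_space "iter k x" by (rule prob_space_iter)
  show ?thesis unfolding finite_borel_def using sets_iter by (auto intro: finite_measure_axioms)
qed

lemma measurable_const_iter: "(\<lambda>k. iter k x) \<in> measurable (measure_pmf p) (subprob_algebra borel)"
  using measurable_space[OF measurable_prob_algebraD[OF iter_measurable], of x] by (simp add: measurable_pmf_measure1)

text \<open>The chain after a Poisson number of steps of mean \<open>r * t\<close>. In operator
  terms this is the exponential of \<open>t\<close> times the bounded generator.\<close>

definition semigroup :: "real \<Rightarrow> 'a \<Rightarrow> 'a measure" where
  "semigroup t x = measure_pmf (pois (r * t)) \<bind> (\<lambda>k. iter k x)"

lemma emeasure_semigroup:
  "A \<in> sets borel \<Longrightarrow> emeasure (semigroup t x) A = (\<integral>\<^sup>+k. emeasure (iter k x) A \<partial>pois (r * t))"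
  unfolding semigroup_def by (subst emeasure_bind[OF _ measurable_const_iter]) auto

lemma sets_semigroup: "sets (semigroup t x) = sets borel"
  unfolding semigroup_def by (rule sets_bind) (auto simp: sets_iter)

lemma prob_space_semigroup: "prob_space (semigroup t x)"
  unfolding semigroup_def by (rule measure_pmf.prob_space_bind[OF _ measurable_const_iter]) (simp add: prob_space_iter)

lemma semigroup_measurable: "semigroup t \<in> borel \<rightarrow>\<^sub>M prob_algebra borel"
proof (rule measurable_prob_algebraI[OF prob_space_semigroup measurable_subprob_algebra])
  show "subprob_space (semigroup t x)" for x
    using prob_space_semigroup by (rule prob_space_imp_subprob_space)
  fix A :: "'a set" assume A: "A \<in> sets borel"
  have [measurable]: "(\<lambda>x. emeasure (iter k x) A) \<in> borel_measurable borel" for k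
    by (rule measurable_compose[OF measurable_prob_algebraD[OF iter_measurable] measurable_emeasure_subprob_algebra[OF A]])
  show "(\<lambda>x. emeasure (semigroup t x) A) \<in> borel_measurable borel"
    unfolding emeasure_semigroup[OF A] nn_integral_measure_pmf nn_integral_count_space_nat by measurable
qed (simp_all add: sets_semigroup)

text \<open>The chain composes by \<open>iter_add\<close>, the numbers of steps by
  \<open>pois_add\<close>. The order of integration over states and numbers of steps is exchanged
  with nonnegative extended integrands.\<close>

lemma semigroup_add:
  assumes "0 \<le> s" "0 \<le> t"
  shows "semigroup (s + t) x = semigroup s x \<bind> semigroup t"
proof (rule measure_eqI)
  have sm: "semigroup t \<in> measurable (semigroup s x) (subprob_algebra borel)"
    unfolding measurable_cong_sets[OF sets_semigroup refl] by (rule measurable_prob_algebraD[OF semigroup_measurable])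
  have sp: "space (semigroup s x) \<noteq> {}" using prob_space.not_empty[OF prob_space_semigroup] .
  have se: "sets (semigroup s x \<bind> semigroup t) = sets borel"
    by (rule sets_bind) (auto simp: sets_semigroup sp)
  then show "sets (semigroup (s + t) x) = sets (semigroup s x \<bind> semigroup t)" by (simp add: sets_semigroup)
  fix A assume "A \<in> sets (semigroup (s + t) x)"
  then have A: "A \<in> sets borel" by (simp add: sets_semigroup)
  have m: "(\<lambda>x. emeasure (iter k x) A) \<in> borel_measurable borel" for k
    by (rule measurable_compose[OF measurable_prob_algebraD[OF iter_measurable] measurable_emeasure_subprob_algebra[OF A]])
  have m': "(\<lambda>x. emeasure (iter k x) A) \<in> borel_measurable (iter l y)" for k l y
    unfolding measurable_cong_sets[OF sets_iter refl] by (rule m)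
  have mT: "(\<lambda>y. emeasure (semigroup t y) A) \<in> borel_measurable borel"
    by (rule measurable_compose[OF measurable_prob_algebraD[OF semigroup_measurable] measurable_emeasure_subprob_algebra[OF A]])
  have add: "(\<integral>\<^sup>+y. emeasure (iter l y) A \<partial>iter k x) = emeasure (iter (k + l) x) A" for k l
    unfolding iter_add
  proof (rule emeasure_bind[OF _ _ A, symmetric])
    show "space (iter k x) \<noteq> {}" using prob_space.not_empty[OF prob_space_iter] .
    show "iter l \<in> iter k x \<rightarrow>\<^sub>M subprob_algebra borel"
      unfolding measurable_cong_sets[OF sets_iter refl] by (rule measurable_prob_algebraD[OF iter_measurable])
  qed
  have "emeasure (semigroup s x \<bind> semigroup t) A = (\<integral>\<^sup>+y. emeasure (semigroup t y) A \<partial>semigroup s x)"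
    by (rule emeasure_bind[OF sp sm A])
  also have "\<dots> = (\<integral>\<^sup>+k. (\<integral>\<^sup>+y. emeasure (semigroup t y) A \<partial>iter k x) \<partial>pois (r * s))"
    unfolding semigroup_def[of s] by (rule nn_integral_bind[OF mT measurable_const_iter])
  also have "\<dots> = (\<integral>\<^sup>+k. (\<integral>\<^sup>+l. emeasure (iter (k + l) x) A \<partial>pois (r * t)) \<partial>pois (r * s))"
  proof (rule nn_integral_cong)
    fix k
    have "(\<integral>\<^sup>+y. emeasure (semigroup t y) A \<partial>iter k x) = (\<integral>\<^sup>+y. (\<Sum>l. ennreal (pmf (pois (r * t)) l) * emeasure (iter l y) A) \<partial>iter k x)"
      unfolding emeasure_semigroup[OF A] nn_integral_measure_pmf nn_integral_count_space_nat ..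
    also have "\<dots> = (\<Sum>l. \<integral>\<^sup>+y. ennreal (pmf (pois (r * t)) l) * emeasure (iter l y) A \<partial>iter k x)"
      by (rule nn_integral_suminf) (use m' in simp)
    also have "\<dots> = (\<Sum>l. ennreal (pmf (pois (r * t)) l) * emeasure (iter (k + l) x) A)"
      by (simp add: nn_integral_cmult m' add)
    finally show "(\<integral>\<^sup>+y. emeasure (semigroup t y) A \<partial>iter k x) = (\<integral>\<^sup>+l. emeasure (iter (k + l) x) A \<partial>pois (r * t))"
      unfolding nn_integral_measure_pmf nn_integral_count_space_nat .
  qed
  also have "\<dots> = (\<integral>\<^sup>+m. emeasure (iter m x) A \<partial>bind_pmf (pois (r * s)) (\<lambda>k. map_pmf ((+) k) (pois (r * t))))"
    by (simp add: nn_integral_bind_pmf)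
  also have "\<dots> = emeasure (semigroup (s + t) x) A"
    unfolding emeasure_semigroup[OF A] using r assms by (simp add: pois_add distrib_left)
  finally show "emeasure (semigroup (s + t) x) A = emeasure (semigroup s x \<bind> semigroup t) A" ..
qed

lemma semigroup_0: "semigroup 0 x = return borel x"
  by (rule measure_eqI) (simp_all add: sets_semigroup emeasure_semigroup pois_def)

lemma markov_transition_semigroup: "markov_transition semigroup"
  unfolding markov_transition_def using semigroup_measurable semigroup_0 semigroup_add by blast

lemma integral_iter_Suc:
  assumes f: "f \<in> borel_measurable borel" "\<And>w. \<bar>f w\<bar> \<le> (b::real)"
  shows "(\<integral>w. f w \<partial>iter (Suc k) x) = (\<integral>y. (\<integral>w. f w \<partial>iter k y) \<partial>jump_step K r x)"
  unfolding iter.simps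
proof (rule integral_bind[where B=b and B'=1])
  show "iter k \<in> jump_step K r x \<rightarrow>\<^sub>M subprob_algebra borel"
    unfolding measurable_cong_sets[OF sets_step refl] by (rule measurable_prob_algebraD[OF iter_measurable])
  show "finite_measure (jump_step K r x)" using prob_space_step by (rule prob_space.finite_measure)
  show "AE y in jump_step K r x. emeasure (iter k y) (space (iter k y)) \<le> ennreal 1"
    by (simp add: prob_space.emeasure_space_1[OF prob_space_iter])
qed (use f in auto)

lemma integral_iter_bound:
  assumes f: "f \<in> borel_measurable borel" "\<And>w. \<bar>f w\<bar> \<le> (b::real)"
  shows "\<bar>\<integral>w. f w \<partial>iter k x\<bar> \<le> b"
  using abs_integral_le_finite_borel[OF finite_borel_iter f, of k x] prob_space.prob_space[OF prob_space_iter, of k x]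
  by (simp add: finite_borel_space[OF finite_borel_iter])

lemma iter_bounded_continuous:
  assumes f: "f \<in> bounded_continuous"
  shows "(\<lambda>x. \<integral>w. f w \<partial>iter k x) \<in> bounded_continuous"
proof (induction k)
  case 0
  show ?case using f by (simp add: integral_return bounded_continuous_measurable)
next
  case (Suc k)
  obtain b where b: "continuous_on UNIV f" "\<And>w. \<bar>f w\<bar> \<le> b" "0 \<le> b" using bounded_continuousE[OF f] by blast
  note m = bounded_continuous_measurable[OF f]
  let ?f = "\<lambda>x. \<integral>w. f w \<partial>iter k x"
  show ?case
  proof (rule bounded_continuousI)
    have "(\<integral>w. f w \<partial>iter (Suc k) x) = ?f x + jump_generator K ?f x / r" for x
      unfolding integral_iter_Suc[OF m b(2)]
      by (rule integral_step[OF bounded_continuous_measurable[OF Suc.IH] integral_iter_bound[OF m b(2)]])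
    then show "continuous_on UNIV (\<lambda>x. \<integral>w. f w \<partial>iter (Suc k) x)"
      using Suc.IH jump_generator_bounded_continuous[OF Suc.IH]
      by (auto simp: bounded_continuous_def divide_inverse intro!: continuous_intros)
    show "\<bar>\<integral>w. f w \<partial>iter (Suc k) x\<bar> \<le> b" for x by (rule integral_iter_bound[OF m b(2)])
  qed
qed

lemma integral_semigroup:
  assumes f: "f \<in> borel_measurable borel" "\<And>w. \<bar>f w\<bar> \<le> (b::real)"
  shows "(\<integral>w. f w \<partial>semigroup t x) = (\<integral>k. (\<integral>w. f w \<partial>iter k x) \<partial>pois (r * t))"
  unfolding semigroup_def
proof (rule integral_bind[OF _ _ measurable_const_iter, where B=b and B'=1])
  show "finite_measure (measure_pmf (pois (r * t)))" by (rule measure_pmf.finite_measure_axioms)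
  show "AE k in pois (r * t). emeasure (iter k x) (space (iter k x)) \<le> ennreal 1"
    by (simp add: prob_space.emeasure_space_1[OF prob_space_iter])
qed (use f in auto)

text \<open>Every iterate preserves bounded continuity with the same bound, so continuity of the
  Poisson mixture follows along sequences by dominated convergence.\<close>

lemma C_Feller_semigroup: "C_Feller semigroup"
  unfolding C_Feller_def
proof (intro conjI allI impI ballI markov_transition_semigroup)
  fix t :: real and f :: "'a \<Rightarrow> real" assume f: "f \<in> bounded_continuous"
  obtain b where b: "continuous_on UNIV f" "\<And>w. \<bar>f w\<bar> \<le> b" "0 \<le> b" using bounded_continuousE[OF f] by blast
  note m = bounded_continuous_measurable[OF f]
  show "(\<lambda>x. \<integral>w. f w \<partial>semigroup t x) \<in> bounded_continuous"
  proof (rule bounded_continuousI)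
    show "\<bar>\<integral>w. f w \<partial>semigroup t x\<bar> \<le> b" for x
    proof -
      have "finite_measure (semigroup t x)" using prob_space_semigroup by (rule prob_space.finite_measure)
      then have "finite_borel (semigroup t x)" by (simp add: finite_borel_def sets_semigroup)
      from abs_integral_le_finite_borel[OF this m b(2)] show ?thesis
        using prob_space.prob_space[OF prob_space_semigroup, of t x] finite_borel_space[OF \<open>finite_borel (semigroup t x)\<close>] by simp
    qed
    show "continuous_on UNIV (\<lambda>x. \<integral>w. f w \<partial>semigroup t x)"
      unfolding continuous_on_sequentially integral_semigroup[OF m b(2)] o_def
    proof (intro allI ballI impI)
      fix X :: "nat \<Rightarrow> 'a" and a assume X: "(\<forall>n. X n \<in> UNIV) \<and> X \<longlonglongrightarrow> a"
      show "(\<lambda>n. \<integral>k. (\<integral>w. f w \<partial>iter k (X n)) \<partial>pois (r * t)) \<longlonglongrightarrow> (\<integral>k. (\<integral>w. f w \<partial>iter k a) \<partial>pois (r * t))"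
      proof (rule integral_bounded_tendsto[where C=b])
        show "finite_measure (measure_pmf (pois (r * t)))" by (rule measure_pmf.finite_measure_axioms)
        show "\<bar>\<integral>w. f w \<partial>iter k (X n)\<bar> \<le> b" for n k by (rule integral_iter_bound[OF m b(2)])
        fix k
        have "continuous_on UNIV (\<lambda>x. \<integral>w. f w \<partial>iter k x)"
          using iter_bounded_continuous[OF f, of k] by (simp add: bounded_continuous_def)
        then show "(\<lambda>n. \<integral>w. f w \<partial>iter k (X n)) \<longlonglongrightarrow> (\<integral>w. f w \<partial>iter k a)"
          using X unfolding continuous_on_sequentially o_def by blast
      qed simp
    qed
  qed
qed

text \<open>The Poisson expansion applied to the means of \<open>f\<close> under the iterates, whose
  first increment is the generator divided by \<open>r\<close>. The constant involves
  \<open>f\<close> only through \<open>b\<close>, as the notion \<open>second_order\<close>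
  requires.\<close>

lemma semigroup_second_order:
  assumes f: "f \<in> borel_measurable borel" "\<And>w. \<bar>f w\<bar> \<le> b" and t: "0 \<le> t"
  shows "\<bar>(\<integral>w. f w \<partial>semigroup t x) - f x - t * jump_generator K f x\<bar> \<le> 3 * b * r\<^sup>2 * t\<^sup>2"
proof -
  define F where "F k = (\<integral>w. f w \<partial>iter k x)" for k
  have F0: "F 0 = f x" using f by (simp add: F_def integral_return)
  have F1: "F 1 = f x + jump_generator K f x / r"
  proof -
    have "F (Suc 0) = (\<integral>w. f w \<partial>jump_step K r x)"
      unfolding F_def integral_iter_Suc[OF f] using f(1) by (simp add: integral_return)
    then show ?thesis by (simp add: integral_step[OF f])
  qed
  have "\<bar>(\<integral>k. F k \<partial>pois (r * t)) - F 0 - (r * t) * (F 1 - F 0)\<bar> \<le> 3 * b * (r * t)\<^sup>2"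
    using r t integral_iter_bound[OF f, of _ x] by (intro pois_second_order) (auto simp: F_def)
  moreover have "r * t * (F 1 - F 0) = t * jump_generator K f x"
    unfolding F0 F1 using r by simp
  ultimately have "\<bar>(\<integral>k. F k \<partial>pois (r * t)) - F 0 - t * jump_generator K f x\<bar> \<le> 3 * b * (r * t)\<^sup>2"
    by (simp only:)
  then show ?thesis
    unfolding integral_semigroup[OF f] F_def[symmetric] F0[symmetric] by (simp add: power_mult_distrib mult.assoc)
qed

end

section \<open>C-Feller semigroups and uniqueness for a given generator\<close>

lemma C_Feller_kernel:
  assumes "C_Feller T" "0 \<le> t"
  shows "prob_space (T t x)" "finite_borel (T t x)" "T t \<in> borel \<rightarrow>\<^sub>M subprob_algebra borel"
proof -
  have T: "T t \<in> borel \<rightarrow>\<^sub>M prob_algebra borel"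
    using assms by (simp add: C_Feller_def markov_transition_def)
  have "T t x \<in> space (prob_algebra borel)" using measurable_space[OF T, of x] by simp
  then have *: "prob_space (T t x)" "sets (T t x) = sets borel" by (auto simp: space_prob_algebra)
  then show "prob_space (T t x)" by simp
  show "finite_borel (T t x)" using prob_space.finite_measure[OF *(1)] *(2) by (simp add: finite_borel_def)
  show "T t \<in> borel \<rightarrow>\<^sub>M subprob_algebra borel" using T by (rule measurable_prob_algebraD)
qed

lemma C_Feller_integral_bound:
  assumes "C_Feller T" "0 \<le> t" "f \<in> borel_measurable borel" "\<And>w. \<bar>f w\<bar> \<le> (b::real)"
  shows "\<bar>\<integral>w. f w \<partial>T t x\<bar> \<le> b"
  using abs_integral_le_finite_borel[OF C_Feller_kernel(2)[OF assms(1,2)] assms(3,4), of x]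
    prob_space.prob_space[OF C_Feller_kernel(1)[OF assms(1,2)], of x]
  by (simp add: finite_borel_space[OF C_Feller_kernel(2)[OF assms(1,2)]])

lemma C_Feller_integrable:
  assumes "C_Feller T" "0 \<le> t" "f \<in> bounded_continuous"
  shows "integrable (T t x) f"
proof -
  obtain b where b: "\<And>w. \<bar>f w\<bar> \<le> b" using bounded_continuousE[OF assms(3)] by blast
  note fb = C_Feller_kernel(2)[OF assms(1,2), of x]
  show ?thesis
    by (rule integrable_bounded[OF _ _ b])
      (use fb finite_borel_measurable[OF fb] bounded_continuous_measurable[OF assms(3)] in \<open>auto simp: finite_borel_def\<close>)
qed

lemma C_Feller_add:
  assumes T: "C_Feller T" and st: "0 \<le> s" "0 \<le> t" and f: "f \<in> bounded_continuous"
  shows "(\<integral>w. f w \<partial>T (s + t) x) = (\<integral>y. (\<integral>w. f w \<partial>T t y) \<partial>T s x)"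
proof -
  obtain b where b: "\<And>w. \<bar>f w\<bar> \<le> b" using bounded_continuousE[OF f] by blast
  have "T (s + t) x = T s x \<bind> T t"
    using T st by (simp add: C_Feller_def markov_transition_def)
  moreover have "(\<integral>w. f w \<partial>(T s x \<bind> T t)) = (\<integral>y. (\<integral>w. f w \<partial>T t y) \<partial>T s x)"
  proof (rule integral_bind[where B=b and B'=1])
    show "f \<in> borel_measurable borel" using f by (rule bounded_continuous_measurable)
    have se: "sets (T s x) = sets borel" using C_Feller_kernel(2)[OF T st(1)] by (simp add: finite_borel_def)
    show "T t \<in> T s x \<rightarrow>\<^sub>M subprob_algebra borel"
      unfolding measurable_cong_sets[OF se refl] by (rule C_Feller_kernel(3)[OF T st(2)])
    show "finite_measure (T s x)" using C_Feller_kernel(2)[OF T st(1)] by (simp add: finite_borel_def)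
    show "AE y in T s x. emeasure (T t y) (space (T t y)) \<le> ennreal 1"
      by (simp add: prob_space.emeasure_space_1[OF C_Feller_kernel(1)[OF T st(2)]])
  qed (use b in auto)
  ultimately show ?thesis by simp
qed

lemma C_Feller_bounded_continuous:
  "C_Feller T \<Longrightarrow> 0 \<le> t \<Longrightarrow> f \<in> bounded_continuous \<Longrightarrow> (\<lambda>x. \<integral>w. f w \<partial>T t x) \<in> bounded_continuous"
  by (simp add: C_Feller_def)

lemma bounded_continuous_diff:
  assumes "f \<in> bounded_continuous" "g \<in> bounded_continuous"
  shows "(\<lambda>x. f x - c * g x) \<in> bounded_continuous"
proof -
  obtain a where a: "continuous_on UNIV f" "\<And>w. \<bar>f w\<bar> \<le> a" using bounded_continuousE[OF assms(1)] by blast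
  obtain b where b: "continuous_on UNIV g" "\<And>w. \<bar>g w\<bar> \<le> b" using bounded_continuousE[OF assms(2)] by blast
  show ?thesis
  proof (rule bounded_continuousI)
    show "continuous_on UNIV (\<lambda>x. f x - c * g x)" using a b by (intro continuous_intros)
    have c: "\<bar>c * g x\<bar> \<le> \<bar>c\<bar> * b" for x unfolding abs_mult using b(2) by (intro mult_left_mono) auto
    show "\<bar>f x - c * g x\<bar> \<le> a + \<bar>c\<bar> * b" for x using a(2)[of x] c[of x] by linarith
  qed
qed

text \<open>The increment over \<open>[0, t]\<close> is the sum of the increments over \<open>m\<close> short intervals.\<close>

lemma C_Feller_increment:
  fixes T :: "real \<Rightarrow> 'a::metric_space \<Rightarrow> 'a measure"
  assumes T: "C_Feller T" and g: "g \<in> bounded_continuous" and f: "f \<in> bounded_continuous"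
    and lim: "uniform_limit UNIV (\<lambda>t y. ((\<integral>u. g u \<partial>T t y) - g y) / t) f (at_right 0)"
    and t: "0 \<le> t" and c: "\<And>s y. 0 \<le> s \<Longrightarrow> s \<le> t \<Longrightarrow> \<bar>(\<integral>u. f u \<partial>T s y) - f y\<bar> \<le> c"
  shows "\<bar>(\<integral>u. g u \<partial>T t x) - g x - t * f x\<bar> \<le> t * c"
proof (cases "t = 0")
  case True
  have "T 0 x = return borel x" using T by (simp add: C_Feller_def markov_transition_def)
  then show ?thesis using True g by (simp add: integral_return bounded_continuous_measurable)
next
  case False
  then have t0: "0 < t" using t by simp
  have "\<bar>(\<integral>u. g u \<partial>T t x) - g x - t * f x\<bar> \<le> t * c + e" if e: "0 < e" for e
  proof -
    \<comment> \<open>An error \<open>e'\<close> per unit of time adds up to \<open>e\<close> over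
      the whole interval.\<close>
    define e' where "e' = e / t"
    have e': "0 < e'" using e t0 by (simp add: e'_def)
    have "\<forall>\<^sub>F s in at_right 0. \<forall>y\<in>UNIV. dist (((\<integral>u. g u \<partial>T s y) - g y) / s) (f y) < e'"
      using lim e' unfolding uniform_limit_iff by blast
    then obtain d where d: "0 < d" "\<And>s y. 0 < s \<Longrightarrow> s < d \<Longrightarrow> dist (((\<integral>u. g u \<partial>T s y) - g y) / s) (f y) < e'"
      unfolding eventually_at_right_field by auto
    obtain m where m: "t / d < real m" using reals_Archimedean2 by blast
    have "0 < t / d" using t0 d by simp
    then have m0: "0 < real m" using m by linarith
    define s where "s = t / real m"
    have s: "0 < s" "s < d" using t0 m0 m d by (auto simp: s_def field_simps)
    \<comment> \<open>The generator limit is uniform in \<open>y\<close>, so one step length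
      \<open>s\<close> serves every position that the process may have reached.\<close>
    have step: "\<bar>(\<integral>u. g u \<partial>T s y) - g y - s * f y\<bar> \<le> s * e'" for y
    proof -
      have "\<bar>((\<integral>u. g u \<partial>T s y) - g y) / s - f y\<bar> < e'" using d(2)[OF s, of y] by (simp add: dist_real_def)
      then have "s * \<bar>((\<integral>u. g u \<partial>T s y) - g y) / s - f y\<bar> \<le> s * e'" using s by (intro mult_left_mono) auto
      moreover have "s * \<bar>((\<integral>u. g u \<partial>T s y) - g y) / s - f y\<bar> = \<bar>s * (((\<integral>u. g u \<partial>T s y) - g y) / s - f y)\<bar>"
        using s by (simp add: abs_mult)
      moreover have "s * (((\<integral>u. g u \<partial>T s y) - g y) / s - f y) = (\<integral>u. g u \<partial>T s y) - g y - s * f y"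
        using s by (simp add: field_simps)
      ultimately show ?thesis by simp
    qed
    have "\<bar>(\<integral>u. g u \<partial>T (real k * s) x) - g x - real k * s * f x\<bar> \<le> real k * (s * e' + s * c)" if "k \<le> m" for k
      using that
    proof (induction k)
      case 0
      have "T 0 x = return borel x" using T by (simp add: C_Feller_def markov_transition_def)
      then show ?case using g by (simp add: integral_return bounded_continuous_measurable)
    next
      case (Suc k)
      let ?S = "T (real k * s) x"
      have ks: "0 \<le> real k * s" "real k * s \<le> t"
      proof -
        show "0 \<le> real k * s" using s by simp
        have "real k * s \<le> real m * s" using Suc.prems s by (intro mult_right_mono) auto
        then show "real k * s \<le> t" using m0 by (simp add: s_def)
      qed
      let ?Tg = "\<lambda>y. \<integral>u. g u \<partial>T s y"
      have Tg: "?Tg \<in> bounded_continuous" using s by (intro C_Feller_bounded_continuous[OF T _ g]) simp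
      \<comment> \<open>The remainder of one short step started at \<open>y\<close>, to be averaged
        over the law at time \<open>k * s\<close>. What is left of that step is \<open>s\<close>
        times the mean of \<open>f\<close> at this time, which differs from \<open>f x\<close> by at
        most \<open>c\<close>.\<close>
      let ?h = "\<lambda>y. ?Tg y - 1 * g y - s * f y"
      have h: "?h \<in> bounded_continuous"
        using bounded_continuous_diff[OF bounded_continuous_diff[OF Tg g, of 1] f, of s] .
      have "(\<integral>u. g u \<partial>T (real (Suc k) * s) x) = (\<integral>y. ?Tg y \<partial>?S)"
        using C_Feller_add[OF T ks(1) _ g, of s x] s by (simp add: algebra_simps)
      moreover have "(\<integral>y. ?h y \<partial>?S) = (\<integral>y. ?Tg y \<partial>?S) - (\<integral>y. g y \<partial>?S) - s * (\<integral>y. f y \<partial>?S)"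
        using C_Feller_integrable[OF T ks(1) Tg] C_Feller_integrable[OF T ks(1) g] C_Feller_integrable[OF T ks(1) f]
        by simp
      moreover have "\<bar>\<integral>y. ?h y \<partial>?S\<bar> \<le> s * e'"
        using step by (intro C_Feller_integral_bound[OF T ks(1) bounded_continuous_measurable[OF h]]) simp
      moreover have "\<bar>s * ((\<integral>y. f y \<partial>?S) - f x)\<bar> \<le> s * c"
        unfolding abs_mult using s c[OF ks] by simp
      ultimately show ?case using Suc.IH Suc.prems by (simp add: algebra_simps) 
    qed
    from this[of m] have "\<bar>(\<integral>u. g u \<partial>T t x) - g x - t * f x\<bar> \<le> real m * (s * e' + s * c)"
      using m0 by (simp add: s_def)
    also have "\<dots> = t * c + e" using m0 t0 by (simp add: s_def e'_def field_simps)
    finally show ?thesis .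
  qed
  then show ?thesis by (rule field_le_epsilon)
qed

context jump_kernel
begin

text \<open>A form of the generator equation without a domain: it concerns all bounded continuous
  functions, with a constant depending on the bound \<open>b\<close> alone. Hence it can be applied
  again to the functions produced by the semigroup itself.\<close>

definition second_order :: "(real \<Rightarrow> 'a \<Rightarrow> 'a measure) \<Rightarrow> bool" where
  "second_order T \<longleftrightarrow> (\<forall>b. \<exists>C. \<forall>f\<in>bounded_continuous. (\<forall>w. \<bar>f w\<bar> \<le> b) \<longrightarrow>
     (\<forall>t\<ge>0. \<forall>x. \<bar>(\<integral>w. f w \<partial>T t x) - f x - t * jump_generator K f x\<bar> \<le> C * t\<^sup>2))"

lemma second_order_semigroup: "second_order semigroup"
  unfolding second_order_def
proof (intro allI exI ballI impI)
  fix b t :: real and x :: 'a and f :: "'a \<Rightarrow> real" assume "f \<in> bounded_continuous" "\<forall>w. \<bar>f w\<bar> \<le> b" "0 \<le> t"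
  then show "\<bar>(\<integral>w. f w \<partial>semigroup t x) - f x - t * jump_generator K f x\<bar> \<le> 3 * b * r\<^sup>2 * t\<^sup>2"
    by (intro semigroup_second_order bounded_continuous_measurable) auto
qed

lemma generates_semigroup: "generates_C_Feller bounded_continuous (jump_generator K) semigroup"
  unfolding generates_C_Feller_def
proof (intro conjI ballI C_Feller_semigroup)
  fix f :: "'a \<Rightarrow> real" assume f: "f \<in> bounded_continuous"
  obtain b where b: "\<And>w. \<bar>f w\<bar> \<le> b" "0 \<le> b" using bounded_continuousE[OF f] by blast
  show "uniform_limit UNIV (\<lambda>t y. ((\<integral>u. f u \<partial>semigroup t y) - f y) / t) (jump_generator K f) (at_right 0)"
    unfolding uniform_limit_iff
  proof (intro allI impI)
    fix e :: real assume e: "0 < e"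
    define d where "d = e / (3 * b * r\<^sup>2 + 1)"
    have pos: "0 < 3 * b * r\<^sup>2 + 1" using b(2) by (simp add: add_nonneg_pos)
    have d: "0 < d" using e pos by (simp add: d_def)
    have "dist (((\<integral>u. f u \<partial>semigroup t y) - f y) / t) (jump_generator K f y) < e" if t: "0 < t" "t < d" for t y
    proof -
      have "\<bar>((\<integral>u. f u \<partial>semigroup t y) - f y) / t - jump_generator K f y\<bar>
        = \<bar>(\<integral>u. f u \<partial>semigroup t y) - f y - t * jump_generator K f y\<bar> / t"
      proof -
        have "((\<integral>u. f u \<partial>semigroup t y) - f y) / t - jump_generator K f y
          = ((\<integral>u. f u \<partial>semigroup t y) - f y - t * jump_generator K f y) / t"
          using t by (simp add: diff_divide_distrib)
        then show ?thesis using t by (simp only: abs_divide)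
      qed
      also have "\<dots> \<le> (3 * b * r\<^sup>2 * t\<^sup>2) / t"
        using t by (intro divide_right_mono semigroup_second_order[OF bounded_continuous_measurable[OF f] b(1)]) auto
      also have "\<dots> = 3 * b * r\<^sup>2 * t" using t by (simp add: power2_eq_square)
      also have "\<dots> \<le> (3 * b * r\<^sup>2 + 1) * t" using t by (simp add: algebra_simps)
      also have "\<dots> < (3 * b * r\<^sup>2 + 1) * d" using t pos by (intro mult_strict_left_mono)
      also have "\<dots> = e" using pos by (simp add: d_def)
      finally show ?thesis by (simp add: dist_real_def)
    qed
    then show "\<forall>\<^sub>F t in at_right 0. \<forall>y\<in>UNIV. dist (((\<integral>u. f u \<partial>semigroup t y) - f y) / t) (jump_generator K f y) < e"
      unfolding eventually_at_right_field using d by blast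
  qed
qed

text \<open>A bootstrap. On \<open>E\<close> the generator equation yields a Lipschitz estimate in
  time depending only on the bound of the function; bounded pointwise limits carry it to all bounded
  continuous functions, in particular to \<open>jump_generator K g\<close>, which need not lie in
  \<open>E\<close>. Lipschitz continuity of the latter improves the error for \<open>g\<close> to
  second order, and a second limit removes the restriction to \<open>E\<close>.\<close>

lemma second_order_of_generator:
  assumes T: "C_Feller T" and E: "E \<subseteq> bounded_continuous"
    and lim: "\<And>g. g \<in> E \<Longrightarrow> uniform_limit UNIV (\<lambda>t y. ((\<integral>u. g u \<partial>T t y) - g y) / t) (jump_generator K g) (at_right 0)"
    and dense: "\<And>f b. f \<in> bounded_continuous \<Longrightarrow> (\<forall>w. \<bar>f w\<bar> \<le> b) \<Longrightarrow>
      \<exists>s::nat \<Rightarrow> _. (\<forall>k. s k \<in> E) \<and> (\<forall>k w. \<bar>s k w\<bar> \<le> b + 1) \<and> (\<forall>w. (\<lambda>k. s k w) \<longlonglongrightarrow> f w)"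
  shows "second_order T"
proof -
  have conv: "(\<lambda>k. \<integral>w. s k w \<partial>M) \<longlonglongrightarrow> (\<integral>w. f w \<partial>M)"
    if fb: "finite_borel M" and s: "\<forall>k. s k \<in> E" "\<forall>k w. \<bar>s k w\<bar> \<le> b + 1" "\<forall>w. (\<lambda>k. s k w) \<longlonglongrightarrow> f w" for M s f b
  proof (rule integral_bounded_tendsto[where C="b + 1"])
    show "finite_measure M" using fb by (simp add: finite_borel_def)
    show "s k \<in> borel_measurable M" for k
      unfolding finite_borel_measurable[OF fb] using s(1) E by (intro bounded_continuous_measurable) auto
  qed (use s in auto)
  \<comment> \<open>The generator is bounded by \<open>2 * r * b\<close>. Its oscillation
    contributes twice this bound and the linear term once, which makes 6.\<close>
  have 1: "\<bar>(\<integral>w. g w \<partial>T t x) - g x\<bar> \<le> t * (6 * r * b)" if g: "g \<in> E" "\<And>w. \<bar>g w\<bar> \<le> b" and t: "0 \<le> t" for g b t x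
  proof -
    have gb: "g \<in> bounded_continuous" using g E by auto
    note m = bounded_continuous_measurable[OF gb]
    note A = jump_generator_bounded_continuous[OF gb]
    note Ab = jump_generator_bound[OF m g(2)]
    have "\<bar>(\<integral>u. g u \<partial>T t x) - g x - t * jump_generator K g x\<bar> \<le> t * (4 * r * b)"
    proof (rule C_Feller_increment[OF T gb A lim[OF g(1)] t])
      fix s y assume "0 \<le> (s::real)"
      from C_Feller_integral_bound[OF T this bounded_continuous_measurable[OF A] Ab, of y] Ab[of y]
      show "\<bar>(\<integral>u. jump_generator K g u \<partial>T s y) - jump_generator K g y\<bar> \<le> 4 * r * b" by linarith
    qed
    moreover have "\<bar>t * jump_generator K g x\<bar> \<le> t * (2 * r * b)"
      unfolding abs_mult using t Ab[of x] by (auto intro: mult_left_mono)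
    ultimately show ?thesis by (simp add: algebra_simps)
  qed
  \<comment> \<open>Approximants are bounded by \<open>b + 1\<close> instead of \<open>b\<close>,
    hence the shift in the constant.\<close>
  have 2: "\<bar>(\<integral>w. f w \<partial>T t x) - f x\<bar> \<le> t * (6 * r * (b + 1))" if f: "f \<in> bounded_continuous" "\<And>w. \<bar>f w\<bar> \<le> b" and t: "0 \<le> t" for f b t x
  proof -
    obtain s where s: "\<forall>k. s k \<in> E" "\<forall>k w. \<bar>s k w\<bar> \<le> b + 1" "\<forall>w. (\<lambda>k::nat. s k w) \<longlonglongrightarrow> f w"
      using dense[OF f(1)] f(2) by metis
    have "(\<lambda>k. \<bar>(\<integral>w. s k w \<partial>T t x) - s k x\<bar>) \<longlonglongrightarrow> \<bar>(\<integral>w. f w \<partial>T t x) - f x\<bar>"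
      using s by (intro tendsto_intros conv[OF C_Feller_kernel(2)[OF T t] s]) auto
    then show ?thesis
      by (rule LIMSEQ_le_const2) (use 1[OF s(1)[rule_format] s(2)[rule_format] t] in blast)
  qed
  \<comment> \<open>The preceding estimate is applied to \<open>jump_generator K g\<close>, with
    bound \<open>2 * r * b\<close>; it replaces the constant oscillation by one proportional to
    \<open>t\<close>.\<close>
  have 3: "\<bar>(\<integral>w. g w \<partial>T t x) - g x - t * jump_generator K g x\<bar> \<le> (6 * r * (2 * r * b + 1)) * t\<^sup>2"
    if g: "g \<in> E" "\<And>w. \<bar>g w\<bar> \<le> b" and t: "0 \<le> t" for g b t x
  proof -
    have gb: "g \<in> bounded_continuous" using g E by auto
    note m = bounded_continuous_measurable[OF gb]
    note A = jump_generator_bounded_continuous[OF gb]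
    note Ab = jump_generator_bound[OF m g(2)]
    have b: "0 \<le> b" using g(2)[of x] by linarith
    have "\<bar>(\<integral>u. g u \<partial>T t x) - g x - t * jump_generator K g x\<bar> \<le> t * (t * (6 * r * (2 * r * b + 1)))"
    proof (rule C_Feller_increment[OF T gb A lim[OF g(1)] t])
      fix s y assume s: "0 \<le> s" "s \<le> t"
      have "\<bar>(\<integral>u. jump_generator K g u \<partial>T s y) - jump_generator K g y\<bar> \<le> s * (6 * r * (2 * r * b + 1))"
        by (rule 2[OF A Ab s(1)])
      also have "\<dots> \<le> t * (6 * r * (2 * r * b + 1))" using s r b by (intro mult_right_mono) auto
      finally show "\<bar>(\<integral>u. jump_generator K g u \<partial>T s y) - jump_generator K g y\<bar> \<le> t * (6 * r * (2 * r * b + 1))" .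
    qed
    then show ?thesis by (simp add: power2_eq_square mult_ac)
  qed
  show ?thesis
    unfolding second_order_def
  proof (intro allI exI ballI impI)
    fix b t :: real and x :: 'a and f :: "'a \<Rightarrow> real" assume f: "f \<in> bounded_continuous" and fb': "\<forall>w. \<bar>f w\<bar> \<le> b" and t: "0 \<le> t"
    obtain s where s: "\<forall>k. s k \<in> E" "\<forall>k w. \<bar>s k w\<bar> \<le> b + 1" "\<forall>w. (\<lambda>k::nat. s k w) \<longlonglongrightarrow> f w"
      using dense[OF f fb'] by metis
    have sm: "s k \<in> borel_measurable borel" for k
      using s(1) E by (intro bounded_continuous_measurable) auto
    have "(\<lambda>k. jump_generator K (s k) x) \<longlonglongrightarrow> jump_generator K f x"
      unfolding jump_generator_eq[OF sm s(2)[rule_format]] jump_generator_eq[OF bounded_continuous_measurable[OF f] fb'[rule_format]]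
      using s(3) by (intro tendsto_intros conv[OF fb s]) auto
    then have "(\<lambda>k. \<bar>(\<integral>w. s k w \<partial>T t x) - s k x - t * jump_generator K (s k) x\<bar>) \<longlonglongrightarrow> \<bar>(\<integral>w. f w \<partial>T t x) - f x - t * jump_generator K f x\<bar>"
      using s(3) by (intro tendsto_intros conv[OF C_Feller_kernel(2)[OF T t] s]) auto
    then show "\<bar>(\<integral>w. f w \<partial>T t x) - f x - t * jump_generator K f x\<bar> \<le> (6 * r * (2 * r * (b + 1) + 1)) * t\<^sup>2"
      by (rule LIMSEQ_le_const2) (use 3[OF s(1)[rule_format] s(2)[rule_format] t] in blast)
  qed
qed

text \<open>Over \<open>m\<close> steps of length \<open>t / m\<close> the two semigroups drift
  apart by at most a multiple of \<open>m * (t / m)^2\<close>, which tends to 0. The induction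
  applies the one-step estimate to functions already moved by \<open>S\<close>; they keep the bound
  \<open>b\<close>, and so the same constant.\<close>

lemma second_order_unique:
  assumes T: "C_Feller T" "second_order T" and S: "C_Feller S" "second_order S" and t: "0 \<le> t"
  shows "T t x = S t x"
proof (rule finite_borel_measure_eqI[OF C_Feller_kernel(2)[OF T(1) t] C_Feller_kernel(2)[OF S(1) t]])
  fix f :: "'a \<Rightarrow> real" assume f: "f \<in> bounded_continuous"
  obtain b where b: "\<And>w. \<bar>f w\<bar> \<le> b" using bounded_continuousE[OF f] by blast
  obtain C1 where C1: "\<forall>f\<in>bounded_continuous. (\<forall>w. \<bar>f w\<bar> \<le> b) \<longrightarrow>
     (\<forall>t\<ge>0. \<forall>x. \<bar>(\<integral>w. f w \<partial>T t x) - f x - t * jump_generator K f x\<bar> \<le> C1 * t\<^sup>2)"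
    using T(2) unfolding second_order_def by blast
  obtain C2 where C2: "\<forall>f\<in>bounded_continuous. (\<forall>w. \<bar>f w\<bar> \<le> b) \<longrightarrow>
     (\<forall>t\<ge>0. \<forall>x. \<bar>(\<integral>w. f w \<partial>S t x) - f x - t * jump_generator K f x\<bar> \<le> C2 * t\<^sup>2)"
    using S(2) unfolding second_order_def by blast
  have step: "\<bar>(\<integral>w. g w \<partial>T s y) - (\<integral>w. g w \<partial>S s y)\<bar> \<le> (C1 + C2) * s\<^sup>2"
    if "g \<in> bounded_continuous" "\<And>w. \<bar>g w\<bar> \<le> b" "0 \<le> s" for g s y
  proof -
    have "\<bar>(\<integral>w. g w \<partial>T s y) - g y - s * jump_generator K g y\<bar> \<le> C1 * s\<^sup>2"
      "\<bar>(\<integral>w. g w \<partial>S s y) - g y - s * jump_generator K g y\<bar> \<le> C2 * s\<^sup>2"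
      using C1 C2 that by blast+
    then show ?thesis by (simp add: algebra_simps)
  qed
  have many: "\<bar>(\<integral>w. g w \<partial>T (real k * s) y) - (\<integral>w. g w \<partial>S (real k * s) y)\<bar> \<le> real k * ((C1 + C2) * s\<^sup>2)"
    if "g \<in> bounded_continuous" "\<And>w. \<bar>g w\<bar> \<le> b" "0 \<le> s" for g s y k
    using that(1,2)
  proof (induction k arbitrary: g)
    case 0
    have "T 0 y = return borel y" "S 0 y = return borel y"
      using T S by (simp_all add: C_Feller_def markov_transition_def)
    then show ?case by simp
  next
    case (Suc k)
    note g = Suc.prems
    have ks: "0 \<le> real k * s" using that(3) by simp
    let ?Tg = "\<lambda>y. \<integral>w. g w \<partial>T s y" and ?Sg = "\<lambda>y. \<integral>w. g w \<partial>S s y"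
    have Tg: "?Tg \<in> bounded_continuous" and Sg: "?Sg \<in> bounded_continuous"
      using C_Feller_bounded_continuous[OF T(1) that(3) g(1)] C_Feller_bounded_continuous[OF S(1) that(3) g(1)] .
    have Sgb: "\<bar>?Sg y\<bar> \<le> b" for y
      by (rule C_Feller_integral_bound[OF S(1) that(3) bounded_continuous_measurable[OF g(1)] g(2)])
    have dc: "(\<lambda>y. ?Tg y - 1 * ?Sg y) \<in> bounded_continuous" by (rule bounded_continuous_diff[OF Tg Sg])
    have "(\<integral>w. g w \<partial>T (real (Suc k) * s) y) = (\<integral>z. ?Tg z \<partial>T (real k * s) y)"
      "(\<integral>w. g w \<partial>S (real (Suc k) * s) y) = (\<integral>z. ?Sg z \<partial>S (real k * s) y)"
      using C_Feller_add[OF T(1) ks that(3) g(1), of y] C_Feller_add[OF S(1) ks that(3) g(1), of y] by (simp_all add: algebra_simps)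
    moreover have "\<bar>(\<integral>z. ?Sg z \<partial>T (real k * s) y) - (\<integral>z. ?Sg z \<partial>S (real k * s) y)\<bar> \<le> real k * ((C1 + C2) * s\<^sup>2)"
      by (rule Suc.IH[OF Sg Sgb])
    moreover have "\<bar>\<integral>z. ?Tg z - 1 * ?Sg z \<partial>T (real k * s) y\<bar> \<le> (C1 + C2) * s\<^sup>2"
      using step[OF g that(3)] by (intro C_Feller_integral_bound[OF T(1) ks bounded_continuous_measurable[OF dc]]) simp
    moreover have "(\<integral>z. ?Tg z - 1 * ?Sg z \<partial>T (real k * s) y) = (\<integral>z. ?Tg z \<partial>T (real k * s) y) - (\<integral>z. ?Sg z \<partial>T (real k * s) y)"
      using C_Feller_integrable[OF T(1) ks Tg] C_Feller_integrable[OF T(1) ks Sg] by simp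
    ultimately show ?case by (simp add: algebra_simps)
  qed
  have bound: "\<bar>(\<integral>w. f w \<partial>T t x) - (\<integral>w. f w \<partial>S t x)\<bar> \<le> (C1 + C2) * t\<^sup>2 * inverse (real (Suc m))" for m
  proof -
    have "\<bar>(\<integral>w. f w \<partial>T (real (Suc m) * (t / real (Suc m))) x) - (\<integral>w. f w \<partial>S (real (Suc m) * (t / real (Suc m))) x)\<bar>
       \<le> real (Suc m) * ((C1 + C2) * (t / real (Suc m))\<^sup>2)"
      using t by (intro many[OF f b]) simp
    moreover have "real (Suc m) * (t / real (Suc m)) = t" by simp
    moreover have "real (Suc m) * ((C1 + C2) * (t / real (Suc m))\<^sup>2) = (C1 + C2) * t\<^sup>2 * inverse (real (Suc m))"
      by (simp add: power2_eq_square field_simps del: of_nat_Suc)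
    ultimately show ?thesis by metis
  qed
  have "(\<lambda>m. (C1 + C2) * t\<^sup>2 * inverse (real (Suc m))) \<longlonglongrightarrow> 0"
    using tendsto_mult_left[OF LIMSEQ_inverse_real_of_nat, of "(C1 + C2) * t\<^sup>2"] by simp
  then have "\<bar>(\<integral>w. f w \<partial>T t x) - (\<integral>w. f w \<partial>S t x)\<bar> \<le> 0"
    by (rule LIMSEQ_le_const) (use bound in blast)
  then show "(\<integral>w. f w \<partial>T t x) = (\<integral>w. f w \<partial>S t x)" by simp
qed

lemma generator_unique:
  assumes T: "generates_C_Feller bounded_continuous (jump_generator K) T" and t: "0 \<le> t"
  shows "T t x = semigroup t x"
proof (rule second_order_unique[OF _ _ C_Feller_semigroup second_order_semigroup t])
  show CF: "C_Feller T" using T by (simp add: generates_C_Feller_def)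
  show "second_order T"
  proof (rule second_order_of_generator[OF CF order_refl])
    show "uniform_limit UNIV (\<lambda>t y. ((\<integral>u. g u \<partial>T t y) - g y) / t) (jump_generator K g) (at_right 0)"
      if "g \<in> bounded_continuous" for g using T that by (simp add: generates_C_Feller_def)
    show "\<exists>s::nat \<Rightarrow> _. (\<forall>k. s k \<in> bounded_continuous) \<and> (\<forall>k w. \<bar>s k w\<bar> \<le> b + 1) \<and> (\<forall>w. (\<lambda>k. s k w) \<longlonglongrightarrow> f w)"
      if "f \<in> bounded_continuous" "\<forall>w. \<bar>f w\<bar> \<le> b" for f :: "'a \<Rightarrow> real" and b
    proof (intro exI[of _ "\<lambda>_. f"] conjI allI)
      show "\<bar>f w\<bar> \<le> b + 1" for w using that(2)[rule_format, of w] by linarith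
    qed (use that in auto)
  qed
qed

end

section \<open>Mixed derivatives of a tail integral almost everywhere\<close>

text \<open>At a Lebesgue point of \<open>p\<close> the averages over the intervals from
  \<open>t\<close> to \<open>t + h\<close> converge to \<open>p t\<close>. Since \<open>u\<close> is
  differentiable everywhere by assumption, these one-sided limits identify the derivative.\<close>

lemma AE_derivative_of_tail_integral:
  fixes p u u' :: "real \<Rightarrow> real"
  assumes p: "integrable lborel p" and u: "\<And>t. u t = c * (\<integral>x. (if t \<le> x then p x else 0) \<partial>lborel)"
    and u': "\<And>t. (u has_real_derivative u' t) (at t)"
  shows "AE t in lborel. u' t = - c * p t"
proof -
  have pm [measurable]: "p \<in> borel_measurable borel" using p by (simp add: borel_measurable_integrable)
  have pi: "integrable lborel (\<lambda>x. if P x then p x else 0)" if "Measurable.pred borel P" for P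
    by (rule Bochner_Integration.integrable_bound[OF p]) (use that in auto)
  have si: "set_integrable lborel (cbox a b) p" for a b
    unfolding set_integrable_def using p by (intro integrable_mult_indicator) auto
  have "p integrable_on cbox a b" for a b
    using si by (rule set_borel_integral_eq_integral)
  then obtain N where N: "negligible N" "\<forall>x e. x \<notin> N \<longrightarrow> 0 < e \<longrightarrow>
     (\<exists>d>0. \<forall>h. 0 < h \<and> h < d \<longrightarrow> norm (integral (cbox x (x + h *\<^sub>R One)) p /\<^sub>R h ^ DIM(real) - p x) < e)"
    by (rule integrable_ccontinuous_explicit) (use that in blast)
  have int: "c * integral (cbox t (t + h)) p = u t - u (t + h)" if h: "0 < h" for t h
  proof -
    have "integral (cbox t (t + h)) p = (\<integral>x. indicator (cbox t (t + h)) x *\<^sub>R p x \<partial>lborel)"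
      using set_borel_integral_eq_integral(2)[OF si, of t "t + h"] by (simp add: set_lebesgue_integral_def)
    also have "\<dots> = (\<integral>x. (if t \<le> x then p x else 0) - (if t + h \<le> x then p x else 0) \<partial>lborel)"
    proof (rule integral_cong_AE)
      show "AE x in lborel. indicator (cbox t (t + h)) x *\<^sub>R p x = (if t \<le> x then p x else 0) - (if t + h \<le> x then p x else 0)"
        using AE_lborel_singleton[of "t + h"] by eventually_elim (use h in \<open>auto simp: indicator_def\<close>)
    qed measurable
    also have "\<dots> = (\<integral>x. (if t \<le> x then p x else 0) \<partial>lborel) - (\<integral>x. (if t + h \<le> x then p x else 0) \<partial>lborel)"
      by (intro Bochner_Integration.integral_diff pi) measurable
    finally show ?thesis by (simp add: u right_diff_distrib)
  qed
  have eq: "u' t = - c * p t" if t: "t \<notin> N" for t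
  proof -
    have "((\<lambda>h. (u (t + h) - u t) / h) \<longlongrightarrow> u' t) (at_right 0)"
      using u'[of t] unfolding DERIV_def by (rule filterlim_mono) (auto simp: at_within_le_at)
    moreover have "((\<lambda>h. (u (t + h) - u t) / h) \<longlongrightarrow> - c * p t) (at_right 0)"
    proof -
      have "((\<lambda>h. integral (cbox t (t + h)) p / h) \<longlongrightarrow> p t) (at_right 0)"
        unfolding tendsto_iff
      proof (intro allI impI)
        fix e :: real assume "0 < e"
        from N(2)[rule_format, OF t this] obtain d where d: "d > 0" "\<And>h. 0 < h \<Longrightarrow> h < d \<Longrightarrow> norm (integral (cbox t (t + h *\<^sub>R One)) p /\<^sub>R h ^ DIM(real) - p t) < e"
          by blast
        then show "\<forall>\<^sub>F h in at_right 0. dist (integral (cbox t (t + h)) p / h) (p t) < e"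
          unfolding eventually_at_right_field by (auto simp: dist_real_def field_simps intro!: exI[of _ d])
      qed
      then have "((\<lambda>h. - c * (integral (cbox t (t + h)) p / h)) \<longlongrightarrow> - c * p t) (at_right 0)"
        by (intro tendsto_intros)
      then show ?thesis
      proof (rule Lim_transform_eventually)
        show "\<forall>\<^sub>F h in at_right 0. - c * (integral (cbox t (t + h)) p / h) = (u (t + h) - u t) / h"
          unfolding eventually_at_right_field
        proof (intro exI[of _ 1] conjI allI impI)
          fix h :: real assume "0 < h"
          from int[OF this, of t] have "- (c * integral (cbox t (t + h)) p) = u (t + h) - u t" by simp
          then show "- c * (integral (cbox t (t + h)) p / h) = (u (t + h) - u t) / h"
            by (metis minus_mult_left times_divide_eq_right)
        qed simp
      qed
    qed
    ultimately show ?thesis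
      by (rule tendsto_unique[rotated]) simp
  qed
  have "AE t in lebesgue. t \<notin> N" using N(1) by (simp add: negligible_iff_null_sets AE_not_in)
  then have "AE t in lebesgue. u' t = - c * p t" by eventually_elim (rule eq)
  then show ?thesis by (simp add: AE_completion_iff)
qed

text \<open>The derivatives come without any regularity, but each one is a pointwise limit of
  difference quotients of a previous one along \<open>inverse (real (Suc k))\<close>.\<close>

lemma mixed_derivatives_measurable:
  fixes g :: "real ^ 'n \<Rightarrow> real"
  assumes md: "mixed_derivatives g G" and g: "g \<in> borel_measurable borel"
  shows "G I \<in> borel_measurable borel"
proof -
  have "finite I" by simp
  then show ?thesis
  proof (induction I rule: finite_induct)
    case empty
    then show ?case using mixed_derivatives_empty[OF md] g by simp
  next
    case (insert i I)
    note [measurable] = insert.IH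
    show ?case
    proof (rule borel_measurable_LIMSEQ_real)
      fix z
      have "((\<lambda>t. G I (z + t *\<^sub>R axis i 1)) has_real_derivative G (insert i I) z) (at 0)"
        using md insert.hyps unfolding mixed_derivatives_def by blast
      then have "((\<lambda>h. (G I (z + h *\<^sub>R axis i 1) - G I z) / h) \<longlongrightarrow> G (insert i I) z) (at 0)"
        by (simp add: DERIV_def)
      moreover have "filterlim (\<lambda>k. inverse (real (Suc k))) (at 0) sequentially"
        by (intro filterlim_atI LIMSEQ_inverse_real_of_nat) auto
      ultimately show "(\<lambda>k. (G I (z + inverse (real (Suc k)) *\<^sub>R axis i 1) - G I z) / inverse (real (Suc k))) \<longlonglongrightarrow> G (insert i I) z"
        by (rule filterlim_compose)
    qed measurable
  qed
qed

lemma pareto_F_measurable: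
  fixes q :: "real ^ 'n \<Rightarrow> real"
  assumes [measurable]: "q \<in> borel_measurable borel"
  shows "pareto_F (with_density q) \<in> borel_measurable borel"
  unfolding pareto_F_with_density less_eq_vec_def by measurable

section \<open>Tail integrals with some coordinates frozen\<close>

text \<open>An identity of measures rather than of integrals, because statements holding almost
  everywhere have to be moved to the product space as well.\<close>

lemma lborel_pi_insert:
  fixes I :: "'n::finite set"
  assumes i: "i \<notin> I"
  shows "lborel_pi (insert i I) = distr (lborel_pi I \<Otimes>\<^sub>M lborel) (lborel_pi (insert i I)) (\<lambda>(x, t). x(i := t))"
proof (rule measure_eqI)
  interpret product_sigma_finite "\<lambda>_::'n. lborel :: real measure" by standard
  interpret sigma_finite_measure "lborel_pi I" by (rule sigma_finite_lborel_pi)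
  interpret pair_sigma_finite "lborel_pi I" "lborel :: real measure" by standard
  fix A assume A: "A \<in> sets (lborel_pi (insert i I))"
  have [measurable]: "(\<lambda>(x, t). x(i := t)) \<in> measurable (lborel_pi I \<Otimes>\<^sub>M lborel) (lborel_pi (insert i I))"
    by (rule measurable_add_dim)
  note [measurable] = A
  have "emeasure (lborel_pi (insert i I)) A = (\<integral>\<^sup>+x. indicator A x \<partial>lborel_pi (insert i I))"
    using A by simp
  also have "\<dots> = (\<integral>\<^sup>+x. \<integral>\<^sup>+t. indicator A (x(i := t)) \<partial>lborel \<partial>lborel_pi I)"
    using A i by (intro product_nn_integral_insert) auto
  also have "\<dots> = (\<integral>\<^sup>+p. indicator A ((\<lambda>(x, t). x(i := t)) p) \<partial>(lborel_pi I \<Otimes>\<^sub>M lborel))"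
    by (subst lborel.nn_integral_fst[symmetric]) auto
  also have "\<dots> = (\<integral>\<^sup>+x. indicator A x \<partial>distr (lborel_pi I \<Otimes>\<^sub>M lborel) (lborel_pi (insert i I)) (\<lambda>(x, t). x(i := t)))"
    by (subst nn_integral_distr) auto
  also have "\<dots> = emeasure (distr (lborel_pi I \<Otimes>\<^sub>M lborel) (lborel_pi (insert i I)) (\<lambda>(x, t). x(i := t))) A"
    using A by simp
  finally show "emeasure (lborel_pi (insert i I)) A = emeasure (distr (lborel_pi I \<Otimes>\<^sub>M lborel) (lborel_pi (insert i I)) (\<lambda>(x, t). x(i := t))) A" .
qed simp

definition merge_vec :: "'n set \<Rightarrow> ('n \<Rightarrow> real) \<Rightarrow> ('n \<Rightarrow> real) \<Rightarrow> real ^ 'n" where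
  "merge_vec I s x = (\<chi> j. if j \<in> I then s j else x j)"

lemma merge_vec_measurable: "(\<lambda>(s, x). merge_vec I s x) \<in> borel_measurable (lborel_pi I \<Otimes>\<^sub>M lborel_pi (- I :: 'n::finite set))"
  unfolding merge_vec_def case_prod_unfold
proof (rule borel_measurable_vec)
  fix j
  show "(\<lambda>p. if j \<in> I then fst p j else snd p j) \<in> borel_measurable (lborel_pi I \<Otimes>\<^sub>M lborel_pi (- I))"
    by (cases "j \<in> I") auto
qed

lemma AE_integrable_merge_vec:
  fixes q :: "real ^ 'n \<Rightarrow> real"
  assumes q: "integrable lborel q"
  shows "AE s in lborel_pi I. integrable (lborel_pi (- I)) (\<lambda>x. q (merge_vec I s x))"
proof -
  interpret product_sigma_finite "\<lambda>_::'n. lborel :: real measure" by standard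
  interpret I: sigma_finite_measure "lborel_pi I" by (rule sigma_finite_lborel_pi)
  interpret C: sigma_finite_measure "lborel_pi (- I)" by (rule sigma_finite_lborel_pi)
  interpret pair_sigma_finite "lborel_pi I" "lborel_pi (- I)" by standard
  have qm [measurable]: "q \<in> borel_measurable borel" using q by (simp add: borel_measurable_integrable)
  have mm: "merge I (- I) \<in> lborel_pi I \<Otimes>\<^sub>M lborel_pi (- I) \<rightarrow>\<^sub>M lborel_pi UNIV"
    using measurable_merge[of I "- I" "\<lambda>_. lborel :: real measure"] by (simp add: Compl_partition)
  have "distr (lborel_pi I \<Otimes>\<^sub>M lborel_pi (- I)) (lborel_pi (I \<union> - I)) (merge I (- I)) = lborel_pi (I \<union> - I)"
    by (rule distr_merge) auto
  then have d: "lborel_pi UNIV = distr (lborel_pi I \<Otimes>\<^sub>M lborel_pi (- I)) (lborel_pi UNIV) (merge I (- I))"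
    by (simp add: Compl_partition)
  have "integrable (lborel_pi UNIV) (\<lambda>z. q (glue UNIV 0 z))"
    using q lborel_integrable_glue[OF qm, of 0] by simp
  then have "integrable (lborel_pi I \<Otimes>\<^sub>M lborel_pi (- I)) (\<lambda>p. q (glue UNIV 0 (merge I (- I) p)))"
    by (subst (asm) d) (simp add: integrable_distr_eq[OF mm])
  moreover have "q (glue UNIV 0 (merge I (- I) p)) = (case p of (s, x) \<Rightarrow> q (merge_vec I s x))" for p
    by (cases p) (auto simp: vec_eq_iff merge_vec_def merge_def intro!: arg_cong[of _ _ q])
  ultimately have "integrable (lborel_pi I \<Otimes>\<^sub>M lborel_pi (- I)) (\<lambda>(s, x). q (merge_vec I s x))"
    by simp
  from AE_integrable_fst'[OF this] show ?thesis by simp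
qed

text \<open>Interpolates between the tail integral and its density: the coordinates in
  \<open>I\<close> are frozen at \<open>s\<close>, the others are integrated above \<open>c\<close>.
  For \<open>I = {}\<close> it is \<open>pareto_F (with_density q)\<close> at \<open>c\<close>, for
  \<open>I = UNIV\<close> it is \<open>q\<close> at \<open>s\<close>.\<close>

definition tail :: "(real ^ 'n \<Rightarrow> real) \<Rightarrow> 'n set \<Rightarrow> ('n \<Rightarrow> real) \<Rightarrow> real ^ 'n \<Rightarrow> real" where
  "tail q I s c = (\<integral>x. (if \<forall>j\<in>- I. c $ j \<le> x j then q (merge_vec I s x) else 0) \<partial>lborel_pi (- I))"

lemma tail_measurable:
  fixes q :: "real ^ 'n \<Rightarrow> real"
  assumes [measurable]: "q \<in> borel_measurable borel"
  shows "(\<lambda>s. tail q I s c) \<in> borel_measurable (lborel_pi I)"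
proof -
  interpret C: sigma_finite_measure "lborel_pi (- I)" by (rule sigma_finite_lborel_pi)
  have [measurable]: "(\<lambda>p. merge_vec I (fst p) (snd p)) \<in> borel_measurable (lborel_pi I \<Otimes>\<^sub>M lborel_pi (- I))"
    using merge_vec_measurable[of I] by (simp add: case_prod_unfold)
  show ?thesis
    unfolding tail_def
    by (rule C.borel_measurable_lebesgue_integral) (simp add: case_prod_unfold, measurable)
qed

text \<open>As \<open>t n\<close> approaches \<open>c $ j\<close> from below, the truth value of the
  orthant condition at any given \<open>x\<close> is eventually constant. From above, points on the
  boundary hyperplane would be lost.\<close>

lemma tail_left_continuous:
  fixes q :: "real ^ 'n \<Rightarrow> real"
  assumes q: "q \<in> borel_measurable borel" and int: "integrable (lborel_pi (- I)) (\<lambda>x. q (merge_vec I s x))"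
    and t: "\<And>n. t n \<le> c $ j" "t \<longlonglongrightarrow> c $ j"
  shows "(\<lambda>n. tail q I s (vupd c j (t n))) \<longlonglongrightarrow> tail q I s c"
  unfolding tail_def
proof (rule integral_dominated_convergence)
  have [measurable]: "(\<lambda>x. q (merge_vec I s x)) \<in> borel_measurable (lborel_pi (- I))"
    using int by (simp add: borel_measurable_integrable)
  show "(\<lambda>x. if \<forall>j\<in>- I. c $ j \<le> x j then q (merge_vec I s x) else 0) \<in> borel_measurable (lborel_pi (- I))"
    "\<And>n. (\<lambda>x. if \<forall>i\<in>- I. vupd c j (t n) $ i \<le> x i then q (merge_vec I s x) else 0) \<in> borel_measurable (lborel_pi (- I))"
    by measurable
  show "integrable (lborel_pi (- I)) (\<lambda>x. \<bar>q (merge_vec I s x)\<bar>)" using int by simp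
  show "AE x in lborel_pi (- I). norm (if \<forall>i\<in>- I. vupd c j (t n) $ i \<le> x i then q (merge_vec I s x) else 0) \<le> \<bar>q (merge_vec I s x)\<bar>" for n
    by auto
  show "AE x in lborel_pi (- I). (\<lambda>n. if \<forall>i\<in>- I. vupd c j (t n) $ i \<le> x i then q (merge_vec I s x) else 0)
      \<longlonglongrightarrow> (if \<forall>j\<in>- I. c $ j \<le> x j then q (merge_vec I s x) else 0)"
  proof (intro AE_I2 tendsto_eventually)
    fix x
    show "\<forall>\<^sub>F n in sequentially. (if \<forall>i\<in>- I. vupd c j (t n) $ i \<le> x i then q (merge_vec I s x) else 0) = (if \<forall>j\<in>- I. c $ j \<le> x j then q (merge_vec I s x) else 0)"
    proof (cases "\<forall>i\<in>- I. c $ i \<le> x i")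
      case True
      have "\<forall>i\<in>- I. vupd c j (t n) $ i \<le> x i" for n
        using True t(1)[of n] by (auto intro: order_trans)
      then show ?thesis using True by simp
    next
      case False
      then obtain i where i: "i \<notin> I" "x i < c $ i" by (auto simp: not_le)
      have "\<forall>\<^sub>F n in sequentially. x i < vupd c j (t n) $ i"
        using i order_tendstoD(1)[OF t(2), of "x i"] by (cases "i = j") auto
      then show ?thesis
      proof eventually_elim
        case (elim n)
        then have "\<not> (\<forall>k\<in>- I. vupd c j (t n) $ k \<le> x k)" using i(1) by (meson ComplI not_le)
        then show ?case using False by (simp only: if_False)
      qed
    qed
  qed
qed

lemma rational_below:
  fixes a :: real
  obtains t :: "nat \<Rightarrow> real" where "\<And>n. t n \<in> \<rat>" "\<And>n. t n \<le> a" "t \<longlonglongrightarrow> a"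
proof -
  have "\<exists>r\<in>\<rat>. a - inverse (real (Suc n)) < r \<and> r < a" for n
    by (rule Rats_dense_in_real) simp
  then obtain t where t: "\<And>n. t n \<in> \<rat>" "\<And>n. a - inverse (real (Suc n)) < t n" "\<And>n. t n < a" by metis
  have "t \<longlonglongrightarrow> a"
  proof (rule tendsto_sandwich[of "\<lambda>n. a - inverse (real (Suc n))" _ _ "\<lambda>_. a"])
    show "(\<lambda>n. a - inverse (real (Suc n))) \<longlonglongrightarrow> a"
      using tendsto_diff[OF tendsto_const LIMSEQ_inverse_real_of_nat, of a] by simp
  qed (use t in \<open>auto intro!: always_eventually less_imp_le\<close>)
  then show ?thesis using that[of t] t by (simp add: less_imp_le)
qed

lemma countable_rational_vecs: "countable {c :: real ^ 'n. \<forall>j. c $ j \<in> \<rat>}"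
proof -
  have "countable (Pi\<^sub>E (UNIV :: 'n set) (\<lambda>_. \<rat> :: real set))"
    by (intro countable_PiE) (auto simp: countable_rat)
  then have "countable ((\<lambda>f. \<chi> j. f j) ` (Pi\<^sub>E (UNIV :: 'n set) (\<lambda>_. \<rat> :: real set)))" by (rule countable_image)
  moreover have "{c :: real ^ 'n. \<forall>j. c $ j \<in> \<rat>} \<subseteq> (\<lambda>f. \<chi> j. f j) ` (Pi\<^sub>E (UNIV :: 'n set) (\<lambda>_. \<rat> :: real set))"
  proof
    fix c :: "real ^ 'n" assume "c \<in> {c. \<forall>j. c $ j \<in> \<rat>}"
    then show "c \<in> (\<lambda>f. \<chi> j. f j) ` (Pi\<^sub>E (UNIV :: 'n set) (\<lambda>_. \<rat> :: real set))"
      by (intro image_eqI[of _ _ "\<lambda>j. c $ j"]) (auto simp: vec_eq_iff)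
  qed
  ultimately show ?thesis by (rule countable_subset[rotated])
qed

text \<open>Both sides are separately left continuous in the coordinates of \<open>c\<close>, so rational \<open>c\<close> suffice.\<close>

lemma tail_eq_from_rationals:
  fixes g :: "real ^ 'n \<Rightarrow> real"
  assumes md: "mixed_derivatives g G" and q: "q \<in> borel_measurable borel"
    and int: "integrable (lborel_pi (- I)) (\<lambda>x. q (merge_vec I s x))"
    and rat: "\<And>c. \<forall>j. c $ j \<in> \<rat> \<Longrightarrow> G I (glue I c s) = \<sigma> * tail q I s c"
  shows "G I (glue I c s) = \<sigma> * tail q I s c"
proof -
  \<comment> \<open>\<open>S\<close> contains the coordinates of \<open>c\<close> that are not known
    to be rational; the induction releases one of them at a time.\<close>
  have "G I (glue I c s) = \<sigma> * tail q I s c" if "finite S" "\<forall>j. j \<notin> S \<longrightarrow> c $ j \<in> \<rat>" for S :: "'n set" and c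
    using that
  proof (induction S arbitrary: c rule: finite_induct)
    case empty
    then show ?case using rat by simp
  next
    case (insert j S)
    have IH: "G I (glue I (vupd c j t) s) = \<sigma> * tail q I s (vupd c j t)" if "t \<in> \<rat>" for t
      using insert.prems that by (intro insert.IH) auto
    show ?case
    proof (cases "j \<in> I")
      \<comment> \<open>A coordinate in \<open>I\<close> is overwritten by \<open>s\<close> on both
        sides, so its entry in \<open>c\<close> may be replaced by the rational number 0.\<close>
      case True
      then have "glue I (vupd c j 0) s = glue I c s" by (auto simp: vec_eq_iff)
      moreover have "tail q I s (vupd c j 0) = tail q I s c"
        unfolding tail_def using True
        by (intro Bochner_Integration.integral_cong refl if_cong ball_cong) auto
      ultimately show ?thesis using IH[of 0] by simp
    next
      case False
      obtain t where t: "\<And>n. t n \<in> \<rat>" "\<And>n. t n \<le> c $ j" "t \<longlonglongrightarrow> c $ j" using rational_below[of "c $ j"] by blast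
      have "((\<lambda>u. G I (vupd (glue I c s) j u)) has_real_derivative G (insert j I) (vupd (glue I c s) j (c $ j))) (at (c $ j))"
        by (rule mixed_derivatives_vupd[OF md False])
      then have "isCont (\<lambda>u. G I (vupd (glue I c s) j u)) (c $ j)" by (rule DERIV_isCont)
      from isCont_tendsto_compose[OF this t(3)]
      have "(\<lambda>n. G I (vupd (glue I c s) j (t n))) \<longlonglongrightarrow> G I (vupd (glue I c s) j (c $ j))" .
      moreover have "vupd (glue I c s) j (c $ j) = glue I c s" using False by (auto simp: vec_eq_iff)
      ultimately have "(\<lambda>n. G I (glue I (vupd c j (t n)) s)) \<longlonglongrightarrow> G I (glue I c s)"
        by (simp add: glue_vupd[OF False])
      moreover have "(\<lambda>n. \<sigma> * tail q I s (vupd c j (t n))) \<longlonglongrightarrow> \<sigma> * tail q I s c"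
        by (intro tendsto_intros tail_left_continuous[OF q int t(2,3)])
      ultimately show ?thesis unfolding IH[OF t(1)] by (rule LIMSEQ_unique)
    qed
  qed
  from this[of UNIV] show ?thesis by simp
qed

text \<open>Differentiating the tail integral in one coordinate after the other, by Lebesgue's theorem in
  dimension one.\<close>

lemma AE_mixed_derivative_eq_tail:
  fixes q :: "real ^ 'n \<Rightarrow> real"
  assumes q: "integrable lborel q" and md: "mixed_derivatives (pareto_F (with_density q)) G"
  shows "AE s in lborel_pi I. \<forall>c. G I (glue I c s) = (-1) ^ card I * tail q I s c"
proof -
  have qm [measurable]: "q \<in> borel_measurable borel" using q by (simp add: borel_measurable_integrable)
  have Gm: "G I \<in> borel_measurable borel" for I
    by (rule mixed_derivatives_measurable[OF md pareto_F_measurable[OF qm]])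
  have "finite I" by simp
  then show ?thesis
  proof (induction I rule: finite_induct)
    case empty
    have "G {} c = tail q {} s c" for c s
    proof -
      have "G {} c = (\<integral>x. (if c \<le> x then q x else 0) \<partial>lborel)"
        unfolding mixed_derivatives_empty[OF md] pareto_F_with_density ..
      also have "\<dots> = (\<integral>x. (if c \<le> glue UNIV c x then q (glue UNIV c x) else 0) \<partial>lborel_pi UNIV)"
        by (rule lborel_integral_glue) (auto simp: less_eq_vec_def)
      also have "\<dots> = tail q {} s c"
      proof -
        have "glue UNIV c x = merge_vec {} s x" for x by (simp add: vec_eq_iff merge_vec_def)
        then show ?thesis unfolding tail_def glue_ge_iff by (simp cong: if_cong)
      qed
      finally show ?thesis .
    qed
    then show ?case by simp
  next
    case (insert i I)
    define K where "K = - insert i I"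
    have K: "- I = insert i K" "i \<notin> K" using insert.hyps by (auto simp: K_def)
    let ?\<sigma> = "(-1 :: real) ^ card I"
    \<comment> \<open>For almost every frozen \<open>s\<close> the section of \<open>G I\<close> in
      coordinate \<open>i\<close> is, up to sign, the tail integral of a one-variable function:
      \<open>q\<close> with coordinate \<open>i\<close> set to \<open>t\<close>, integrated over the
      coordinates in \<open>K\<close> above \<open>c\<close>. The one-dimensional lemma then gives
      its derivative.\<close>
    have one: "AE s in lborel_pi I. AE t in lborel. G (insert i I) (glue (insert i I) c (s(i := t))) = - ?\<sigma> * tail q (insert i I) (s(i := t)) c" for c
      using insert.IH AE_integrable_merge_vec[OF q, of I]
    proof eventually_elim
      case (elim s)
      interpret sigma_finite_measure "lborel_pi K" by (rule sigma_finite_lborel_pi)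
      interpret pair_sigma_finite "lborel_pi K" "lborel :: real measure" by standard
      have up: "(\<lambda>(x, t). x(i := t)) \<in> measurable (lborel_pi K \<Otimes>\<^sub>M lborel) (lborel_pi (insert i K))"
        by (rule measurable_add_dim)
      have jm [measurable]: "(\<lambda>x. q (merge_vec I s x)) \<in> borel_measurable (lborel_pi (insert i K))"
        using elim(2) unfolding K(1) by (simp add: borel_measurable_integrable)
      have j2: "merge_vec I s (x(i := t)) = merge_vec (insert i I) (s(i := t)) x" for x t
        using insert.hyps by (auto simp: vec_eq_iff merge_vec_def)
      define h where "h x t = (if \<forall>j\<in>K. c $ j \<le> x j then q (merge_vec (insert i I) (s(i := t)) x) else 0)" for x t
      have fin: "integrable (lborel_pi (insert i K)) (\<lambda>x. if P x then q (merge_vec I s x) else 0)" if "Measurable.pred (lborel_pi (insert i K)) P" for P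
        by (rule Bochner_Integration.integrable_bound[OF elim(2)[unfolded K(1)]]) (use that in auto)
      have push: "integrable (lborel_pi K \<Otimes>\<^sub>M lborel) (\<lambda>(x, t). f (x(i := t)))" "integral\<^sup>L (lborel_pi (insert i K)) f = (\<integral>t. (\<integral>x. f (x(i := t)) \<partial>lborel_pi K) \<partial>lborel)"
        if f: "integrable (lborel_pi (insert i K)) f" for f :: "_ \<Rightarrow> real"
      proof -
        have fm: "f \<in> borel_measurable (lborel_pi (insert i K))" using f by (rule borel_measurable_integrable)
        show *: "integrable (lborel_pi K \<Otimes>\<^sub>M lborel) (\<lambda>(x, t). f (x(i := t)))"
        proof -
          have "integrable (distr (lborel_pi K \<Otimes>\<^sub>M lborel) (lborel_pi (insert i K)) (\<lambda>(x, t). x(i := t))) f"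
            using f by (subst lborel_pi_insert[OF K(2), symmetric])
          then show ?thesis unfolding integrable_distr_eq[OF up fm] by (simp add: case_prod_unfold)
        qed
        have "integral\<^sup>L (lborel_pi (insert i K)) f = (\<integral>p. f ((\<lambda>(x, t). x(i := t)) p) \<partial>(lborel_pi K \<Otimes>\<^sub>M lborel))"
          by (subst lborel_pi_insert[OF K(2)]) (rule integral_distr[OF up fm])
        also have "\<dots> = (\<integral>t. (\<integral>x. f (x(i := t)) \<partial>lborel_pi K) \<partial>lborel)"
          using integral_snd[OF *] by (simp add: case_prod_unfold)
        finally show "integral\<^sup>L (lborel_pi (insert i K)) f = (\<integral>t. (\<integral>x. f (x(i := t)) \<partial>lborel_pi K) \<partial>lborel)" .
      qed
      have tail_h: "tail q (insert i I) (s(i := t)) c = (\<integral>x. h x t \<partial>lborel_pi K)" for t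
        by (simp add: tail_def h_def K_def)
      have hc: "(if \<forall>j\<in>K. c $ j \<le> (x(i := t)) j then q (merge_vec I s (x(i := t))) else 0) = h x t" for x t
        unfolding h_def j2 using K(2) by (intro if_cong ball_cong) auto
      have p: "integrable lborel (\<lambda>t. \<integral>x. h x t \<partial>lborel_pi K)"
      proof -
        have "integrable (lborel_pi K \<Otimes>\<^sub>M lborel) (\<lambda>(x, t). h x t)"
          using push(1)[OF fin[of "\<lambda>x. \<forall>j\<in>K. c $ j \<le> x j"]] unfolding hc by measurable
        from integrable_snd[OF this] show ?thesis .
      qed
      have u: "G I (glue I (vupd c i t) s) = ?\<sigma> * (\<integral>\<tau>. (if t \<le> \<tau> then \<integral>x. h x \<tau> \<partial>lborel_pi K else 0) \<partial>lborel)" for t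
      proof -
        have "tail q I s (vupd c i t) = (\<integral>x. (if \<forall>j\<in>insert i K. vupd c i t $ j \<le> x j then q (merge_vec I s x) else 0) \<partial>lborel_pi (insert i K))"
          by (simp add: tail_def K(1))
        also have "\<dots> = (\<integral>\<tau>. (\<integral>x. (if \<forall>j\<in>insert i K. vupd c i t $ j \<le> (x(i := \<tau>)) j then q (merge_vec I s (x(i := \<tau>))) else 0) \<partial>lborel_pi K) \<partial>lborel)"
          by (intro push(2) fin) measurable
        also have "\<dots> = (\<integral>\<tau>. (if t \<le> \<tau> then \<integral>x. h x \<tau> \<partial>lborel_pi K else 0) \<partial>lborel)"
        proof (intro Bochner_Integration.integral_cong refl)
          fix \<tau>
          have "(\<forall>j\<in>insert i K. vupd c i t $ j \<le> (x(i := \<tau>)) j) \<longleftrightarrow> t \<le> \<tau> \<and> (\<forall>j\<in>K. c $ j \<le> x j)" for x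
            using K(2) by auto
          then show "(\<integral>x. (if \<forall>j\<in>insert i K. vupd c i t $ j \<le> (x(i := \<tau>)) j then q (merge_vec I s (x(i := \<tau>))) else 0) \<partial>lborel_pi K)
             = (if t \<le> \<tau> then \<integral>x. h x \<tau> \<partial>lborel_pi K else 0)"
            unfolding h_def j2 by (cases "t \<le> \<tau>") simp_all
        qed
        finally show ?thesis using elim(1) by simp
      qed
      have "AE t in lborel. G (insert i I) (vupd (glue I c s) i t) = - ?\<sigma> * (\<integral>x. h x t \<partial>lborel_pi K)"
      proof (rule AE_derivative_of_tail_integral[OF p])
        show "G I (vupd (glue I c s) i t) = ?\<sigma> * (\<integral>\<tau>. (if t \<le> \<tau> then \<integral>x. h x \<tau> \<partial>lborel_pi K else 0) \<partial>lborel)" for t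
          using u[of t] glue_vupd[OF insert.hyps(2), of c t s] by simp
        show "((\<lambda>t. G I (vupd (glue I c s) i t)) has_real_derivative G (insert i I) (vupd (glue I c s) i t)) (at t)" for t
          by (rule mixed_derivatives_vupd[OF md insert.hyps(2)])
      qed
      then show ?case unfolding tail_h glue_insert_upd[OF insert.hyps(2)] .
    qed
    \<comment> \<open>Passage from almost every \<open>t\<close> for almost every \<open>s\<close>
      to almost every point of the product requires the set where equality holds to be measurable,
      which is the point of \<open>S\<close> and \<open>S2\<close>.\<close>
    have two: "AE s in lborel_pi (insert i I). G (insert i I) (glue (insert i I) c s) = - ?\<sigma> * tail q (insert i I) s c" for c
    proof -
      interpret sigma_finite_measure "lborel_pi I" by (rule sigma_finite_lborel_pi)
      interpret pair_sigma_finite "lborel_pi I" "lborel :: real measure" by standard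
      have up: "(\<lambda>(x, t). x(i := t)) \<in> measurable (lborel_pi I \<Otimes>\<^sub>M lborel) (lborel_pi (insert i I))"
        by (rule measurable_add_dim)
      note [measurable] = Gm tail_measurable[OF qm]
      have S: "{s \<in> space (lborel_pi (insert i I)). G (insert i I) (glue (insert i I) c s) = - ?\<sigma> * tail q (insert i I) s c} \<in> sets (lborel_pi (insert i I))"
        by measurable
      have S2: "{p \<in> space (lborel_pi I \<Otimes>\<^sub>M lborel). G (insert i I) (glue (insert i I) c (case p of (x, t) \<Rightarrow> x(i := t))) = - ?\<sigma> * tail q (insert i I) (case p of (x, t) \<Rightarrow> x(i := t)) c} \<in> sets (lborel_pi I \<Otimes>\<^sub>M lborel)"
        using measurable_sets[OF up S] by (rule back_subst[of "\<lambda>A. A \<in> _"]) (use measurable_space[OF up] in auto)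
      have "AE p in lborel_pi I \<Otimes>\<^sub>M lborel. G (insert i I) (glue (insert i I) c (case p of (x, t) \<Rightarrow> x(i := t))) = - ?\<sigma> * tail q (insert i I) (case p of (x, t) \<Rightarrow> x(i := t)) c"
        using AE_pair_measure[OF S2] one[of c] by simp
      then show ?thesis
        by (subst lborel_pi_insert[OF insert.hyps(2)]) (subst AE_distr_iff[OF up S])
    qed
    \<comment> \<open>The null set so far depends on \<open>c\<close>, while the next
      differentiation varies a coordinate of \<open>c\<close> and needs one null set for all of
      them. Countably many rational \<open>c\<close> can be combined, and left continuity covers the
      rest.\<close>
    have "AE s in lborel_pi (insert i I). \<forall>c\<in>{c. \<forall>j. c $ j \<in> \<rat>}. G (insert i I) (glue (insert i I) c s) = - ?\<sigma> * tail q (insert i I) s c"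
      using two by (subst AE_ball_countable[OF countable_rational_vecs]) auto
    then show ?case
      using AE_integrable_merge_vec[OF q, of "insert i I"]
    proof eventually_elim
      case (elim s)
      have "G (insert i I) (glue (insert i I) c s) = - ?\<sigma> * tail q (insert i I) s c" for c
        by (rule tail_eq_from_rationals[OF md qm elim(2)]) (use elim(1) in auto)
      then show ?case using insert.hyps by simp
    qed
  qed
qed

lemma AE_top_derivative_eq_density:
  fixes q :: "real ^ 'n \<Rightarrow> real"
  assumes q: "integrable lborel q" and md: "mixed_derivatives (pareto_F (with_density q)) G"
  shows "AE z in lborel. G UNIV z = (-1) ^ CARD('n) * q z"
proof -
  have qm [measurable]: "q \<in> borel_measurable borel" using q by (simp add: borel_measurable_integrable)
  have [measurable]: "G UNIV \<in> borel_measurable borel"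
    by (rule mixed_derivatives_measurable[OF md pareto_F_measurable[OF qm]])
  have "AE s in lborel_pi UNIV. G UNIV (glue UNIV 0 s) = (-1) ^ CARD('n) * q (glue UNIV 0 s)"
    using AE_mixed_derivative_eq_tail[OF q md, of UNIV]
  proof eventually_elim
    case (elim s)
    have "tail q UNIV s 0 = q (glue UNIV 0 s)"
      by (simp add: tail_def merge_vec_def glue_UNIV PiM_empty)
    then show ?case using elim by simp
  qed
  then show ?thesis
    by (subst lborel_eq_distr_glue[of 0], subst AE_distr_iff) auto
qed

section \<open>The formula with the top mixed derivative\<close>

text \<open>The bracket equals the tail mass minus the total mass restricted to the orthant above
  \<open>y\<close>, which is the kernel in \<open>pareto_dual_generator_eq\<close>. Under the
  integral the top derivative may be replaced by the density, equal to it almost everywhere up to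
  the sign; that sign then cancels the one in front.\<close>

proposition pareto_dual_generator_top_derivative:
  fixes \<nu> :: "real ^ 'n \<Rightarrow> (real ^ 'n) measure"
  assumes nu: "bounded_kernel \<nu>" and g: "g \<in> pareto_range" and md: "mixed_derivatives g G"
  shows "pareto_dual_generator \<nu> g y = (-1) ^ CARD('n) * (\<integral>z. G UNIV z *
      (indicator {z. \<not> y \<le> z} z * measure (\<nu> z) {w. y \<le> w} - indicator {z. y \<le> z} z * measure (\<nu> z) {w. \<not> y \<le> w}) \<partial>lborel)"
proof -
  let ?q = "pareto_F_inv g"
  note q = pareto_F_invD[OF g]
  have qm [measurable]: "?q \<in> borel_measurable borel" using q by (simp add: borel_measurable_integrable)
  have md': "mixed_derivatives (pareto_F (with_density ?q)) G" using md q(2) by simp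
  have [measurable]: "G UNIV \<in> borel_measurable borel"
    by (rule mixed_derivatives_measurable[OF md' pareto_F_measurable[OF qm]])
  obtain B where B: "0 < B" "\<And>x A. measure (\<nu> x) A \<le> B" using bounded_kernelE[OF nu] by blast
  have m [measurable]: "(\<lambda>x. measure (\<nu> x) A) \<in> borel_measurable borel" if "A \<in> sets borel" for A
    using bounded_kernel_measurable[OF nu that] .
  let ?k = "\<lambda>z. indicator {z. \<not> y \<le> z} z * measure (\<nu> z) {w. y \<le> w} - indicator {z. y \<le> z} z * measure (\<nu> z) {w. \<not> y \<le> w} :: real"
  have k: "?k z = measure (\<nu> z) {w. y \<le> w} - (if y \<le> z then measure (\<nu> z) UNIV else 0)" for z
  proof -
    have fb: "finite_borel (\<nu> z)" using nu by (rule bounded_kernel_finite_borel)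
    interpret finite_measure "\<nu> z" using fb by (simp add: finite_borel_def)
    have "measure (\<nu> z) (space (\<nu> z) - {w. y \<le> w}) = measure (\<nu> z) (space (\<nu> z)) - measure (\<nu> z) {w. y \<le> w}"
      using fb by (intro finite_measure_compl) (simp add: finite_borel_def)
    moreover have "space (\<nu> z) - {w. y \<le> w} = {w. \<not> y \<le> w}" using finite_borel_space[OF fb] by auto
    ultimately show ?thesis by (simp add: finite_borel_space[OF fb] indicator_def)
  qed
  have km [measurable]: "?k \<in> borel_measurable borel" by measurable
  have "(\<integral>z. G UNIV z * ?k z \<partial>lborel) = (\<integral>z. (-1) ^ CARD('n) * (?q z * ?k z) \<partial>lborel)"
  proof (rule integral_cong_AE)
    show "AE z in lborel. G UNIV z * ?k z = (-1) ^ CARD('n) * (?q z * ?k z)"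
      using AE_top_derivative_eq_density[OF q(1) md'] by eventually_elim (simp only: mult.assoc)
  qed measurable
  also have "\<dots> = (-1) ^ CARD('n) * (\<integral>z. ?q z * ?k z \<partial>lborel)" by simp
  also have "(\<integral>z. ?q z * ?k z \<partial>lborel) = pareto_dual_generator \<nu> g y"
  proof -
    have "(\<integral>z. ?q z * ?k z \<partial>lborel) = (\<integral>z. ?q z * measure (\<nu> z) {w. y \<le> w} - (if y \<le> z then ?q z * measure (\<nu> z) UNIV else 0) \<partial>lborel)"
      unfolding k by (intro Bochner_Integration.integral_cong) (auto simp: algebra_simps)
    also have "\<dots> = pareto_dual_generator \<nu> g y"
      unfolding pareto_dual_generator_eq
    proof (rule Bochner_Integration.integral_diff)
      have i: "integrable lborel (\<lambda>z. ?q z * measure (\<nu> z) A)" if "A \<in> sets borel" for A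
        using B(2) m[OF that] by (intro integrable_bounded_mult[OF q(1), of _ B]) auto
      show "integrable lborel (\<lambda>z. ?q z * measure (\<nu> z) {w. y \<le> w})" by (rule i) simp
      show "integrable lborel (\<lambda>z. if y \<le> z then ?q z * measure (\<nu> z) UNIV else 0)"
        by (rule Bochner_Integration.integrable_bound[OF i[of UNIV]]) (auto simp: less_eq_vec_def)
    qed
    finally show ?thesis .
  qed
  finally show ?thesis by (simp flip: mult.assoc power_mult_distrib)
qed

section \<open>Smooth test functions\<close>

definition smooth_factors :: "('n \<Rightarrow> real \<Rightarrow> real) \<Rightarrow> ('n \<Rightarrow> real \<Rightarrow> real) \<Rightarrow> bool" where
  "smooth_factors u u' \<longleftrightarrow> (\<forall>i t. (u i has_real_derivative u' i t) (at t)) \<and> (\<forall>i. continuous_on UNIV (u' i)) \<and>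
     (\<exists>c. \<forall>i t. c \<le> \<bar>t\<bar> \<longrightarrow> u i t = 0 \<and> u' i t = 0)"

abbreviation tensor :: "('n::finite \<Rightarrow> real \<Rightarrow> real) \<Rightarrow> real ^ 'n \<Rightarrow> real" where
  "tensor u \<equiv> \<lambda>z. \<Prod>i\<in>UNIV. u i (z $ i)"

lemma smooth_factorsE:
  assumes "smooth_factors u u'"
  obtains c where "0 \<le> c" "\<And>i t. (u i has_real_derivative u' i t) (at t)" "\<And>i. continuous_on UNIV (u i)"
    "\<And>i. continuous_on UNIV (u' i)" "\<And>i t. c \<le> \<bar>t\<bar> \<Longrightarrow> u i t = 0" "\<And>i t. c \<le> \<bar>t\<bar> \<Longrightarrow> u' i t = 0"
proof -
  from assms obtain c where c: "\<forall>i t. c \<le> \<bar>t\<bar> \<longrightarrow> u i t = 0 \<and> u' i t = 0"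
    unfolding smooth_factors_def by blast
  have d: "\<And>i t. (u i has_real_derivative u' i t) (at t)" and cu': "\<And>i. continuous_on UNIV (u' i)"
    using assms unfolding smooth_factors_def by blast+
  show ?thesis
  proof (rule that[of "max 0 c"])
    show "continuous_on UNIV (u i)" for i
      using d by (meson DERIV_continuous_on has_field_derivative_at_within)
  qed (use c d cu' in auto)
qed

lemma continuous_compact_support:
  fixes v :: "real \<Rightarrow> real"
  assumes v: "continuous_on UNIV v" and out: "\<And>t. c \<le> \<bar>t\<bar> \<Longrightarrow> v t = 0"
  shows "integrable lborel v" "\<exists>B. \<forall>t. \<bar>v t\<bar> \<le> B"
proof -
  have cont: "continuous_on {-\<bar>c\<bar>..\<bar>c\<bar>} v" using v by (rule continuous_on_subset) simp
  have eq: "indicator {-\<bar>c\<bar>..\<bar>c\<bar>} t *\<^sub>R v t = v t" for t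
  proof (cases "c \<le> \<bar>t\<bar>")
    case False
    then have "t \<in> {-\<bar>c\<bar>..\<bar>c\<bar>}" by auto
    then show ?thesis by simp
  qed (simp add: out)
  show "integrable lborel v"
    using borel_integrable_compact[OF _ cont] unfolding eq by simp
  have "compact (v ` {-\<bar>c\<bar>..\<bar>c\<bar>})" by (intro compact_continuous_image cont) simp
  then obtain B where B: "\<forall>x\<in>v ` {-\<bar>c\<bar>..\<bar>c\<bar>}. norm x \<le> B" unfolding compact_eq_bounded_closed bounded_iff by blast
  have "\<bar>v t\<bar> \<le> max 0 B" for t
  proof (cases "c \<le> \<bar>t\<bar>")
    case False
    then have "t \<in> {-\<bar>c\<bar>..\<bar>c\<bar>}" by auto
    then have "norm (v t) \<le> B" using B by blast
    then show ?thesis by simp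
  qed (simp add: out)
  then show "\<exists>B. \<forall>t. \<bar>v t\<bar> \<le> B" by blast
qed

lemma tail_integral_derivative:
  fixes u u' :: "real \<Rightarrow> real"
  assumes d: "\<And>t. (u has_real_derivative u' t) (at t)" and cont: "continuous_on UNIV u'"
    and out: "\<And>t. c \<le> \<bar>t\<bar> \<Longrightarrow> u t = 0" "\<And>t. c \<le> \<bar>t\<bar> \<Longrightarrow> u' t = 0"
  shows "(\<integral>t. (if a \<le> t then - u' t else 0) \<partial>lborel) = u a"
proof -
  let ?b = "max a \<bar>c\<bar>"
  have "(\<integral>t. u' t * indicator {a..?b} t \<partial>lborel) = u ?b - u a"
    by (rule integral_FTC_Icc_real) (use d cont in \<open>auto simp: continuous_on_eq_continuous_at\<close>)
  moreover have "u ?b = 0" by (rule out) auto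
  moreover have "(\<integral>t. (if a \<le> t then - u' t else 0) \<partial>lborel) = (\<integral>t. - (u' t * indicator {a..?b} t) \<partial>lborel)"
  proof (intro Bochner_Integration.integral_cong refl)
    fix t
    have "u' t = 0" if "\<not> t \<le> ?b" using that by (intro out(2)) auto
    then show "(if a \<le> t then - u' t else 0) = - (u' t * indicator {a..?b} t)"
      by (auto simp: indicator_def)
  qed
  ultimately show ?thesis by simp
qed

text \<open>The density is the product of the functions \<open>- u' i\<close>. Their tail integrals
  return the factors because these have compact support.\<close>

lemma tensor_pareto_range:
  fixes u u' :: "'n::finite \<Rightarrow> real \<Rightarrow> real"
  assumes "smooth_factors u u'"
  shows "tensor u \<in> pareto_range"
proof -
  interpret product_sigma_finite "\<lambda>_::'n. lborel :: real measure" by standard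
  from assms obtain c where c: "0 \<le> c" "\<And>i t. (u i has_real_derivative u' i t) (at t)" "\<And>i. continuous_on UNIV (u i)"
    "\<And>i. continuous_on UNIV (u' i)" "\<And>i t. c \<le> \<bar>t\<bar> \<Longrightarrow> u i t = 0" "\<And>i t. c \<le> \<bar>t\<bar> \<Longrightarrow> u' i t = 0"
    by (rule smooth_factorsE) (use that in blast)
  have [measurable]: "u' i \<in> borel_measurable borel" for i using c(4) by (rule borel_measurable_continuous_onI)
  have int: "integrable lborel (\<lambda>t. - u' i t)" for i
    using continuous_compact_support(1)[OF c(4) c(6)] by simp
  let ?q = "\<lambda>x::real^'n. \<Prod>i\<in>UNIV. - u' i (x $ i)"
  have "integrable (lborel_pi UNIV) (\<lambda>z. \<Prod>i\<in>UNIV. - u' i (z i))"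
    by (intro product_integrable_prod int) auto
  then have q: "integrable lborel ?q"
    by (subst lborel_integrable_glue[of _ 0]) auto
  have "pareto_F (with_density ?q) y = tensor u y" for y
  proof -
    have "pareto_F (with_density ?q) y = (\<integral>z. (if y \<le> glue UNIV y z then ?q (glue UNIV y z) else 0) \<partial>lborel_pi UNIV)"
      unfolding pareto_F_with_density by (rule lborel_integral_glue) (simp add: less_eq_vec_def)
    also have "\<dots> = (\<integral>z. (\<Prod>i\<in>UNIV. if y $ i \<le> z i then - u' i (z i) else 0) \<partial>lborel_pi UNIV)"
    proof (intro Bochner_Integration.integral_cong refl)
      fix z
      show "(if y \<le> glue UNIV y z then ?q (glue UNIV y z) else 0) = (\<Prod>i\<in>UNIV. if y $ i \<le> z i then - u' i (z i) else 0)"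
      proof (cases "y \<le> glue UNIV y z")
        case True
        then show ?thesis by (auto simp: less_eq_vec_def)
      next
        case False
        then have "\<exists>i. \<not> y $ i \<le> z i" by (simp add: less_eq_vec_def)
        then have "(\<Prod>i\<in>UNIV. if y $ i \<le> z i then - u' i (z i) else 0) = 0" by (intro prod_zero) auto
        then show ?thesis using False by simp
      qed
    qed
    also have "\<dots> = (\<Prod>i\<in>UNIV. \<integral>t. (if y $ i \<le> t then - u' i t else 0) \<partial>lborel)"
      by (rule product_integral_prod) (auto intro!: Bochner_Integration.integrable_bound[OF int])
    also have "\<dots> = tensor u y"
      by (intro prod.cong refl tail_integral_derivative[of _ _ c]) (use c in auto)
    finally show ?thesis .
  qed
  then have "pareto_F (with_density ?q) = tensor u" by (intro ext)
  then show ?thesis unfolding pareto_range_def using q by blast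
qed

lemma tensor_vanishing:
  fixes u u' :: "'n::finite \<Rightarrow> real \<Rightarrow> real"
  assumes sf: "smooth_factors u u'"
  shows "tensor u \<in> vanishing_test_functions" "tensor u \<in> bounded_continuous"
proof -
  interpret product_sigma_finite "\<lambda>_::'n. lborel :: real measure" by standard
  from sf obtain c where c: "0 \<le> c" "\<And>i t. (u i has_real_derivative u' i t) (at t)" "\<And>i. continuous_on UNIV (u i)"
    "\<And>i. continuous_on UNIV (u' i)" "\<And>i t. c \<le> \<bar>t\<bar> \<Longrightarrow> u i t = 0" "\<And>i t. c \<le> \<bar>t\<bar> \<Longrightarrow> u' i t = 0"
    by (rule smooth_factorsE) (use that in blast)
  have "\<exists>B. \<forall>t. \<bar>u i t\<bar> \<le> B" for i
    using continuous_compact_support(2)[OF c(3) c(5)] by blast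
  then obtain B where B: "\<And>i t. \<bar>u i t\<bar> \<le> B i" by metis
  have bd: "\<bar>tensor u z\<bar> \<le> (\<Prod>i\<in>UNIV. B i)" for z
    unfolding abs_prod by (intro prod_mono) (use B in auto)
  have cont: "continuous_on UNIV (prod_deriv u u' I)" for I
    by (rule continuous_on_prod_deriv[OF c(3,4)])
  have md: "mixed_derivatives (tensor u) (prod_deriv u u')"
    by (rule mixed_derivatives_prod[OF c(2)])
  have e: "prod_deriv u u' {} = tensor u" using mixed_derivatives_empty[OF md] .
  have m [measurable]: "tensor u \<in> borel_measurable borel"
    using cont[of "{}"] unfolding e by (rule borel_measurable_continuous_onI)
  show "tensor u \<in> bounded_continuous"
    using cont[of "{}"] bd unfolding e by (rule bounded_continuousI)
  have out: "prod_deriv u u' I z = 0" if "c \<le> \<bar>z $ i\<bar>" for I z i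
    unfolding prod_deriv_def using c(5)[OF that] c(6)[OF that] by (intro prod_zero) (auto intro!: bexI[of _ i])
  have "(prod_deriv u u' I \<longlongrightarrow> 0) at_infinity" for I
  proof (rule tendsto_eventually)
    show "\<forall>\<^sub>F z in at_infinity. prod_deriv u u' I z = 0"
      unfolding eventually_at_infinity
    proof (intro exI allI impI)
      \<comment> \<open>The Euclidean norm is at most the sum of the absolute coordinates, so beyond
        this radius some coordinate has absolute value at least \<open>c\<close>.\<close>
      fix z :: "real ^ 'n" assume z: "real CARD('n) * c + 1 \<le> norm z"
      have "\<exists>i. c \<le> \<bar>z $ i\<bar>"
      proof (rule ccontr)
        assume "\<not> (\<exists>i. c \<le> \<bar>z $ i\<bar>)"
        then have "(\<Sum>i\<in>UNIV. \<bar>z $ i\<bar>) \<le> (\<Sum>i\<in>(UNIV::'n set). c)" by (intro sum_mono) (auto simp: not_le less_imp_le)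
        then show False using norm_le_l1_cart[of z] z by simp
      qed
      then show "prod_deriv u u' I z = 0" using out by blast
    qed
  qed
  moreover have "integrable lborel (tensor u)"
  proof -
    have "integrable (lborel_pi UNIV) (\<lambda>z. \<Prod>i\<in>UNIV. u i (z i))"
      by (intro product_integrable_prod continuous_compact_support(1)[OF c(3) c(5)]) auto
    then show ?thesis by (subst lborel_integrable_glue[of _ 0]) auto
  qed
  moreover have "set_integrable (lborel_pi I) {z. \<forall>i\<in>I. y $ i \<le> z i} (\<lambda>z. tensor u (glue I y z))" for y I
    unfolding set_integrable_def
  proof (rule lborel_pi_integrable_box[where a="\<lambda>_. - c" and b="\<lambda>_. c" and C="\<Prod>i\<in>UNIV. B i"])
    have "(\<lambda>z. if \<forall>i\<in>I. y $ i \<le> z i then tensor u (glue I y z) else 0) \<in> borel_measurable (lborel_pi I)"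
      by measurable
    then show "(\<lambda>z. indicator {z. \<forall>i\<in>I. y $ i \<le> z i} z *\<^sub>R tensor u (glue I y z)) \<in> borel_measurable (lborel_pi I)"
      by (rule back_subst[of "\<lambda>f. f \<in> _"]) (auto simp: fun_eq_iff indicator_def)
    show "\<bar>indicator {z. \<forall>i\<in>I. y $ i \<le> z i} z *\<^sub>R tensor u (glue I y z)\<bar> \<le> (\<Prod>i\<in>UNIV. B i)" for z
      using bd[of "glue I y z"] by (auto simp: indicator_def simp del: glue_nth)
    show "indicator {z. \<forall>i\<in>I. y $ i \<le> z i} z *\<^sub>R tensor u (glue I y z) = 0" if "\<not> (\<forall>i\<in>I. - c \<le> z i \<and> z i \<le> c)" for z
    proof -
      from that obtain i where i: "i \<in> I" "c \<le> \<bar>glue I y z $ i\<bar>" by auto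
      from out[OF i(2), of "{}"] show ?thesis unfolding e by simp
    qed
  qed
  ultimately show "tensor u \<in> vanishing_test_functions"
    unfolding vanishing_test_functions_def using tensor_pareto_range[OF sf] md by blast
qed

section \<open>Density of the products of one-variable functions\<close>

text \<open>Only sums are generated explicitly; scalar multiples are absorbed into one of the
  factors.\<close>

inductive_set tensor_span :: "(real ^ 'n::finite \<Rightarrow> real) set" where
  tensor: "smooth_factors u u' \<Longrightarrow> tensor u \<in> tensor_span"
| add: "f \<in> tensor_span \<Longrightarrow> g \<in> tensor_span \<Longrightarrow> (\<lambda>z. f z + g z) \<in> tensor_span"

lemma pareto_range_add:
  fixes f g :: "real ^ 'n \<Rightarrow> real"
  assumes "f \<in> pareto_range" "g \<in> pareto_range"
  shows "(\<lambda>z. f z + g z) \<in> pareto_range"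
proof -
  from assms obtain p q where p: "integrable lborel p" "pareto_F (with_density p) = f"
    and q: "integrable lborel q" "pareto_F (with_density q) = g" unfolding pareto_range_def by blast
  have int: "integrable lborel (\<lambda>x. if y \<le> x then h x else 0)" if "integrable lborel h" for h :: "real ^ 'n \<Rightarrow> real" and y
    by (rule Bochner_Integration.integrable_bound[OF that]) (use that in \<open>auto simp: less_eq_vec_def borel_measurable_integrable\<close>)
  have "pareto_F (with_density (\<lambda>x. p x + q x)) y = f y + g y" for y
  proof -
    have "(\<integral>x. (if y \<le> x then p x + q x else 0) \<partial>lborel) = (\<integral>x. (if y \<le> x then p x else 0) + (if y \<le> x then q x else 0) \<partial>lborel)"
      by (intro Bochner_Integration.integral_cong) auto
    then show ?thesis
      using p q int[OF p(1)] int[OF q(1)] unfolding pareto_F_with_density by (auto simp: fun_eq_iff)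
  qed
  then have "pareto_F (with_density (\<lambda>x. p x + q x)) = (\<lambda>z. f z + g z)" by (intro ext)
  then show ?thesis unfolding pareto_range_def using p q by blast
qed

lemma vanishing_test_functions_add:
  fixes f g :: "real ^ 'n \<Rightarrow> real"
  assumes f: "f \<in> vanishing_test_functions" and g: "g \<in> vanishing_test_functions"
  shows "(\<lambda>z. f z + g z) \<in> vanishing_test_functions"
proof -
  obtain F where F: "mixed_derivatives f F" "\<forall>I. (F I \<longlongrightarrow> 0) at_infinity" using f unfolding vanishing_test_functions_def by blast
  obtain G where G: "mixed_derivatives g G" "\<forall>I. (G I \<longlongrightarrow> 0) at_infinity" using g unfolding vanishing_test_functions_def by blast
  have "\<exists>H. mixed_derivatives (\<lambda>z. f z + g z) H \<and> (\<forall>I. (H I \<longlongrightarrow> 0) at_infinity)"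
    using mixed_derivatives_add[OF F(1) G(1)] tendsto_add_zero[OF F(2)[rule_format] G(2)[rule_format]] by blast
  moreover have "(\<lambda>z. f z + g z) \<in> pareto_range"
    using f g unfolding vanishing_test_functions_def by (intro pareto_range_add) blast+
  moreover have "integrable lborel (\<lambda>z. f z + g z)"
    using f g unfolding vanishing_test_functions_def by (intro Bochner_Integration.integrable_add) blast+
  moreover have "set_integrable (lborel_pi I) {z. \<forall>i\<in>I. y $ i \<le> z i} (\<lambda>z. f (glue I y z) + g (glue I y z))" if "I \<noteq> {} \<and> I \<noteq> UNIV" for y I
    using f g that unfolding vanishing_test_functions_def by (intro set_integral_add(1)) blast+
  ultimately show ?thesis unfolding vanishing_test_functions_def by blast
qed

lemma bounded_continuous_add:
  "f \<in> bounded_continuous \<Longrightarrow> g \<in> bounded_continuous \<Longrightarrow> (\<lambda>x. f x + g x) \<in> bounded_continuous"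
  using bounded_continuous_diff[of f g "-1"] by simp

lemma tensor_span_vanishing: "f \<in> tensor_span \<Longrightarrow> f \<in> vanishing_test_functions"
  by (induction rule: tensor_span.induct) (auto intro: tensor_vanishing vanishing_test_functions_add)

lemma tensor_span_bounded_continuous: "f \<in> tensor_span \<Longrightarrow> f \<in> bounded_continuous"
  by (induction rule: tensor_span.induct) (auto intro: tensor_vanishing bounded_continuous_add)

text \<open>Multiplication of a product by an affine function of one coordinate alters only the
  factor of that coordinate. The affine form yields multiplication by a coordinate and by a constant
  in one argument.\<close>

lemma tensor_span_coordinate:
  fixes f :: "real ^ 'n::finite \<Rightarrow> real"
  assumes "f \<in> tensor_span"
  shows "(\<lambda>z. a * z $ i * f z) \<in> tensor_span" "(\<lambda>z. a * f z) \<in> tensor_span"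
proof -
  have affine: "(\<lambda>z. (a * z $ i + b) * f z) \<in> tensor_span" for a b and i :: 'n
    using assms
  proof (induction rule: tensor_span.induct)
    case (tensor u u')
    define v where "v j t = (if j = i then (a * t + b) * u j t else u j t)" for j t
    define v' where "v' j t = (if j = i then a * u j t + (a * t + b) * u' j t else u' j t)" for j t
    from tensor obtain c where c: "0 \<le> c" "\<And>i t. (u i has_real_derivative u' i t) (at t)" "\<And>i. continuous_on UNIV (u i)"
      "\<And>i. continuous_on UNIV (u' i)" "\<And>i t. c \<le> \<bar>t\<bar> \<Longrightarrow> u i t = 0" "\<And>i t. c \<le> \<bar>t\<bar> \<Longrightarrow> u' i t = 0"
      by (rule smooth_factorsE) (use that in blast)
    have "(v j has_real_derivative v' j t) (at t)" for j t
    proof (cases "j = i")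
      case True
      have "((\<lambda>t. (a * t + b) * u j t) has_real_derivative a * u j t + u' j t * (a * t + b)) (at t)"
        by (rule DERIV_mult[OF _ c(2)]) (auto intro!: derivative_eq_intros)
      then show ?thesis using True by (simp add: v_def[abs_def] v'_def mult.commute)
    qed (use c(2) in \<open>simp add: v_def[abs_def] v'_def\<close>)
    moreover have "continuous_on UNIV (v' j)" for j
      unfolding v'_def[abs_def] by (cases "j = i") (auto intro!: continuous_intros c)
    moreover have "v j t = 0 \<and> v' j t = 0" if "c \<le> \<bar>t\<bar>" for j t
      using c(5)[OF that] c(6)[OF that] by (simp add: v_def v'_def)
    ultimately have "smooth_factors v v'" unfolding smooth_factors_def by blast
    then have "tensor v \<in> tensor_span" by (rule tensor_span.tensor)
    moreover have "tensor v z = (a * z $ i + b) * tensor u z" for z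
    proof -
      have "tensor v z = v i (z $ i) * (\<Prod>j\<in>UNIV - {i}. v j (z $ j))" by (rule prod.remove) auto
      also have "(\<Prod>j\<in>UNIV - {i}. v j (z $ j)) = (\<Prod>j\<in>UNIV - {i}. u j (z $ j))"
        by (intro prod.cong) (auto simp: v_def)
      also have "v i (z $ i) * (\<Prod>j\<in>UNIV - {i}. u j (z $ j)) = (a * z $ i + b) * (u i (z $ i) * (\<Prod>j\<in>UNIV - {i}. u j (z $ j)))"
        by (simp add: v_def)
      also have "u i (z $ i) * (\<Prod>j\<in>UNIV - {i}. u j (z $ j)) = tensor u z" by (rule prod.remove[symmetric]) auto
      finally show ?thesis .
    qed
    ultimately show ?case by simp
  next
    case (add f g)
    then show ?case using tensor_span.add[OF add.IH] by (simp add: distrib_left)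
  qed
  from affine[of a i 0] show "(\<lambda>z. a * z $ i * f z) \<in> tensor_span" by simp
  from affine[of 0 _ a] show "(\<lambda>z. a * f z) \<in> tensor_span" by simp
qed

lemma tensor_span_sum:
  assumes "finite S" "\<And>i. i \<in> S \<Longrightarrow> f i \<in> tensor_span" "S \<noteq> {}"
  shows "(\<lambda>z. \<Sum>i\<in>S. f i z) \<in> tensor_span"
  using assms(1,3,2)
  by (induction S rule: finite_ne_induct) (auto intro: tensor_span.add)

text \<open>Makes polynomials times a cutoff available as test functions, and thereby
  Stone-Weierstrass applicable. The function \<open>f\<close> is left general because a product of
  polynomials is applied factor by factor.\<close>

lemma tensor_span_polynomial:
  fixes p :: "real ^ 'n::finite \<Rightarrow> real"
  assumes "real_polynomial_function p" "f \<in> tensor_span"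
  shows "(\<lambda>z. p z * f z) \<in> tensor_span"
  using assms
proof (induction arbitrary: f rule: real_polynomial_function.induct)
  case (linear p)
  have pz: "p z = (\<Sum>i\<in>UNIV. p (axis i 1) * z $ i)" for z
  proof -
    interpret bounded_linear p by fact
    have "p z = p (\<Sum>i\<in>UNIV. z $ i *\<^sub>R axis i 1)" using basis_expansion[of z] by (simp add: scalar_mult_eq_scaleR)
    then show ?thesis by (simp add: sum scaleR mult.commute)
  qed
  have "(\<lambda>z. \<Sum>i\<in>UNIV. p (axis i 1) * z $ i * f z) \<in> tensor_span"
    by (intro tensor_span_sum tensor_span_coordinate linear) auto
  moreover have "p z * f z = (\<Sum>i\<in>UNIV. p (axis i 1) * z $ i * f z)" for z
    by (subst pz) (rule sum_distrib_right)
  ultimately show ?case by (simp only:)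
next
  case (const c)
  then show ?case by (intro tensor_span_coordinate)
next
  case (add p q)
  then show ?case using tensor_span.add[of "\<lambda>z. p z * f z" "\<lambda>z. q z * f z"] by (simp add: distrib_right)
next
  case (mult p q)
  then show ?case using mult.IH(1)[of "\<lambda>z. q z * f z"] by (simp add: mult.assoc)
qed

lemma smooth_factors_bump:
  assumes a: "\<And>i. 0 < a i"
  shows "smooth_factors (\<lambda>i t. bump ((t - p i) / a i)) (\<lambda>i::'n::finite. \<lambda>t. bump' ((t - p i) / a i) / a i)"
proof -
  have "((\<lambda>t. bump ((t - p i) / a i)) has_real_derivative bump' ((t - p i) / a i) / a i) (at t)" for i t
  proof -
    have "((\<lambda>t. (t - p i) / a i) has_real_derivative 1 / a i) (at t)"
      using a[of i] by (auto intro!: derivative_eq_intros)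
    from DERIV_chain2[OF bump_deriv this] show ?thesis by simp
  qed
  moreover have "continuous_on UNIV (\<lambda>t. bump' ((t - p i) / a i) / a i)" for i
    using a[of i] by (intro continuous_intros continuous_on_compose2[OF continuous_bump(2)[of UNIV]]) auto
  moreover have "\<exists>c. \<forall>i t. c \<le> \<bar>t\<bar> \<longrightarrow> bump ((t - p i) / a i) = 0 \<and> bump' ((t - p i) / a i) / a i = 0"
  proof (intro exI allI impI)
    fix i t assume t: "(\<Sum>i\<in>UNIV. \<bar>p i\<bar> + a i) \<le> \<bar>t\<bar>"
    have "\<bar>p i\<bar> + a i \<le> (\<Sum>i\<in>UNIV. \<bar>p i\<bar> + a i)" by (rule member_le_sum) (auto intro!: add_nonneg_nonneg less_imp_le[OF a])
    then have "a i \<le> \<bar>t - p i\<bar>" using t by linarith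
    then have "1 \<le> \<bar>(t - p i) / a i\<bar>" using a[of i] by simp
    from bump_outside[OF this] show "bump ((t - p i) / a i) = 0 \<and> bump' ((t - p i) / a i) / a i = 0" by simp
  qed
  ultimately show ?thesis unfolding smooth_factors_def by blast
qed

lemma cutoff_tensor_span: "cutoff k {} \<in> tensor_span"
proof -
  have "smooth_factors (\<lambda>i t. bump ((t - 0) / real (Suc k))) (\<lambda>i::'a. \<lambda>t. bump' ((t - 0) / real (Suc k)) / real (Suc k))"
    by (rule smooth_factors_bump) simp
  from tensor_span.tensor[OF this] show ?thesis
    by (simp add: cutoff_def prod_deriv_def[abs_def])
qed

lemma cutoff_bounds: "0 \<le> cutoff k {} z" "cutoff k {} z \<le> 1"
  unfolding cutoff_def prod_deriv_def by (auto intro!: prod_nonneg prod_le_1 bump_le_1)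

text \<open>A polynomial is close to \<open>f\<close> on a cube only, but the cutoff vanishes
  outside this cube, so the estimate for the product is global.\<close>

lemma tensor_span_approximation:
  fixes f :: "real ^ 'n::finite \<Rightarrow> real"
  assumes f: "continuous_on UNIV f" and e: "0 < e"
  obtains s where "s \<in> tensor_span" "\<And>z. \<bar>s z - f z * cutoff k {} z\<bar> \<le> e"
proof -
  let ?S = "cbox (\<chi> i. - real (Suc k)) (\<chi> i. real (Suc k)) :: (real^'n) set"
  obtain p where p: "real_polynomial_function p" "\<And>x. x \<in> ?S \<Longrightarrow> \<bar>f x - p x\<bar> < e"
    by (rule Stone_Weierstrass_real_polynomial_function[of ?S f e]) (use f e in \<open>auto intro: continuous_on_subset\<close>)
  show ?thesis
  proof (rule that)
    show "(\<lambda>z. p z * cutoff k {} z) \<in> tensor_span"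
      by (rule tensor_span_polynomial[OF p(1) cutoff_tensor_span])
    fix z
    show "\<bar>p z * cutoff k {} z - f z * cutoff k {} z\<bar> \<le> e"
    proof (cases "z \<in> ?S")
      case True
      have "\<bar>(f z - p z) * cutoff k {} z\<bar> \<le> e * 1"
        unfolding abs_mult using p(2)[OF True] cutoff_bounds[of k z] by (intro mult_mono) auto
      then show ?thesis by (simp add: algebra_simps abs_minus_commute)
    next
      case False
      then obtain i where "z $ i < - real (Suc k) \<or> real (Suc k) < z $ i" by (auto simp: mem_box_cart not_le)
      then have "real (Suc k) \<le> \<bar>z $ i\<bar>" by auto
      from cutoff_outside[OF this, of "{}"] show ?thesis using e by simp
    qed
  qed
qed

text \<open>Uniform density is out of reach, as \<open>f\<close> need not vanish at infinity.
  Growing cutoffs together with a polynomial error of \<open>inverse (real (Suc k))\<close> give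
  bounded pointwise convergence; this error accounts for the \<open>+ 1\<close>.\<close>

lemma tensor_span_bp_dense:
  fixes f :: "real ^ 'n::finite \<Rightarrow> real"
  assumes f: "f \<in> bounded_continuous" and b: "\<forall>w. \<bar>f w\<bar> \<le> b"
  shows "\<exists>s::nat \<Rightarrow> _. (\<forall>k. s k \<in> tensor_span) \<and> (\<forall>k w. \<bar>s k w\<bar> \<le> b + 1) \<and> (\<forall>w. (\<lambda>k. s k w) \<longlonglongrightarrow> f w)"
proof -
  have fc: "continuous_on UNIV f" using f by (simp add: bounded_continuous_def)
  have "\<exists>s\<in>tensor_span. \<forall>z. \<bar>s z - f z * cutoff k {} z\<bar> \<le> inverse (real (Suc k))" for k
    using tensor_span_approximation[OF fc, of "inverse (real (Suc k))" k] by (metis inverse_positive_iff_positive of_nat_0_less_iff zero_less_Suc)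
  then obtain s where s: "\<And>k. s k \<in> tensor_span" "\<And>k z. \<bar>s k z - f z * cutoff k {} z\<bar> \<le> inverse (real (Suc k))"
    by metis
  have "\<bar>s k w\<bar> \<le> b + 1" for k w
  proof -
    have "\<bar>f w * cutoff k {} w\<bar> \<le> b * 1"
      unfolding abs_mult using b cutoff_bounds[of k w] by (intro mult_mono) (auto intro: order_trans[OF abs_ge_zero])
    moreover have "inverse (real (Suc k)) \<le> 1" by (simp add: inverse_le_1_iff)
    ultimately show ?thesis using s(2)[of k w] by linarith
  qed
  moreover have "(\<lambda>k. s k w) \<longlonglongrightarrow> f w" for w
  proof -
    have "(\<lambda>k. s k w - f w * cutoff k {} w) \<longlonglongrightarrow> 0"
      by (rule Lim_null_comparison[OF _ LIMSEQ_inverse_real_of_nat]) (use s(2) in auto)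
    moreover have "(\<lambda>k. f w * cutoff k {} w) \<longlonglongrightarrow> f w * 1"
      using cutoff_tendsto[of "{}" w] by (intro tendsto_intros) simp
    ultimately have "(\<lambda>k. (s k w - f w * cutoff k {} w) + f w * cutoff k {} w) \<longlonglongrightarrow> 0 + f w * 1" by (rule tendsto_add)
    then show ?thesis by simp
  qed
  ultimately show ?thesis using s(1) by blast
qed

section \<open>Necessity of the sign conditions\<close>

text \<open>Positive maximum principle: since \<open>g y = 0\<close>, the difference quotient at
  \<open>y\<close> is a mean of a nonnegative function divided by \<open>t\<close>.\<close>

lemma generator_nonneg_at_minimum:
  assumes gen: "generates_C_Feller E A Y" and g: "g \<in> E" "\<And>z. 0 \<le> g z" "g y = 0"
  shows "0 \<le> A g y"
proof (rule tendsto_lowerbound)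
  have "uniform_limit UNIV (\<lambda>t y. ((\<integral>u. g u \<partial>Y t y) - g y) / t) (A g) (at_right 0)"
    using gen g(1) by (simp add: generates_C_Feller_def)
  from tendsto_uniform_limitI[OF this, of y]
  show "((\<lambda>t. ((\<integral>u. g u \<partial>Y t y) - g y) / t) \<longlongrightarrow> A g y) (at_right 0)" by simp
  show "\<forall>\<^sub>F t in at_right 0. 0 \<le> ((\<integral>u. g u \<partial>Y t y) - g y) / t"
    unfolding eventually_at_right_field using g by (intro exI[of _ 1]) (simp add: integral_nonneg)
qed simp

lemma integrable_bump: "integrable lborel bump"
  by (rule continuous_compact_support(1)[OF continuous_bump(1) bump_outside(1)])

lemma integral_bump: "0 < (\<integral>t. bump t \<partial>lborel)" "(\<integral>t. bump t \<partial>lborel) \<le> 2"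
proof -
  have "(\<integral>t. bump t \<partial>lborel) \<le> (\<integral>t. indicator {-1..1::real} t \<partial>lborel)"
  proof (rule integral_mono[OF integrable_bump])
    show "bump t \<le> indicator {-1..1::real} t" for t
      using bump_le_1[of t] bump_outside(1)[of t] by (cases "1 \<le> \<bar>t\<bar>") (auto simp: indicator_def)
  qed simp
  then show "(\<integral>t. bump t \<partial>lborel) \<le> 2" by simp
  \<comment> \<open>On the interval from -1/2 to 1/2 the base of the square is at least 3/4.\<close>
  have "(\<integral>t. 9 / 16 * indicator {-1/2..1/2::real} t \<partial>lborel) \<le> (\<integral>t. bump t \<partial>lborel)"
  proof (rule integral_mono[OF _ integrable_bump])
    show "9 / 16 * indicator {-1/2..1/2::real} t \<le> bump t" for t :: real
    proof (cases "t \<in> {-1/2..1/2}")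
      case True
      then have "\<bar>t\<bar>\<^sup>2 \<le> (1/2)\<^sup>2" by (intro power_mono) auto
      then have "t\<^sup>2 \<le> 1 / 4" by (simp add: power2_eq_square)
      then have "3 / 4 \<le> max 0 (1 - t\<^sup>2)" by simp
      then have "(3 / 4)\<^sup>2 \<le> bump t" unfolding bump_def by (rule power_mono) simp
      then show ?thesis using True by (simp add: power2_eq_square)
    qed simp
  qed simp
  then show "0 < (\<integral>t. bump t \<partial>lborel)" by simp
qed

lemma bump_scaled:
  assumes a: "0 < a"
  shows "integrable lborel (\<lambda>t. bump ((t - p) / a))" "(\<integral>t. bump ((t - p) / a) \<partial>lborel) = a * (\<integral>t. bump t \<partial>lborel)"
proof -
  show "integrable lborel (\<lambda>t. bump ((t - p) / a))"
  proof (rule continuous_compact_support(1))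
    show "continuous_on UNIV (\<lambda>t. bump ((t - p) / a))"
      using a by (intro continuous_on_compose2[OF continuous_bump(1)[of UNIV]] continuous_intros) auto
    show "bump ((t - p) / a) = 0" if "\<bar>p\<bar> + a \<le> \<bar>t\<bar>" for t
    proof -
      have "a \<le> \<bar>t - p\<bar>" using that by linarith
      then have "1 \<le> \<bar>(t - p) / a\<bar>" using a by simp
      then show ?thesis by (rule bump_outside)
    qed
  qed
  show "(\<integral>t. bump ((t - p) / a) \<partial>lborel) = a * (\<integral>t. bump t \<partial>lborel)"
    using a lborel_integral_real_affine[of a "\<lambda>t. bump ((t - p) / a)" p] by simp
qed

lemma bump_product_integral:
  fixes I :: "'n::finite set"
  assumes a: "\<And>i. 0 < a i"
  shows "integrable (lborel_pi I) (\<lambda>z. \<Prod>i\<in>I. bump ((z i - p i) / a i))"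
    "(\<integral>z. (\<Prod>i\<in>I. bump ((z i - p i) / a i)) \<partial>lborel_pi I) = (\<Prod>i\<in>I. a i * (\<integral>t. bump t \<partial>lborel))"
proof -
  interpret product_sigma_finite "\<lambda>_::'n. lborel :: real measure" by standard
  show "integrable (lborel_pi I) (\<lambda>z. \<Prod>i\<in>I. bump ((z i - p i) / a i))"
    by (rule product_integrable_prod) (auto intro: bump_scaled(1) a)
  have "(\<integral>z. (\<Prod>i\<in>I. bump ((z i - p i) / a i)) \<partial>lborel_pi I) = (\<Prod>i\<in>I. \<integral>t. bump ((t - p i) / a i) \<partial>lborel)"
    by (rule product_integral_prod) (auto intro: bump_scaled(1) a)
  then show "(\<integral>z. (\<Prod>i\<in>I. bump ((z i - p i) / a i)) \<partial>lborel_pi I) = (\<Prod>i\<in>I. a i * (\<integral>t. bump t \<partial>lborel))"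
    by (simp add: bump_scaled(2)[OF a])
qed

text \<open>On a proper face the density vanishes off the part above \<open>y\<close>, where
  \<open>g\<close> is integrable by the choice of test functions; on the full face \<open>g\<close>
  is integrable outright. The density is bounded in both cases.\<close>

lemma faces_integrable:
  fixes g :: "real ^ 'n \<Rightarrow> real"
  assumes D: "kernel_mixed_derivatives \<nu> D" and g: "g \<in> vanishing_test_functions"
  shows "integrable (lborel_pi I) (\<lambda>z. g (glue I y z) * dual_density D y I (glue I y z))"
proof -
  obtain C where "0 < C" and C: "\<And>y I z. \<bar>dual_density D y I z\<bar> \<le> C" using dual_density_bound[OF D] by blast
  have gi: "integrable lborel g" using g unfolding vanishing_test_functions_def by blast
  have gm [measurable]: "g \<in> borel_measurable borel" using gi by (simp add: borel_measurable_integrable)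
  have dm [measurable]: "dual_density D y I \<in> borel_measurable borel" by (rule dual_density_measurable[OF D])
  show ?thesis
  proof (cases "I = UNIV")
    case True
    have "integrable lborel (\<lambda>z. g z * dual_density D y I z)"
      by (rule integrable_bounded_mult[OF gi _ C]) simp
    then show ?thesis
      using lborel_integrable_glue[of "\<lambda>z. g z * dual_density D y I z" y] True by simp
  next
    case False
    have eq: "g (glue I y z) * dual_density D y I (glue I y z) = (if \<forall>i\<in>I. y $ i \<le> z i then g (glue I y z) else 0) * dual_density D y I (glue I y z)" for z
      using False by (simp add: dual_density_def glue_ge_iff)
    show ?thesis
      unfolding eq by (rule integrable_bounded_mult[OF vanishing_faces_integrable[OF g] _ C]) measurable
  qed
qed

lemma dist_vec_le_box:
  fixes w p :: "real ^ 'n"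
  assumes "\<And>i. \<bar>w $ i - p $ i\<bar> \<le> e"
  shows "dist w p \<le> real CARD('n) * e"
proof -
  have "dist w p \<le> (\<Sum>i\<in>UNIV. \<bar>(w - p) $ i\<bar>)" unfolding dist_norm by (rule norm_le_l1_cart)
  also have "\<dots> \<le> (\<Sum>i\<in>(UNIV::'n set). e)" by (intro sum_mono) (use assms in simp)
  finally show ?thesis by simp
qed

text \<open>A bump of width \<open>e\<close> in the directions of \<open>I\<close> and of width \<open>\<delta>\<close> in the others lives near the face
  \<open>I\<close> only: on the larger faces its integral is \<open>O(\<delta>)\<close>, on the others it vanishes.\<close>

proposition nonpositive_rate_derivatives_necessary:
  fixes \<nu> :: "real ^ 'n \<Rightarrow> (real ^ 'n) measure"
  assumes nu: "bounded_kernel \<nu>" and D: "kernel_mixed_derivatives \<nu> D"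
    and gen: "generates_C_Feller vanishing_test_functions (pareto_dual_generator \<nu>) Y"
  shows "nonpositive_rate_derivatives D"
  unfolding nonpositive_rate_derivatives_def
proof (intro allI impI, rule ccontr)
  fix I :: "'n set" and p assume I: "I \<noteq> {} \<and> I \<noteq> UNIV" and "\<not> smeasure (D I p) UNIV \<le> 0"
  then have pos: "0 < smeasure (D I p) UNIV" by simp
  let ?m = "\<integral>t. bump t \<partial>lborel" and ?R = "\<lambda>w. smeasure (D I w) UNIV" and ?N = "CARD('n)"
  define a where "a = ?R p / 2"
  have a: "0 < a" "a < ?R p" using pos by (auto simp: a_def)
  obtain C where C0: "0 < C" and C: "\<And>y I z. \<bar>dual_density D y I z\<bar> \<le> C" using dual_density_bound[OF D] by blast
  have "open {w. a < ?R w}"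
    by (intro open_Collect_less continuous_on_const smeasure_UNIV_derivatives(2)[OF nu D])
  then obtain d where d: "0 < d" "\<And>w. dist w p < d \<Longrightarrow> a < ?R w"
    unfolding open_dist using a(2) by blast
  define e where "e = min (1/2) (d / (2 * real ?N))"
  have e: "0 < e" "e < 1" using d(1) by (auto simp: e_def)
  have near: "a < ?R w" if "\<And>i. \<bar>w $ i - p $ i\<bar> \<le> e" for w
  proof (rule d(2))
    have "dist w p \<le> real ?N * e" by (rule dist_vec_le_box[OF that])
    also have "\<dots> \<le> real ?N * (d / (2 * real ?N))" by (intro mult_left_mono) (auto simp: e_def)
    also have "\<dots> < d" using d(1) by simp
    finally show "dist w p < d" .
  qed
  \<comment> \<open>In the directions of \<open>I\<close> the vertex is shifted by 1, beyond the
    width \<open>e\<close> of the bump, so \<open>g\<close> vanishes on every face that does not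
    contain \<open>I\<close>. In the other directions the vertex agrees with \<open>p\<close>, so
    \<open>p\<close> itself lies on the face \<open>I\<close>.\<close>
  define y :: "real ^ 'n" where "y = (\<chi> i. if i \<in> I then p $ i - 1 else p $ i)"
  define \<beta> where "\<beta> = (\<Prod>i\<in>I. e * ?m)"
  have \<beta>: "0 < \<beta>" unfolding \<beta>_def using e integral_bump(1) by (intro prod_pos) auto
  \<comment> \<open>There are at most \<open>2 ^ CARD('n)\<close> other faces, each contributing at
    most \<open>C * 2 ^ CARD('n) * \<delta>\<close>; this choice keeps their sum within half of the
    main term \<open>a * \<beta>\<close>.\<close>
  define \<delta> where "\<delta> = min 1 (a * \<beta> / (2 * (2 ^ ?N * (C * 2 ^ ?N))))"
  have \<delta>: "0 < \<delta>" "\<delta> \<le> 1" using a \<beta> C0 by (auto simp: \<delta>_def)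
  define wd where "wd i = (if i \<in> I then e else \<delta>)" for i
  have wd: "0 < wd i" "wd i \<le> 1" for i using e \<delta> by (auto simp: wd_def)
  define g where "g = tensor (\<lambda>i t. bump ((t - p $ i) / wd i))"
  have sf: "smooth_factors (\<lambda>i t. bump ((t - p $ i) / wd i)) (\<lambda>i t. bump' ((t - p $ i) / wd i) / wd i)"
    by (rule smooth_factors_bump[OF wd(1)])
  have g: "g \<in> vanishing_test_functions" unfolding g_def by (rule tensor_vanishing[OF sf])
  have gnn: "0 \<le> g z" for z unfolding g_def by (intro prod_nonneg) simp
  have gzero: "g z = 0" if "i \<in> I" "z $ i = y $ i" for z i
  proof -
    have "1 \<le> \<bar>(z $ i - p $ i) / wd i\<bar>" using that e by (simp add: y_def wd_def)
    from bump_outside(1)[OF this] show ?thesis unfolding g_def by (intro prod_zero) auto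
  qed
  have gy: "g y = 0" using I gzero by blast
  \<comment> \<open>A direction outside \<open>J\<close> is outside \<open>I\<close>, so
    \<open>y\<close> coincides with \<open>p\<close> there and the factor is
    \<open>bump 0 = 1\<close>.\<close>
  have gface: "g (glue J y z) = (\<Prod>i\<in>J. bump ((z i - p $ i) / wd i))" if "I \<subseteq> J" for J z
  proof -
    have "g (glue J y z) = (\<Prod>i\<in>J. bump ((glue J y z $ i - p $ i) / wd i))"
      unfolding g_def using that by (intro prod.mono_neutral_right) (auto simp: y_def)
    then show ?thesis by simp
  qed
  let ?T = "\<lambda>J. \<integral>z. g (glue J y z) * dual_density D y J (glue J y z) \<partial>lborel_pi J"
  have other: "?T J \<le> C * 2 ^ ?N * \<delta>" if J: "J \<noteq> I" for J
  proof (cases "I \<subseteq> J")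
    case False
    then obtain i where "i \<in> I" "i \<notin> J" by blast
    then have "g (glue J y z) = 0" for z by (intro gzero[of i]) auto
    then show ?thesis using C0 \<delta> by simp
  next
    case True
    then obtain j where j: "j \<in> J" "j \<notin> I" using J by blast
    have "?T J \<le> (\<integral>z. C * (\<Prod>i\<in>J. bump ((z i - p $ i) / wd i)) \<partial>lborel_pi J)"
    proof (rule integral_mono')
      show "integrable (lborel_pi J) (\<lambda>z. C * (\<Prod>i\<in>J. bump ((z i - p $ i) / wd i)))"
        by (intro integrable_mult_right bump_product_integral(1)[OF wd(1)])
      fix z
      show nn: "0 \<le> C * (\<Prod>i\<in>J. bump ((z i - p $ i) / wd i))" using C0 by (intro mult_nonneg_nonneg prod_nonneg) auto
      have "dual_density D y J (glue J y z) \<le> C" using C[of y J "glue J y z"] by linarith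
      then have "g (glue J y z) * dual_density D y J (glue J y z) \<le> g (glue J y z) * C" using gnn by (rule mult_left_mono)
      then show "g (glue J y z) * dual_density D y J (glue J y z) \<le> C * (\<Prod>i\<in>J. bump ((z i - p $ i) / wd i))"
        unfolding gface[OF True] by (simp add: mult.commute)
    qed
    also have "\<dots> = C * (\<Prod>i\<in>J. wd i * ?m)" by (simp add: bump_product_integral(2)[OF wd(1)])
    also have "(\<Prod>i\<in>J. wd i * ?m) \<le> 2 ^ ?N * \<delta>"
    proof -
      have le2: "wd i * ?m \<le> 2" for i
        using mult_mono[OF wd(2)[of i] integral_bump(2)] wd(1)[of i] integral_bump(1) by simp
      have "(\<Prod>i\<in>J. wd i * ?m) = (wd j * ?m) * (\<Prod>i\<in>J - {j}. wd i * ?m)" using j by (intro prod.remove) auto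
      also have "\<dots> \<le> (\<delta> * 2) * (\<Prod>i\<in>J - {j}. 2)"
      proof (rule mult_mono)
        show "wd j * ?m \<le> \<delta> * 2" using j \<delta> integral_bump by (auto simp: wd_def)
        have nn: "0 \<le> wd i * ?m" for i using wd(1)[of i] integral_bump(1) by simp
        show "(\<Prod>i\<in>J - {j}. wd i * ?m) \<le> (\<Prod>i\<in>J - {j}. 2)" by (intro prod_mono conjI nn le2)
        show "0 \<le> (\<Prod>i\<in>J - {j}. wd i * ?m)" by (intro prod_nonneg nn)
      qed (use \<delta> in simp)
      also have "\<dots> = \<delta> * 2 ^ Suc (card (J - {j}))" by simp
      also have "Suc (card (J - {j})) = card J" using j by (metis card.remove finite)
      also have "\<delta> * 2 ^ card J \<le> \<delta> * 2 ^ ?N" using \<delta> by (intro mult_left_mono power_increasing card_mono) auto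
      finally show ?thesis by (simp add: mult.commute)
    qed
    then have "C * (\<Prod>i\<in>J. wd i * ?m) \<le> C * (2 ^ ?N * \<delta>)" using C0 by (intro mult_left_mono) auto
    finally show ?thesis by (simp add: mult.assoc)
  qed
  \<comment> \<open>On the support of the bump in the face \<open>I\<close> every point is within
    \<open>e\<close> of \<open>p\<close> in each coordinate, so the rate derivative exceeds
    \<open>a\<close> there and the density is below \<open>- a\<close>.\<close>
  have main: "?T I \<le> - (a * \<beta>)"
  proof -
    let ?B = "\<lambda>z. \<Prod>i\<in>I. bump ((z i - p $ i) / wd i)"
    have "?T I \<le> (\<integral>z. - (a * ?B z) \<partial>lborel_pi I)"
    proof (rule integral_mono)
      show "integrable (lborel_pi I) (\<lambda>z. g (glue I y z) * dual_density D y I (glue I y z))" by (rule faces_integrable[OF D g])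
      show "integrable (lborel_pi I) (\<lambda>z. - (a * ?B z))"
        by (intro Bochner_Integration.integrable_minus integrable_mult_right bump_product_integral(1)[OF wd(1)])
      fix z
      have B0: "0 \<le> ?B z" by (intro prod_nonneg) auto
      show "g (glue I y z) * dual_density D y I (glue I y z) \<le> - (a * ?B z)"
      proof (cases "\<forall>i\<in>I. \<bar>z i - p $ i\<bar> < e")
        case True
        have "\<bar>glue I y z $ i - p $ i\<bar> \<le> e" for i using True e by (auto simp: y_def less_imp_le)
        then have "a < ?R (glue I y z)" by (rule near)
        moreover have "y \<le> glue I y z" unfolding glue_ge_iff
        proof
          fix i assume "i \<in> I"
          then show "y $ i \<le> z i" using True e by (force simp: y_def)
        qed
        ultimately have "dual_density D y I (glue I y z) \<le> - a" using I by (simp add: dual_density_def)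
        then have "?B z * dual_density D y I (glue I y z) \<le> ?B z * (- a)" using B0 by (rule mult_left_mono)
        then show ?thesis unfolding gface[OF order_refl] by (simp add: mult.commute)
      next
        case False
        then obtain i where i: "i \<in> I" "e \<le> \<bar>z i - p $ i\<bar>" by (auto simp: not_less)
        then have "1 \<le> \<bar>(z i - p $ i) / wd i\<bar>" using e by (simp add: wd_def)
        from bump_outside(1)[OF this] i(1) have B: "?B z = 0" by (intro prod_zero) auto
        show ?thesis unfolding gface[OF order_refl] B by simp
      qed
    qed
    also have "\<dots> = - (a * \<beta>)"
    proof -
      have "(\<Prod>i\<in>I. wd i * ?m) = \<beta>" unfolding \<beta>_def by (intro prod.cong) (auto simp: wd_def)
      then show ?thesis by (simp add: bump_product_integral(2)[OF wd(1)])
    qed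
    finally show ?thesis .
  qed
  have "0 \<le> pareto_dual_generator \<nu> g y"
    by (rule generator_nonneg_at_minimum[OF gen g gnn gy])
  also have "\<dots> = (\<Sum>J | J \<noteq> {}. ?T J)"
    unfolding pareto_dual_generator_faces[OF nu D g] by (simp add: gy)
  also have "\<dots> = ?T I + (\<Sum>J\<in>{J. J \<noteq> {}} - {I}. ?T J)"
    using I by (intro sum.remove) auto
  also have "(\<Sum>J\<in>{J. J \<noteq> {}} - {I}. ?T J) \<le> (\<Sum>J\<in>{J. J \<noteq> {}} - {I}. C * 2 ^ ?N * \<delta>)"
    by (intro sum_mono other) auto
  also have "\<dots> \<le> 2 ^ ?N * (C * 2 ^ ?N * \<delta>)"
  proof -
    have "card ({J. J \<noteq> {}} - {I}) \<le> card (UNIV :: 'n set set)" by (intro card_mono) auto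
    also have "card (UNIV :: 'n set set) = 2 ^ ?N" using card_Pow[of "UNIV :: 'n set"] by simp
    finally have "real (card ({J. J \<noteq> {}} - {I})) \<le> 2 ^ ?N" by (metis of_nat_le_iff of_nat_numeral of_nat_power)
    then show ?thesis using C0 \<delta> by (auto intro!: mult_right_mono)
  qed
  also have "2 ^ ?N * (C * 2 ^ ?N * \<delta>) \<le> a * \<beta> / 2"
  proof -
    have "\<delta> \<le> a * \<beta> / (2 * (2 ^ ?N * (C * 2 ^ ?N)))" by (simp add: \<delta>_def)
    then have "(2 ^ ?N * (C * 2 ^ ?N)) * \<delta> \<le> (2 ^ ?N * (C * 2 ^ ?N)) * (a * \<beta> / (2 * (2 ^ ?N * (C * 2 ^ ?N))))"
      using C0 by (intro mult_left_mono) auto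
    also have "\<dots> = a * \<beta> / 2" using C0 by simp
    finally show ?thesis by (simp add: mult_ac)
  qed
  finally have "0 \<le> - (a * \<beta>) + a * \<beta> / 2" using main by linarith
  moreover have "0 < a * \<beta>" using a \<beta> by simp
  ultimately show False by linarith
qed

section \<open>Signs of the top derivative\<close>

lemma continuous_on_Min:
  fixes f :: "'i \<Rightarrow> 'a::topological_space \<Rightarrow> real"
  assumes "finite S" "S \<noteq> {}" "\<And>i. i \<in> S \<Longrightarrow> continuous_on A (f i)"
  shows "continuous_on A (\<lambda>x. Min ((\<lambda>i. f i x) ` S))"
  using assms
proof (induction S rule: finite_ne_induct)
  case (insert j S)
  then have "continuous_on A (\<lambda>x. min (f j x) (Min ((\<lambda>i. f i x) ` S)))"
    by (intro continuous_on_min insert.IH insert.prems) auto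
  then show ?case using insert.hyps by simp
qed simp

text \<open>A continuous substitute for the indicator of the orthant above \<open>y\<close>. The
  minimum makes its superlevel sets at positive levels orthants again, with vertices between
  \<open>y - 2 * \<epsilon>\<close> and \<open>y - \<epsilon>\<close> in each coordinate. It is thus
  an average of orthant indicators whose vertices keep a distance from \<open>y\<close>.\<close>

definition ramp :: "real ^ 'n \<Rightarrow> real \<Rightarrow> real ^ 'n \<Rightarrow> real" where
  "ramp y \<epsilon> w = Min (range (\<lambda>i. max 0 (min 1 ((w $ i - y $ i + 2 * \<epsilon>) / \<epsilon>))))"

lemma ramp_bounds: "0 \<le> ramp y \<epsilon> w" "ramp y \<epsilon> w \<le> 1"
  unfolding ramp_def by (auto simp: Min_le_iff)

lemma ramp_bounded_continuous: "0 < \<epsilon> \<Longrightarrow> ramp y \<epsilon> \<in> bounded_continuous"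
proof (rule bounded_continuousI)
  assume "0 < \<epsilon>"
  then show "continuous_on UNIV (ramp y \<epsilon>)"
    unfolding ramp_def[abs_def] by (intro continuous_on_Min continuous_intros) auto
  show "\<bar>ramp y \<epsilon> w\<bar> \<le> 1" for w using ramp_bounds[of y \<epsilon> w] by simp
qed

lemma ramp_ge_iff:
  assumes "0 < \<epsilon>" "0 < u" "u \<le> 1"
  shows "u \<le> ramp y \<epsilon> w \<longleftrightarrow> (\<chi> i. y $ i - 2 * \<epsilon> + u * \<epsilon>) \<le> w"
proof -
  have "u \<le> max 0 (min 1 ((w $ i - y $ i + 2 * \<epsilon>) / \<epsilon>)) \<longleftrightarrow> y $ i - 2 * \<epsilon> + u * \<epsilon> \<le> w $ i" for i
    using assms by (auto simp: le_max_iff_disj pos_le_divide_eq algebra_simps)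
  then show ?thesis unfolding ramp_def by (simp add: less_eq_vec_def)
qed

lemma ramp_tendsto:
  assumes e: "0 < e"
  shows "(\<lambda>k. ramp y (e / real (Suc k)) w) \<longlonglongrightarrow> indicator {w. y \<le> w} w"
proof (cases "y \<le> w")
  case True
  have "ramp y (e / real (Suc k)) w = 1" for k
  proof -
    have "1 \<le> ramp y (e / real (Suc k)) w"
      using True e by (subst ramp_ge_iff) (auto simp: less_eq_vec_def intro: order_trans[rotated])
    then show ?thesis using ramp_bounds(2)[of y "e / real (Suc k)" w] by simp
  qed
  then show ?thesis using True by simp
next
  case False
  then obtain i where i: "w $ i < y $ i" by (auto simp: less_eq_vec_def not_le)
  have "(\<lambda>k. 2 * (e / real (Suc k))) \<longlonglongrightarrow> 2 * (e * 0)"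
    unfolding divide_inverse by (intro tendsto_intros LIMSEQ_inverse_real_of_nat)
  then have "\<forall>\<^sub>F k in sequentially. 2 * (e / real (Suc k)) < y $ i - w $ i"
    by (rule order_tendstoD) (use i in simp)
  then have "\<forall>\<^sub>F k in sequentially. ramp y (e / real (Suc k)) w = 0"
  proof eventually_elim
    case (elim k)
    have "ramp y (e / real (Suc k)) w \<le> max 0 (min 1 ((w $ i - y $ i + 2 * (e / real (Suc k))) / (e / real (Suc k))))"
      unfolding ramp_def by (rule Min_le) auto
    also have "(w $ i - y $ i + 2 * (e / real (Suc k))) / (e / real (Suc k)) \<le> 0"
      using elim e by (intro divide_nonpos_pos) auto
    then have "max 0 (min 1 ((w $ i - y $ i + 2 * (e / real (Suc k))) / (e / real (Suc k)))) = 0" by simp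
    finally show ?case using ramp_bounds(1)[of y "e / real (Suc k)" w] by simp
  qed
  then show ?thesis using False by (simp add: tendsto_eventually)
qed

text \<open>The sum counts the levels \<open>k / m\<close> below \<open>x\<close> and equals the
  floor of \<open>m * x\<close>. A finite version of the layer cake formula avoids integration over
  the vertices of orthants.\<close>

lemma layer_cake_discrete:
  assumes x: "0 \<le> x" "x \<le> (1 :: real)" and m: "0 < m"
  shows "\<bar>x - (\<Sum>k\<in>{1..m}. if real k / real m \<le> x then 1 else 0) / real m\<bar> \<le> 1 / real m"
proof -
  have eq: "{k \<in> {1..m}. real k / real m \<le> x} = {1..nat \<lfloor>real m * x\<rfloor>}"
  proof -
    have "real m * x \<le> real m * 1" using x by (intro mult_left_mono) auto
    then have "\<lfloor>real m * x\<rfloor> \<le> int m" by (simp add: floor_le_iff)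
    moreover have iff: "real k / real m \<le> x \<longleftrightarrow> k \<le> nat \<lfloor>real m * x\<rfloor>" for k
    proof -
      have "real k / real m \<le> x \<longleftrightarrow> int k \<le> \<lfloor>real m * x\<rfloor>"
        using m by (simp add: le_floor_iff pos_divide_le_eq mult.commute)
      moreover have "0 \<le> \<lfloor>real m * x\<rfloor>" using x by simp
      ultimately show ?thesis by (simp add: le_nat_iff)
    qed
    ultimately have "k \<in> {1..m} \<and> real k / real m \<le> x \<longleftrightarrow> k \<in> {1..nat \<lfloor>real m * x\<rfloor>}" for k
      unfolding iff by auto
    then show ?thesis by blast
  qed
  have "(\<Sum>k\<in>{1..m}. if real k / real m \<le> x then 1 else 0 :: real) = real (card {k \<in> {1..m}. real k / real m \<le> x})"
    by (subst sum.If_cases) (auto intro!: arg_cong[of _ _ card])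
  also have "\<dots> = of_int \<lfloor>real m * x\<rfloor>" unfolding eq using x by simp
  finally have s: "(\<Sum>k\<in>{1..m}. if real k / real m \<le> x then 1 else 0 :: real) = of_int \<lfloor>real m * x\<rfloor>" .
  have "\<bar>real m * x - of_int \<lfloor>real m * x\<rfloor>\<bar> \<le> 1" by linarith
  then have "\<bar>real m * x - of_int \<lfloor>real m * x\<rfloor>\<bar> / real m \<le> 1 / real m" using m by (intro divide_right_mono) auto
  moreover have "x - of_int \<lfloor>real m * x\<rfloor> / real m = (real m * x - of_int \<lfloor>real m * x\<rfloor>) / real m"
    using m by (simp add: field_simps)
  ultimately show ?thesis unfolding s using m by (simp add: abs_divide)
qed

lemma sintegral_linear:
  assumes D: "kernel_mixed_derivatives \<nu> D"
  shows "f \<in> borel_measurable borel \<Longrightarrow> g \<in> borel_measurable borel \<Longrightarrow> (\<And>w. \<bar>f w\<bar> \<le> b) \<Longrightarrow> (\<And>w. \<bar>g w\<bar> \<le> c) \<Longrightarrow>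
      sintegral (D I z) (\<lambda>w. f w - g w) = sintegral (D I z) f - sintegral (D I z) g"
    "A \<in> sets borel \<Longrightarrow> sintegral (D I z) (indicator A) = smeasure (D I z) A"
proof -
  note fb = kernel_derivative_finite_borel[OF D, of I z]
  have int: "integrable M f" if "finite_borel M" "f \<in> borel_measurable borel" "\<And>w. \<bar>f w\<bar> \<le> b" for M :: "(real^'a) measure" and f :: "real ^ 'a \<Rightarrow> real" and b
    by (rule integrable_bounded[OF _ _ that(3)]) (use that in \<open>simp_all add: finite_borel_def measurable_cong_sets[of M borel borel borel]\<close>)
  show "f \<in> borel_measurable borel \<Longrightarrow> g \<in> borel_measurable borel \<Longrightarrow> (\<And>w. \<bar>f w\<bar> \<le> b) \<Longrightarrow> (\<And>w. \<bar>g w\<bar> \<le> c) \<Longrightarrow>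
      sintegral (D I z) (\<lambda>w. f w - g w) = sintegral (D I z) f - sintegral (D I z) g"
    unfolding sintegral_def
    by (subst (1 2) Bochner_Integration.integral_diff) (auto intro: int[OF fb(1)] int[OF fb(2)])
  show "A \<in> sets borel \<Longrightarrow> sintegral (D I z) (indicator A) = smeasure (D I z) A"
    unfolding sintegral_def smeasure_def using integral_indicator_finite_borel[OF fb(1)] integral_indicator_finite_borel[OF fb(2)] by simp
qed

text \<open>The ramp is within \<open>1 / m\<close> of the mean of \<open>m\<close> orthant
  indicators to which the hypothesis applies. The resulting error in the integral is at most a
  constant times \<open>1 / m\<close>, because the derivative kernel is bounded and \<open>g\<close>
  is integrable.\<close>

lemma ramp_average_nonneg:
  fixes \<nu> :: "real ^ 'n \<Rightarrow> (real ^ 'n) measure"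
  assumes nu: "bounded_kernel \<nu>" and D: "kernel_mixed_derivatives \<nu> D" and eps: "0 < \<epsilon>"
    and g: "integrable lborel g" "\<And>z. 0 \<le> g z"
    and nonneg: "\<And>y'. (\<And>i. y $ i - 2 * \<epsilon> \<le> y' $ i \<and> y' $ i \<le> y $ i - \<epsilon>) \<Longrightarrow>
      0 \<le> (\<integral>z. g z * (smeasure (D UNIV z) {w. y' \<le> w} - \<kappa> * smeasure (D UNIV z) UNIV) \<partial>lborel)"
  shows "0 \<le> (\<integral>z. g z * (sintegral (D UNIV z) (ramp y \<epsilon>) - \<kappa> * smeasure (D UNIV z) UNIV) \<partial>lborel)"
proof -
  obtain C where C0: "0 < C" and C: "\<And>I z A. \<bar>smeasure (D I z) A\<bar> \<le> C" using smeasure_bound[OF D] by blast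
  obtain C' where C': "0 < C'" "\<forall>I z \<phi> b. \<phi> \<in> borel_measurable borel \<longrightarrow> (\<forall>w. \<bar>\<phi> w\<bar> \<le> b) \<longrightarrow> \<bar>sintegral (D I z) \<phi>\<bar> \<le> C' * b"
    by (rule sintegral_bound[OF D])
  let ?\<phi> = "ramp y \<epsilon>" and ?R = "\<lambda>z. smeasure (D UNIV z) UNIV"
  have \<phi>: "?\<phi> \<in> bounded_continuous" by (rule ramp_bounded_continuous[OF eps])
  note \<phi>m = bounded_continuous_measurable[OF \<phi>]
  have \<phi>1: "\<bar>?\<phi> w\<bar> \<le> 1" for w using ramp_bounds[of y \<epsilon> w] by simp
  have gm [measurable]: "g \<in> borel_measurable borel" using g(1) by (simp add: borel_measurable_integrable)
  have sm: "(\<lambda>z. smeasure (D UNIV z) A) \<in> borel_measurable borel" if "A \<in> sets borel" for A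
    using D that by (rule smeasure_measurable)
  have gS: "integrable lborel (\<lambda>z. g z * smeasure (D UNIV z) A)" if "A \<in> sets borel" for A
    by (rule integrable_bounded_mult[OF g(1) _ C]) (simp add: sm[OF that])
  have gphi: "integrable lborel (\<lambda>z. g z * sintegral (D UNIV z) ?\<phi>)"
  proof (rule integrable_bounded_mult[OF g(1)])
    show "(\<lambda>z. sintegral (D UNIV z) ?\<phi>) \<in> borel_measurable lborel"
      using borel_measurable_continuous_onI[OF kernel_mixed_derivativesD(2)[OF D \<phi>]] by simp
    show "\<bar>sintegral (D UNIV z) ?\<phi>\<bar> \<le> C' * 1" for z using C'(2) \<phi>m \<phi>1 by blast
  qed
  let ?S = "\<integral>z. g z * (sintegral (D UNIV z) ?\<phi> - \<kappa> * ?R z) \<partial>lborel"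
  have S: "?S = (\<integral>z. g z * sintegral (D UNIV z) ?\<phi> \<partial>lborel) - \<kappa> * (\<integral>z. g z * ?R z \<partial>lborel)"
  proof -
    have "?S = (\<integral>z. g z * sintegral (D UNIV z) ?\<phi> - \<kappa> * (g z * ?R z) \<partial>lborel)"
      by (intro Bochner_Integration.integral_cong) (auto simp: algebra_simps)
    then show ?thesis using gphi gS[of UNIV] by simp
  qed
  have bound: "- (C' * (\<integral>z. g z \<partial>lborel)) * inverse (real (Suc n)) \<le> ?S" for n
  proof -
    define m where "m = Suc n"
    have m: "0 < m" by (simp add: m_def)
    \<comment> \<open>The vertex of the superlevel set of the ramp at level \<open>k / m\<close>.
      The count starts at 1, since at level 0 the superlevel set is the whole space.\<close>
    define yk :: "nat \<Rightarrow> real ^ 'n" where "yk k = (\<chi> i. y $ i - 2 * \<epsilon> + real k / real m * \<epsilon>)" for k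
    define \<phi>m' where "\<phi>m' w = (\<Sum>k\<in>{1..m}. indicator {w. yk k \<le> w} w :: real) / real m" for w
    have ik: "indicator {w. yk k \<le> w} w = (if real k / real m \<le> ?\<phi> w then 1 else 0 :: real)" if "k \<in> {1..m}" for k w
    proof -
      have "0 < real k / real m" "real k / real m \<le> 1" using that m by auto
      from ramp_ge_iff[OF eps this, of y w] show ?thesis unfolding yk_def indicator_def by simp
    qed
    have diff: "\<bar>?\<phi> w - \<phi>m' w\<bar> \<le> 1 / real m" for w
    proof -
      have "\<phi>m' w = (\<Sum>k\<in>{1..m}. if real k / real m \<le> ?\<phi> w then 1 else 0) / real m"
        unfolding \<phi>m'_def using ik by (intro arg_cong2[where f="(/)"] sum.cong refl) auto
      then show ?thesis using layer_cake_discrete[OF ramp_bounds m, of y \<epsilon> w] by simp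
    qed
    have sm': "sintegral (D UNIV z) \<phi>m' = (\<Sum>k\<in>{1..m}. smeasure (D UNIV z) {w. yk k \<le> w}) / real m" for z
    proof -
      have "(\<integral>w. \<phi>m' w \<partial>M) = (\<Sum>k\<in>{1..m}. measure M {w. yk k \<le> w}) / real m" if fb: "finite_borel M" for M
      proof -
        interpret finite_measure M using fb by (simp add: finite_borel_def)
        have se: "{w. yk k \<le> w} \<in> sets M" for k using fb by (simp add: finite_borel_def)
        have "integrable M (\<lambda>w. indicator {w. yk k \<le> w} w :: real)" for k
          using se by (intro integrable_real_indicator) (auto simp: emeasure_eq_measure)
        then show ?thesis
          unfolding \<phi>m'_def using integral_indicator_finite_borel[OF fb vec_le_sets(1)] by simp
      qed
      then show ?thesis
        unfolding sintegral_def smeasure_def using kernel_derivative_finite_borel[OF D, of UNIV z]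
        by (simp add: sum_subtractf diff_divide_distrib)
    qed
    have \<phi>m'm: "\<phi>m' \<in> borel_measurable borel" unfolding \<phi>m'_def[abs_def] by measurable
    have \<phi>m'1: "\<bar>\<phi>m' w\<bar> \<le> 2" for w
      using diff[of w] \<phi>1[of w] m by (auto simp: abs_le_iff intro: order_trans[OF _ divide_left_mono] split: if_splits) (smt (verit) divide_le_eq_1 of_nat_1 of_nat_mono Suc_leI One_nat_def)+
    have close: "sintegral (D UNIV z) \<phi>m' - C' * (1 / real m) \<le> sintegral (D UNIV z) ?\<phi>" for z
    proof -
      have "\<bar>sintegral (D UNIV z) (\<lambda>w. ?\<phi> w - \<phi>m' w)\<bar> \<le> C' * (1 / real m)"
        using C'(2) diff \<phi>m \<phi>m'm borel_measurable_diff by blast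
      then show ?thesis unfolding sintegral_linear(1)[OF D \<phi>m \<phi>m'm \<phi>1 \<phi>m'1] by linarith
    qed
    have gk: "integrable lborel (\<lambda>z. g z * (smeasure (D UNIV z) {w. yk k \<le> w} - \<kappa> * ?R z))" for k
    proof -
      have "integrable lborel (\<lambda>z. g z * smeasure (D UNIV z) {w. yk k \<le> w} - \<kappa> * (g z * ?R z))"
        using gS[of UNIV] gS[of "{w. yk k \<le> w}"] by simp
      then show ?thesis by (simp add: algebra_simps)
    qed
    have "0 \<le> (\<Sum>k\<in>{1..m}. \<integral>z. g z * (smeasure (D UNIV z) {w. yk k \<le> w} - \<kappa> * ?R z) \<partial>lborel) / real m"
    proof (intro divide_nonneg_nonneg sum_nonneg nonneg)
      fix k i assume k: "k \<in> {1..m}"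
      have "real k / real m * \<epsilon> \<le> 1 * \<epsilon>" using k m eps by (intro mult_right_mono) auto
      then show "y $ i - 2 * \<epsilon> \<le> yk k $ i \<and> yk k $ i \<le> y $ i - \<epsilon>" using eps by (simp add: yk_def)
    qed simp
    also have "\<dots> = (\<integral>z. (\<Sum>k\<in>{1..m}. g z * (smeasure (D UNIV z) {w. yk k \<le> w} - \<kappa> * ?R z)) / real m \<partial>lborel)"
      using gk by simp
    also have "\<dots> \<le> (\<integral>z. g z * (sintegral (D UNIV z) ?\<phi> - \<kappa> * ?R z) + C' * (1 / real m) * g z \<partial>lborel)"
    proof (rule integral_mono)
      show "integrable lborel (\<lambda>z. (\<Sum>k\<in>{1..m}. g z * (smeasure (D UNIV z) {w. yk k \<le> w} - \<kappa> * ?R z)) / real m)"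
        using gk by simp
      have "integrable lborel (\<lambda>z. (g z * sintegral (D UNIV z) ?\<phi> - \<kappa> * (g z * ?R z)) + C' * (1 / real m) * g z)"
        using gS[of UNIV] gphi g(1) by simp
      then show "integrable lborel (\<lambda>z. g z * (sintegral (D UNIV z) ?\<phi> - \<kappa> * ?R z) + C' * (1 / real m) * g z)"
        by (simp add: right_diff_distrib mult.left_commute)
      fix z
      have "(\<Sum>k\<in>{1..m}. g z * (smeasure (D UNIV z) {w. yk k \<le> w} - \<kappa> * ?R z)) / real m = g z * (sintegral (D UNIV z) \<phi>m' - \<kappa> * ?R z)"
        unfolding sm' using m by (simp add: sum_subtractf right_diff_distrib sum_distrib_left[symmetric] diff_divide_distrib)
      also have "\<dots> \<le> g z * (sintegral (D UNIV z) ?\<phi> + C' * (1 / real m) - \<kappa> * ?R z)"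
        using close[of z] by (intro mult_left_mono g(2)) linarith
      finally show "(\<Sum>k\<in>{1..m}. g z * (smeasure (D UNIV z) {w. yk k \<le> w} - \<kappa> * ?R z)) / real m
         \<le> g z * (sintegral (D UNIV z) ?\<phi> - \<kappa> * ?R z) + C' * (1 / real m) * g z" by (simp add: algebra_simps)
    qed
    also have "\<dots> = ?S + C' * (1 / real m) * (\<integral>z. g z \<partial>lborel)"
    proof -
      have "integrable lborel (\<lambda>z. g z * sintegral (D UNIV z) ?\<phi> - \<kappa> * (g z * ?R z))" using gS[of UNIV] gphi by simp
      then have "integrable lborel (\<lambda>z. g z * (sintegral (D UNIV z) ?\<phi> - \<kappa> * ?R z))"
        by (simp add: right_diff_distrib mult.left_commute)
      then show ?thesis using g(1) by simp
    qed
    finally show ?thesis by (simp add: m_def inverse_eq_divide mult_ac)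
  qed
  have "(\<lambda>n. - (C' * (\<integral>z. g z \<partial>lborel)) * inverse (real (Suc n))) \<longlonglongrightarrow> - (C' * (\<integral>z. g z \<partial>lborel)) * 0"
    by (intro tendsto_intros LIMSEQ_inverse_real_of_nat)
  then show ?thesis
    using LIMSEQ_le_const2[of "\<lambda>n. - (C' * (\<integral>z. g z \<partial>lborel)) * inverse (real (Suc n))" 0 ?S] bound by auto
qed

text \<open>Were the continuous expression negative at \<open>p\<close>, it would be negative near
  \<open>p\<close>. A bump there vanishes on all proper faces at each vertex \<open>y'\<close> by
  \<open>away\<close>, and on its support the orthant indicator has the constant value
  \<open>\<kappa>\<close> by \<open>side\<close>. The maximum principle at \<open>y'\<close>
  therefore makes the integral nonnegative for every such vertex, and averaging over the vertices is
  a contradiction.\<close>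

lemma smoothed_sign:
  fixes \<nu> :: "real ^ 'n \<Rightarrow> (real ^ 'n) measure"
  assumes nu: "bounded_kernel \<nu>" and D: "kernel_mixed_derivatives \<nu> D"
    and gen: "generates_C_Feller vanishing_test_functions (pareto_dual_generator \<nu>) Y"
    and eps: "0 < \<epsilon>"
    and away: "\<And>y' I w. (\<And>i. y $ i - 2 * \<epsilon> \<le> y' $ i \<and> y' $ i \<le> y $ i - \<epsilon>) \<Longrightarrow> y' \<le> glue I y' w \<Longrightarrow> I \<noteq> UNIV \<Longrightarrow>
      \<exists>i. \<epsilon> \<le> \<bar>glue I y' w $ i - p $ i\<bar>"
    and side: "\<And>y' w. (\<And>i. y $ i - 2 * \<epsilon> \<le> y' $ i \<and> y' $ i \<le> y $ i - \<epsilon>) \<Longrightarrow> (\<And>i. \<bar>w $ i - p $ i\<bar> < \<epsilon>) \<Longrightarrow>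
      \<kappa> = (if y' \<le> w then 1 else 0)"
  shows "0 \<le> sintegral (D UNIV p) (ramp y \<epsilon>) - \<kappa> * smeasure (D UNIV p) UNIV"
proof (rule ccontr)
  let ?S = "\<lambda>z. sintegral (D UNIV z) (ramp y \<epsilon>) - \<kappa> * smeasure (D UNIV z) UNIV"
  assume "\<not> 0 \<le> ?S p"
  then have neg: "?S p < 0" by simp
  define s where "s = ?S p"
  define a where "a = - s / 2"
  have "s < 0" using neg by (simp only: s_def)
  then have "0 < a" "s < - a" by (simp_all add: a_def)
  then have a: "0 < a" "?S p < - a" by (simp_all only: s_def)
  have \<phi>: "ramp y \<epsilon> \<in> bounded_continuous" by (rule ramp_bounded_continuous[OF eps])
  have cont: "continuous_on UNIV ?S"
    by (intro continuous_intros kernel_mixed_derivativesD(2)[OF D \<phi>] smeasure_UNIV_derivatives(2)[OF nu D])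
  have "open {w. ?S w < - a}" by (intro open_Collect_less continuous_on_const cont)
  then obtain d where d: "0 < d" "\<And>w. dist w p < d \<Longrightarrow> ?S w < - a" unfolding open_dist using a(2) by blast
  define \<rho> where "\<rho> = min \<epsilon> (d / (2 * real CARD('n)))"
  have \<rho>: "0 < \<rho>" "\<rho> \<le> \<epsilon>" using eps d(1) by (auto simp: \<rho>_def)
  have near: "?S w < - a" if "\<And>i. \<bar>w $ i - p $ i\<bar> \<le> \<rho>" for w
  proof (rule d(2))
    have "dist w p \<le> real CARD('n) * \<rho>" by (rule dist_vec_le_box[OF that])
    also have "\<dots> \<le> real CARD('n) * (d / (2 * real CARD('n)))" by (intro mult_left_mono) (auto simp: \<rho>_def)
    also have "\<dots> < d" using d(1) by simp
    finally show "dist w p < d" .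
  qed
  define g where "g = tensor (\<lambda>i t. bump ((t - p $ i) / \<rho>))"
  have g: "g \<in> vanishing_test_functions"
    unfolding g_def by (rule tensor_vanishing[OF smooth_factors_bump[where a="\<lambda>_. \<rho>" and p="($) p"]]) (rule \<rho>)
  have gi: "integrable lborel g" using g unfolding vanishing_test_functions_def by blast
  have gnn: "0 \<le> g z" for z unfolding g_def by (intro prod_nonneg) simp
  have gzero: "g z = 0" if "\<rho> \<le> \<bar>z $ i - p $ i\<bar>" for z i
  proof -
    have "1 \<le> \<bar>(z $ i - p $ i) / \<rho>\<bar>" using that \<rho> by simp
    from bump_outside(1)[OF this] show ?thesis unfolding g_def by (intro prod_zero) auto
  qed
  have ig: "0 < (\<integral>z. g z \<partial>lborel)"
  proof -
    have "(\<integral>z. g z \<partial>lborel) = (\<integral>z. g (glue UNIV 0 z) \<partial>lborel_pi UNIV)"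
      using gi by (intro lborel_integral_glue) (simp add: borel_measurable_integrable)
    also have "\<dots> = (\<Prod>i\<in>(UNIV::'n set). \<rho> * (\<integral>t. bump t \<partial>lborel))"
      unfolding g_def using bump_product_integral(2)[of "\<lambda>_. \<rho>" UNIV "($) p"] \<rho> by simp
    also have "\<dots> > 0" using \<rho> integral_bump by (intro prod_pos) auto
    finally show ?thesis .
  qed
  have "0 \<le> (\<integral>z. g z * ?S z \<partial>lborel)"
  proof (rule ramp_average_nonneg[OF nu D eps gi gnn])
    fix y' :: "real ^ 'n" assume y': "\<And>i. y $ i - 2 * \<epsilon> \<le> y' $ i \<and> y' $ i \<le> y $ i - \<epsilon>"
    have gl: "g (glue I y' w) = 0" if "y' \<le> glue I y' w" "I \<noteq> UNIV" for I w
    proof -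
      from away[OF y' that] obtain i where "\<epsilon> \<le> \<bar>glue I y' w $ i - p $ i\<bar>" by blast
      then show ?thesis using \<rho>(2) by (intro gzero[of _ i]) linarith
    qed
    have gy: "g y' = 0" using gl[of "{}" undefined] by simp
    have dm: "dual_density D y' UNIV \<in> borel_measurable borel" by (rule dual_density_measurable[OF D])
    have gm: "g \<in> borel_measurable borel" using gi by (simp add: borel_measurable_integrable)
    have "0 \<le> pareto_dual_generator \<nu> g y'"
      by (rule generator_nonneg_at_minimum[OF gen g gnn gy])
    also have "\<dots> = (\<Sum>J\<in>{J. J \<noteq> {}}. \<integral>z. g (glue J y' z) * dual_density D y' J (glue J y' z) \<partial>lborel_pi J)"
      unfolding pareto_dual_generator_faces[OF nu D g] by (simp add: gy)
    also have "\<dots> = (\<Sum>J\<in>{UNIV}. \<integral>z. g (glue J y' z) * dual_density D y' J (glue J y' z) \<partial>lborel_pi J)"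
    proof (rule sum.mono_neutral_right)
      show "\<forall>J\<in>{J. J \<noteq> {}} - {UNIV}. (\<integral>z. g (glue J y' z) * dual_density D y' J (glue J y' z) \<partial>lborel_pi J) = 0"
      proof
        fix J :: "'n set" assume J: "J \<in> {J. J \<noteq> {}} - {UNIV}"
        have z0: "g (glue J y' z) * dual_density D y' J (glue J y' z) = 0" for z
          using gl[of J z] J by (cases "y' \<le> glue J y' z") (auto simp: dual_density_def)
        show "(\<integral>z. g (glue J y' z) * dual_density D y' J (glue J y' z) \<partial>lborel_pi J) = 0" unfolding z0 by simp
      qed
    qed auto
    also have "\<dots> = (\<integral>z. g z * dual_density D y' UNIV z \<partial>lborel)"
      using lborel_integral_glue[of "\<lambda>z. g z * dual_density D y' UNIV z" y'] dm gm by simp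
    also have "\<dots> = (\<integral>z. g z * (smeasure (D UNIV z) {w. y' \<le> w} - \<kappa> * smeasure (D UNIV z) UNIV) \<partial>lborel)"
    proof (intro Bochner_Integration.integral_cong refl)
      fix z
      show "g z * dual_density D y' UNIV z = g z * (smeasure (D UNIV z) {w. y' \<le> w} - \<kappa> * smeasure (D UNIV z) UNIV)"
      proof (cases "\<forall>i. \<bar>z $ i - p $ i\<bar> < \<rho>")
        case True
        then have "\<kappa> = (if y' \<le> z then 1 else 0)" using \<rho>(2) by (intro side[OF y']) (auto intro: less_le_trans)
        then show ?thesis by (simp add: dual_density_UNIV[OF D])
      next
        case False
        then show ?thesis using gzero[of z] by (auto simp: not_less)
      qed
    qed
    finally show "0 \<le> (\<integral>z. g z * (smeasure (D UNIV z) {w. y' \<le> w} - \<kappa> * smeasure (D UNIV z) UNIV) \<partial>lborel)" .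
  qed
  also have "\<dots> \<le> (\<integral>z. - a * g z \<partial>lborel)"
  proof (cases "integrable lborel (\<lambda>z. g z * ?S z)")
    case True
    then show ?thesis
    proof (rule integral_mono)
      show "integrable lborel (\<lambda>z. - a * g z)" using gi by simp
      fix z
      show "g z * ?S z \<le> - a * g z"
      proof (cases "\<forall>i. \<bar>z $ i - p $ i\<bar> < \<rho>")
        case True
        then have "?S z < - a" by (intro near) (auto intro: less_imp_le)
        then have "g z * ?S z \<le> g z * (- a)" using gnn by (intro mult_left_mono) auto
        then show ?thesis by (simp add: mult.commute)
      next
        case False
        then show ?thesis using gzero[of z] by (auto simp: not_less)
      qed
    qed
  next
    \<comment> \<open>This case is contradictory: the second factor is bounded and measurable, and
      \<open>g\<close> is integrable.\<close>
    case False
    obtain C where C0: "0 < C" and C: "\<And>I z A. \<bar>smeasure (D I z) A\<bar> \<le> C" using smeasure_bound[OF D] by blast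
    obtain C' where C': "0 < C'" "\<forall>I z \<phi> b. \<phi> \<in> borel_measurable borel \<longrightarrow> (\<forall>w. \<bar>\<phi> w\<bar> \<le> b) \<longrightarrow> \<bar>sintegral (D I z) \<phi>\<bar> \<le> C' * b"
      by (rule sintegral_bound[OF D])
    have "integrable lborel (\<lambda>z. g z * ?S z)"
    proof (rule integrable_bounded_mult[OF gi])
      show "?S \<in> borel_measurable lborel" using borel_measurable_continuous_onI[OF cont] by simp
      fix z
      have "\<bar>ramp y \<epsilon> w\<bar> \<le> 1" for w using ramp_bounds[of y \<epsilon> w] by simp
      then have "\<bar>sintegral (D UNIV z) (ramp y \<epsilon>)\<bar> \<le> C' * 1" using C'(2) bounded_continuous_measurable[OF \<phi>] by blast
      moreover have "\<bar>\<kappa> * smeasure (D UNIV z) UNIV\<bar> \<le> \<bar>\<kappa>\<bar> * C" unfolding abs_mult by (intro mult_left_mono C) simp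
      ultimately show "\<bar>?S z\<bar> \<le> C' + \<bar>\<kappa>\<bar> * C" by linarith
    qed
    then show ?thesis using False by simp
  qed
  also have "\<dots> = - (a * (\<integral>z. g z \<partial>lborel))" by simp
  also have "\<dots> < 0" using a ig by simp
  finally show False by simp
qed

text \<open>Both signs are instances of \<open>smoothed_sign\<close>, with
  \<open>\<kappa> = 0\<close> off the orthant and \<open>\<kappa> = 1\<close> in it. As
  \<open>\<epsilon>\<close> tends to 0 the ramps converge to the indicator of the closed orthant,
  boundary included.\<close>

proposition top_derivative_signs_necessary:
  fixes \<nu> :: "real ^ 'n \<Rightarrow> (real ^ 'n) measure"
  assumes nu: "bounded_kernel \<nu>" and D: "kernel_mixed_derivatives \<nu> D"
    and gen: "generates_C_Feller vanishing_test_functions (pareto_dual_generator \<nu>) Y"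
  shows "top_derivative_signs D"
proof -
  have lim: "0 \<le> smeasure (D UNIV z) {w. y \<le> w} - \<kappa> * smeasure (D UNIV z) UNIV"
    if e: "0 < e" and s: "\<And>\<epsilon>. 0 < \<epsilon> \<Longrightarrow> \<epsilon> \<le> e \<Longrightarrow> 0 \<le> sintegral (D UNIV z) (ramp y \<epsilon>) - \<kappa> * smeasure (D UNIV z) UNIV" for e \<kappa> y z
  proof (rule LIMSEQ_le_const)
    have pos: "0 < e / real (Suc k)" "e / real (Suc k) \<le> e" for k using e by (auto simp: field_simps)
    have "(\<lambda>k. sintegral (D UNIV z) (ramp y (e / real (Suc k)))) \<longlonglongrightarrow> smeasure (D UNIV z) {w. y \<le> w}"
    proof (rule smeasure_closed_approximation[where \<phi>="\<lambda>k. ramp y (e / real (Suc k))", OF D closed_vec_ge])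
      show "ramp y (e / real (Suc k)) \<in> bounded_continuous" for k by (rule ramp_bounded_continuous[OF pos(1)])
      show "(\<lambda>k. ramp y (e / real (Suc k)) w) \<longlonglongrightarrow> indicator {w. y \<le> w} w" for w by (rule ramp_tendsto[OF e])
    qed (rule ramp_bounds)+
    then show "(\<lambda>k. sintegral (D UNIV z) (ramp y (e / real (Suc k))) - \<kappa> * smeasure (D UNIV z) UNIV)
       \<longlonglongrightarrow> smeasure (D UNIV z) {w. y \<le> w} - \<kappa> * smeasure (D UNIV z) UNIV" by (intro tendsto_intros)
    show "\<exists>N. \<forall>n\<ge>N. 0 \<le> sintegral (D UNIV z) (ramp y (e / real (Suc n))) - \<kappa> * smeasure (D UNIV z) UNIV"
      using s[OF pos] by blast
  qed
  show ?thesis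
    unfolding top_derivative_signs_def
  proof (intro allI conjI impI)
    fix y z :: "real ^ 'n"
    assume "\<not> y \<le> z"
    then obtain j where j: "z $ j < y $ j" by (auto simp: less_eq_vec_def not_le)
    \<comment> \<open>With \<open>\<epsilon>\<close> at most a third of the gap, every admissible
      vertex, and every point above it, exceeds \<open>z\<close> by at least
      \<open>\<epsilon>\<close> in coordinate \<open>j\<close>.\<close>
    define e where "e = (y $ j - z $ j) / 3"
    have e: "0 < e" using j by (simp add: e_def)
    have far: "\<epsilon> \<le> w $ j - z $ j" if "0 < \<epsilon>" "\<epsilon> \<le> e" "\<And>i. y $ i - 2 * \<epsilon> \<le> y' $ i \<and> y' $ i \<le> y $ i - \<epsilon>" "y' \<le> w" for \<epsilon> y' w
    proof -
      have "y $ j - 2 * \<epsilon> \<le> y' $ j" "y' $ j \<le> w $ j" using that(3)[of j] that(4) by (auto simp: less_eq_vec_def)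
      moreover have "3 * \<epsilon> \<le> y $ j - z $ j" using that(2) by (simp add: e_def)
      ultimately show ?thesis by linarith
    qed
    have "0 \<le> smeasure (D UNIV z) {w. y \<le> w} - 0 * smeasure (D UNIV z) UNIV"
    proof (rule lim[OF e])
      fix \<epsilon> assume eps: "0 < \<epsilon>" "\<epsilon> \<le> e"
      show "0 \<le> sintegral (D UNIV z) (ramp y \<epsilon>) - 0 * smeasure (D UNIV z) UNIV"
      proof (rule smoothed_sign[OF nu D gen eps(1)])
        fix y' w :: "real ^ 'n" assume y': "\<And>i. y $ i - 2 * \<epsilon> \<le> y' $ i \<and> y' $ i \<le> y $ i - \<epsilon>"
        show "0 = (if y' \<le> w then 1 else 0 :: real)" if "\<And>i. \<bar>w $ i - z $ i\<bar> < \<epsilon>"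
        proof -
          have "\<not> y' \<le> w" using far[OF eps y', of w] that[of j] by linarith
          then show ?thesis by simp
        qed
      next
        fix y' :: "real ^ 'n" and w I assume y': "\<And>i. y $ i - 2 * \<epsilon> \<le> y' $ i \<and> y' $ i \<le> y $ i - \<epsilon>" and "y' \<le> glue I y' w"
        from far[OF eps this] show "\<exists>i. \<epsilon> \<le> \<bar>glue I y' w $ i - z $ i\<bar>" by (intro exI[of _ j]) linarith
      qed
    qed
    then show "0 \<le> smeasure (D UNIV z) {w. y \<le> w}" by simp
  next
    fix y z :: "real ^ 'n"
    assume yz: "y \<le> z"
    \<comment> \<open>The admissible vertices lie at least \<open>\<epsilon>\<close> below
      \<open>y\<close>, hence below \<open>z\<close>, in every coordinate. The bump around
      \<open>z\<close> stays inside their orthants and misses all proper faces for every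
      \<open>\<epsilon>\<close>, so the range up to 1 is an arbitrary choice.\<close>
    have "0 \<le> smeasure (D UNIV z) {w. y \<le> w} - 1 * smeasure (D UNIV z) UNIV"
    proof (rule lim[of 1])
      fix \<epsilon> :: real assume eps: "0 < \<epsilon>" "\<epsilon> \<le> 1"
      show "0 \<le> sintegral (D UNIV z) (ramp y \<epsilon>) - 1 * smeasure (D UNIV z) UNIV"
      proof (rule smoothed_sign[OF nu D gen eps(1)])
        fix y' w :: "real ^ 'n" assume y': "\<And>i. y $ i - 2 * \<epsilon> \<le> y' $ i \<and> y' $ i \<le> y $ i - \<epsilon>"
        show "1 = (if y' \<le> w then 1 else 0 :: real)" if "\<And>i. \<bar>w $ i - z $ i\<bar> < \<epsilon>"
        proof -
          have "y' $ i \<le> w $ i" for i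
          proof -
            have "y $ i \<le> z $ i" using yz by (simp add: less_eq_vec_def)
            then show ?thesis using y'[of i] that[of i] by linarith
          qed
          then show ?thesis by (simp add: less_eq_vec_def)
        qed
      next
        fix y' :: "real ^ 'n" and w and I :: "'n set" assume y': "\<And>i. y $ i - 2 * \<epsilon> \<le> y' $ i \<and> y' $ i \<le> y $ i - \<epsilon>" and "I \<noteq> UNIV"
        then obtain i where i: "i \<notin> I" by blast
        have "y $ i \<le> z $ i" using yz by (simp add: less_eq_vec_def)
        then have "\<epsilon> \<le> \<bar>glue I y' w $ i - z $ i\<bar>" using y'[of i] i by simp
        then show "\<exists>i. \<epsilon> \<le> \<bar>glue I y' w $ i - z $ i\<bar>" by blast
      qed
    qed simp
    then show "smeasure (D UNIV z) {w. \<not> y \<le> w} \<le> 0" by (simp add: smeasure_compl[OF D])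
  qed
qed

section \<open>The kernel of the dual process\<close>

definition corner :: "('n \<Rightarrow> real) \<Rightarrow> ('n \<Rightarrow> real) \<Rightarrow> 'n set \<Rightarrow> 'n \<Rightarrow> real" where
  "corner a x K i = (if i \<in> K then a i else x i)"

text \<open>Inclusion and exclusion: each coordinate in \<open>J\<close> contributes a difference of
  an upper and a lower value, and \<open>K\<close> records the coordinates in which the lower one is
  chosen.\<close>

lemma corner_integral:
  fixes h :: "real ^ 'n \<Rightarrow> real"
  assumes md: "mixed_derivatives h H" and cont: "\<And>I. continuous_on UNIV (H I)" and le: "\<And>i. a i \<le> x i"
  shows "(\<integral>z. (if \<forall>i\<in>J. a i \<le> z i \<and> z i \<le> x i then H J (glue J c z) else 0) \<partial>lborel_pi J) =
    (\<Sum>K\<in>Pow J. (-1) ^ card K * h (glue J c (corner a x K)))"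
proof -
  have "finite J" by simp
  then show ?thesis
  proof (induction J arbitrary: c rule: finite_induct)
    case empty
    have "H {} = h" using mixed_derivatives_empty[OF md] .
    then show ?case by (simp add: PiM_empty)
  next
    case (insert j J)
    note j = insert.hyps(2)
    let ?b = "\<lambda>z. \<forall>i\<in>J. a i \<le> z i \<and> z i \<le> x i"
    have up: "vupd (glue J c z) j t = glue J (vupd c j t) z" for z t
      using glue_vupd[OF j, of c t z] by simp
    have "(\<integral>z. (if \<forall>i\<in>insert j J. a i \<le> z i \<and> z i \<le> x i then H (insert j J) (glue (insert j J) c z) else 0) \<partial>lborel_pi (insert j J))
      = (\<integral>z. (if ?b z then H J (glue J (vupd c j (x j)) z) - H J (glue J (vupd c j (a j)) z) else 0) \<partial>lborel_pi J)"
      unfolding integral_face_insert[OF cont j] unfolding mixed_derivatives_FTC[OF md cont j le] unfolding up ..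
    also have "\<dots> = (\<integral>z. (if ?b z then H J (glue J (vupd c j (x j)) z) else 0) - (if ?b z then H J (glue J (vupd c j (a j)) z) else 0) \<partial>lborel_pi J)"
      by (intro Bochner_Integration.integral_cong) auto
    also have "\<dots> = (\<Sum>K\<in>Pow J. (-1) ^ card K * h (glue J (vupd c j (x j)) (corner a x K))) - (\<Sum>K\<in>Pow J. (-1) ^ card K * h (glue J (vupd c j (a j)) (corner a x K)))"
      unfolding insert.IH[symmetric] by (intro Bochner_Integration.integral_diff face_integrable[OF cont])
    also have "(\<Sum>K\<in>Pow J. (-1) ^ card K * h (glue J (vupd c j (x j)) (corner a x K))) = (\<Sum>K\<in>Pow J. (-1) ^ card K * h (glue (insert j J) c (corner a x K)))"
    proof (intro sum.cong refl)
      fix K assume "K \<in> Pow J"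
      then have "glue J (vupd c j (x j)) (corner a x K) = glue (insert j J) c (corner a x K)"
        using j by (auto simp: vec_eq_iff corner_def)
      then show "(-1) ^ card K * h (glue J (vupd c j (x j)) (corner a x K)) = (-1) ^ card K * h (glue (insert j J) c (corner a x K))" by simp
    qed
    also have "(\<Sum>K\<in>Pow J. (-1) ^ card K * h (glue J (vupd c j (a j)) (corner a x K))) = - (\<Sum>K\<in>insert j ` Pow J. (-1) ^ card K * h (glue (insert j J) c (corner a x K)))"
    proof -
      have inj: "inj_on (insert j) (Pow J)"
        using j by (intro inj_onI) (metis PowD insert_ident subsetD)
      have "(-1) ^ card K * h (glue J (vupd c j (a j)) (corner a x K)) = - ((-1) ^ card (insert j K) * h (glue (insert j J) c (corner a x (insert j K))))" if "K \<in> Pow J" for K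
      proof -
        have "j \<notin> K" using that j by auto
        then have "card (insert j K) = Suc (card K)" by simp
        moreover have "glue J (vupd c j (a j)) (corner a x K) = glue (insert j J) c (corner a x (insert j K))"
          using that j by (auto simp: vec_eq_iff corner_def)
        ultimately show ?thesis by simp
      qed
      then show ?thesis by (simp add: sum.reindex[OF inj] sum_negf)
    qed
    also have "(\<Sum>K\<in>Pow J. (-1) ^ card K * h (glue (insert j J) c (corner a x K))) - - (\<Sum>K\<in>insert j ` Pow J. (-1) ^ card K * h (glue (insert j J) c (corner a x K)))
      = (\<Sum>K\<in>Pow (insert j J). (-1) ^ card K * h (glue (insert j J) c (corner a x K)))"
      unfolding Pow_insert using j by (subst sum.union_disjoint) auto
    finally show ?case .
  qed
qed

lemma tendsto_if_const:
  fixes X :: "_ \<Rightarrow> real"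
  assumes "(X \<longlongrightarrow> l) F"
  shows "((\<lambda>k. if P then X k else 0) \<longlongrightarrow> (if P then l else 0)) F"
  using assms by (cases P) auto

text \<open>The identity holds for bounded continuous integrands and passes to the closed set by
  dominated convergence on the box.\<close>

lemma corner_integral_closed:
  fixes \<nu> :: "real ^ 'n \<Rightarrow> (real ^ 'n) measure"
  assumes nu: "bounded_kernel \<nu>" and D: "kernel_mixed_derivatives \<nu> D" and A: "closed A" and le: "\<And>i. a i \<le> x i"
  shows "(\<integral>z. (if \<forall>i. a i \<le> z i \<and> z i \<le> x i then smeasure (D UNIV (glue UNIV c z)) A else 0) \<partial>lborel_pi UNIV) =
    (\<Sum>K\<in>UNIV. (-1) ^ card K * measure (\<nu> (glue UNIV c (corner a x K))) A)"
proof -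
  obtain \<phi> :: "nat \<Rightarrow> real ^ 'n \<Rightarrow> real" where \<phi>: "\<And>k. \<phi> k \<in> bounded_continuous" "\<And>k w. 0 \<le> \<phi> k w" "\<And>k w. \<phi> k w \<le> 1"
    "\<And>w. (\<lambda>k. \<phi> k w) \<longlonglongrightarrow> indicator A w" using closed_approximation[OF A] by blast
  obtain C where C: "0 < C" "\<forall>I z \<phi> b. \<phi> \<in> borel_measurable borel \<longrightarrow> (\<forall>w. \<bar>\<phi> w\<bar> \<le> b) \<longrightarrow> \<bar>sintegral (D I z) \<phi>\<bar> \<le> C * b"
    by (rule sintegral_bound[OF D])
  have fb: "finite_borel (\<nu> x)" for x using nu by (rule bounded_kernel_finite_borel)
  let ?B = "{z \<in> space (lborel_pi UNIV). \<forall>i\<in>UNIV. a i \<le> z i \<and> z i \<le> x i}"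
  have eq: "(\<integral>z. (if \<forall>i. a i \<le> z i \<and> z i \<le> x i then sintegral (D UNIV (glue UNIV c z)) (\<phi> k) else 0) \<partial>lborel_pi UNIV) =
    (\<Sum>K\<in>UNIV. (-1) ^ card K * (\<integral>w. \<phi> k w \<partial>\<nu> (glue UNIV c (corner a x K))))" for k
    using corner_integral[OF kernel_mixed_derivativesD[OF D \<phi>(1)[of k]] le, where J=UNIV and c=c] by simp
  show ?thesis
  proof (rule LIMSEQ_unique)
    show "(\<lambda>k. \<integral>z. (if \<forall>i. a i \<le> z i \<and> z i \<le> x i then sintegral (D UNIV (glue UNIV c z)) (\<phi> k) else 0) \<partial>lborel_pi UNIV)
      \<longlonglongrightarrow> (\<Sum>K\<in>UNIV. (-1) ^ card K * measure (\<nu> (glue UNIV c (corner a x K))) A)"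
      unfolding eq
    proof (intro tendsto_sum tendsto_mult tendsto_const)
      show "(\<lambda>k. \<integral>w. \<phi> k w \<partial>\<nu> (glue UNIV c (corner a x K))) \<longlonglongrightarrow> measure (\<nu> (glue UNIV c (corner a x K))) A" for K
        by (rule integral_closed_approximation[where \<phi>=\<phi>]) (fact fb A \<phi>)+
    qed
    show "(\<lambda>k. \<integral>z. (if \<forall>i. a i \<le> z i \<and> z i \<le> x i then sintegral (D UNIV (glue UNIV c z)) (\<phi> k) else 0) \<partial>lborel_pi UNIV)
      \<longlonglongrightarrow> (\<integral>z. (if \<forall>i. a i \<le> z i \<and> z i \<le> x i then smeasure (D UNIV (glue UNIV c z)) A else 0) \<partial>lborel_pi UNIV)"
    proof (rule integral_dominated_convergence)
      have [measurable]: "(\<lambda>z. sintegral (D UNIV z) (\<phi> k)) \<in> borel_measurable borel" for k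
        by (rule borel_measurable_continuous_onI[OF kernel_mixed_derivativesD(2)[OF D \<phi>(1)]])
      have [measurable]: "(\<lambda>z. smeasure (D UNIV z) A) \<in> borel_measurable borel"
        using D A by (intro smeasure_measurable borel_closed)
      show "(\<lambda>z. if \<forall>i. a i \<le> z i \<and> z i \<le> x i then smeasure (D UNIV (glue UNIV c z)) A else 0) \<in> borel_measurable (lborel_pi UNIV)"
        "\<And>k. (\<lambda>z. if \<forall>i. a i \<le> z i \<and> z i \<le> x i then sintegral (D UNIV (glue UNIV c z)) (\<phi> k) else 0) \<in> borel_measurable (lborel_pi UNIV)"
        by measurable
      show "integrable (lborel_pi UNIV) (\<lambda>z. C * indicator ?B z)"
        using lborel_pi_box[of UNIV a x] by simp
      show "AE z in lborel_pi UNIV. (\<lambda>k. if \<forall>i. a i \<le> z i \<and> z i \<le> x i then sintegral (D UNIV (glue UNIV c z)) (\<phi> k) else 0)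
         \<longlonglongrightarrow> (if \<forall>i. a i \<le> z i \<and> z i \<le> x i then smeasure (D UNIV (glue UNIV c z)) A else 0)"
      proof (intro AE_I2)
        fix z
        have "(\<lambda>k. sintegral (D UNIV (glue UNIV c z)) (\<phi> k)) \<longlonglongrightarrow> smeasure (D UNIV (glue UNIV c z)) A"
          by (rule smeasure_closed_approximation[where \<phi>=\<phi>]) (fact D A \<phi>)+
        then show "(\<lambda>k. if \<forall>i. a i \<le> z i \<and> z i \<le> x i then sintegral (D UNIV (glue UNIV c z)) (\<phi> k) else 0)
         \<longlonglongrightarrow> (if \<forall>i. a i \<le> z i \<and> z i \<le> x i then smeasure (D UNIV (glue UNIV c z)) A else 0)" by (rule tendsto_if_const)
      qed
      have "\<bar>\<phi> k w\<bar> \<le> 1" for k w using \<phi>(2)[of k w] \<phi>(3)[of k w] by linarith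
      then have "\<bar>sintegral (D UNIV z) (\<phi> k)\<bar> \<le> C * 1" for k z using C(2) bounded_continuous_measurable[OF \<phi>(1)] by blast
      then show "AE z in lborel_pi UNIV. norm (if \<forall>i. a i \<le> z i \<and> z i \<le> x i then sintegral (D UNIV (glue UNIV c z)) (\<phi> k) else 0) \<le> C * indicator ?B z" for k
        by (intro AE_I2) (auto simp: indicator_def)
    qed
  qed
qed

lemma nn_integral_eq_ennreal:
  fixes f :: "'a \<Rightarrow> real"
  assumes "integrable M f" "\<And>x. 0 \<le> f x"
  shows "(\<integral>\<^sup>+x. ennreal (f x) \<partial>M) = ennreal (\<integral>x. f x \<partial>M)" "0 \<le> (\<integral>x. f x \<partial>M)"
  using assms by (auto intro!: nn_integral_eq_integral integral_nonneg)

section \<open>Masses of the dual kernel\<close>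

locale dual_kernel =
  fixes \<nu> :: "real ^ 'n \<Rightarrow> (real ^ 'n) measure" and D :: "'n set \<Rightarrow> real ^ 'n \<Rightarrow> (real ^ 'n) signed_measure"
  assumes nu: "bounded_kernel \<nu>" and wc: "weakly_continuous \<nu>" and D: "kernel_mixed_derivatives \<nu> D"
    and proper: "pareto_proper \<nu>" and nonpos: "nonpositive_rate_derivatives D" and signs: "top_derivative_signs D"
begin

abbreviation rate :: "real ^ 'n \<Rightarrow> real" where "rate z \<equiv> measure (\<nu> z) UNIV"

abbreviation dens :: "real ^ 'n \<Rightarrow> 'n set \<Rightarrow> real ^ 'n \<Rightarrow> real" where "dens \<equiv> dual_density D"

lemma dens_nonneg: "I \<noteq> {} \<Longrightarrow> 0 \<le> dens y I z"
  using nonpos signs unfolding nonpositive_rate_derivatives_def top_derivative_signs_def dual_density_def by simp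

lemma dens_measurable [measurable]: "dens y I \<in> borel_measurable borel"
  by (rule dual_density_measurable[OF D])

lemma fb: "finite_borel (\<nu> x)"
  using nu by (rule bounded_kernel_finite_borel)

lemma rate_cont: "continuous_on UNIV (\<lambda>z. smeasure (D I z) UNIV)"
  by (rule smeasure_UNIV_derivatives(2)[OF nu D])

text \<open>The terms in the expansion of \<open>rate x\<close> over the faces at \<open>y\<close>
  of the box between \<open>y\<close> and \<open>x\<close>. The guard is essential on faces other
  than the full one, whose box condition does not see the coordinates outside
  \<open>I\<close>.\<close>

definition rate_int :: "real ^ 'n \<Rightarrow> real ^ 'n \<Rightarrow> 'n set \<Rightarrow> real" where
  "rate_int y x I = (if y \<le> x then
     \<integral>z. (if \<forall>i\<in>I. y $ i \<le> z i \<and> z i \<le> x $ i then smeasure (D I (glue I y z)) UNIV else 0) \<partial>lborel_pi I else 0)"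

lemma proper_minus_infinity:
  "((\<lambda>s. measure (\<nu> (vupd x i s)) {w. y \<le> w}) \<longlongrightarrow> 0) at_bot"
  using proper unfolding pareto_proper_def vupd_def by blast

lemma hyperplane_null: "measure (\<nu> x) {w. w $ i = c} = 0"
  using proper unfolding pareto_proper_def by blast

lemma if_diff:
  fixes u v :: real
  assumes "P \<and> R \<longleftrightarrow> Q"
  shows "(if P then u - (if R then v else 0) else 0) = (if P then u else 0) - (if Q then v else 0)"
  using assms by (cases P; cases R) auto

text \<open>\<open>S\<close> is the set of coordinates whose lower bound has been sent to minus
  infinity. For \<open>S = {}\<close> this is the alternating sum over corners, with the part above
  \<open>y\<close> corrected by the total mass. When a further bound recedes, the left side grows
  monotonically and every corner using that bound disappears by properness. Nonnegativity is carried
  along because \<open>ennreal\<close> truncates negative values.\<close>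

lemma top_density_boxes:
  assumes a: "\<And>i. a i \<le> x $ i" "\<And>i. a i \<le> y $ i"
  shows "(\<integral>\<^sup>+z. (if (\<forall>i\<in>- S. a i \<le> z i) \<and> glue UNIV y z \<le> x then ennreal (dens y UNIV (glue UNIV y z)) else 0) \<partial>lborel_pi UNIV) =
      ennreal ((\<Sum>K\<in>Pow (- S). (-1) ^ card K * measure (\<nu> (glue UNIV y (corner a (($) x) K))) {w. y \<le> w}) - rate_int y x UNIV)"
    "0 \<le> (\<Sum>K\<in>Pow (- S). (-1) ^ card K * measure (\<nu> (glue UNIV y (corner a (($) x) K))) {w. y \<le> w}) - rate_int y x UNIV"
proof -
  let ?m = "\<lambda>z. ennreal (dens y UNIV (glue UNIV y z))"
  let ?L = "\<lambda>S a. \<integral>\<^sup>+z. (if (\<forall>i\<in>- S. a i \<le> z i) \<and> glue UNIV y z \<le> x then ?m z else 0) \<partial>lborel_pi UNIV"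
  let ?C = "\<lambda>a K. (-1) ^ card K * measure (\<nu> (glue UNIV y (corner a (($) x) K))) {w. y \<le> w}"
  let ?E = "\<lambda>S a. (\<Sum>K\<in>Pow (- S). ?C a K) - rate_int y x UNIV"
  have [measurable]: "Measurable.pred (lborel_pi UNIV) (\<lambda>z. glue UNIV y z \<le> x)"
    unfolding less_eq_vec_def by measurable
  have "finite S" by simp
  then have "?L S a = ennreal (?E S a) \<and> 0 \<le> ?E S a"
    using a
  proof (induction S arbitrary: a rule: finite_induct)
    case empty
    have dm: "(\<lambda>z. smeasure (D UNIV z) A) \<in> borel_measurable borel" if "A \<in> sets borel" for A
      using D that by (rule smeasure_measurable)
    obtain C where C0: "0 < C" and C: "\<And>y I z. \<bar>dens y I z\<bar> \<le> C" using dual_density_bound[OF D] by blast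
    obtain C' where C'0: "0 < C'" and C': "\<And>I z A. \<bar>smeasure (D I z) A\<bar> \<le> C'" using smeasure_bound[OF D] by blast
    let ?b = "\<lambda>z. \<forall>i. a i \<le> z i \<and> z i \<le> x $ i"
    let ?f = "\<lambda>z. if ?b z then dens y UNIV (glue UNIV y z) else 0"
    let ?f1 = "\<lambda>z. if ?b z then smeasure (D UNIV (glue UNIV y z)) {w. y \<le> w} else 0"
    let ?f2 = "\<lambda>z. if \<forall>i. y $ i \<le> z i \<and> z i \<le> x $ i then smeasure (D UNIV (glue UNIV y z)) UNIV else 0"
    note [measurable] = dm[OF vec_le_sets(1)] dm[OF sets.top, unfolded space_borel]
    have i: "integrable (lborel_pi UNIV) ?f"
    proof (rule lborel_pi_integrable_box[where a=a and b="($) x" and C=C])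
      show "?f \<in> borel_measurable (lborel_pi UNIV)" by measurable
    qed (use C C0 in \<open>auto simp: less_imp_le\<close>)
    have i1: "integrable (lborel_pi UNIV) ?f1"
    proof (rule lborel_pi_integrable_box[where a=a and b="($) x" and C=C'])
      show "?f1 \<in> borel_measurable (lborel_pi UNIV)" by measurable
    qed (use C' C'0 in \<open>auto simp: less_imp_le\<close>)
    have i2: "integrable (lborel_pi UNIV) ?f2"
    proof (rule lborel_pi_integrable_box[where a="($) y" and b="($) x" and C=C'])
      show "?f2 \<in> borel_measurable (lborel_pi UNIV)" by measurable
    qed (use C' C'0 in \<open>auto simp: less_imp_le\<close>)
    have r2: "(\<integral>z. ?f2 z \<partial>lborel_pi UNIV) = rate_int y x UNIV"
    proof (cases "y \<le> x")
      case True
      then show ?thesis by (simp add: rate_int_def)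
    next
      case False
      then obtain i where "x $ i < y $ i" by (auto simp: less_eq_vec_def not_le)
      then have "\<not> (\<forall>i. y $ i \<le> z i \<and> z i \<le> x $ i)" for z by (metis not_le order_trans)
      then have "?f2 = (\<lambda>_. 0)" by (intro ext) (simp only: if_False)
      then have "(\<integral>z. ?f2 z \<partial>lborel_pi UNIV) = 0" by (simp only: Bochner_Integration.integral_zero)
      then show ?thesis using False by (simp add: rate_int_def)
    qed
    \<comment> \<open>The lower bounds lie below \<open>y\<close>, so the part of the box above
      \<open>y\<close> is exactly the box between \<open>y\<close> and \<open>x\<close>.\<close>
    have split: "?f z = ?f1 z - ?f2 z" for z
    proof -
      have "?b z \<and> y \<le> glue UNIV y z \<longleftrightarrow> (\<forall>i. y $ i \<le> z i \<and> z i \<le> x $ i)"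
        using empty.prems(2) by (auto simp: less_eq_vec_def intro: order_trans)
      then show ?thesis unfolding dual_density_UNIV[OF D] by (rule if_diff)
    qed
    have "(\<integral>z. ?f z \<partial>lborel_pi UNIV) = (\<integral>z. ?f1 z \<partial>lborel_pi UNIV) - (\<integral>z. ?f2 z \<partial>lborel_pi UNIV)"
      unfolding split using i1 i2 by (rule Bochner_Integration.integral_diff)
    also have "\<dots> = ?E {} a"
      unfolding r2 corner_integral_closed[OF nu D closed_vec_ge empty.prems(1)] by simp
    finally have E: "(\<integral>z. ?f z \<partial>lborel_pi UNIV) = ?E {} a" .
    have nn: "0 \<le> ?f z" for z using dens_nonneg[of UNIV] by simp
    have "?L {} a = (\<integral>\<^sup>+z. ennreal (?f z) \<partial>lborel_pi UNIV)"
    proof (intro nn_integral_cong)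
      fix z
      have "(\<forall>i\<in>- {}. a i \<le> z i) \<and> glue UNIV y z \<le> x \<longleftrightarrow> ?b z" by (auto simp: less_eq_vec_def)
      then show "(if (\<forall>i\<in>- {}. a i \<le> z i) \<and> glue UNIV y z \<le> x then ?m z else 0) = ennreal (?f z)" by simp
    qed
    then show ?case using nn_integral_eq_ennreal[OF i nn] E by (simp only:)
  next
    case (insert j S)
    \<comment> \<open>Only the bound in coordinate \<open>j\<close> recedes, so the corners not
      using it stay put and the others move to minus infinity along the axis
      \<open>j\<close>.\<close>
    define an where "an n = a(j := a j - real n)" for n
    have an: "an n i \<le> x $ i" "an n i \<le> y $ i" for n i
      using insert.prems(1)[of i] insert.prems(2)[of i] by (auto simp: an_def)
    have IH: "?L S (an n) = ennreal (?E S (an n))" "0 \<le> ?E S (an n)" for n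
      using insert.IH[of "an n", OF an(1)[of n] an(2)[of n]] by blast+
    have S: "- S = insert j (- insert j S)" "j \<notin> - insert j S" using insert.hyps by auto
    have L: "(\<lambda>n. ?L S (an n)) \<longlonglongrightarrow> ?L (insert j S) a"
    proof -
      let ?F = "\<lambda>n z. if (\<forall>i\<in>- S. an n i \<le> z i) \<and> glue UNIV y z \<le> x then ?m z else 0"
      have inc: "incseq ?F"
      proof (intro incseq_SucI le_funI)
        fix n z
        have "an (Suc n) i \<le> an n i" for i by (simp add: an_def)
        then show "?F n z \<le> ?F (Suc n) z" by (auto intro: order_trans)
      qed
      have "(\<lambda>n. \<integral>\<^sup>+z. ?F n z \<partial>lborel_pi UNIV) \<longlonglongrightarrow> (SUP n. \<integral>\<^sup>+z. ?F n z \<partial>lborel_pi UNIV)"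
        using inc by (intro LIMSEQ_SUP) (auto simp: incseq_def le_fun_def intro!: nn_integral_mono)
      also have "(SUP n. \<integral>\<^sup>+z. ?F n z \<partial>lborel_pi UNIV) = (\<integral>\<^sup>+z. (SUP n. ?F n z) \<partial>lborel_pi UNIV)"
        by (rule nn_integral_monotone_convergence_SUP[symmetric, OF inc]) measurable
      also have "\<dots> = ?L (insert j S) a"
      proof (intro nn_integral_cong)
        fix z :: "'n \<Rightarrow> real"
        have "(\<lambda>n. ?F n z) \<longlonglongrightarrow> (SUP n. ?F n z)"
          using inc by (intro LIMSEQ_SUP) (auto simp: incseq_def le_fun_def)
        moreover have "(\<lambda>n. ?F n z) \<longlonglongrightarrow> (if (\<forall>i\<in>- insert j S. a i \<le> z i) \<and> glue UNIV y z \<le> x then ?m z else 0)"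
        proof (rule tendsto_eventually)
          obtain N where N: "a j - z j \<le> real N" using real_arch_simple by blast
          have "(\<forall>i\<in>- S. an n i \<le> z i) \<longleftrightarrow> (\<forall>i\<in>- insert j S. a i \<le> z i)" if "n \<ge> N" for n
          proof -
            have "an n j \<le> z j" using N that by (simp add: an_def)
            then show ?thesis unfolding S(1) using S(2) by (auto simp: an_def)
          qed
          then show "\<forall>\<^sub>F n in sequentially. ?F n z = (if (\<forall>i\<in>- insert j S. a i \<le> z i) \<and> glue UNIV y z \<le> x then ?m z else 0)"
            unfolding eventually_sequentially by (intro exI[of _ N]) auto
        qed
        ultimately show "(SUP n. ?F n z) = (if (\<forall>i\<in>- insert j S. a i \<le> z i) \<and> glue UNIV y z \<le> x then ?m z else 0)"
          by (rule LIMSEQ_unique)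
      qed
      finally show ?thesis .
    qed
    have R: "(\<lambda>n. ?E S (an n)) \<longlonglongrightarrow> ?E (insert j S) a"
    proof -
      have inj: "inj_on (insert j) (Pow (- insert j S))"
        using S(2) by (intro inj_onI) (metis PowD insert_ident subsetD)
      have sp: "(\<Sum>K\<in>Pow (- S). ?C (an n) K) = (\<Sum>K\<in>Pow (- insert j S). ?C a K) + (\<Sum>K\<in>Pow (- insert j S). ?C (an n) (insert j K))" for n
      proof -
        have "(\<Sum>K\<in>Pow (- S). ?C (an n) K) = (\<Sum>K\<in>Pow (- insert j S). ?C (an n) K) + (\<Sum>K\<in>insert j ` Pow (- insert j S). ?C (an n) K)"
          unfolding S(1) Pow_insert using S(2) by (intro sum.union_disjoint) auto
        also have "(\<Sum>K\<in>Pow (- insert j S). ?C (an n) K) = (\<Sum>K\<in>Pow (- insert j S). ?C a K)"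
        proof (intro sum.cong refl)
          fix K assume "K \<in> Pow (- insert j S)"
          then have "corner (an n) (($) x) K = corner a (($) x) K"
            by (auto simp: corner_def an_def fun_eq_iff)
          then show "?C (an n) K = ?C a K" by simp
        qed
        finally show ?thesis by (simp add: sum.reindex[OF inj])
      qed
      have "(\<lambda>n. ?C (an n) (insert j K)) \<longlonglongrightarrow> (-1) ^ card (insert j K) * 0" if "K \<in> Pow (- insert j S)" for K
      proof (intro tendsto_mult tendsto_const)
        have c: "glue UNIV y (corner (an n) (($) x) (insert j K)) = vupd (glue UNIV y (corner a (($) x) K)) j (a j - real n)" for n
          by (auto simp: vec_eq_iff corner_def an_def)
        have "filterlim (\<lambda>n. a j - real n) at_bot sequentially"
          unfolding filterlim_at_bot eventually_sequentially
        proof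
          fix Z :: real
          obtain N where "a j - Z \<le> real N" using real_arch_simple by blast
          then have "\<forall>n\<ge>N. a j - real n \<le> Z" by (auto intro: order_trans[of _ "a j - real N"])
          then show "\<exists>N. \<forall>n\<ge>N. a j - real n \<le> Z" by blast
        qed
        then show "(\<lambda>n. measure (\<nu> (glue UNIV y (corner (an n) (($) x) (insert j K)))) {w. y \<le> w}) \<longlonglongrightarrow> 0"
          unfolding c by (rule filterlim_compose[OF proper_minus_infinity])
      qed
      then have "(\<lambda>n. (\<Sum>K\<in>Pow (- insert j S). ?C a K) + (\<Sum>K\<in>Pow (- insert j S). ?C (an n) (insert j K)) - rate_int y x UNIV)
        \<longlonglongrightarrow> (\<Sum>K\<in>Pow (- insert j S). ?C a K) + (\<Sum>K\<in>Pow (- insert j S). (-1) ^ card (insert j K) * 0) - rate_int y x UNIV"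
        by (intro tendsto_diff tendsto_add tendsto_const tendsto_sum)
      then show ?thesis unfolding sp by simp
    qed
    have "(\<lambda>n. ennreal (?E S (an n))) \<longlonglongrightarrow> ennreal (?E (insert j S) a)" using R by (rule tendsto_ennrealI)
    then have "?L (insert j S) a = ennreal (?E (insert j S) a)"
      using LIMSEQ_unique[OF L] IH by simp
    moreover have "0 \<le> ?E (insert j S) a"
    proof (rule LIMSEQ_le_const[OF R], intro exI allI impI)
      show "0 \<le> ?E S (an n)" for n by (rule IH(2))
    qed
    ultimately show ?case by blast
  qed
  then show "?L S a = ennreal (?E S a)" "0 \<le> ?E S a" by blast+
qed

text \<open>With all lower bounds removed the single corner \<open>x\<close> remains. The
  coordinatewise minimum is merely an admissible starting vector.\<close>

lemma top_density_below:
  "(\<integral>\<^sup>+z. (if glue UNIV y z \<le> x then ennreal (dens y UNIV (glue UNIV y z)) else 0) \<partial>lborel_pi UNIV) =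
     ennreal (measure (\<nu> x) {w. y \<le> w} - rate_int y x UNIV)"
  "0 \<le> measure (\<nu> x) {w. y \<le> w} - rate_int y x UNIV"
proof -
  have "glue UNIV y (corner (\<lambda>i. min (x $ i) (y $ i)) (($) x) {}) = x" by (simp add: vec_eq_iff corner_def)
  then show "(\<integral>\<^sup>+z. (if glue UNIV y z \<le> x then ennreal (dens y UNIV (glue UNIV y z)) else 0) \<partial>lborel_pi UNIV) =
     ennreal (measure (\<nu> x) {w. y \<le> w} - rate_int y x UNIV)"
    "0 \<le> measure (\<nu> x) {w. y \<le> w} - rate_int y x UNIV"
    using top_density_boxes[of "\<lambda>i. min (x $ i) (y $ i)" x y UNIV] by simp_all
qed

lemma face_density_below:
  assumes I: "I \<noteq> {}" "I \<noteq> UNIV"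
  shows "(\<integral>\<^sup>+z. (if glue I y z \<le> x then ennreal (dens y I (glue I y z)) else 0) \<partial>lborel_pi I) = ennreal (- rate_int y x I)"
    "rate_int y x I \<le> 0"
proof -
  let ?f = "\<lambda>z. if \<forall>i\<in>I. y $ i \<le> z i \<and> z i \<le> x $ i then smeasure (D I (glue I y z)) UNIV else 0"
  have np: "?f z \<le> 0" for z using nonpos I unfolding nonpositive_rate_derivatives_def by simp
  have i: "integrable (lborel_pi I) ?f" by (rule face_integrable[OF rate_cont])
  have int: "(\<integral>\<^sup>+z. ennreal (- ?f z) \<partial>lborel_pi I) = ennreal (- (\<integral>z. ?f z \<partial>lborel_pi I))" "0 \<le> - (\<integral>z. ?f z \<partial>lborel_pi I)"
  proof -
    have "integrable (lborel_pi I) (\<lambda>z. - ?f z)" "\<And>z. 0 \<le> - ?f z" using i np by (auto simp del: neg_0_le_iff_le simp: neg_0_le_iff_le)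
    from nn_integral_eq_ennreal[OF this] show "(\<integral>\<^sup>+z. ennreal (- ?f z) \<partial>lborel_pi I) = ennreal (- (\<integral>z. ?f z \<partial>lborel_pi I))" "0 \<le> - (\<integral>z. ?f z \<partial>lborel_pi I)"
      unfolding Bochner_Integration.integral_minus .
  qed
  show "rate_int y x I \<le> 0" using int(2) unfolding rate_int_def by auto
  show "(\<integral>\<^sup>+z. (if glue I y z \<le> x then ennreal (dens y I (glue I y z)) else 0) \<partial>lborel_pi I) = ennreal (- rate_int y x I)"
  proof (cases "y \<le> x")
    case True
    have "(if glue I y z \<le> x then ennreal (dens y I (glue I y z)) else 0) = ennreal (- ?f z)" for z
    proof -
      have "glue I y z \<le> x \<longleftrightarrow> (\<forall>i\<in>I. z i \<le> x $ i)" using True by (auto simp: less_eq_vec_def)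
      then show ?thesis using I(2) unfolding dual_density_def glue_ge_iff by auto
    qed
    then show ?thesis using int(1) True by (simp add: rate_int_def)
  next
    case False
    have "(if glue I y z \<le> x then ennreal (dens y I (glue I y z)) else 0) = 0" for z
    proof -
      have "\<not> (y \<le> glue I y z \<and> glue I y z \<le> x)" using False by (meson order_trans)
      then show ?thesis using I(2) by (auto simp: dual_density_def)
    qed
    then show ?thesis using False by (simp add: rate_int_def)
  qed
qed

text \<open>The part of the dual kernel carried by the face, as a measure on the full space. For
  nonempty \<open>I\<close> the density is nonnegative by the sign conditions, so
  \<open>ennreal\<close> loses nothing.\<close>

definition face :: "real ^ 'n \<Rightarrow> 'n set \<Rightarrow> (real ^ 'n) measure" where
  "face y I = distr (density (lborel_pi I) (\<lambda>z. ennreal (dens y I (glue I y z)))) borel (glue I y)"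

definition \<kappa> :: "real ^ 'n \<Rightarrow> (real ^ 'n) measure" where
  "\<kappa> y = sum_measure {I. I \<noteq> {}} (face y)"

lemma sets_face [simp]: "sets (face y I) = sets borel"
  by (simp add: face_def)

lemma sets_kappa [simp]: "sets (\<kappa> y) = sets borel"
  by (simp add: \<kappa>_def)

lemma space_kappa [simp]: "space (\<kappa> y) = UNIV"
  by (simp add: \<kappa>_def)

lemma emeasure_face:
  assumes [measurable]: "A \<in> sets borel"
  shows "emeasure (face y I) A = (\<integral>\<^sup>+z. (if glue I y z \<in> A then ennreal (dens y I (glue I y z)) else 0) \<partial>lborel_pi I)"
proof -
  have "emeasure (face y I) A = (\<integral>\<^sup>+z. indicator A z \<partial>face y I)" by simp
  also have "\<dots> = (\<integral>\<^sup>+z. ennreal (dens y I (glue I y z)) * indicator A (glue I y z) \<partial>lborel_pi I)"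
    unfolding face_def by (subst nn_integral_distr) (auto simp: nn_integral_density)
  also have "\<dots> = (\<integral>\<^sup>+z. (if glue I y z \<in> A then ennreal (dens y I (glue I y z)) else 0) \<partial>lborel_pi I)"
    by (intro nn_integral_cong) (auto simp: indicator_def)
  finally show ?thesis .
qed

text \<open>Proper faces contribute \<open>- rate_int y x I\<close>, the full one the tail mass
  minus \<open>rate_int y x UNIV\<close>. For \<open>y \<le> x\<close> the expansion of
  \<open>rate x\<close> identifies the sum of these terms over nonempty \<open>I\<close> as
  \<open>rate x - rate y\<close>.\<close>

lemma kappa_below:
  "emeasure (\<kappa> y) {z. z \<le> x} = ennreal (measure (\<nu> x) {w. y \<le> w} + (if y \<le> x then rate y - rate x else 0))"
  "0 \<le> measure (\<nu> x) {w. y \<le> w} + (if y \<le> x then rate y - rate x else 0)"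
proof -
  let ?P = "{I. I \<noteq> {} \<and> I \<noteq> (UNIV :: 'n set)}"
  have P: "{I. I \<noteq> {}} = insert UNIV ?P" "UNIV \<notin> ?P" by auto
  have s: "(\<Sum>I\<in>?P. - rate_int y x I) + (measure (\<nu> x) {w. y \<le> w} - rate_int y x UNIV) = measure (\<nu> x) {w. y \<le> w} + (if y \<le> x then rate y - rate x else 0)"
  proof (cases "y \<le> x")
    case True
    have "glue UNIV y (($) x) = x" by (simp add: vec_eq_iff)
    moreover have "rate (glue UNIV y (($) x)) = (\<Sum>I\<in>Pow UNIV. \<integral>z. (if \<forall>i\<in>I. y $ i \<le> z i \<and> z i \<le> x $ i then smeasure (D I (glue I y z)) UNIV else 0) \<partial>lborel_pi I)"
      by (rule mixed_derivatives_expansion[OF smeasure_UNIV_derivatives[OF nu D]]) (use True in \<open>auto simp: less_eq_vec_def\<close>)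
    ultimately have "rate x = (\<Sum>I\<in>UNIV. rate_int y x I)" using True by (simp add: rate_int_def)
    also have "\<dots> = rate_int y x {} + (\<Sum>I\<in>?P. rate_int y x I) + rate_int y x UNIV" by (rule sum_subsets_split)
    also have "rate_int y x {} = rate y"
      using True fun_cong[OF mixed_derivatives_empty[OF smeasure_UNIV_derivatives(1)[OF nu D]], of y]
      by (simp add: rate_int_def PiM_empty)
    finally show ?thesis using True by (simp add: sum_negf)
  next
    case False
    then show ?thesis by (simp add: rate_int_def)
  qed
  have nn: "0 \<le> (\<Sum>I\<in>?P. - rate_int y x I)" using face_density_below(2) by (intro sum_nonneg) auto
  then show "0 \<le> measure (\<nu> x) {w. y \<le> w} + (if y \<le> x then rate y - rate x else 0)"
    unfolding s[symmetric] using top_density_below(2)[of x y] by (rule add_nonneg_nonneg)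
  have "emeasure (\<kappa> y) {z. z \<le> x} = (\<Sum>I\<in>{I. I \<noteq> {}}. emeasure (face y I) {z. z \<le> x})"
    unfolding \<kappa>_def by (rule emeasure_sum_measure) auto
  also have "\<dots> = emeasure (face y UNIV) {z. z \<le> x} + (\<Sum>I\<in>?P. emeasure (face y I) {z. z \<le> x})"
    unfolding P(1) using P(2) by (rule sum.insert[rotated]) simp
  also have "emeasure (face y UNIV) {z. z \<le> x} = ennreal (measure (\<nu> x) {w. y \<le> w} - rate_int y x UNIV)"
    unfolding emeasure_face[OF vec_le_sets(2)] mem_Collect_eq by (rule top_density_below)
  also have "(\<Sum>I\<in>?P. emeasure (face y I) {z. z \<le> x}) = (\<Sum>I\<in>?P. ennreal (- rate_int y x I))"
    unfolding emeasure_face[OF vec_le_sets(2)] mem_Collect_eq by (intro sum.cong refl face_density_below(1)) auto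
  also have "\<dots> = ennreal (\<Sum>I\<in>?P. - rate_int y x I)" using face_density_below(2) by (intro sum_ennreal) auto
  also have "ennreal (measure (\<nu> x) {w. y \<le> w} - rate_int y x UNIV) + \<dots> = ennreal ((\<Sum>I\<in>?P. - rate_int y x I) + (measure (\<nu> x) {w. y \<le> w} - rate_int y x UNIV))"
    using nn top_density_below(2)[of x y] by (simp add: add.commute flip: ennreal_plus)
  finally show "emeasure (\<kappa> y) {z. z \<le> x} = ennreal (measure (\<nu> x) {w. y \<le> w} + (if y \<le> x then rate y - rate x else 0))"
    unfolding s .
qed

text \<open>The point \<open>x\<close> goes to infinity along the diagonal. Once it is above
  \<open>y\<close>, the mass below \<open>x\<close> is \<open>rate y\<close> minus the mass that
  \<open>\<nu> x\<close> puts off the orthant above \<open>y\<close>, and the latter vanishes by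
  properness.\<close>

lemma kappa_total: "emeasure (\<kappa> y) UNIV = ennreal (rate y)"
proof -
  let ?x = "\<lambda>n::nat. (\<chi> j. real n) :: real^'n"
  have un: "(\<Union>n. {z. z \<le> ?x n}) = UNIV"
  proof (intro set_eqI iffI UNIV_I)
    fix z :: "real^'n"
    obtain N where N: "(\<Sum>i\<in>UNIV. \<bar>z $ i\<bar>) \<le> real N" using real_arch_simple by blast
    have "z $ i \<le> real N" for i
    proof -
      have "\<bar>z $ i\<bar> \<le> (\<Sum>i\<in>UNIV. \<bar>z $ i\<bar>)" by (rule member_le_sum) auto
      then show ?thesis using N by linarith
    qed
    then show "z \<in> (\<Union>n. {z. z \<le> ?x n})" by (auto simp: less_eq_vec_def)
  qed
  have "(\<lambda>n. emeasure (\<kappa> y) {z. z \<le> ?x n}) \<longlonglongrightarrow> emeasure (\<kappa> y) (\<Union>n. {z. z \<le> ?x n})"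
    by (rule Lim_emeasure_incseq) (auto simp: incseq_def less_eq_vec_def intro: order_trans)
  moreover have "(\<lambda>n. emeasure (\<kappa> y) {z. z \<le> ?x n}) \<longlonglongrightarrow> ennreal (rate y)"
  proof -
    have "((\<lambda>s. measure (\<nu> (\<chi> j. s)) {w. \<not> y \<le> w}) \<longlongrightarrow> 0) at_top"
      using proper unfolding pareto_proper_def by blast
    then have "(\<lambda>n. measure (\<nu> (?x n)) {w. \<not> y \<le> w}) \<longlonglongrightarrow> 0"
      by (rule filterlim_compose[OF _ filterlim_real_sequentially])
    then have lim: "(\<lambda>n. ennreal (rate y - measure (\<nu> (?x n)) {w. \<not> y \<le> w})) \<longlonglongrightarrow> ennreal (rate y - 0)"
      by (intro tendsto_ennrealI tendsto_intros)
    have "\<forall>\<^sub>F n in sequentially. ennreal (rate y - measure (\<nu> (?x n)) {w. \<not> y \<le> w}) = emeasure (\<kappa> y) {z. z \<le> ?x n}"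
    proof -
      obtain N where N: "y \<in> {z. z \<le> ?x N}" using un by blast
      have "ennreal (rate y - measure (\<nu> (?x n)) {w. \<not> y \<le> w}) = emeasure (\<kappa> y) {z. z \<le> ?x n}" if "n \<ge> N" for n
      proof -
        have "real N \<le> real n" using that by simp
        then have le: "y \<le> ?x n" using N by (auto simp: less_eq_vec_def intro: order_trans)
        interpret finite_measure "\<nu> (?x n)" using fb[of "?x n"] by (simp add: finite_borel_def)
        have "measure (\<nu> (?x n)) (space (\<nu> (?x n)) - {w. y \<le> w}) = measure (\<nu> (?x n)) (space (\<nu> (?x n))) - measure (\<nu> (?x n)) {w. y \<le> w}"
          using fb[of "?x n"] by (intro finite_measure_compl) (simp add: finite_borel_def)
        moreover have "space (\<nu> (?x n)) - {w. y \<le> w} = {w. \<not> y \<le> w}" using finite_borel_space[OF fb] by auto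
        ultimately have "rate y - measure (\<nu> (?x n)) {w. \<not> y \<le> w} = measure (\<nu> (?x n)) {w. y \<le> w} + (rate y - rate (?x n))"
          by (simp add: finite_borel_space[OF fb])
        then show ?thesis using le by (simp only: kappa_below(1) if_True)
      qed
      then show ?thesis unfolding eventually_sequentially by blast
    qed
    from Lim_transform_eventually[OF lim this] show ?thesis by simp
  qed
  ultimately show ?thesis using LIMSEQ_unique unfolding un by blast
qed

lemma finite_borel_kappa: "finite_borel (\<kappa> y)"
  unfolding finite_borel_def by (auto intro!: finite_measureI simp: kappa_total)

lemma measure_kappa_UNIV: "measure (\<kappa> y) UNIV = rate y"
  by (rule measure_eq_emeasure_eq_ennreal) (auto simp: kappa_total)

lemma measure_kappa_below: "measure (\<kappa> y) {z. z \<le> x} = measure (\<nu> x) {w. y \<le> w} + (if y \<le> x then rate y - rate x else 0)"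
  by (rule measure_eq_emeasure_eq_ennreal[OF kappa_below(2) kappa_below(1)])

lemma integral_kappa:
  assumes g: "g \<in> vanishing_test_functions"
  shows "integrable (\<kappa> y) g" "(\<integral>z. g z \<partial>\<kappa> y) = pareto_dual_generator \<nu> g y + g y * rate y"
proof -
  have gi: "integrable lborel g" using g unfolding vanishing_test_functions_def by blast
  have gm [measurable]: "g \<in> borel_measurable borel" using gi by (simp add: borel_measurable_integrable)
  have face: "integrable (face y I) g" "(\<integral>z. g z \<partial>face y I) = (\<integral>z. g (glue I y z) * dens y I (glue I y z) \<partial>lborel_pi I)" if I: "I \<in> {I. I \<noteq> {}}" for I
  proof -
    have nn: "AE z in lborel_pi I. 0 \<le> dens y I (glue I y z)" using dens_nonneg I by simp
    show "integrable (face y I) g"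
      unfolding face_def using faces_integrable[OF D g, of I y] nn
      by (subst integrable_distr_eq) (auto simp: integrable_density mult.commute)
    show "(\<integral>z. g z \<partial>face y I) = (\<integral>z. g (glue I y z) * dens y I (glue I y z) \<partial>lborel_pi I)"
      unfolding face_def using nn
      by (subst integral_distr) (auto simp: integral_density mult.commute)
  qed
  show "integrable (\<kappa> y) g" unfolding \<kappa>_def by (rule integral_sum_measure(1)) (auto intro: face)
  have "(\<integral>z. g z \<partial>\<kappa> y) = (\<Sum>I\<in>{I. I \<noteq> {}}. \<integral>z. g z \<partial>face y I)"
    unfolding \<kappa>_def by (rule integral_sum_measure(2)) (auto intro: face)
  also have "\<dots> = (\<Sum>I\<in>{I. I \<noteq> {}}. \<integral>z. g (glue I y z) * dens y I (glue I y z) \<partial>lborel_pi I)"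
    by (intro sum.cong refl face(2))
  also have "\<dots> = pareto_dual_generator \<nu> g y + g y * rate y"
    unfolding pareto_dual_generator_faces[OF nu D g] by simp
  finally show "(\<integral>z. g z \<partial>\<kappa> y) = pareto_dual_generator \<nu> g y + g y * rate y" .
qed

end

section \<open>Duality\<close>

lemma hyperplane_sets [measurable]: "{x :: real ^ 'n. x $ i = c} \<in> sets borel"
  by (intro borel_closed closed_Collect_eq continuous_intros)

lemma AE_lborel_coordinate: "AE x in lborel. (x :: real ^ 'n) $ i \<noteq> c"
proof -
  have "{x :: real ^ 'n. x $ i = c} \<in> null_sets lebesgue"
    using negligible_standard_hyperplane[of "axis i 1 :: real ^ 'n" c] by (simp add: negligible_iff_null_sets inner_axis axis_in_Basis_iff)
  then have "{x :: real ^ 'n. x $ i = c} \<in> null_sets lborel"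
    using hyperplane_sets[of i c] by (simp add: null_sets_completion_iff)
  from AE_not_in[OF this] show ?thesis by simp
qed

text \<open>If no coordinate of \<open>x\<close> equals that of \<open>a\<close>, the condition
  \<open>y \<le> x\<close> is constant for \<open>y\<close> near \<open>a\<close>; the exceptional
  \<open>x\<close> form a null set. The measure is kept general because Lebesgue measure and, by
  properness, \<open>\<nu> x\<close> both qualify.\<close>

lemma tail_integral_continuous:
  fixes q :: "real ^ 'n \<Rightarrow> real"
  assumes q: "integrable M q" and M: "sets M = sets borel" and null: "\<And>i c. AE x in M. x $ i \<noteq> c"
  shows "continuous_on UNIV (\<lambda>y. \<integral>x. (if y \<le> x then q x else 0) \<partial>M)"
proof (rule continuous_on_sequentiallyI)
  fix u :: "nat \<Rightarrow> real ^ 'n" and a assume u: "u \<longlonglongrightarrow> a"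
  have qm: "q \<in> borel_measurable M" using q by (rule borel_measurable_integrable)
  have s: "{x \<in> space M. y \<le> x} \<in> sets M" for y :: "real ^ 'n"
  proof -
    have "space M = UNIV" using sets_eq_imp_space_eq[OF M] by simp
    then show ?thesis unfolding M by simp
  qed
  show "(\<lambda>n. \<integral>x. (if u n \<le> x then q x else 0) \<partial>M) \<longlonglongrightarrow> (\<integral>x. (if a \<le> x then q x else 0) \<partial>M)"
  proof (rule integral_dominated_convergence)
    show "(\<lambda>x. if a \<le> x then q x else 0) \<in> borel_measurable M" "\<And>n. (\<lambda>x. if u n \<le> x then q x else 0) \<in> borel_measurable M"
      using qm s by (auto intro!: measurable_If)
    show "integrable M (\<lambda>x. \<bar>q x\<bar>)" using q by (rule integrable_abs)
    show "AE x in M. norm (if u n \<le> x then q x else 0) \<le> \<bar>q x\<bar>" for n by (intro AE_I2) auto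
    have "AE x in M. \<forall>i\<in>UNIV. x $ i \<noteq> a $ i" by (intro AE_finite_allI null) simp
    then show "AE x in M. (\<lambda>n. if u n \<le> x then q x else 0) \<longlonglongrightarrow> (if a \<le> x then q x else 0)"
    proof (elim AE_mp, intro AE_I2 impI)
      fix x assume x: "\<forall>i\<in>UNIV. x $ i \<noteq> a $ i"
      have ui: "(\<lambda>n. u n $ i) \<longlonglongrightarrow> a $ i" for i by (rule tendsto_vec_nth[OF u])
      have "\<forall>\<^sub>F n in sequentially. (u n \<le> x) = (a \<le> x)"
      proof (cases "a \<le> x")
        case True
        then have "a $ i < x $ i" for i using x unfolding less_eq_vec_def by (metis UNIV_I less_le)
        then have "\<forall>\<^sub>F n in sequentially. u n $ i < x $ i" for i by (rule order_tendstoD(2)[OF ui])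
        then have "\<forall>\<^sub>F n in sequentially. \<forall>i. u n $ i < x $ i" by (rule eventually_all_finite)
        then show ?thesis by eventually_elim (use True in \<open>auto simp: less_eq_vec_def less_imp_le\<close>)
      next
        case False
        then obtain i where "x $ i < a $ i" by (auto simp: less_eq_vec_def not_le)
        then have "\<forall>\<^sub>F n in sequentially. x $ i < u n $ i" by (rule order_tendstoD(1)[OF ui])
        then show ?thesis
        proof eventually_elim
          fix n assume "x $ i < u n $ i"
          then have "\<not> u n \<le> x" unfolding less_eq_vec_def by (auto simp: not_le)
          then show "(u n \<le> x) = (a \<le> x)" using False by blast
        qed
      qed
      then have "\<forall>\<^sub>F n in sequentially. (if a \<le> x then q x else 0) = (if u n \<le> x then q x else 0)"
        by eventually_elim simp
      from Lim_transform_eventually[OF tendsto_const this]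
      show "(\<lambda>n. if u n \<le> x then q x else 0) \<longlonglongrightarrow> (if a \<le> x then q x else 0)" .
    qed
  qed
qed

lemma pareto_range_bounded_continuous:
  assumes "g \<in> pareto_range"
  shows "g \<in> bounded_continuous"
proof -
  from assms obtain q where q: "integrable lborel q" and g: "g = pareto_F (with_density q)" by (auto simp: pareto_range_def)
  have g: "g = (\<lambda>y. \<integral>x. (if y \<le> x then q x else 0) \<partial>lborel)" unfolding g pareto_F_with_density[abs_def] ..
  show ?thesis
  proof (rule bounded_continuousI[where b="\<integral>x. \<bar>q x\<bar> \<partial>lborel"])
    show "continuous_on UNIV g" unfolding g using q by (rule tail_integral_continuous) (auto intro: AE_lborel_coordinate)
    show "\<bar>g y\<bar> \<le> (\<integral>x. \<bar>q x\<bar> \<partial>lborel)" for y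
    proof -
      have "\<bar>g y\<bar> \<le> (\<integral>x. \<bar>if y \<le> x then q x else 0\<bar> \<partial>lborel)" unfolding g by (rule integral_abs_bound)
      also have "\<dots> \<le> (\<integral>x. \<bar>q x\<bar> \<partial>lborel)" using q by (intro integral_mono') auto
      finally show ?thesis .
    qed
  qed
qed

lemma vanishing_bounded_continuous: "g \<in> vanishing_test_functions \<Longrightarrow> g \<in> bounded_continuous"
  by (rule pareto_range_bounded_continuous) (simp add: vanishing_test_functions_def)

section \<open>Duality of the uniformized chains\<close>

text \<open>The first step of the \<open>K\<close> chain is split off and the induction hypothesis
  turns the remaining ones into steps of the \<open>L\<close> chain. Fubini on the closed set of
  pairs with \<open>z \<le> w\<close> then turns the split step into a last step of the
  \<open>L\<close> chain.\<close>

lemma iter_duality: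
  fixes K L :: "real ^ 'n \<Rightarrow> (real ^ 'n) measure"
  assumes K: "jump_kernel K r" and L: "jump_kernel L r"
    and dual: "\<And>x y. measure (jump_step K r x) {w. y \<le> w} = measure (jump_step L r y) {w. w \<le> x}"
  shows "emeasure (jump_kernel.iter K r k x) {w. y \<le> w} = emeasure (jump_kernel.iter L r k y) {w. w \<le> x}"
proof -
  interpret K: jump_kernel K r by fact
  interpret L: jump_kernel L r by fact
  show ?thesis
  proof (induction k arbitrary: x)
    case 0
    show ?case by (simp add: indicator_def)
  next
    case (Suc k)
    let ?M = "jump_step K r x" and ?N = "L.iter k y"
    interpret M: prob_space ?M by (rule K.prob_space_step)
    interpret N: prob_space ?N by (rule L.prob_space_iter)
    interpret pair_sigma_finite ?M ?N by standard
    have spM: "space ?M = UNIV" "space ?N = UNIV"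
      using sets_eq_imp_space_eq[OF K.sets_step[of x]] sets_eq_imp_space_eq[OF L.sets_iter[of k y]] by auto
    have sub: "K.iter k \<in> ?M \<rightarrow>\<^sub>M subprob_algebra borel" "jump_step L r \<in> ?N \<rightarrow>\<^sub>M subprob_algebra borel"
      using measurable_prob_algebraD[OF K.iter_measurable] measurable_prob_algebraD[OF L.step_measurable]
      by (simp_all add: measurable_cong_sets[OF K.sets_step refl] measurable_cong_sets[OF L.sets_iter refl])
    have m: "(\<lambda>(w, z). indicator {z. z \<le> w} z :: ennreal) \<in> borel_measurable (?M \<Otimes>\<^sub>M ?N)"
    proof -
      have "{p. snd p \<le> (fst p :: real ^ 'n)} \<in> sets (borel \<Otimes>\<^sub>M borel)"
        unfolding borel_prod less_eq_vec_def by (intro borel_closed closed_Collect_all closed_Collect_le continuous_intros)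
      moreover have "sets (?M \<Otimes>\<^sub>M ?N) = sets (borel \<Otimes>\<^sub>M borel)" by (intro sets_pair_measure_cong K.sets_step L.sets_iter)
      ultimately have "(indicator {p. snd p \<le> (fst p :: real ^ 'n)} :: _ \<Rightarrow> ennreal) \<in> borel_measurable (?M \<Otimes>\<^sub>M ?N)"
        by (intro borel_measurable_indicator) simp
      moreover have "indicator {p. snd p \<le> (fst p :: real ^ 'n)} = (\<lambda>(w, z). indicator {z. z \<le> w} z :: ennreal)"
        by (auto simp: fun_eq_iff indicator_def)
      ultimately show ?thesis by simp
    qed
    have "emeasure (K.iter (Suc k) x) {w. y \<le> w} = (\<integral>\<^sup>+w. emeasure (K.iter k w) {w. y \<le> w} \<partial>?M)"
      unfolding K.iter.simps by (rule emeasure_bind[OF _ sub(1)]) (auto simp: spM)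
    also have "\<dots> = (\<integral>\<^sup>+w. \<integral>\<^sup>+z. indicator {z. z \<le> w} z \<partial>?N \<partial>?M)"
      unfolding Suc.IH by (intro nn_integral_cong) (simp add: L.sets_iter)
    also have "\<dots> = (\<integral>\<^sup>+z. \<integral>\<^sup>+w. indicator {z. z \<le> w} z \<partial>?M \<partial>?N)"
      by (rule Fubini'[OF m, symmetric])
    also have "\<dots> = (\<integral>\<^sup>+z. emeasure (jump_step L r z) {v. v \<le> x} \<partial>?N)"
    proof (intro nn_integral_cong)
      fix z
      have "(\<integral>\<^sup>+w. indicator {z. z \<le> w} z \<partial>?M) = (\<integral>\<^sup>+w. indicator {w. z \<le> w} w \<partial>?M)"
        by (intro nn_integral_cong) (simp add: indicator_def)
      also have "\<dots> = emeasure ?M {w. z \<le> w}" by simp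
      also have "\<dots> = emeasure (jump_step L r z) {v. v \<le> x}"
        using dual[of x z] M.emeasure_eq_measure prob_space.finite_measure[OF L.prob_space_step[of z]]
        by (simp add: finite_measure.emeasure_eq_measure)
      finally show "(\<integral>\<^sup>+w. indicator {z. z \<le> w} z \<partial>?M) = emeasure (jump_step L r z) {v. v \<le> x}" .
    qed
    also have "\<dots> = emeasure (?N \<bind> jump_step L r) {v. v \<le> x}"
      by (rule emeasure_bind[OF _ sub(2), symmetric]) (auto simp: spM)
    also have "?N \<bind> jump_step L r = L.iter (Suc k) y"
    proof -
      have "L.iter (Suc 0) = jump_step L r" by (simp add: fun_eq_iff L.iter_0' bind_return'')
      then show ?thesis using L.iter_add[of k "Suc 0" y] by simp
    qed
    finally show ?case .
  qed
qed

text \<open>With a common \<open>r\<close> both semigroups mix their iterates with the same Poisson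
  weights.\<close>

lemma semigroup_duality:
  fixes K L :: "real ^ 'n \<Rightarrow> (real ^ 'n) measure"
  assumes K: "jump_kernel K r" and L: "jump_kernel L r"
    and dual: "\<And>x y. measure (jump_step K r x) {w. y \<le> w} = measure (jump_step L r y) {w. w \<le> x}"
  shows "measure (jump_kernel.semigroup K r t x) {w. y \<le> w} = measure (jump_kernel.semigroup L r t y) {w. w \<le> x}"
  unfolding measure_def
  by (simp add: jump_kernel.emeasure_semigroup[OF K] jump_kernel.emeasure_semigroup[OF L] iter_duality[OF K L dual])

section \<open>The dual process\<close>

context dual_kernel
begin

lemma rate_continuous: "continuous_on UNIV rate"
proof -
  have "\<forall>\<phi>\<in>bounded_continuous. continuous_on UNIV (\<lambda>x. \<integral>w. \<phi> w \<partial>\<nu> x)"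
    using wc unfolding weakly_continuous_def .
  from bspec[OF this const_bounded_continuous[of 1]] show ?thesis by (simp add: finite_borel_space[OF fb])
qed

lemma AE_nu_coordinate: "AE w in \<nu> x. w $ i \<noteq> c"
proof -
  interpret finite_measure "\<nu> x" using fb by (simp add: finite_borel_def)
  have "{w. w $ i = c} \<in> sets (\<nu> x)" using fb[of x] hyperplane_sets by (simp add: finite_borel_def)
  then have "{w. w $ i = c} \<in> null_sets (\<nu> x)"
    using hyperplane_null[of x i c] by (simp add: null_sets_def emeasure_eq_measure)
  from AE_not_in[OF this] show ?thesis by simp
qed

lemma ge_continuous: "continuous_on UNIV (\<lambda>y. measure (\<nu> x) {w. y \<le> w})"
proof -
  have "measure (\<nu> x) {w. y \<le> w} = (\<integral>w. (if y \<le> w then 1 else 0) \<partial>\<nu> x)" for y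
  proof -
    have "(\<integral>w. (if y \<le> w then 1 else 0) \<partial>\<nu> x) = (\<integral>w. indicator {w. y \<le> w} w \<partial>\<nu> x)"
      by (intro Bochner_Integration.integral_cong) (auto simp: indicator_def)
    also have "\<dots> = measure (\<nu> x) {w. y \<le> w}" by (rule integral_indicator_finite_borel[OF fb vec_le_sets(1)])
    finally show ?thesis by (rule sym)
  qed
  moreover have "continuous_on UNIV (\<lambda>y. \<integral>w. (if y \<le> w then 1 else 0 :: real) \<partial>\<nu> x)"
  proof (rule tail_integral_continuous)
    interpret finite_measure "\<nu> x" using fb by (simp add: finite_borel_def)
    show "integrable (\<nu> x) (\<lambda>w. 1 :: real)" by simp
    show "sets (\<nu> x) = sets borel" using fb[of x] by (simp add: finite_borel_def)
  qed (rule AE_nu_coordinate)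
  ultimately show ?thesis by simp
qed

text \<open>Weak continuity of \<open>\<nu>\<close> concerns its base point, not the vertex
  \<open>y\<close>. Continuity in \<open>y\<close> rests on null hyperplanes: those of
  \<open>\<nu> x\<close> for the gain term, those of Lebesgue measure for the loss term.\<close>

lemma generator_continuous:
  assumes g: "g \<in> pareto_range"
  shows "continuous_on UNIV (pareto_dual_generator \<nu> g)"
proof -
  note q = pareto_F_invD(1)[OF g]
  obtain B where B: "0 < B" "\<And>x A. measure (\<nu> x) A \<le> B" using bounded_kernelE[OF nu] by blast
  have m: "(\<lambda>x. measure (\<nu> x) A) \<in> borel_measurable borel" if "A \<in> sets borel" for A
    using nu that by (rule bounded_kernel_measurable)
  have qm [measurable]: "pareto_F_inv g \<in> borel_measurable borel" using q by (simp add: borel_measurable_integrable)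
  have bd: "\<bar>measure (\<nu> x) A\<bar> \<le> B" for x A using B(2)[of x A] by simp
  have 1: "continuous_on UNIV (\<lambda>y. \<integral>x. pareto_F_inv g x * measure (\<nu> x) {w. y \<le> w} \<partial>lborel)"
  proof (rule continuous_on_sequentiallyI)
    fix u :: "nat \<Rightarrow> real ^ 'n" and a assume u: "u \<longlonglongrightarrow> a"
    show "(\<lambda>n. \<integral>x. pareto_F_inv g x * measure (\<nu> x) {w. u n \<le> w} \<partial>lborel) \<longlonglongrightarrow>
      (\<integral>x. pareto_F_inv g x * measure (\<nu> x) {w. a \<le> w} \<partial>lborel)"
    proof (rule integral_mult_tendsto[OF q, where C=B])
      show "(\<lambda>x. measure (\<nu> x) {w. u n \<le> w}) \<in> borel_measurable lborel" for n using m by simp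
      show "\<bar>measure (\<nu> x) {w. u n \<le> w}\<bar> \<le> B" for n x by (rule bd)
      show "(\<lambda>n. measure (\<nu> x) {w. u n \<le> w}) \<longlonglongrightarrow> measure (\<nu> x) {w. a \<le> w}" for x
        using ge_continuous[of x] u unfolding continuous_on_sequentially by (auto simp: o_def)
    qed
  qed
  have 2: "continuous_on UNIV (\<lambda>y. \<integral>x. (if y \<le> x then pareto_F_inv g x * rate x else 0) \<partial>lborel)"
  proof (rule tail_integral_continuous)
    show "integrable lborel (\<lambda>x. pareto_F_inv g x * rate x)"
      using q m[of UNIV] bd by (intro integrable_bounded_mult[where C=B]) auto
  qed (auto intro: AE_lborel_coordinate)
  show ?thesis unfolding pareto_dual_generator_eq[abs_def] using 1 2 by (rule continuous_on_diff)
qed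

lemma integral_kappa_continuous:
  assumes "g \<in> vanishing_test_functions"
  shows "continuous_on UNIV (\<lambda>y. \<integral>z. g z \<partial>\<kappa> y)"
proof -
  have "g \<in> pareto_range" using assms by (simp add: vanishing_test_functions_def)
  moreover have "continuous_on UNIV g" using vanishing_bounded_continuous[OF assms] by (simp add: bounded_continuous_def)
  ultimately show ?thesis unfolding integral_kappa(2)[OF assms]
    by (intro continuous_intros generator_continuous rate_continuous)
qed

lemma integrable_kappa: "\<phi> \<in> bounded_continuous \<Longrightarrow> integrable (\<kappa> y) \<phi>"
proof -
  assume "\<phi> \<in> bounded_continuous"
  then obtain b where "continuous_on UNIV \<phi>" "\<And>w. \<bar>\<phi> w\<bar> \<le> b" by (metis bounded_continuousE)
  moreover have "finite_measure (\<kappa> y)" using finite_borel_kappa by (simp add: finite_borel_def)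
  ultimately show ?thesis
    by (intro integrable_bounded[where b=b]) (auto simp: finite_borel_measurable[OF finite_borel_kappa] intro: borel_measurable_continuous_onI)
qed

text \<open>
  The integral of a bounded continuous function is approximated by integrals of test functions; the
  error is controlled by the mass outside a large box, which is itself continuous in \<open>y\<close> since the
  total mass of \<open>\<kappa> y\<close> is.
\<close>

lemma weakly_continuous_kappa: "weakly_continuous \<kappa>"
  unfolding weakly_continuous_def
proof
  fix \<phi> :: "real ^ 'n \<Rightarrow> real" assume \<phi>: "\<phi> \<in> bounded_continuous"
  then obtain b where b: "continuous_on UNIV \<phi>" "\<And>w. \<bar>\<phi> w\<bar> \<le> b" "0 \<le> b" by (rule bounded_continuousE) blast
  obtain B where B: "0 < B" "\<And>x A. measure (\<nu> x) A \<le> B" using bounded_kernelE[OF nu] by blast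
  show "continuous_on UNIV (\<lambda>y. \<integral>w. \<phi> w \<partial>\<kappa> y)"
  proof (rule continuous_on_sequentiallyI)
    fix u :: "nat \<Rightarrow> real ^ 'n" and a assume u: "u \<longlonglongrightarrow> a"
    show "(\<lambda>n. \<integral>w. \<phi> w \<partial>\<kappa> (u n)) \<longlonglongrightarrow> (\<integral>w. \<phi> w \<partial>\<kappa> a)"
    proof (rule tendstoI)
      fix e :: real assume e: "0 < e"
      \<comment> \<open>With this choice the approximation error at \<open>a\<close> is at most
        \<open>e / 4\<close>. It occurs once at \<open>u n\<close> and once at \<open>a\<close>, and
        half of \<open>e\<close> remains to spare.\<close>
      define d where "d = e / (4 * (b + B))"
      have d: "0 < d" "4 * (d * (b + B)) = e" using e add_nonneg_pos[OF b(3) B(1)] by (simp_all add: d_def del: distrib_left_numeral)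
      have c: "cutoff k {} \<in> bounded_continuous" for k by (rule tensor_span_bounded_continuous[OF cutoff_tensor_span])
      have "(\<lambda>k. \<integral>w. cutoff k {} w \<partial>\<kappa> a) \<longlonglongrightarrow> (\<integral>w. 1 \<partial>\<kappa> a)"
      proof (rule integral_bounded_tendsto[where C=1])
        show "finite_measure (\<kappa> a)" using finite_borel_kappa by (simp add: finite_borel_def)
        show "cutoff k {} \<in> borel_measurable (\<kappa> a)" for k using integrable_kappa[OF c] by (rule borel_measurable_integrable)
        show "\<bar>cutoff k {} w\<bar> \<le> 1" for k and w :: "real ^ 'n" using cutoff_bounds[of k w] by simp
        show "(\<lambda>k. cutoff k {} w) \<longlonglongrightarrow> 1" for w :: "real ^ 'n" using cutoff_tendsto[of "{}" w] by simp
      qed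
      then have "(\<lambda>k. \<integral>w. cutoff k {} w \<partial>\<kappa> a) \<longlonglongrightarrow> rate a" by (simp add: measure_kappa_UNIV)
      from order_tendstoD(1)[OF this, of "rate a - d"] d(1) have "\<forall>\<^sub>F k in sequentially. rate a - d < (\<integral>w. cutoff k {} w \<partial>\<kappa> a)" by simp
      then obtain k where k: "rate a - d < (\<integral>w. cutoff k {} w \<partial>\<kappa> a)"
        using eventually_happens'[OF sequentially_bot] by blast
      obtain s where s: "s \<in> tensor_span" "\<And>z. \<bar>s z - \<phi> z * cutoff k {} z\<bar> \<le> d"
        by (rule tensor_span_approximation[OF b(1) d(1), of k]) blast
      let ?I = "\<lambda>f y. \<integral>w. f w \<partial>\<kappa> y"
      \<comment> \<open>Error outside the cutoff plus error of the approximation inside it. The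
        bound is itself continuous in \<open>y\<close>, because the cutoff is a test function and
        the total mass of the dual kernel is \<open>rate\<close>.\<close>
      let ?R = "\<lambda>y. b * (rate y - ?I (cutoff k {}) y) + d * rate y"
      have sb: "s \<in> bounded_continuous" by (rule tensor_span_bounded_continuous[OF s(1)])
      have err: "\<bar>?I \<phi> y - ?I s y\<bar> \<le> ?R y" for y
      proof -
        interpret finite_measure "\<kappa> y" using finite_borel_kappa by (simp add: finite_borel_def)
        have i: "integrable (\<kappa> y) \<phi>" "integrable (\<kappa> y) s" "integrable (\<kappa> y) (cutoff k {})"
          using integrable_kappa \<phi> sb c by blast+
        have "\<bar>?I \<phi> y - ?I s y\<bar> = \<bar>\<integral>w. \<phi> w - s w \<partial>\<kappa> y\<bar>" using i by simp
        also have "\<dots> \<le> (\<integral>w. \<bar>\<phi> w - s w\<bar> \<partial>\<kappa> y)" by (rule integral_abs_bound)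
        also have "\<dots> \<le> (\<integral>w. b * (1 - cutoff k {} w) + d \<partial>\<kappa> y)"
        proof (rule integral_mono)
          show "integrable (\<kappa> y) (\<lambda>w. \<bar>\<phi> w - s w\<bar>)" "integrable (\<kappa> y) (\<lambda>w. b * (1 - cutoff k {} w) + d)" using i by auto
          fix w :: "real ^ 'n"
          have "\<phi> w - s w = \<phi> w * (1 - cutoff k {} w) - (s w - \<phi> w * cutoff k {} w)" by (simp add: algebra_simps)
          then have "\<bar>\<phi> w - s w\<bar> \<le> \<bar>\<phi> w * (1 - cutoff k {} w)\<bar> + \<bar>s w - \<phi> w * cutoff k {} w\<bar>" by linarith
          also have "\<bar>\<phi> w * (1 - cutoff k {} w)\<bar> \<le> b * (1 - cutoff k {} w)"
            unfolding abs_mult using b(2)[of w] cutoff_bounds[of k w] by (intro mult_mono) auto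
          finally show "\<bar>\<phi> w - s w\<bar> \<le> b * (1 - cutoff k {} w) + d" using s(2)[of w] by linarith
        qed
        also have "\<dots> = ?R y" using i by (simp add: measure_kappa_UNIV algebra_simps)
        finally show ?thesis .
      qed
      have Ra: "2 * ?R a < e"
      proof -
        have "b * (rate a - ?I (cutoff k {}) a) \<le> b * d" using k b(3) by (intro mult_left_mono) auto
        moreover have "d * rate a \<le> d * B" using B(2)[of a UNIV] d(1) by (intro mult_left_mono) auto
        ultimately have "?R a \<le> d * (b + B)" by (simp add: algebra_simps)
        then have "2 * ?R a \<le> 2 * (d * (b + B))" by (rule mult_left_mono) simp
        also have "\<dots> < e" using d(2) e by linarith
        finally show ?thesis .
      qed
      have seq: "(\<lambda>n. f (u n)) \<longlonglongrightarrow> f a" if "continuous_on UNIV f" for f :: "real ^ 'n \<Rightarrow> real"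
        using that u unfolding continuous_on_sequentially by (auto simp: o_def)
      have S: "(\<lambda>n. ?I s (u n)) \<longlonglongrightarrow> ?I s a"
        by (rule seq[OF integral_kappa_continuous[OF tensor_span_vanishing[OF s(1)]]])
      have C: "(\<lambda>n. ?I (cutoff k {}) (u n)) \<longlonglongrightarrow> ?I (cutoff k {}) a"
        by (rule seq[OF integral_kappa_continuous[OF tensor_span_vanishing[OF cutoff_tensor_span]]])
      have "(\<lambda>n. \<bar>?I s (u n) - ?I s a\<bar> + ?R (u n) + ?R a) \<longlonglongrightarrow> \<bar>?I s a - ?I s a\<bar> + ?R a + ?R a"
        by (intro tendsto_intros S C seq[OF rate_continuous])
      then have "\<forall>\<^sub>F n in sequentially. \<bar>?I s (u n) - ?I s a\<bar> + ?R (u n) + ?R a < e"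
        by (rule order_tendstoD(2)) (use Ra in \<open>simp only: diff_self abs_zero add_0 mult_2\<close>)
      then show "\<forall>\<^sub>F n in sequentially. dist (?I \<phi> (u n)) (?I \<phi> a) < e"
      proof eventually_elim
        fix n assume "\<bar>?I s (u n) - ?I s a\<bar> + ?R (u n) + ?R a < e"
        then show "dist (?I \<phi> (u n)) (?I \<phi> a) < e"
          using err[of "u n"] err[of a] unfolding dist_real_def by linarith
      qed
    qed
  qed
qed

lemma jump_kernels:
  assumes "0 < r" "\<And>x. rate x \<le> r"
  shows "jump_kernel \<nu> r" "jump_kernel \<kappa> r"
proof -
  show "jump_kernel \<nu> r" by unfold_locales (use nu wc assms in auto)
  have "bounded_kernel \<kappa>"
    unfolding bounded_kernel_def
  proof (intro conjI allI ballI exI)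
    show "finite_measure (\<kappa> y)" for y using finite_borel_kappa by (simp add: finite_borel_def)
    show "(\<lambda>y. measure (\<kappa> y) A) \<in> borel_measurable borel" if "A \<in> sets borel" for A
      by (rule weakly_continuous_measurable[OF finite_borel_kappa weakly_continuous_kappa that])
    show "measure (\<kappa> y) UNIV \<le> r" for y using assms(2) by (simp add: measure_kappa_UNIV)
  qed simp
  then show "jump_kernel \<kappa> r"
    by unfold_locales (use weakly_continuous_kappa assms in \<open>auto simp: measure_kappa_UNIV\<close>)
qed

lemma jump_generator_kappa:
  assumes "0 < r" "\<And>x. rate x \<le> r" and g: "g \<in> vanishing_test_functions"
  shows "jump_generator \<kappa> g = pareto_dual_generator \<nu> g"
proof
  fix y
  interpret jump_kernel \<kappa> r by (rule jump_kernels) fact+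
  have gb: "g \<in> bounded_continuous" using g by (rule vanishing_bounded_continuous)
  then obtain b where b: "\<And>w. \<bar>g w\<bar> \<le> b" by (metis bounded_continuousE)
  show "jump_generator \<kappa> g y = pareto_dual_generator \<nu> g y"
    unfolding jump_generator_eq[OF bounded_continuous_measurable[OF gb] b] integral_kappa(2)[OF g] measure_kappa_UNIV by simp
qed

theorem dual_generates:
  "\<exists>Y. generates_C_Feller vanishing_test_functions (pareto_dual_generator \<nu>) Y"
proof -
  obtain r where bound: "0 < r" "\<And>x A. measure (\<nu> x) A \<le> r" using bounded_kernelE[OF nu] by blast
  interpret jump_kernel \<kappa> r by (rule jump_kernels) (fact bound)+
  have "generates_C_Feller vanishing_test_functions (pareto_dual_generator \<nu>) semigroup"
    unfolding generates_C_Feller_def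
  proof (intro conjI ballI)
    show "C_Feller semigroup" by (rule C_Feller_semigroup)
    fix g :: "real ^ 'n \<Rightarrow> real" assume g: "g \<in> vanishing_test_functions"
    show "uniform_limit UNIV (\<lambda>t y. ((\<integral>u. g u \<partial>semigroup t y) - g y) / t) (pareto_dual_generator \<nu> g) (at_right 0)"
      using generates_semigroup vanishing_bounded_continuous[OF g]
      unfolding generates_C_Feller_def jump_generator_kappa[OF bound g, symmetric] by blast
  qed
  then show ?thesis by blast
qed

text \<open>\<open>X\<close> and \<open>Y\<close> are arbitrary processes with the given generators;
  uniqueness replaces them by the Poisson semigroups of the two kernels, and the duality of single
  steps does the rest.\<close>

theorem duality:
  assumes X: "generates_C_Feller bounded_continuous (jump_generator \<nu>) X"
    and Y: "generates_C_Feller vanishing_test_functions (pareto_dual_generator \<nu>) Y" and t: "0 \<le> t"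
  shows "measure (X t x) {w. y \<le> w} = measure (Y t y) {w. w \<le> x}"
proof -
  obtain r where r: "0 < r" "\<And>x A. measure (\<nu> x) A \<le> r" using bounded_kernelE[OF nu] by blast
  have jk: "jump_kernel \<nu> r" "jump_kernel \<kappa> r" by (rule jump_kernels; fact r)+
  interpret N: jump_kernel \<nu> r by (rule jk(1))
  interpret K: jump_kernel \<kappa> r by (rule jk(2))
  have FY: "C_Feller Y" using Y by (simp add: generates_C_Feller_def)
  \<comment> \<open>The generator of \<open>Y\<close> is prescribed on test functions only, but the
    products of one-variable functions among them are dense in the sense of bounded pointwise
    limits.\<close>
  have "K.second_order Y"
  proof (rule K.second_order_of_generator[OF FY, where E=tensor_span])
    show "tensor_span \<subseteq> (bounded_continuous :: (real ^ 'n \<Rightarrow> real) set)" by (auto intro: tensor_span_bounded_continuous)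
    show "uniform_limit UNIV (\<lambda>t y. ((\<integral>u. g u \<partial>Y t y) - g y) / t) (jump_generator \<kappa> g) (at_right 0)" if "g \<in> tensor_span" for g
      using Y tensor_span_vanishing[OF that] jump_generator_kappa[OF r tensor_span_vanishing[OF that]]
      unfolding generates_C_Feller_def by simp
  qed (rule tensor_span_bp_dense)
  then have "Y t y = K.semigroup t y"
    by (rule K.second_order_unique[OF FY _ K.C_Feller_semigroup K.second_order_semigroup t])
  moreover have "X t x = N.semigroup t x" by (rule N.generator_unique[OF X t])
  \<comment> \<open>For \<open>y \<le> x\<close> the staying probabilities
    \<open>1 - rate x / r\<close> and \<open>1 - rate y / r\<close> differ by exactly the correction
    in \<open>measure_kappa_below\<close> divided by \<open>r\<close>; otherwise neither chain
    contributes a staying term.\<close>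
  moreover have "measure (jump_step \<nu> r x) {w. y \<le> w} = measure (jump_step \<kappa> r y) {w. w \<le> x}" for x y
    unfolding N.measure_step[OF vec_le_sets(1)] K.measure_step[OF vec_le_sets(2)] measure_kappa_below measure_kappa_UNIV
    using r(1) by (simp add: indicator_def field_simps)
  ultimately show ?thesis using semigroup_duality[OF jk] by simp
qed

end

section \<open>The second formula and the combined statement\<close>

lemma generator_integrated_by_parts:
  fixes \<nu> :: "real ^ 'n \<Rightarrow> (real ^ 'n) measure"
  assumes nu: "bounded_kernel \<nu>" and D: "kernel_mixed_derivatives \<nu> D" and g: "g \<in> vanishing_test_functions"
  shows "pareto_dual_generator \<nu> g y =
            - (g y * measure (\<nu> y) UNIV)
            - (\<Sum>I | I \<noteq> {} \<and> I \<noteq> UNIV.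
                 LINT z:{z. \<forall>i\<in>I. y $ i \<le> z i}|Pi\<^sub>M I (\<lambda>_. lborel).
                   g (glue I y z) * smeasure (D I (glue I y z)) UNIV)
            + (\<integral>z. g z *
                 (indicator {z. \<not> y \<le> z} z * smeasure (D UNIV z) {w. y \<le> w}
                  - indicator {z. y \<le> z} z * smeasure (D UNIV z) {w. \<not> y \<le> w}) \<partial>lborel)"
proof -
  have "g \<in> borel_measurable borel"
    using g by (intro bounded_continuous_measurable vanishing_bounded_continuous)
  then have m: "(\<lambda>z. g z * dual_density D y UNIV z) \<in> borel_measurable borel"
    by (intro borel_measurable_times dual_density_measurable[OF D])
  have top: "(\<integral>z. g (glue UNIV y z) * dual_density D y UNIV (glue UNIV y z) \<partial>lborel_pi UNIV) =
      (\<integral>z. g z * (indicator {z. \<not> y \<le> z} z * smeasure (D UNIV z) {w. y \<le> w}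
                  - indicator {z. y \<le> z} z * smeasure (D UNIV z) {w. \<not> y \<le> w}) \<partial>lborel)"
    unfolding lborel_integral_glue[OF m, symmetric]
    by (intro Bochner_Integration.integral_cong refl) (simp add: dual_density_def)
  have proper: "(\<integral>z. g (glue I y z) * dual_density D y I (glue I y z) \<partial>lborel_pi I) =
      - (LINT z:{z. \<forall>i\<in>I. y $ i \<le> z i}|Pi\<^sub>M I (\<lambda>_. lborel). g (glue I y z) * smeasure (D I (glue I y z)) UNIV)"
    if "I \<noteq> UNIV" for I
    unfolding set_lebesgue_integral_def Bochner_Integration.integral_minus[symmetric] using that
    by (intro Bochner_Integration.integral_cong refl) (simp add: dual_density_def glue_ge_iff)
  have "{I. I \<noteq> {}} = insert UNIV {I. I \<noteq> {} \<and> I \<noteq> (UNIV :: 'n set)}" by auto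
  then have "(\<Sum>I | I \<noteq> {}. \<integral>z. g (glue I y z) * dual_density D y I (glue I y z) \<partial>lborel_pi I) =
      (\<integral>z. g (glue UNIV y z) * dual_density D y UNIV (glue UNIV y z) \<partial>lborel_pi UNIV) +
      (\<Sum>I | I \<noteq> {} \<and> I \<noteq> UNIV. \<integral>z. g (glue I y z) * dual_density D y I (glue I y z) \<partial>lborel_pi I)"
    by simp
  also have "(\<Sum>I | I \<noteq> {} \<and> I \<noteq> UNIV. \<integral>z. g (glue I y z) * dual_density D y I (glue I y z) \<partial>lborel_pi I) =
      - (\<Sum>I | I \<noteq> {} \<and> I \<noteq> UNIV. LINT z:{z. \<forall>i\<in>I. y $ i \<le> z i}|Pi\<^sub>M I (\<lambda>_. lborel). g (glue I y z) * smeasure (D I (glue I y z)) UNIV)"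
    unfolding sum_negf[symmetric] by (intro sum.cong refl proper) simp
  finally show ?thesis unfolding pareto_dual_generator_faces[OF nu D g] top by linarith
qed

theorem proposition2p6:
  fixes \<nu> :: "real ^ 'n \<Rightarrow> (real ^ 'n) measure"
  assumes "bounded_kernel \<nu>" and "weakly_continuous \<nu>"
  shows "(\<exists>X. generates_C_Feller bounded_continuous (jump_generator \<nu>) X) \<and>
    (\<forall>g G y. g \<in> pareto_range \<and> mixed_derivatives g G \<longrightarrow>
       pareto_dual_generator \<nu> g y =
         (-1) ^ CARD('n) *
         (\<integral>z. G UNIV z *
              (indicator {z. \<not> y \<le> z} z * measure (\<nu> z) {w. y \<le> w}
               - indicator {z. y \<le> z} z * measure (\<nu> z) {w. \<not> y \<le> w}) \<partial>lborel)) \<and>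
    (\<forall>D. kernel_mixed_derivatives \<nu> D \<longrightarrow>
       (\<forall>g\<in>vanishing_test_functions. \<forall>y.
          pareto_dual_generator \<nu> g y =
            - (g y * measure (\<nu> y) UNIV)
            - (\<Sum>I | I \<noteq> {} \<and> I \<noteq> UNIV.
                 LINT z:{z. \<forall>i\<in>I. y $ i \<le> z i}|Pi\<^sub>M I (\<lambda>_. lborel).
                   g (glue I y z) * smeasure (D I (glue I y z)) UNIV)
            + (\<integral>z. g z *
                 (indicator {z. \<not> y \<le> z} z * smeasure (D UNIV z) {w. y \<le> w}
                  - indicator {z. y \<le> z} z * smeasure (D UNIV z) {w. \<not> y \<le> w}) \<partial>lborel)) \<and>
       ((\<exists>Y. generates_C_Feller vanishing_test_functions (pareto_dual_generator \<nu>) Y) \<longrightarrow>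
          nonpositive_rate_derivatives D \<and> top_derivative_signs D) \<and>
       (pareto_proper \<nu> \<longrightarrow>
          ((\<exists>Y. generates_C_Feller vanishing_test_functions (pareto_dual_generator \<nu>) Y) \<longleftrightarrow>
             nonpositive_rate_derivatives D \<and> top_derivative_signs D) \<and>
          (\<forall>X Y. generates_C_Feller bounded_continuous (jump_generator \<nu>) X \<and>
             generates_C_Feller vanishing_test_functions (pareto_dual_generator \<nu>) Y \<longrightarrow>
             (\<forall>t\<ge>0. \<forall>x y. measure (X t x) {w. y \<le> w} = measure (Y t y) {w. w \<le> x}))))"
proof (intro conjI allI ballI impI)
  note nu = assms(1)
  obtain B where B: "0 < B" "\<And>x A. measure (\<nu> x) A \<le> B" using bounded_kernelE[OF nu] by blast
  have "jump_kernel \<nu> B" by unfold_locales (use assms B in auto)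
  then show "\<exists>X. generates_C_Feller bounded_continuous (jump_generator \<nu>) X"
    using jump_kernel.generates_semigroup by blast
next
  fix g :: "real ^ 'n \<Rightarrow> real" and G y assume "g \<in> pareto_range \<and> mixed_derivatives g G"
  then show "pareto_dual_generator \<nu> g y =
         (-1) ^ CARD('n) *
         (\<integral>z. G UNIV z *
              (indicator {z. \<not> y \<le> z} z * measure (\<nu> z) {w. y \<le> w}
               - indicator {z. y \<le> z} z * measure (\<nu> z) {w. \<not> y \<le> w}) \<partial>lborel)"
    using pareto_dual_generator_top_derivative[OF assms(1)] by blast
next
  fix D :: "'n set \<Rightarrow> real ^ 'n \<Rightarrow> (real ^ 'n) signed_measure" assume D: "kernel_mixed_derivatives \<nu> D"
  note nu = assms(1)
  show "pareto_dual_generator \<nu> g y =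
            - (g y * measure (\<nu> y) UNIV)
            - (\<Sum>I | I \<noteq> {} \<and> I \<noteq> UNIV.
                 LINT z:{z. \<forall>i\<in>I. y $ i \<le> z i}|Pi\<^sub>M I (\<lambda>_. lborel).
                   g (glue I y z) * smeasure (D I (glue I y z)) UNIV)
            + (\<integral>z. g z *
                 (indicator {z. \<not> y \<le> z} z * smeasure (D UNIV z) {w. y \<le> w}
                  - indicator {z. y \<le> z} z * smeasure (D UNIV z) {w. \<not> y \<le> w}) \<partial>lborel)"
    if "g \<in> vanishing_test_functions" for g :: "real ^ 'n \<Rightarrow> real" and y
    using nu D that by (rule generator_integrated_by_parts)
  have nec: "nonpositive_rate_derivatives D" "top_derivative_signs D"
    if "\<exists>Y. generates_C_Feller vanishing_test_functions (pareto_dual_generator \<nu>) Y"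
    using that nonpositive_rate_derivatives_necessary[OF nu D] top_derivative_signs_necessary[OF nu D] by blast+
  then show "nonpositive_rate_derivatives D" "top_derivative_signs D"
    if "\<exists>Y. generates_C_Feller vanishing_test_functions (pareto_dual_generator \<nu>) Y"
    using that by blast+
  assume proper: "pareto_proper \<nu>"
  have dual: "dual_kernel \<nu> D" if "nonpositive_rate_derivatives D" "top_derivative_signs D"
    using assms D proper that by unfold_locales
  show "(\<exists>Y. generates_C_Feller vanishing_test_functions (pareto_dual_generator \<nu>) Y) \<longleftrightarrow>
             nonpositive_rate_derivatives D \<and> top_derivative_signs D"
    using nec dual_kernel.dual_generates[OF dual] by blast
  fix X Y :: "real \<Rightarrow> real ^ 'n \<Rightarrow> (real ^ 'n) measure" and t :: real and x y :: "real ^ 'n"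
  assume XY: "generates_C_Feller bounded_continuous (jump_generator \<nu>) X \<and>
             generates_C_Feller vanishing_test_functions (pareto_dual_generator \<nu>) Y" and t: "0 \<le> t"
  \<comment> \<open>The existence of \<open>Y\<close> forces the sign conditions by necessity, so
    the constructed dual kernel is available for the comparison.\<close>
  then have "dual_kernel \<nu> D" using dual nec by blast
  then show "measure (X t x) {w. y \<le> w} = measure (Y t y) {w. w \<le> x}"
    using XY t by (intro dual_kernel.duality) auto
qed

end
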